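(* Let $n\ge2$, let $r+s=n$ be a partition, and let $I\subset\{0,\dots,\lfloor n/2\rfloor\}$ be a nonempty admissible subset. Let $R$ be an $\mathcal{O}_E$-algebra and let $(\mathcal{F}_i\subset\Lambda_i\otimes_{\mathcal{O}_{F_0}}R)_{i\in\pm I+n\mathbb{Z}}$ be a family satisfying conditions (LM1)–(LM4). If the family satisfies condition $(\mathrm{K}_n)$, then it satisfies the Kottwitz condition: for all $i$, $$\det(T\cdot\mathrm{id}-\pi\otimes1\mid\mathcal{F}_i)=(T-\pi)^s(T+\pi)^r\in R[T].$$ A fortiori, if the family satisfies the refined condition $(\mathrm{N})$, then it satisfies the Kottwitz condition.
   Context: Setting. $F/F_0$ is a ramified quadratic extension of discretely valued non-Archimedean fields, with rings of integers $\mathcal{O}_F,\mathcal{O}_{F_0}$, uniformizers $\pi,\pi_0$ with $\pi^2=\pi_0$, and common residue field of characteristic $\ne2$. $n\ge2$, $m=\lfloor n/2\rfloor$, $r+s=n$. $E=F$ if $r\ne s$ and $E=F_0$ if $r=s$. A nonempty $I\subset\{0,\dots,m\}$ is called admissible if: $n$ even and $m-1\in I$ imply $m\in I$. When $r=s$ the polynomial $(T-\pi)^s(T+\pi)^r$ is interpreted as $(T^2-\pi_0)^s$. $e_1,\dots,e_n$ is the standard basis of $F^n$; $i^\vee=n+1-i$; $\phi$ is the Hermitian form with $\phi(ae_i,be_j)=\bar ab\,\delta_{i,j^\vee}$; $\langle x,y\rangle=\tfrac12\operatorname{tr}_{F/F_0}(\pi^{-1}\phi(x,y))$. For $i=bn+c$,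 $0\le c<n$, $\Lambda_i=\sum_{j=1}^c\pi^{-b-1}\mathcal{O}_Fe_j+\sum_{j=c+1}^n\pi^{-b}\mathcal{O}_Fe_j$; $\langle\ ,\ \rangle$ induces perfect pairings $\Lambda_i\times\Lambda_{-i}\to\mathcal{O}_{F_0}$. Conditions (LM1)–(LM4): (LM1) each $\mathcal{F}_i$ is an $\mathcal{O}_F\otimes_{\mathcal{O}_{F_0}}R$-submodule of $\Lambda_i\otimes_{\mathcal{O}_{F_0}}R$ and an $R$-direct summand of rank $n$; (LM2) for $i<j$, $\Lambda_i\otimes R\to\Lambda_j\otimes R$ carries $\mathcal{F}_i$ into $\mathcal{F}_j$; (LM3) the isomorphism $\pi\otimes1:\Lambda_i\otimes R\to\Lambda_{i-n}\otimes R$ carries $\mathcal{F}_i$ onto $\mathcal{F}_{i-n}$; (LM4) $\mathcal{F}_i^\perp=\mathcal{F}_{-i}$ under $(\Lambda_i\otimes R)\times(\Lambda_{-i}\otimes R)\to R$. Let $V=F^n\otimes_{F_0}F$ ($F$-space of dimension $2n$ via the right factor), $W=\bigwedge^n_FV$, $V_{\pm\pi}\subset V$ the $\pm\pi$-eigenspace of $\pi\otimes1$, $W^{r,s}=\bigwedge^r_FV_{-\pi}\otimes_F\bigwedge^s_FV_\pi\subset W$, and $W(\Lambda)=\bigwedge^n_{\mathcal{O}_F}(\Lambda\otimes_{\mathcal{O}_{F_0}}\mathcal{O}_F)\subset W$. Condition $(\mathrm{K}_n)$, for $R$ an $\mathcal{O}_F$-algebra: for all $i$, the line $\bigwedge^n_R\mathcal{F}_i\subset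 W(\Lambda_i)\otimes_{\mathcal{O}_F}R$ is contained in $\operatorname{im}[(W^{r,s}\cap W(\Lambda_i))\otimes_{\mathcal{O}_F}R\to W(\Lambda_i)\otimes_{\mathcal{O}_F}R]$. Condition $(\mathrm{N})$, for $R$ an $\mathcal{O}_F$-algebra: for all $i$, $\bigwedge^n_R\mathcal{F}_i$ is contained in $\operatorname{im}[(W^{r,s}\cap W_{(-1)^s}\cap W(\Lambda_i))\otimes_{\mathcal{O}_F}R\to W(\Lambda_i)\otimes_{\mathcal{O}_F}R]$, where $W_{\pm1}$ is as follows. Let $f_1,\dots,f_{2n}$ be the ordered basis of $V$ which for $n=2m$ is the image ($x\mapsto x\otimes1$) of $-\pi^{-1}e_1,\dots,-\pi^{-1}e_m,e_{m+1},\dots,e_n,e_1,\dots,e_m,\pi e_{m+1},\dots,\pi e_n$, and for $n=2m+1$ is $-\pi^{-1}e_1\otimes1,\dots,-\pi^{-1}e_m\otimes1,\ e_{m+1}\otimes1-\pi e_{m+1}\otimes\pi^{-1},\ e_{m+2}\otimes1,\dots,e_n\otimes1,\ e_1\otimes1,\dots,e_m\otimes1,\ \tfrac12(e_{m+1}\otimes1+\pi e_{m+1}\otimes\pi^{-1}),\ \pi e_{m+2}\otimes1,\dots,\pi e_n\otimes1$. For $S=\{i_1<\dots<i_n\}\subset\{1,\dots,2n\}$, $f_S=f_{i_1}\wedge\dots\wedge f_{i_n}$, $S^\perp=\{1,\dots,2n\}\setminus\{2n+1-i:i\in S\}$, $\sigma_S$ is the permutation carrying $\{1,\dots,n\}$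 to $S$ and $\{n+1,\dots,2n\}$ to the complement of $S$, both in increasing order, and $W_{\pm1}=\operatorname{span}_F\{f_S\pm\operatorname{sgn}(\sigma_S)f_{S^\perp}:\#S=n\}$. When $r=s$ these conditions are Galois-stable and descend to $\mathcal{O}_{F_0}$: for an $\mathcal{O}_{F_0}$-algebra $R$ they mean that the condition holds after base change to $R\otimes_{\mathcal{O}_{F_0}}\mathcal{O}_F$. *)

theory Defs
  imports "HOL-Algebra.UnivPoly" "HOL-Algebra.Embedded_Algebras" "HOL-Combinatorics.Permutations"
begin

section \<open>Modules given by generators and relations\<close>

text \<open>
  Carriers are explicit throughout, so that the zero ring is a legitimate base ring and rings such as
  \<open>R \<otimes> \<O>\<^sub>F\<close> can be formed inside a statement. A module record has multiplicative fields, which are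
  never used and are left \<^const>\<open>undefined\<close>.
\<close>

definition lin_span ::
  "('r, 'x) ring_scheme \<Rightarrow> ('r, 'm, 'y) module_scheme \<Rightarrow> 'm set \<Rightarrow> 'm set" where
  "lin_span R M S = \<Inter>{N. submodule N R M \<and> S \<subseteq> N}"

definition direct_summand ::
  "('r, 'x) ring_scheme \<Rightarrow> ('r, 'm, 'y) module_scheme \<Rightarrow> 'm set \<Rightarrow> bool" where
  "direct_summand R M P \<longleftrightarrow> submodule P R M \<and>
     (\<exists>Q. submodule Q R M \<and> P <+>\<^bsub>M\<^esub> Q = carrier M \<and> P \<inter> Q = {\<zero>\<^bsub>M\<^esub>})"

definition supp :: "('r, 'x) ring_scheme \<Rightarrow> ('g \<Rightarrow> 'r) \<Rightarrow> 'g set" where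
  "supp R f = {g. f g \<noteq> \<zero>\<^bsub>R\<^esub>}"

definition free_mod :: "('r, 'x) ring_scheme \<Rightarrow> 'g set \<Rightarrow> ('r, 'g \<Rightarrow> 'r) module" where
  "free_mod R G = \<lparr>
     carrier = {f. range f \<subseteq> carrier R \<and> supp R f \<subseteq> G \<and> finite (supp R f)},
     monoid.mult = undefined, monoid.one = undefined,
     ring.zero = (\<lambda>g. \<zero>\<^bsub>R\<^esub>),
     ring.add = (\<lambda>f h g. f g \<oplus>\<^bsub>R\<^esub> h g),
     module.smult = (\<lambda>c f g. c \<otimes>\<^bsub>R\<^esub> f g)\<rparr>"

definition single :: "('r, 'x) ring_scheme \<Rightarrow> 'g \<Rightarrow> 'r \<Rightarrow> 'g \<Rightarrow> 'r" where
  "single R g c = (\<lambda>h. if h = g then c else \<zero>\<^bsub>R\<^esub>)"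

definition quot_mod ::
  "('r, 'x) ring_scheme \<Rightarrow> ('r, 'm, 'y) module_scheme \<Rightarrow> 'm set \<Rightarrow> ('r, 'm set) module" where
  "quot_mod R M N = \<lparr>
     carrier = a_rcosets\<^bsub>M\<^esub> N,
     monoid.mult = undefined, monoid.one = undefined,
     ring.zero = N,
     ring.add = (\<lambda>C D. C <+>\<^bsub>M\<^esub> D),
     module.smult = (\<lambda>c C. \<Union>x\<in>C. N +>\<^bsub>M\<^esub> (c \<odot>\<^bsub>M\<^esub> x))\<rparr>"

text \<open>The \<open>R\<close>-module with generators \<open>G\<close> and relations \<open>k = 0\<close> for \<open>k \<in> K\<close>.\<close>

definition presented ::
  "('r, 'x) ring_scheme \<Rightarrow> 'g set \<Rightarrow> ('g \<Rightarrow> 'r) set \<Rightarrow> ('r, ('g \<Rightarrow> 'r) set) module" where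
  "presented R G K = quot_mod R (free_mod R G) (lin_span R (free_mod R G) K)"

definition pclass ::
  "('r, 'x) ring_scheme \<Rightarrow> 'g set \<Rightarrow> ('g \<Rightarrow> 'r) set \<Rightarrow> ('g \<Rightarrow> 'r) \<Rightarrow> ('g \<Rightarrow> 'r) set" where
  "pclass R G K f = lin_span R (free_mod R G) K +>\<^bsub>free_mod R G\<^esub> f"

text \<open>
  For a ring homomorphism \<open>\<rho> : R \<rightarrow> R'\<close> and a map \<open>h : G \<rightarrow> G'\<close> that respects the relations, the
  induced \<open>\<rho>\<close>-semilinear map of presented modules. The union runs over all representatives of the
  class \<open>C\<close>; when \<open>h\<close> respects the relations, all its terms are one and the same class.
\<close>

definition pushforward ::
  "('r, 'x) ring_scheme \<Rightarrow> ('s, 'y) ring_scheme \<Rightarrow> ('r \<Rightarrow> 's) \<Rightarrow> ('g \<Rightarrow> 'h) \<Rightarrow> ('g \<Rightarrow> 'r) \<Rightarrow> 'h \<Rightarrow> 's"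
  where
  "pushforward R R' \<rho> h f = (\<lambda>y. \<Oplus>\<^bsub>R'\<^esub> x \<in> {x \<in> supp R f. h x = y}. \<rho> (f x))"

definition pres_map ::
  "('r, 'x) ring_scheme \<Rightarrow> ('s, 'y) ring_scheme \<Rightarrow> 'h set \<Rightarrow> ('h \<Rightarrow> 's) set \<Rightarrow> ('r \<Rightarrow> 's) \<Rightarrow> ('g \<Rightarrow> 'h) \<Rightarrow>
     ('g \<Rightarrow> 'r) set \<Rightarrow> ('h \<Rightarrow> 's) set" where
  "pres_map R R' G' K' \<rho> h C = (\<Union>f\<in>C. pclass R' G' K' (pushforward R R' \<rho> h f))"


section \<open>Extension of scalars and exterior powers\<close>

text \<open>
  \<open>M \<otimes>\<^sub>A R\<close> for an \<open>A\<close>-module \<open>M\<close> and an \<open>A\<close>-algebra \<open>\<phi> : A \<rightarrow> R\<close>, as an \<open>R\<close>-module: it is generated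
  over \<open>R\<close> by the symbols \<open>x \<otimes> 1\<close>, subject to additivity and \<open>A\<close>-linearity in \<open>x\<close>.
\<close>

definition tensor_rels ::
  "('a, 'x) ring_scheme \<Rightarrow> ('a \<Rightarrow> 'r) \<Rightarrow> ('r, 'y) ring_scheme \<Rightarrow> ('a, 'm, 'z) module_scheme \<Rightarrow>
     ('m \<Rightarrow> 'r) set" where
  "tensor_rels A \<phi> R M = (let L = free_mod R (carrier M) in
     {single R (x \<oplus>\<^bsub>M\<^esub> y) \<one>\<^bsub>R\<^esub> \<ominus>\<^bsub>L\<^esub> (single R x \<one>\<^bsub>R\<^esub> \<oplus>\<^bsub>L\<^esub> single R y \<one>\<^bsub>R\<^esub>) | x y.
        x \<in> carrier M \<and> y \<in> carrier M} \<union>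
     {single R (a \<odot>\<^bsub>M\<^esub> x) \<one>\<^bsub>R\<^esub> \<ominus>\<^bsub>L\<^esub> (\<phi> a \<odot>\<^bsub>L\<^esub> single R x \<one>\<^bsub>R\<^esub>) | a x.
        a \<in> carrier A \<and> x \<in> carrier M})"

definition tensor ::
  "('a, 'x) ring_scheme \<Rightarrow> ('a \<Rightarrow> 'r) \<Rightarrow> ('r, 'y) ring_scheme \<Rightarrow> ('a, 'm, 'z) module_scheme \<Rightarrow>
     ('r, ('m \<Rightarrow> 'r) set) module" where
  "tensor A \<phi> R M = presented R (carrier M) (tensor_rels A \<phi> R M)"

text \<open>The pure tensor \<open>x \<otimes> c\<close>.\<close>

definition pure_tensor ::
  "('a, 'x) ring_scheme \<Rightarrow> ('a \<Rightarrow> 'r) \<Rightarrow> ('r, 'y) ring_scheme \<Rightarrow> ('a, 'm, 'z) module_scheme \<Rightarrow>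
     'm \<Rightarrow> 'r \<Rightarrow> ('m \<Rightarrow> 'r) set" where
  "pure_tensor A \<phi> R M x c = pclass R (carrier M) (tensor_rels A \<phi> R M) (single R x c)"

text \<open>
  The map \<open>h \<otimes> \<rho> : M \<otimes>\<^sub>A R \<rightarrow> M' \<otimes>\<^bsub>A'\<^esub> R'\<close> with \<open>x \<otimes> c \<mapsto> h x \<otimes> \<rho> c\<close>, where the arguments
  \<open>A'\<close>, \<open>\<phi>'\<close>, \<open>R'\<close>, \<open>M'\<close> describe the target.
\<close>

definition tensor_map ::
  "('r, 'w) ring_scheme \<Rightarrow> ('a, 'x) ring_scheme \<Rightarrow> ('a \<Rightarrow> 's) \<Rightarrow> ('s, 'y) ring_scheme \<Rightarrow>
     ('a, 'n, 'z) module_scheme \<Rightarrow> ('r \<Rightarrow> 's) \<Rightarrow> ('m \<Rightarrow> 'n) \<Rightarrow> ('m \<Rightarrow> 'r) set \<Rightarrow> ('n \<Rightarrow> 's) set" where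
  "tensor_map R A' \<phi>' R' M' \<rho> h = pres_map R R' (carrier M') (tensor_rels A' \<phi>' R' M') \<rho> h"

text \<open>
  \<open>\<And>\<^sup>n\<^sub>R M\<close>: generated by the symbols \<open>x\<^sub>1 \<and> \<dots> \<and> x\<^sub>n\<close> (lists of length \<open>n\<close>), which are
  multilinear and alternating.
\<close>

definition tuples :: "nat \<Rightarrow> 'm set \<Rightarrow> 'm list set" where
  "tuples n S = {xs. length xs = n \<and> set xs \<subseteq> S}"

definition ext_rels ::
  "('r, 'x) ring_scheme \<Rightarrow> nat \<Rightarrow> ('r, 'm, 'y) module_scheme \<Rightarrow> ('m list \<Rightarrow> 'r) set" where
  "ext_rels R n M = (let L = free_mod R (tuples n (carrier M)) in
     {single R (xs[i := x \<oplus>\<^bsub>M\<^esub> y]) \<one>\<^bsub>R\<^esub> \<ominus>\<^bsub>L\<^esub>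
        (single R (xs[i := x]) \<one>\<^bsub>R\<^esub> \<oplus>\<^bsub>L\<^esub> single R (xs[i := y]) \<one>\<^bsub>R\<^esub>) | xs i x y.
        xs \<in> tuples n (carrier M) \<and> i < n \<and> x \<in> carrier M \<and> y \<in> carrier M} \<union>
     {single R (xs[i := c \<odot>\<^bsub>M\<^esub> x]) \<one>\<^bsub>R\<^esub> \<ominus>\<^bsub>L\<^esub> (c \<odot>\<^bsub>L\<^esub> single R (xs[i := x]) \<one>\<^bsub>R\<^esub>) | xs i c x.
        xs \<in> tuples n (carrier M) \<and> i < n \<and> c \<in> carrier R \<and> x \<in> carrier M} \<union>
     {single R xs \<one>\<^bsub>R\<^esub> | xs.
        xs \<in> tuples n (carrier M) \<and> (\<exists>i j. i < j \<and> j < n \<and> xs ! i = xs ! j)})"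

definition ext_power ::
  "('r, 'x) ring_scheme \<Rightarrow> nat \<Rightarrow> ('r, 'm, 'y) module_scheme \<Rightarrow> ('r, ('m list \<Rightarrow> 'r) set) module" where
  "ext_power R n M = presented R (tuples n (carrier M)) (ext_rels R n M)"

definition wedge ::
  "('r, 'x) ring_scheme \<Rightarrow> nat \<Rightarrow> ('r, 'm, 'y) module_scheme \<Rightarrow> 'm list \<Rightarrow> ('m list \<Rightarrow> 'r) set" where
  "wedge R n M xs = pclass R (tuples n (carrier M)) (ext_rels R n M) (single R xs \<one>\<^bsub>R\<^esub>)"

text \<open>The map \<open>\<And>\<^sup>n\<^sub>R M \<rightarrow> \<And>\<^sup>n\<^bsub>R'\<^esub> M'\<close> induced by a \<open>\<rho>\<close>-semilinear map \<open>h : M \<rightarrow> M'\<close>.\<close>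

definition ext_map ::
  "('r, 'x) ring_scheme \<Rightarrow> ('s, 'y) ring_scheme \<Rightarrow> nat \<Rightarrow> ('s, 'n, 'z) module_scheme \<Rightarrow> ('r \<Rightarrow> 's) \<Rightarrow>
     ('m \<Rightarrow> 'n) \<Rightarrow> ('m list \<Rightarrow> 'r) set \<Rightarrow> ('n list \<Rightarrow> 's) set" where
  "ext_map R R' n M' \<rho> h = pres_map R R' (tuples n (carrier M')) (ext_rels R' n M') \<rho> (map h)"

text \<open>For a submodule \<open>P\<close> of \<open>M\<close>, the image of \<open>\<And>\<^sup>n P\<close> in \<open>\<And>\<^sup>n M\<close>.\<close>

definition ext_sub ::
  "('r, 'x) ring_scheme \<Rightarrow> nat \<Rightarrow> ('r, 'm, 'y) module_scheme \<Rightarrow> 'm set \<Rightarrow> ('m list \<Rightarrow> 'r) set set" where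
  "ext_sub R n M P = lin_span R (ext_power R n M) (wedge R n M ` tuples n P)"

text \<open>
  The ring \<open>B \<otimes>\<^sub>A R\<close> for \<open>A\<close>-algebras \<open>R\<close> (via \<open>\<phi>\<close>) and \<open>B\<close> (containing \<open>A\<close>). Its product is
  \<open>(x \<otimes> c) (y \<otimes> d) = x y \<otimes> c d\<close>, written on representatives as a convolution.
\<close>

definition ring_as_module :: "('a, 'x) ring_scheme \<Rightarrow> ('a, 'a) module" where
  "ring_as_module B = \<lparr>carrier = carrier B, monoid.mult = monoid.mult B, monoid.one = \<one>\<^bsub>B\<^esub>,
     ring.zero = \<zero>\<^bsub>B\<^esub>, ring.add = ring.add B, module.smult = monoid.mult B\<rparr>"

definition convolve ::
  "('a, 'x) ring_scheme \<Rightarrow> ('r, 'y) ring_scheme \<Rightarrow> ('a \<Rightarrow> 'r) \<Rightarrow> ('a \<Rightarrow> 'r) \<Rightarrow> 'a \<Rightarrow> 'r" where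
  "convolve B R f g = (\<lambda>z. \<Oplus>\<^bsub>R\<^esub> p \<in> {p \<in> supp R f \<times> supp R g. fst p \<otimes>\<^bsub>B\<^esub> snd p = z}.
     f (fst p) \<otimes>\<^bsub>R\<^esub> g (snd p))"

definition tensor_ring ::
  "('a, 'x) ring_scheme \<Rightarrow> ('a \<Rightarrow> 'r) \<Rightarrow> ('r, 'y) ring_scheme \<Rightarrow> ('a, 'z) ring_scheme \<Rightarrow>
     ('a \<Rightarrow> 'r) set ring" where
  "tensor_ring A \<phi> R B = (let M = ring_as_module B; T = tensor A \<phi> R M in
     \<lparr>carrier = carrier T,
      monoid.mult = (\<lambda>C D. \<Union>f\<in>C. \<Union>g\<in>D. pclass R (carrier M) (tensor_rels A \<phi> R M) (convolve B R f g)),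
      monoid.one = pure_tensor A \<phi> R M \<one>\<^bsub>B\<^esub> \<one>\<^bsub>R\<^esub>,
      ring.zero = \<zero>\<^bsub>T\<^esub>,
      ring.add = ring.add T\<rparr>)"


section \<open>Characteristic polynomials on locally free modules\<close>

text \<open>
  \<open>local_basis R M P n p as\<close>: the images of \<open>as\<^sub>0, \<dots>, as\<^sub>n\<^sub>-\<^sub>1\<close> form a basis of the localization \<open>P\<^sub>p\<close>
  over \<open>R\<^sub>p\<close>, with denominators cleared.
\<close>

definition local_basis ::
  "('r, 'x) ring_scheme \<Rightarrow> ('r, 'm, 'y) module_scheme \<Rightarrow> 'm set \<Rightarrow> nat \<Rightarrow> 'r set \<Rightarrow> 'm list \<Rightarrow> bool" where
  "local_basis R M P n p as \<longleftrightarrow> as \<in> tuples n P \<and>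
     (\<forall>x\<in>P. \<exists>t\<in>carrier R - p. \<exists>c\<in>{..<n} \<rightarrow> carrier R.
        t \<odot>\<^bsub>M\<^esub> x = (\<Oplus>\<^bsub>M\<^esub> j\<in>{..<n}. c j \<odot>\<^bsub>M\<^esub> as ! j)) \<and>
     (\<forall>c\<in>{..<n} \<rightarrow> carrier R. (\<Oplus>\<^bsub>M\<^esub> j\<in>{..<n}. c j \<odot>\<^bsub>M\<^esub> as ! j) = \<zero>\<^bsub>M\<^esub> \<longrightarrow>
        (\<exists>t\<in>carrier R - p. \<forall>j<n. t \<otimes>\<^bsub>R\<^esub> c j = \<zero>\<^bsub>R\<^esub>))"

text \<open>For a direct summand \<open>P\<close> of a finite free module: \<open>P\<close> has constant rank \<open>n\<close>.\<close>

definition has_rank ::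
  "('r, 'x) ring_scheme \<Rightarrow> ('r, 'm, 'y) module_scheme \<Rightarrow> 'm set \<Rightarrow> nat \<Rightarrow> bool" where
  "has_rank R M P n \<longleftrightarrow> (\<forall>p. primeideal p R \<longrightarrow> (\<exists>as. local_basis R M P n p as))"

definition determinant :: "('r, 'x) ring_scheme \<Rightarrow> nat \<Rightarrow> (nat \<Rightarrow> nat \<Rightarrow> 'r) \<Rightarrow> 'r" where
  "determinant S n A = (\<Oplus>\<^bsub>S\<^esub> \<sigma>\<in>{\<sigma>. \<sigma> permutes {..<n}}.
     [sign \<sigma>] \<cdot>\<^bsub>S\<^esub> (\<Otimes>\<^bsub>S\<^esub> i\<in>{..<n}. A i (\<sigma> i)))"

text \<open>
  \<open>det (T id - u | P)\<close> in \<open>R[T]\<close> for an endomorphism \<open>u\<close> of a finite locally free module \<open>P\<close> of rank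
  \<open>n\<close>: the polynomial whose image in \<open>R\<^sub>p[T]\<close>, for every prime \<open>p\<close>, is the characteristic polynomial
  of a matrix of \<open>u\<close> in a basis of \<open>P\<^sub>p\<close>. If that matrix is \<open>c / t\<close>, then \<open>det (T - c / t)\<close> is
  \<open>t\<^sup>-\<^sup>n det (t T - c)\<close>; the factor \<open>q\<close> expresses equality in \<open>R\<^sub>p[T]\<close>. Uniqueness holds
  because a polynomial that vanishes in every \<open>R\<^sub>p[T]\<close> is zero.
\<close>

definition is_charpoly ::
  "('r, 'x) ring_scheme \<Rightarrow> ('r, 'm, 'y) module_scheme \<Rightarrow> 'm set \<Rightarrow> nat \<Rightarrow> ('m \<Rightarrow> 'm) \<Rightarrow>
     (nat \<Rightarrow> 'r) \<Rightarrow> bool" where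
  "is_charpoly R M P n u \<chi> \<longleftrightarrow> \<chi> \<in> carrier (UP R) \<and>
     (\<forall>p as t c. primeideal p R \<longrightarrow> local_basis R M P n p as \<longrightarrow> t \<in> carrier R - p \<longrightarrow>
        (\<forall>j<n. \<forall>k<n. c j k \<in> carrier R) \<longrightarrow>
        (\<forall>k<n. t \<odot>\<^bsub>M\<^esub> u (as ! k) = (\<Oplus>\<^bsub>M\<^esub> j\<in>{..<n}. c j k \<odot>\<^bsub>M\<^esub> as ! j)) \<longrightarrow>
        (\<exists>q\<in>carrier R - p.
           q \<odot>\<^bsub>UP R\<^esub> ((t [^]\<^bsub>R\<^esub> n) \<odot>\<^bsub>UP R\<^esub> \<chi>) =
           q \<odot>\<^bsub>UP R\<^esub> determinant (UP R) n (\<lambda>j k.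
             monom (UP R) (if j = k then t else \<zero>\<^bsub>R\<^esub>) 1 \<ominus>\<^bsub>UP R\<^esub> monom (UP R) (c j k) 0)))"

definition charpoly ::
  "('r, 'x) ring_scheme \<Rightarrow> ('r, 'm, 'y) module_scheme \<Rightarrow> 'm set \<Rightarrow> nat \<Rightarrow> ('m \<Rightarrow> 'm) \<Rightarrow> nat \<Rightarrow> 'r" where
  "charpoly R M P n u = (THE \<chi>. is_charpoly R M P n u \<chi>)"


section \<open>Ramified quadratic extensions\<close>

text \<open>
  \<open>fld\<close> is the field \<open>F\<close>, \<open>base\<close> the subfield \<open>F\<^sub>0\<close>, \<open>val\<close> the normalized valuation of \<open>F\<close> (meaningful
  on nonzero elements only), \<open>unif\<close> and \<open>unif0\<close> are \<open>\<pi>\<close> and \<open>\<pi>\<^sub>0\<close>, and \<open>bar\<close> is the nontrivial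
  automorphism of \<open>F\<close> over \<open>F\<^sub>0\<close>.
\<close>

record 'f ramext =
  fld :: "'f ring"
  base :: "'f set"
  val :: "'f \<Rightarrow> int"
  unif :: 'f
  unif0 :: 'f
  bar :: "'f \<Rightarrow> 'f"

definition discrete_valuation :: "('f, 'x) ring_scheme \<Rightarrow> ('f \<Rightarrow> int) \<Rightarrow> bool" where
  "discrete_valuation F v \<longleftrightarrow>
     (\<forall>x\<in>carrier F - {\<zero>\<^bsub>F\<^esub>}. \<forall>y\<in>carrier F - {\<zero>\<^bsub>F\<^esub>}.
        v (x \<otimes>\<^bsub>F\<^esub> y) = v x + v y \<and>
        (x \<oplus>\<^bsub>F\<^esub> y \<noteq> \<zero>\<^bsub>F\<^esub> \<longrightarrow> min (v x) (v y) \<le> v (x \<oplus>\<^bsub>F\<^esub> y))) \<and>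
     v ` (carrier F - {\<zero>\<^bsub>F\<^esub>}) = UNIV"

text \<open>
  The value group of \<open>F\<^sub>0\<close> is \<open>2\<int>\<close> because the ramification index is 2. Hence the residue fields of
  \<open>F\<close> and \<open>F\<^sub>0\<close> agree automatically, and their characteristic is not 2 iff 2 is a unit.
\<close>

definition ramified_quadratic :: "'f ramext \<Rightarrow> bool" where
  "ramified_quadratic K \<longleftrightarrow>
     field (fld K) \<and> subfield (base K) (fld K) \<and>
     ring.dimension (fld K) 2 (base K) (carrier (fld K)) \<and>
     discrete_valuation (fld K) (val K) \<and>
     val K ` (base K - {\<zero>\<^bsub>fld K\<^esub>}) = {k. even k} \<and>
     unif K \<in> carrier (fld K) - {\<zero>\<^bsub>fld K\<^esub>} \<and> val K (unif K) = 1 \<and>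
     unif0 K \<in> base K \<and> unif K \<otimes>\<^bsub>fld K\<^esub> unif K = unif0 K \<and>
     \<one>\<^bsub>fld K\<^esub> \<oplus>\<^bsub>fld K\<^esub> \<one>\<^bsub>fld K\<^esub> \<noteq> \<zero>\<^bsub>fld K\<^esub> \<and> val K (\<one>\<^bsub>fld K\<^esub> \<oplus>\<^bsub>fld K\<^esub> \<one>\<^bsub>fld K\<^esub>) = 0 \<and>
     bar K \<in> ring_iso (fld K) (fld K) \<and> (\<forall>a\<in>base K. bar K a = a) \<and>
     (\<exists>x\<in>carrier (fld K). bar K x \<noteq> x)"

definition int_ring :: "'f ramext \<Rightarrow> 'f ring" where
  "int_ring K = (fld K)\<lparr>carrier := {x \<in> carrier (fld K). x = \<zero>\<^bsub>fld K\<^esub> \<or> 0 \<le> val K x}\<rparr>"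

definition base_ring :: "'f ramext \<Rightarrow> 'f ring" where
  "base_ring K = (fld K)\<lparr>carrier := base K\<rparr>"

definition int_ring0 :: "'f ramext \<Rightarrow> 'f ring" where
  "int_ring0 K = (fld K)\<lparr>carrier := carrier (int_ring K) \<inter> base K\<rparr>"

definition int_ringE :: "'f ramext \<Rightarrow> nat \<Rightarrow> nat \<Rightarrow> 'f ring" where
  "int_ringE K r s = (if r = s then int_ring0 K else int_ring K)"


section \<open>The standard lattice chain\<close>

text \<open>Types of the elements of base changes to \<open>R\<close> of lattices in \<open>F\<^sup>n\<close>, and of their exterior powers.\<close>

type_synonym ('f, 'r) tens = "((nat \<Rightarrow> 'f) \<Rightarrow> 'r) set"
type_synonym ('f, 'r) tens_ext = "(('f, 'r) tens list \<Rightarrow> 'r) set"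

definition vecs :: "'f ramext \<Rightarrow> nat \<Rightarrow> ('f, nat \<Rightarrow> 'f) module" where
  "vecs K n = \<lparr>
     carrier = {1..n} \<rightarrow>\<^sub>E carrier (fld K),
     monoid.mult = undefined, monoid.one = undefined,
     ring.zero = (\<lambda>i\<in>{1..n}. \<zero>\<^bsub>fld K\<^esub>),
     ring.add = (\<lambda>x y. \<lambda>i\<in>{1..n}. x i \<oplus>\<^bsub>fld K\<^esub> y i),
     module.smult = (\<lambda>a x. \<lambda>i\<in>{1..n}. a \<otimes>\<^bsub>fld K\<^esub> x i)\<rparr>"

definition std_basis :: "'f ramext \<Rightarrow> nat \<Rightarrow> nat \<Rightarrow> nat \<Rightarrow> 'f" where
  "std_basis K n i = (\<lambda>j\<in>{1..n}. if j = i then \<one>\<^bsub>fld K\<^esub> else \<zero>\<^bsub>fld K\<^esub>)"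

definition herm :: "'f ramext \<Rightarrow> nat \<Rightarrow> (nat \<Rightarrow> 'f) \<Rightarrow> (nat \<Rightarrow> 'f) \<Rightarrow> 'f" where
  "herm K n x y = (\<Oplus>\<^bsub>fld K\<^esub> i\<in>{1..n}. bar K (x i) \<otimes>\<^bsub>fld K\<^esub> y (n + 1 - i))"

definition trace :: "'f ramext \<Rightarrow> 'f \<Rightarrow> 'f" where
  "trace K z = z \<oplus>\<^bsub>fld K\<^esub> bar K z"

definition alt_form :: "'f ramext \<Rightarrow> nat \<Rightarrow> (nat \<Rightarrow> 'f) \<Rightarrow> (nat \<Rightarrow> 'f) \<Rightarrow> 'f" where
  "alt_form K n x y = inv\<^bsub>fld K\<^esub> (\<one>\<^bsub>fld K\<^esub> \<oplus>\<^bsub>fld K\<^esub> \<one>\<^bsub>fld K\<^esub>) \<otimes>\<^bsub>fld K\<^esub>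
     trace K (inv\<^bsub>fld K\<^esub> (unif K) \<otimes>\<^bsub>fld K\<^esub> herm K n x y)"

definition std_lattice :: "'f ramext \<Rightarrow> nat \<Rightarrow> int \<Rightarrow> ('f, nat \<Rightarrow> 'f) module"  (\<open>\<Lambda>\<close>) where
  "\<Lambda> K n i = (let b = i div int n; c = i mod int n in
     (vecs K n)\<lparr>carrier := {x \<in> carrier (vecs K n). \<forall>j\<in>{1..n}.
        x j \<in> (\<lambda>a. unif K [^]\<^bsub>fld K\<^esub> (if int j \<le> c then - b - 1 else - b) \<otimes>\<^bsub>fld K\<^esub> a) ` carrier (int_ring K)}\<rparr>)"

definition admissible_set :: "nat \<Rightarrow> nat set \<Rightarrow> bool" where
  "admissible_set n I \<longleftrightarrow> (even n \<and> n div 2 - 1 \<in> I \<longrightarrow> n div 2 \<in> I)"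

definition index_set :: "nat \<Rightarrow> nat set \<Rightarrow> int set" where
  "index_set n I = {i. \<exists>k\<in>I. \<exists>l. i = int k + l * int n \<or> i = - int k + l * int n}"


section \<open>The linear-algebra conditions on a family \<open>\<F>\<^sub>i \<subseteq> \<Lambda>\<^sub>i \<otimes> R\<close>\<close>

text \<open>\<open>\<Lambda>\<^sub>i \<otimes> R\<close> over \<open>\<O>\<^sub>F\<^sub>0\<close>.\<close>

definition LamR ::
  "'f ramext \<Rightarrow> nat \<Rightarrow> ('r, 'x) ring_scheme \<Rightarrow> ('f \<Rightarrow> 'r) \<Rightarrow> int \<Rightarrow> ('r, ('f, 'r) tens) module"
  where
  "LamR K n R \<iota> i = tensor (int_ring0 K) \<iota> R (\<Lambda> K n i)"

text \<open>The \<open>R\<close>-linear map into \<open>\<Lambda>\<^sub>j \<otimes> R\<close> induced by multiplication by \<open>a \<in> F\<close>.\<close>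

definition mulR ::
  "'f ramext \<Rightarrow> nat \<Rightarrow> ('r, 'x) ring_scheme \<Rightarrow> ('f \<Rightarrow> 'r) \<Rightarrow> int \<Rightarrow> 'f \<Rightarrow>
     ('f, 'r) tens \<Rightarrow> ('f, 'r) tens" where
  "mulR K n R \<iota> j a =
     tensor_map R (int_ring0 K) \<iota> R (\<Lambda> K n j) (\<lambda>c. c) (\<lambda>x. a \<odot>\<^bsub>vecs K n\<^esub> x)"

definition formR ::
  "'f ramext \<Rightarrow> nat \<Rightarrow> ('r, 'x) ring_scheme \<Rightarrow> ('f \<Rightarrow> 'r) \<Rightarrow>
     ((nat \<Rightarrow> 'f) \<Rightarrow> 'r) \<Rightarrow> ((nat \<Rightarrow> 'f) \<Rightarrow> 'r) \<Rightarrow> 'r" where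
  "formR K n R \<iota> f g = (\<Oplus>\<^bsub>R\<^esub> p \<in> supp R f \<times> supp R g.
     f (fst p) \<otimes>\<^bsub>R\<^esub> g (snd p) \<otimes>\<^bsub>R\<^esub> \<iota> (alt_form K n (fst p) (snd p)))"

definition pairing ::
  "'f ramext \<Rightarrow> nat \<Rightarrow> ('r, 'x) ring_scheme \<Rightarrow> ('f \<Rightarrow> 'r) \<Rightarrow>
     ('f, 'r) tens \<Rightarrow> ('f, 'r) tens \<Rightarrow> 'r" where
  "pairing K n R \<iota> C D = (THE z. \<exists>f\<in>C. \<exists>g\<in>D. z = formR K n R \<iota> f g)"

text \<open>
  Being stable under \<open>\<O>\<^sub>F \<otimes> R\<close> means being an \<open>R\<close>-submodule stable under all \<open>a \<otimes> 1\<close>.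
\<close>

definition LM1 ::
  "'f ramext \<Rightarrow> nat \<Rightarrow> nat set \<Rightarrow> ('r, 'x) ring_scheme \<Rightarrow> ('f \<Rightarrow> 'r) \<Rightarrow>
     (int \<Rightarrow> ('f, 'r) tens set) \<Rightarrow> bool" where
  "LM1 K n I R \<iota> Fam \<longleftrightarrow> (\<forall>i\<in>index_set n I.
     direct_summand R (LamR K n R \<iota> i) (Fam i) \<and>
     has_rank R (LamR K n R \<iota> i) (Fam i) n \<and>
     (\<forall>a\<in>carrier (int_ring K). mulR K n R \<iota> i a ` Fam i \<subseteq> Fam i))"

definition LM2 ::
  "'f ramext \<Rightarrow> nat \<Rightarrow> nat set \<Rightarrow> ('r, 'x) ring_scheme \<Rightarrow> ('f \<Rightarrow> 'r) \<Rightarrow>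
     (int \<Rightarrow> ('f, 'r) tens set) \<Rightarrow> bool" where
  "LM2 K n I R \<iota> Fam \<longleftrightarrow> (\<forall>i\<in>index_set n I. \<forall>j\<in>index_set n I. i < j \<longrightarrow>
     tensor_map R (int_ring0 K) \<iota> R (\<Lambda> K n j) (\<lambda>c. c) (\<lambda>x. x) ` Fam i \<subseteq> Fam j)"

definition LM3 ::
  "'f ramext \<Rightarrow> nat \<Rightarrow> nat set \<Rightarrow> ('r, 'x) ring_scheme \<Rightarrow> ('f \<Rightarrow> 'r) \<Rightarrow>
     (int \<Rightarrow> ('f, 'r) tens set) \<Rightarrow> bool" where
  "LM3 K n I R \<iota> Fam \<longleftrightarrow>
     (\<forall>i\<in>index_set n I. mulR K n R \<iota> (i - int n) (unif K) ` Fam i = Fam (i - int n))"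

definition LM4 ::
  "'f ramext \<Rightarrow> nat \<Rightarrow> nat set \<Rightarrow> ('r, 'x) ring_scheme \<Rightarrow> ('f \<Rightarrow> 'r) \<Rightarrow>
     (int \<Rightarrow> ('f, 'r) tens set) \<Rightarrow> bool" where
  "LM4 K n I R \<iota> Fam \<longleftrightarrow> (\<forall>i\<in>index_set n I.
     {y \<in> carrier (LamR K n R \<iota> (- i)). \<forall>x\<in>Fam i. pairing K n R \<iota> x y = \<zero>\<^bsub>R\<^esub>} = Fam (- i))"


section \<open>The spaces \<open>V\<close> and \<open>W\<close>\<close>

definition VF :: "'f ramext \<Rightarrow> nat \<Rightarrow> ('f, ('f, 'f) tens) module" where
  "VF K n = tensor (base_ring K) (\<lambda>a. a) (fld K) (vecs K n)"

text \<open>The element \<open>x \<otimes> a\<close> of \<open>V\<close>.\<close>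

definition VF_pure :: "'f ramext \<Rightarrow> nat \<Rightarrow> (nat \<Rightarrow> 'f) \<Rightarrow> 'f \<Rightarrow> ('f, 'f) tens" where
  "VF_pure K n x a = pure_tensor (base_ring K) (\<lambda>a. a) (fld K) (vecs K n) x a"

text \<open>The eigenspace of \<open>\<pi> \<otimes> 1\<close> on \<open>V\<close> for the eigenvalue \<open>c\<close>.\<close>

definition VF_eig :: "'f ramext \<Rightarrow> nat \<Rightarrow> 'f \<Rightarrow> ('f, 'f) tens set" where
  "VF_eig K n c = {v \<in> carrier (VF K n).
     tensor_map (fld K) (base_ring K) (\<lambda>a. a) (fld K) (vecs K n) (\<lambda>a. a)
       (\<lambda>x. unif K \<odot>\<^bsub>vecs K n\<^esub> x) v = c \<odot>\<^bsub>VF K n\<^esub> v}"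

definition WF :: "'f ramext \<Rightarrow> nat \<Rightarrow> ('f, ('f, 'f) tens_ext) module" where
  "WF K n = ext_power (fld K) n (VF K n)"

text \<open>
  \<open>W\<^sup>r\<^sup>,\<^sup>s\<close>, the image of \<open>\<And>\<^sup>r V\<^sub>-\<^sub>\<pi> \<otimes> \<And>\<^sup>s V\<^sub>\<pi>\<close> under \<open>\<xi> \<otimes> \<eta> \<mapsto> \<xi> \<and> \<eta>\<close>.
\<close>

definition W_rs :: "'f ramext \<Rightarrow> nat \<Rightarrow> nat \<Rightarrow> nat \<Rightarrow> ('f, 'f) tens_ext set" where
  "W_rs K n r s = lin_span (fld K) (WF K n)
     {wedge (fld K) n (VF K n) (xs @ ys) | xs ys.
        xs \<in> tuples r (VF_eig K n (\<ominus>\<^bsub>fld K\<^esub> unif K)) \<and> ys \<in> tuples s (VF_eig K n (unif K))}"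

text \<open>The basis \<open>f\<^sub>1, \<dots>, f\<^bsub>2n\<^esub>\<close> of \<open>V\<close>; for \<open>n\<close> odd, positions \<open>m + 1\<close> and \<open>n + m + 1\<close> are special.\<close>

definition f_basis :: "'f ramext \<Rightarrow> nat \<Rightarrow> nat \<Rightarrow> ('f, 'f) tens" where
  "f_basis K n j = (let
     F = fld K; p = unif K; pinv = inv\<^bsub>fld K\<^esub> (unif K); m = n div 2;
     e = std_basis K n;
     sc = (\<lambda>a x. a \<odot>\<^bsub>vecs K n\<^esub> x);
     em1 = VF_pure K n (e (m + 1)) \<one>\<^bsub>F\<^esub>;
     em2 = VF_pure K n (sc p (e (m + 1))) pinv
   in
     if j \<le> m then VF_pure K n (sc (\<ominus>\<^bsub>F\<^esub> pinv) (e j)) \<one>\<^bsub>F\<^esub>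
     else if odd n \<and> j = m + 1 then em1 \<ominus>\<^bsub>VF K n\<^esub> em2
     else if j \<le> n then VF_pure K n (e j) \<one>\<^bsub>F\<^esub>
     else if j \<le> n + m then VF_pure K n (e (j - n)) \<one>\<^bsub>F\<^esub>
     else if odd n \<and> j = n + m + 1 then
       inv\<^bsub>F\<^esub> (\<one>\<^bsub>F\<^esub> \<oplus>\<^bsub>F\<^esub> \<one>\<^bsub>F\<^esub>) \<odot>\<^bsub>VF K n\<^esub> (em1 \<oplus>\<^bsub>VF K n\<^esub> em2)
     else VF_pure K n (sc p (e (j - n))) \<one>\<^bsub>F\<^esub>)"

definition f_wedge :: "'f ramext \<Rightarrow> nat \<Rightarrow> nat set \<Rightarrow> ('f, 'f) tens_ext" where
  "f_wedge K n S = wedge (fld K) n (VF K n) (map (f_basis K n) (sorted_list_of_set S))"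

definition perp_set :: "nat \<Rightarrow> nat set \<Rightarrow> nat set" where
  "perp_set n S = {1..2 * n} - (\<lambda>i. 2 * n + 1 - i) ` S"

definition sigma_perm :: "nat \<Rightarrow> nat set \<Rightarrow> nat \<Rightarrow> nat" where
  "sigma_perm n S j = (if j \<in> {1..2 * n}
     then (sorted_list_of_set S @ sorted_list_of_set ({1..2 * n} - S)) ! (j - 1) else j)"

text \<open>\<open>W\<^sub>\<epsilon>\<close> for a sign \<open>\<epsilon>\<close>.\<close>

definition W_sign :: "'f ramext \<Rightarrow> nat \<Rightarrow> int \<Rightarrow> ('f, 'f) tens_ext set" where
  "W_sign K n \<epsilon> = lin_span (fld K) (WF K n)
     {f_wedge K n S \<oplus>\<^bsub>WF K n\<^esub> [(\<epsilon> * sign (sigma_perm n S))] \<cdot>\<^bsub>WF K n\<^esub> f_wedge K n (perp_set n S) | S.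
        S \<subseteq> {1..2 * n} \<and> card S = n}"


section \<open>The Kottwitz condition and its refinements\<close>

text \<open>
  \<open>W(\<Lambda>\<^sub>i)\<close> is the exterior power of \<open>\<Lambda>\<^sub>i \<otimes> \<O>\<^sub>F\<close> over \<open>\<O>\<^sub>F\<close>. It is viewed in \<open>W\<close> through
  \<open>WLam_incl\<close>, and \<open>W(\<Lambda>\<^sub>i) \<otimes> R\<close> is identified with \<open>\<And>\<^sup>n\<^sub>R (\<Lambda>\<^sub>i \<otimes> R)\<close>, the canonical map from
  \<open>W(\<Lambda>\<^sub>i)\<close> to it being \<open>WLam_red\<close>.
\<close>

definition LamO :: "'f ramext \<Rightarrow> nat \<Rightarrow> int \<Rightarrow> ('f, ('f, 'f) tens) module" where
  "LamO K n i = LamR K n (int_ring K) (\<lambda>a. a) i"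

definition WLam :: "'f ramext \<Rightarrow> nat \<Rightarrow> int \<Rightarrow> ('f, ('f, 'f) tens_ext) module" where
  "WLam K n i = ext_power (int_ring K) n (LamO K n i)"

definition WLam_incl ::
  "'f ramext \<Rightarrow> nat \<Rightarrow> ('f, 'f) tens_ext \<Rightarrow> ('f, 'f) tens_ext" where
  "WLam_incl K n = ext_map (int_ring K) (fld K) n (VF K n) (\<lambda>a. a)
     (tensor_map (int_ring K) (base_ring K) (\<lambda>a. a) (fld K) (vecs K n) (\<lambda>a. a) (\<lambda>x. x))"

definition WLam_red ::
  "'f ramext \<Rightarrow> nat \<Rightarrow> ('r, 'x) ring_scheme \<Rightarrow> ('f \<Rightarrow> 'r) \<Rightarrow> int \<Rightarrow>
     ('f, 'f) tens_ext \<Rightarrow> ('f, 'r) tens_ext" where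
  "WLam_red K n R \<iota> i = ext_map (int_ring K) R n (LamR K n R \<iota> i) \<iota>
     (tensor_map (int_ring K) (int_ring0 K) \<iota> R (\<Lambda> K n i) \<iota> (\<lambda>x. x))"

text \<open>
  For \<open>\<iota> : \<O>\<^sub>F \<rightarrow> R\<close> and a subspace \<open>U\<close> of \<open>W\<close>: for all \<open>i\<close>, the line \<open>\<And>\<^sup>n \<F>\<^sub>i\<close> lies in the image of
  \<open>(U \<inter> W(\<Lambda>\<^sub>i)) \<otimes> R\<close>, that is, in the \<open>R\<close>-span of the image of \<open>U \<inter> W(\<Lambda>\<^sub>i)\<close>.
\<close>

definition lines_in ::
  "'f ramext \<Rightarrow> nat \<Rightarrow> nat set \<Rightarrow> ('f, 'f) tens_ext set \<Rightarrow>
     ('r, 'x) ring_scheme \<Rightarrow> ('f \<Rightarrow> 'r) \<Rightarrow> (int \<Rightarrow> ('f, 'r) tens set) \<Rightarrow> bool" where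
  "lines_in K n I U R \<iota> Fam \<longleftrightarrow> (\<forall>i\<in>index_set n I.
     ext_sub R n (LamR K n R \<iota> i) (Fam i) \<subseteq>
     lin_span R (ext_power R n (LamR K n R \<iota> i))
       (WLam_red K n R \<iota> i ` {w \<in> carrier (WLam K n i). WLam_incl K n w \<in> U}))"

text \<open>
  For an \<open>\<O>\<^sub>F\<^sub>0\<close>-algebra \<open>R\<close>: the ring \<open>R \<otimes> \<O>\<^sub>F\<close> over \<open>\<O>\<^sub>F\<^sub>0\<close>, its structure maps from \<open>R\<close> and from
  \<open>\<O>\<^sub>F\<close>, and the base change of a family.
\<close>

definition bc_ring :: "'f ramext \<Rightarrow> ('r, 'x) ring_scheme \<Rightarrow> ('f \<Rightarrow> 'r) \<Rightarrow> ('f \<Rightarrow> 'r) set ring" where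
  "bc_ring K R \<iota> = tensor_ring (int_ring0 K) \<iota> R (int_ring K)"

definition bc_left ::
  "'f ramext \<Rightarrow> ('r, 'x) ring_scheme \<Rightarrow> ('f \<Rightarrow> 'r) \<Rightarrow> 'r \<Rightarrow> ('f \<Rightarrow> 'r) set" where
  "bc_left K R \<iota> c =
     pure_tensor (int_ring0 K) \<iota> R (ring_as_module (int_ring K)) \<one>\<^bsub>fld K\<^esub> c"

definition bc_right ::
  "'f ramext \<Rightarrow> ('r, 'x) ring_scheme \<Rightarrow> ('f \<Rightarrow> 'r) \<Rightarrow> 'f \<Rightarrow> ('f \<Rightarrow> 'r) set" where
  "bc_right K R \<iota> a =
     pure_tensor (int_ring0 K) \<iota> R (ring_as_module (int_ring K)) a \<one>\<^bsub>R\<^esub>"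

definition bc_family ::
  "'f ramext \<Rightarrow> nat \<Rightarrow> ('r, 'x) ring_scheme \<Rightarrow> ('f \<Rightarrow> 'r) \<Rightarrow>
     (int \<Rightarrow> ('f, 'r) tens set) \<Rightarrow> int \<Rightarrow> ('f, ('f \<Rightarrow> 'r) set) tens set" where
  "bc_family K n R \<iota> Fam i = (let R' = bc_ring K R \<iota>; \<iota>' = bc_right K R \<iota> in
     lin_span R' (LamR K n R' \<iota>' i)
       (tensor_map R (int_ring0 K) \<iota>' R' (\<Lambda> K n i) (bc_left K R \<iota>) (\<lambda>x. x) ` Fam i))"

text \<open>The condition for \<open>\<O>\<^sub>E\<close>-algebras: if \<open>r = s\<close>, it is tested after base change to \<open>R \<otimes> \<O>\<^sub>F\<close>.\<close>

definition lines_inE ::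
  "'f ramext \<Rightarrow> nat \<Rightarrow> nat \<Rightarrow> nat \<Rightarrow> nat set \<Rightarrow> ('f, 'f) tens_ext set \<Rightarrow>
     ('r, 'x) ring_scheme \<Rightarrow> ('f \<Rightarrow> 'r) \<Rightarrow> (int \<Rightarrow> ('f, 'r) tens set) \<Rightarrow> bool" where
  "lines_inE K n r s I U R \<iota> Fam \<longleftrightarrow>
     (if r = s then lines_in K n I U (bc_ring K R \<iota>) (bc_right K R \<iota>) (bc_family K n R \<iota> Fam)
      else lines_in K n I U R \<iota> Fam)"

definition condition_K ::
  "'f ramext \<Rightarrow> nat \<Rightarrow> nat \<Rightarrow> nat \<Rightarrow> nat set \<Rightarrow> ('r, 'x) ring_scheme \<Rightarrow> ('f \<Rightarrow> 'r) \<Rightarrow>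
     (int \<Rightarrow> ('f, 'r) tens set) \<Rightarrow> bool" where
  "condition_K K n r s I R \<iota> Fam \<longleftrightarrow> lines_inE K n r s I (W_rs K n r s) R \<iota> Fam"

definition condition_N ::
  "'f ramext \<Rightarrow> nat \<Rightarrow> nat \<Rightarrow> nat \<Rightarrow> nat set \<Rightarrow> ('r, 'x) ring_scheme \<Rightarrow> ('f \<Rightarrow> 'r) \<Rightarrow>
     (int \<Rightarrow> ('f, 'r) tens set) \<Rightarrow> bool" where
  "condition_N K n r s I R \<iota> Fam \<longleftrightarrow>
     lines_inE K n r s I (W_rs K n r s \<inter> W_sign K n ((- 1) ^ s)) R \<iota> Fam"

text \<open>\<open>(T - \<pi>)\<^sup>s (T + \<pi>)\<^sup>r\<close> in \<open>R[T]\<close>, read as \<open>(T\<^sup>2 - \<pi>\<^sub>0)\<^sup>s\<close> if \<open>r = s\<close>.\<close>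

definition kottwitz_poly ::
  "'f ramext \<Rightarrow> nat \<Rightarrow> nat \<Rightarrow> ('r, 'x) ring_scheme \<Rightarrow> ('f \<Rightarrow> 'r) \<Rightarrow> nat \<Rightarrow> 'r" where
  "kottwitz_poly K r s R \<iota> = (let P = UP R; T = monom (UP R) \<one>\<^bsub>R\<^esub> in
     if r = s then (T 2 \<ominus>\<^bsub>P\<^esub> monom P (\<iota> (unif0 K)) 0) [^]\<^bsub>P\<^esub> s
     else (T 1 \<ominus>\<^bsub>P\<^esub> monom P (\<iota> (unif K)) 0) [^]\<^bsub>P\<^esub> s \<otimes>\<^bsub>P\<^esub>
          (T 1 \<oplus>\<^bsub>P\<^esub> monom P (\<iota> (unif K)) 0) [^]\<^bsub>P\<^esub> r)"

definition kottwitz ::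
  "'f ramext \<Rightarrow> nat \<Rightarrow> nat \<Rightarrow> nat \<Rightarrow> nat set \<Rightarrow> ('r, 'x) ring_scheme \<Rightarrow> ('f \<Rightarrow> 'r) \<Rightarrow>
     (int \<Rightarrow> ('f, 'r) tens set) \<Rightarrow> bool" where
  "kottwitz K n r s I R \<iota> Fam \<longleftrightarrow> (\<forall>i\<in>index_set n I.
     charpoly R (LamR K n R \<iota> i) (Fam i) n (mulR K n R \<iota> i (unif K)) = kottwitz_poly K r s R \<iota>)"

end

theory Submission
  imports Defs "HOL-Algebra.Ring_Divisibility"
begin

text \<open>
  Choose coordinates \<open>c\<^sub>1, \<dots>, c\<^bsub>2n\<^esub>\<close> on \<open>\<Lambda>\<^sub>i \<otimes> R\<close> coming from an \<open>\<O>\<^sub>F\<^sub>0\<close>-basis of \<open>\<Lambda>\<^sub>i\<close>, and let \<open>u = \<pi> \<otimes> 1\<close>.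
  For \<open>n\<close> of the coordinates, \<open>det (T c\<^sub>j(x\<^sub>k) - c\<^sub>j(u x\<^sub>k))\<close> and \<open>det (c\<^sub>j(x\<^sub>k))\<close> are alternating in
  \<open>x\<^sub>1, \<dots>, x\<^sub>n\<close>, hence functionals on the exterior power with values in \<open>R[T]\<close>. On \<open>W\<^sup>r\<^sup>,\<^sup>s\<close> the first is
  \<open>\<chi> = (T - \<pi>)\<^sup>s (T + \<pi>)\<^sup>r\<close> times the second, because the vectors there are eigenvectors of \<open>u\<close>. Both functionals
  are compatible with \<open>W(\<Lambda>\<^sub>i) \<subseteq> W\<close> and with \<open>W(\<Lambda>\<^sub>i) \<rightarrow> \<And>\<^sup>n(\<Lambda>\<^sub>i \<otimes> R)\<close>, so the relation carries over
  to the line \<open>\<And>\<^sup>n \<F>\<^sub>i\<close>. On a local basis of \<open>\<F>\<^sub>i\<close> the first functional is also \<open>det (T - u | \<F>\<^sub>i)\<close> times the second,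
  and the minors \<open>det (c\<^sub>j(x\<^sub>k))\<close> of the basis generate the unit ideal locally because \<open>\<F>\<^sub>i\<close> is a direct summand.
  If \<open>r = s\<close>, the relation is obtained in \<open>R \<otimes> \<O>\<^sub>F\<close> and pulled back along the injection \<open>R \<rightarrow> R \<otimes> \<O>\<^sub>F\<close>.
\<close>

section \<open>Modules given by generators and relations\<close>

context cring
begin

lemma supp_add: "supp R (\<lambda>g. f g \<oplus> h g) \<subseteq> supp R f \<union> supp R h"
  by (auto simp: supp_def)

lemma free_mod_carrier_iff:
  "f \<in> carrier (free_mod R G) \<longleftrightarrow> (\<forall>g. f g \<in> carrier R) \<and> supp R f \<subseteq> G \<and> finite (supp R f)"
  by (auto simp: free_mod_def)

lemma single_closed [simp, intro]:
  assumes "g \<in> G" "c \<in> carrier R"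
  shows "single R g c \<in> carrier (free_mod R G)"
proof -
  have "supp R (single R g c) \<subseteq> {g}" by (auto simp: supp_def single_def)
  then show ?thesis using assms finite_subset
    by (auto simp: free_mod_carrier_iff single_def)
qed

lemma free_mod_simps [simp]:
  "\<zero>\<^bsub>free_mod R G\<^esub> = (\<lambda>g. \<zero>)"
  "f \<oplus>\<^bsub>free_mod R G\<^esub> h = (\<lambda>g. f g \<oplus> h g)"
  "c \<odot>\<^bsub>free_mod R G\<^esub> f = (\<lambda>g. c \<otimes> f g)"
  by (simp_all add: free_mod_def)

lemma free_mod_module: "module R (free_mod R G)"
proof (rule moduleI)
  show "cring R" by (rule is_cring)
  show "abelian_group (free_mod R G)"
  proof (rule abelian_groupI)
    fix f h assume fh: "f \<in> carrier (free_mod R G)" "h \<in> carrier (free_mod R G)"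
    show "f \<oplus>\<^bsub>free_mod R G\<^esub> h \<in> carrier (free_mod R G)"
      using fh supp_add[of f h] by (auto simp: free_mod_carrier_iff intro: finite_subset)
    show "f \<oplus>\<^bsub>free_mod R G\<^esub> h = h \<oplus>\<^bsub>free_mod R G\<^esub> f"
      using fh by (auto simp: free_mod_carrier_iff a_comm)
    fix k assume k: "k \<in> carrier (free_mod R G)"
    show "f \<oplus>\<^bsub>free_mod R G\<^esub> h \<oplus>\<^bsub>free_mod R G\<^esub> k = f \<oplus>\<^bsub>free_mod R G\<^esub> (h \<oplus>\<^bsub>free_mod R G\<^esub> k)"
      using fh k by (auto simp: free_mod_carrier_iff a_assoc)
  next
    show "\<zero>\<^bsub>free_mod R G\<^esub> \<in> carrier (free_mod R G)"
      by (auto simp: free_mod_carrier_iff supp_def)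
  next
    fix f assume f: "f \<in> carrier (free_mod R G)"
    show "\<zero>\<^bsub>free_mod R G\<^esub> \<oplus>\<^bsub>free_mod R G\<^esub> f = f" using f by (auto simp: free_mod_carrier_iff)
    have s: "supp R (\<lambda>g. \<ominus> f g) = supp R f"
      using f by (auto simp: supp_def free_mod_carrier_iff)
    show "\<exists>h\<in>carrier (free_mod R G). h \<oplus>\<^bsub>free_mod R G\<^esub> f = \<zero>\<^bsub>free_mod R G\<^esub>"
      using f s by (intro bexI[of _ "\<lambda>g. \<ominus> f g"]) (auto simp: free_mod_carrier_iff l_neg)
  qed
next
  fix a f assume a: "a \<in> carrier R" and f: "f \<in> carrier (free_mod R G)"
  have "supp R (\<lambda>g. a \<otimes> f g) \<subseteq> supp R f" using a by (auto simp: supp_def)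
  then show "a \<odot>\<^bsub>free_mod R G\<^esub> f \<in> carrier (free_mod R G)"
    using a f by (auto simp: free_mod_carrier_iff intro: finite_subset)
qed (auto simp: free_mod_carrier_iff l_distr r_distr m_assoc)

lemma free_mod_zero [simp]: "(\<lambda>g. \<zero>) \<in> carrier (free_mod R G)"
  by (auto simp: free_mod_carrier_iff supp_def)

lemma free_mod_a_inv:
  assumes f: "f \<in> carrier (free_mod R G)"
  shows "\<ominus>\<^bsub>free_mod R G\<^esub> f = (\<lambda>g. \<ominus> f g)"
proof -
  interpret L: module R "free_mod R G" by (rule free_mod_module)
  have s: "supp R (\<lambda>g. \<ominus> f g) = supp R f"
    using f by (auto simp: supp_def free_mod_carrier_iff)
  have "(\<lambda>g. \<ominus> f g) \<in> carrier (free_mod R G)"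
    using f s by (auto simp: free_mod_carrier_iff)
  then show ?thesis using f
    by (intro L.minus_equality) (auto simp: free_mod_carrier_iff l_neg)
qed

lemma free_mod_induct [consumes 1, case_names zero single add]:
  assumes f: "f \<in> carrier (free_mod R G)"
    and zero: "P (\<lambda>g. \<zero>)"
    and single: "\<And>g c. g \<in> G \<Longrightarrow> c \<in> carrier R \<Longrightarrow> P (single R g c)"
    and add: "\<And>f h. f \<in> carrier (free_mod R G) \<Longrightarrow> h \<in> carrier (free_mod R G) \<Longrightarrow> P f \<Longrightarrow> P h
        \<Longrightarrow> P (\<lambda>g. f g \<oplus> h g)"
  shows "P f"
proof -
  have "\<forall>f. f \<in> carrier (free_mod R G) \<longrightarrow> supp R f \<subseteq> A \<longrightarrow> P f" if "finite A" "A \<subseteq> G" for A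
    using that
  proof (induction A)
    case empty
    have "f = (\<lambda>g. \<zero>)" if "supp R f \<subseteq> {}" for f using that by (auto simp: supp_def)
    then show ?case using zero by blast
  next
    case (insert a A)
    show ?case
    proof (intro allI impI)
      fix f assume f: "f \<in> carrier (free_mod R G)" and s: "supp R f \<subseteq> insert a A"
      define h where "h = f(a := \<zero>)"
      have hs: "supp R h \<subseteq> A" using s by (auto simp: supp_def h_def)
      have hc: "h \<in> carrier (free_mod R G)"
        using f hs insert.prems insert.hyps
        by (auto simp: free_mod_carrier_iff h_def intro: finite_subset)
      have "f = (\<lambda>g. single R a (f a) g \<oplus> h g)"
        using f by (auto simp: single_def h_def free_mod_carrier_iff)
      moreover have "P (\<lambda>g. single R a (f a) g \<oplus> h g)"
        using insert hs hc f by (intro add single single_closed) (auto simp: free_mod_carrier_iff)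
      ultimately show "P f" by simp
    qed
  qed
  then show ?thesis using f by (auto simp: free_mod_carrier_iff)
qed

end

lemma lin_span_superset: "S \<subseteq> lin_span R M S"
  by (auto simp: lin_span_def)

lemma lin_span_least: "submodule N R M \<Longrightarrow> S \<subseteq> N \<Longrightarrow> lin_span R M S \<subseteq> N"
  by (auto simp: lin_span_def)

context module
begin

lemma submodule_zero:
  assumes "submodule N R M" shows "\<zero>\<^bsub>M\<^esub> \<in> N"
  using subgroup.one_closed[OF submodule.axioms(1)[OF assms]] by simp

lemma lin_span_submodule:
  assumes "S \<subseteq> carrier M"
  shows "submodule (lin_span R M S) R M"
proof (rule submoduleI)
  show "lin_span R M S \<subseteq> carrier M"
    using lin_span_least[OF carrier_is_submodule assms] .
  show "\<zero>\<^bsub>M\<^esub> \<in> lin_span R M S"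
    by (auto simp: lin_span_def submodule_zero)
  show "\<ominus>\<^bsub>M\<^esub> a \<in> lin_span R M S" if "a \<in> lin_span R M S" for a
    using that submoduleE(3) by (auto simp: lin_span_def)
  show "a \<oplus>\<^bsub>M\<^esub> b \<in> lin_span R M S" if "a \<in> lin_span R M S" "b \<in> lin_span R M S" for a b
    using that submoduleE(5) by (auto simp: lin_span_def)
  show "a \<odot>\<^bsub>M\<^esub> b \<in> lin_span R M S" if "a \<in> carrier R" "b \<in> lin_span R M S" for a b
    using that submoduleE(4) by (auto simp: lin_span_def)
qed

lemma submodule_finsum:
  assumes "submodule N R M" "\<And>i. i \<in> A \<Longrightarrow> f i \<in> N"
  shows "(\<Oplus>\<^bsub>M\<^esub>i\<in>A. f i) \<in> N"
  using assms(2)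
proof (induction A rule: infinite_finite_induct)
  case (insert x F)
  have "f \<in> F \<rightarrow> carrier M" "f x \<in> carrier M" using insert submoduleE(1)[OF assms(1)] by auto
  then show ?case using insert by (simp add: submoduleE(5)[OF assms(1)])
qed (use assms(1) in \<open>auto simp: submodule_zero\<close>)


context
  fixes N assumes N: "submodule N R M"
begin

lemma submodule_abelian_subgroup: "abelian_subgroup N M"
  using submodule.axioms(1)[OF N]
  by (intro abelian_subgroupI3 additive_subgroup.intro M.abelian_group_axioms) 

interpretation N: abelian_subgroup N M by (rule submodule_abelian_subgroup)

lemma quot_carrier: "carrier (quot_mod R M N) = (\<lambda>x. N +>\<^bsub>M\<^esub> x) ` carrier M"
  by (auto simp: quot_mod_def A_RCOSETS_def')

lemma quot_add:
  "x \<in> carrier M \<Longrightarrow> y \<in> carrier M \<Longrightarrow>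
    (N +>\<^bsub>M\<^esub> x) \<oplus>\<^bsub>quot_mod R M N\<^esub> (N +>\<^bsub>M\<^esub> y) = N +>\<^bsub>M\<^esub> (x \<oplus>\<^bsub>M\<^esub> y)"
  by (simp add: quot_mod_def N.a_rcos_sum)

lemma quot_eqI:
  assumes "x \<in> carrier M" "y \<in> carrier M" "x \<ominus>\<^bsub>M\<^esub> y \<in> N"
  shows "N +>\<^bsub>M\<^esub> x = N +>\<^bsub>M\<^esub> y"
  using assms N.a_rcos_module_rev[of y x] M.a_repr_independence[of x N y, OF _ _ N.a_subgroup]
  by (simp only: M.minus_eq)

lemma quot_mem:
  assumes "x \<in> carrier M" "y \<in> N +>\<^bsub>M\<^esub> x"
  shows "y \<in> carrier M \<and> y \<ominus>\<^bsub>M\<^esub> x \<in> N \<and> N +>\<^bsub>M\<^esub> y = N +>\<^bsub>M\<^esub> x"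
proof -
  have y: "y \<in> carrier M" using assms N.a_elemrcos_carrier by auto
  moreover have "y \<ominus>\<^bsub>M\<^esub> x \<in> N" using N.a_rcos_module_imp[OF assms] by (simp only: M.minus_eq)
  moreover have "N +>\<^bsub>M\<^esub> x = N +>\<^bsub>M\<^esub> y" using M.a_repr_independence[OF assms(2,1) N.a_subgroup] .
  ultimately show ?thesis by simp
qed

lemma quot_self: "x \<in> carrier M \<Longrightarrow> x \<in> N +>\<^bsub>M\<^esub> x"
  by (rule N.a_rcos_self)

lemma quot_smult:
  assumes "c \<in> carrier R" "x \<in> carrier M"
  shows "c \<odot>\<^bsub>quot_mod R M N\<^esub> (N +>\<^bsub>M\<^esub> x) = N +>\<^bsub>M\<^esub> (c \<odot>\<^bsub>M\<^esub> x)"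
proof -
  have eq: "N +>\<^bsub>M\<^esub> (c \<odot>\<^bsub>M\<^esub> y) = N +>\<^bsub>M\<^esub> (c \<odot>\<^bsub>M\<^esub> x)" if "y \<in> N +>\<^bsub>M\<^esub> x" for y
  proof (rule quot_eqI)
    have y: "y \<in> carrier M" "y \<ominus>\<^bsub>M\<^esub> x \<in> N" using quot_mem[OF assms(2) that] by auto
    then have "c \<odot>\<^bsub>M\<^esub> (y \<ominus>\<^bsub>M\<^esub> x) \<in> N" using submoduleE(4)[OF N] assms by auto
    then show "c \<odot>\<^bsub>M\<^esub> y \<ominus>\<^bsub>M\<^esub> c \<odot>\<^bsub>M\<^esub> x \<in> N"
      using y assms by (simp add: M.minus_eq smult_r_distr smult_r_minus)
    show "c \<odot>\<^bsub>M\<^esub> y \<in> carrier M" using y assms by auto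
  qed (use assms in auto)
  have "(\<Union>y\<in>N +>\<^bsub>M\<^esub> x. N +>\<^bsub>M\<^esub> (c \<odot>\<^bsub>M\<^esub> y)) = N +>\<^bsub>M\<^esub> (c \<odot>\<^bsub>M\<^esub> x)"
    by (rule SUP_eq_const) (use quot_self[OF assms(2)] eq in blast)+
  then show ?thesis by (simp add: quot_mod_def)
qed

lemma quot_zero: "\<zero>\<^bsub>quot_mod R M N\<^esub> = N +>\<^bsub>M\<^esub> \<zero>\<^bsub>M\<^esub>"
  by (simp add: quot_mod_def N.a_subset)

lemma quot_module: "module R (quot_mod R M N)"
proof (rule moduleI)
  let ?Q = "quot_mod R M N"
  show "cring R" by unfold_locales
  show "abelian_group ?Q"
  proof (rule abelian_groupI)
    fix X assume "X \<in> carrier ?Q"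
    then obtain x where x: "x \<in> carrier M" "X = N +>\<^bsub>M\<^esub> x" by (auto simp: quot_carrier)
    show "\<zero>\<^bsub>?Q\<^esub> \<oplus>\<^bsub>?Q\<^esub> X = X" using x by (simp add: quot_zero quot_add)
    show "\<exists>Y\<in>carrier ?Q. Y \<oplus>\<^bsub>?Q\<^esub> X = \<zero>\<^bsub>?Q\<^esub>"
      using x by (intro bexI[of _ "N +>\<^bsub>M\<^esub> (\<ominus>\<^bsub>M\<^esub> x)"]) (simp_all add: quot_zero quot_add M.l_neg quot_carrier)
  qed (auto simp: quot_carrier quot_add quot_zero M.a_ac)
qed (auto simp: quot_carrier quot_add quot_smult smult_l_distr smult_r_distr smult_assoc1)

end

end

locale presentation = cring R for R :: "('a, 'x) ring_scheme" (structure) +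
  fixes G :: "'g set" and K :: "('g \<Rightarrow> 'a) set"
  assumes K_carrier: "K \<subseteq> carrier (free_mod R G)"
begin

abbreviation "L \<equiv> free_mod R G"
abbreviation "N \<equiv> lin_span R (free_mod R G) K"
abbreviation "Q \<equiv> presented R G K"
abbreviation "cl \<equiv> pclass R G K"

lemma L_module: "module R L" by (rule free_mod_module)

lemma N_submodule: "submodule N R L"
  by (rule module.lin_span_submodule[OF L_module K_carrier])

lemma Q_module: "module R Q"
  unfolding presented_def by (rule module.quot_module[OF L_module N_submodule])

lemma Q_carrier: "carrier Q = cl ` carrier L"
  unfolding presented_def pclass_def by (rule module.quot_carrier[OF L_module N_submodule])

lemma cl_closed [simp, intro]: "f \<in> carrier L \<Longrightarrow> cl f \<in> carrier Q"
  by (simp add: Q_carrier)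

lemma cl_add: "f \<in> carrier L \<Longrightarrow> h \<in> carrier L \<Longrightarrow> cl f \<oplus>\<^bsub>Q\<^esub> cl h = cl (\<lambda>g. f g \<oplus> h g)"
  using module.quot_add[OF L_module N_submodule, of f h]
  unfolding presented_def pclass_def by simp

lemma cl_smult: "f \<in> carrier L \<Longrightarrow> c \<in> carrier R \<Longrightarrow> c \<odot>\<^bsub>Q\<^esub> cl f = cl (\<lambda>g. c \<otimes> f g)"
  using module.quot_smult[OF L_module N_submodule, of c f]
  unfolding presented_def pclass_def by simp

lemma cl_zero: "\<zero>\<^bsub>Q\<^esub> = cl (\<lambda>g. \<zero>)"
  using module.quot_zero[OF L_module N_submodule]
  unfolding presented_def pclass_def by simp

lemma cl_eqI: "f \<in> carrier L \<Longrightarrow> h \<in> carrier L \<Longrightarrow> f \<ominus>\<^bsub>L\<^esub> h \<in> N \<Longrightarrow> cl f = cl h"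
  unfolding pclass_def by (rule module.quot_eqI[OF L_module N_submodule])

lemma cl_mem:
  assumes "f \<in> carrier L" "h \<in> cl f"
  shows "h \<in> carrier L" "h \<ominus>\<^bsub>L\<^esub> f \<in> N" "cl h = cl f"
  using module.quot_mem[OF L_module N_submodule, of f h] assms unfolding pclass_def by auto

lemma cl_self: "f \<in> carrier L \<Longrightarrow> f \<in> cl f"
  unfolding pclass_def by (rule module.quot_self[OF L_module N_submodule])

lemma cl_rel:
  assumes "f \<in> carrier L" "h \<in> carrier L" "f \<ominus>\<^bsub>L\<^esub> h \<in> K"
  shows "cl f = cl h"
  using assms lin_span_superset[of K R L] by (intro cl_eqI) auto

lemma Q_induct [consumes 1, case_names single add]:
  assumes x: "x \<in> carrier Q"
    and single: "\<And>g c. g \<in> G \<Longrightarrow> c \<in> carrier R \<Longrightarrow> P (cl (single R g c))"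
    and zero: "P \<zero>\<^bsub>Q\<^esub>"
    and add: "\<And>x y. x \<in> carrier Q \<Longrightarrow> y \<in> carrier Q \<Longrightarrow> P x \<Longrightarrow> P y \<Longrightarrow> P (x \<oplus>\<^bsub>Q\<^esub> y)"
  shows "P x"
proof -
  obtain f where f: "f \<in> carrier L" "x = cl f" using x by (auto simp: Q_carrier)
  have "P (cl f)" using f(1)
  proof (induction rule: free_mod_induct)
    case zero then show ?case using assms(3) by (simp add: cl_zero)
  next
    case (single g c) then show ?case using assms(2) by simp
  next
    case (add f h)
    then show ?case using assms(4)[of "cl f" "cl h"] by (simp add: cl_add)
  qed
  then show ?thesis by (simp add: f)
qed

end

definition evf :: "('a, 'x) ring_scheme \<Rightarrow> ('b, 'y) ring_scheme \<Rightarrow> ('a \<Rightarrow> 'b) \<Rightarrow> ('g \<Rightarrow> 'b) \<Rightarrow> ('g \<Rightarrow> 'a) \<Rightarrow> 'b" where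
  "evf R S \<phi> h f = (\<Oplus>\<^bsub>S\<^esub>g\<in>supp R f. \<phi> (f g) \<otimes>\<^bsub>S\<^esub> h g)"

text \<open>
  The value on a class is computed on a representative; the choice is immaterial only if \<open>h\<close> respects the relations.
\<close>

definition evc :: "('a, 'x) ring_scheme \<Rightarrow> ('b, 'y) ring_scheme \<Rightarrow> ('a \<Rightarrow> 'b) \<Rightarrow> ('g \<Rightarrow> 'b) \<Rightarrow> ('g \<Rightarrow> 'a) set \<Rightarrow> 'b" where
  "evc R S \<phi> h C = evf R S \<phi> h (SOME f. f \<in> C)"

locale coeff_hom = H?: ring_hom_cring R S \<phi>
  for R :: "('a, 'x) ring_scheme" (structure) and S :: "('b, 'y) ring_scheme" (structure)
    and \<phi> :: "'a \<Rightarrow> 'b"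
begin

lemma evf_superset:
  assumes "f \<in> carrier (free_mod R G)" "h \<in> G \<rightarrow> carrier S" "finite A" "supp R f \<subseteq> A" "A \<subseteq> G"
  shows "evf R S \<phi> h f = (\<Oplus>\<^bsub>S\<^esub>g\<in>A. \<phi> (f g) \<otimes>\<^bsub>S\<^esub> h g)"
  unfolding evf_def
  using assms
  by (intro H.S.add.finprod_mono_neutral_cong_left)
     (auto simp: R.free_mod_carrier_iff supp_def Pi_iff subset_iff)

lemma evf_closed:
  assumes "f \<in> carrier (free_mod R G)" "h \<in> G \<rightarrow> carrier S"
  shows "evf R S \<phi> h f \<in> carrier S"
  unfolding evf_def using assms
  by (intro H.S.finsum_closed) (auto simp: R.free_mod_carrier_iff)

lemma evf_zero: "evf R S \<phi> h (\<lambda>g. \<zero>) = \<zero>\<^bsub>S\<^esub>"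
  by (simp add: evf_def supp_def)

lemma evf_single:
  assumes "g \<in> G" "c \<in> carrier R" "h \<in> G \<rightarrow> carrier S"
  shows "evf R S \<phi> h (single R g c) = \<phi> c \<otimes>\<^bsub>S\<^esub> h g"
proof -
  have "evf R S \<phi> h (single R g c) = (\<Oplus>\<^bsub>S\<^esub>x\<in>{g}. \<phi> (single R g c x) \<otimes>\<^bsub>S\<^esub> h x)"
    using assms R.single_closed[OF assms(1,2)]
    by (intro evf_superset[where G = G]) (auto simp: supp_def single_def[of R g c])
  also have "\<dots> = \<phi> c \<otimes>\<^bsub>S\<^esub> h g"
    using assms by (subst H.S.finsum_insert) (auto simp: single_def Pi_iff)
  finally show ?thesis .
qed

lemma evf_add:
  assumes f: "f \<in> carrier (free_mod R G)" and k: "k \<in> carrier (free_mod R G)" and h: "h \<in> G \<rightarrow> carrier S"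
  shows "evf R S \<phi> h (\<lambda>g. f g \<oplus> k g) = evf R S \<phi> h f \<oplus>\<^bsub>S\<^esub> evf R S \<phi> h k"
proof -
  interpret L: module R "free_mod R G" by (rule R.free_mod_module)
  let ?A = "supp R f \<union> supp R k"
  have A: "finite ?A" "?A \<subseteq> G" using f k by (auto simp: R.free_mod_carrier_iff)
  have fk: "(\<lambda>g. f g \<oplus> k g) \<in> carrier (free_mod R G)" using L.add.m_closed[OF f k] by simp
  have c: "f g \<in> carrier R" "k g \<in> carrier R" for g using f k by (auto simp: R.free_mod_carrier_iff)
  have "evf R S \<phi> h (\<lambda>g. f g \<oplus> k g) = (\<Oplus>\<^bsub>S\<^esub>g\<in>?A. \<phi> (f g \<oplus> k g) \<otimes>\<^bsub>S\<^esub> h g)"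
    by (rule evf_superset[OF fk h A(1) _ A(2)]) (rule R.supp_add)
  also have "\<dots> = (\<Oplus>\<^bsub>S\<^esub>g\<in>?A. \<phi> (f g) \<otimes>\<^bsub>S\<^esub> h g \<oplus>\<^bsub>S\<^esub> \<phi> (k g) \<otimes>\<^bsub>S\<^esub> h g)"
    using c h A by (intro H.S.finsum_cong') (auto simp: H.S.l_distr Pi_iff subset_iff)
  also have "\<dots> = (\<Oplus>\<^bsub>S\<^esub>g\<in>?A. \<phi> (f g) \<otimes>\<^bsub>S\<^esub> h g) \<oplus>\<^bsub>S\<^esub> (\<Oplus>\<^bsub>S\<^esub>g\<in>?A. \<phi> (k g) \<otimes>\<^bsub>S\<^esub> h g)"
    using c h A by (intro H.S.finsum_addf) (auto simp: Pi_iff subset_iff)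
  also have "\<dots> = evf R S \<phi> h f \<oplus>\<^bsub>S\<^esub> evf R S \<phi> h k"
    using evf_superset[OF f h A(1) _ A(2)] evf_superset[OF k h A(1) _ A(2)] by simp
  finally show ?thesis .
qed

lemma evf_smult:
  assumes f: "f \<in> carrier (free_mod R G)" and a: "a \<in> carrier R" and h: "h \<in> G \<rightarrow> carrier S"
  shows "evf R S \<phi> h (\<lambda>g. a \<otimes> f g) = \<phi> a \<otimes>\<^bsub>S\<^esub> evf R S \<phi> h f"
proof -
  interpret L: module R "free_mod R G" by (rule R.free_mod_module)
  let ?A = "supp R f"
  have A: "finite ?A" "?A \<subseteq> G" using f by (auto simp: R.free_mod_carrier_iff)
  have fk: "(\<lambda>g. a \<otimes> f g) \<in> carrier (free_mod R G)" using L.smult_closed[OF a f] by simp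
  have c: "f g \<in> carrier R" for g using f by (auto simp: R.free_mod_carrier_iff)
  have "evf R S \<phi> h (\<lambda>g. a \<otimes> f g) = (\<Oplus>\<^bsub>S\<^esub>g\<in>?A. \<phi> (a \<otimes> f g) \<otimes>\<^bsub>S\<^esub> h g)"
    using a by (intro evf_superset[OF fk h A(1) _ A(2)]) (auto simp: supp_def)
  also have "\<dots> = (\<Oplus>\<^bsub>S\<^esub>g\<in>?A. \<phi> a \<otimes>\<^bsub>S\<^esub> (\<phi> (f g) \<otimes>\<^bsub>S\<^esub> h g))"
    using c h a A by (intro H.S.finsum_cong') (auto simp: H.S.m_assoc Pi_iff subset_iff)
  also have "\<dots> = \<phi> a \<otimes>\<^bsub>S\<^esub> evf R S \<phi> h f"
    unfolding evf_def using c h a A by (intro H.S.finsum_rdistr[symmetric]) (auto simp: Pi_iff subset_iff)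
  finally show ?thesis .
qed

lemma evf_diff:
  assumes f: "f \<in> carrier (free_mod R G)" and k: "k \<in> carrier (free_mod R G)" and h: "h \<in> G \<rightarrow> carrier S"
  shows "evf R S \<phi> h (f \<ominus>\<^bsub>free_mod R G\<^esub> k) = evf R S \<phi> h f \<ominus>\<^bsub>S\<^esub> evf R S \<phi> h k"
proof -
  interpret L: module R "free_mod R G" by (rule R.free_mod_module)
  let ?d = "f \<ominus>\<^bsub>free_mod R G\<^esub> k"
  have d: "?d \<in> carrier (free_mod R G)" using f k by simp
  have "f = ?d \<oplus>\<^bsub>free_mod R G\<^esub> k"
    using f k by (simp only: L.minus_eq L.a_assoc L.a_inv_closed L.l_neg L.r_zero)
  then have "f = (\<lambda>g. ?d g \<oplus> k g)" by simp
  then have "evf R S \<phi> h f = evf R S \<phi> h ?d \<oplus>\<^bsub>S\<^esub> evf R S \<phi> h k"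
    using evf_add[OF d k h] by simp
  then show ?thesis
    using evf_closed[OF d h] evf_closed[OF k h] by (simp add: H.S.minus_eq H.S.a_assoc H.S.r_neg)
qed

end

locale functional = coeff_hom R S \<phi> + presentation R G K
  for R :: "('a, 'x) ring_scheme" (structure) and S :: "('b, 'y) ring_scheme" (structure)
    and \<phi> :: "'a \<Rightarrow> 'b" and G :: "'g set" and K :: "('g \<Rightarrow> 'a) set" +
  fixes h :: "'g \<Rightarrow> 'b"
  assumes h_closed: "h \<in> G \<rightarrow> carrier S"
    and h_rel: "\<And>k. k \<in> K \<Longrightarrow> evf R S \<phi> h k = \<zero>\<^bsub>S\<^esub>"
begin

lemma evf_N:
  assumes "k \<in> N" shows "evf R S \<phi> h k = \<zero>\<^bsub>S\<^esub>"
proof -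
  interpret L: module R L by (rule L_module)
  have "submodule {k \<in> carrier L. evf R S \<phi> h k = \<zero>\<^bsub>S\<^esub>} R L"
  proof (rule L.submoduleI)
    fix a assume a: "a \<in> {k \<in> carrier L. evf R S \<phi> h k = \<zero>\<^bsub>S\<^esub>}"
    then have ac: "a \<in> carrier L" by blast
    have "evf R S \<phi> h (\<zero>\<^bsub>L\<^esub> \<ominus>\<^bsub>L\<^esub> a) = \<zero>\<^bsub>S\<^esub>"
      using a by (subst evf_diff[OF _ _ h_closed]) (auto simp: evf_zero H.S.minus_eq)
    moreover have "\<zero>\<^bsub>L\<^esub> \<ominus>\<^bsub>L\<^esub> a = \<ominus>\<^bsub>L\<^esub> a" using ac by (simp only: L.minus_eq L.l_zero L.a_inv_closed)
    ultimately show "\<ominus>\<^bsub>L\<^esub> a \<in> {k \<in> carrier L. evf R S \<phi> h k = \<zero>\<^bsub>S\<^esub>}"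
      using ac by simp
  qed (use L.zero_closed L.add.m_closed L.smult_closed evf_add[OF _ _ h_closed]
        evf_smult[OF _ _ h_closed] in \<open>auto simp: evf_zero\<close>)
  then have "N \<subseteq> {k \<in> carrier L. evf R S \<phi> h k = \<zero>\<^bsub>S\<^esub>}"
    by (rule lin_span_least) (use h_rel K_carrier in auto)
  then show ?thesis using assms by auto
qed

lemma evf_cl:
  assumes "f \<in> carrier L" "k \<in> cl f"
  shows "evf R S \<phi> h k = evf R S \<phi> h f"
proof -
  note k = cl_mem[OF assms]
  have "evf R S \<phi> h k \<ominus>\<^bsub>S\<^esub> evf R S \<phi> h f = \<zero>\<^bsub>S\<^esub>"
    using evf_diff[OF k(1) assms(1) h_closed] evf_N[OF k(2)] by simp
  then show ?thesis
    using evf_closed[OF _ h_closed] k(1) assms(1) by simp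
qed

lemma evc_cl:
  assumes "f \<in> carrier L"
  shows "evc R S \<phi> h (cl f) = evf R S \<phi> h f"
  unfolding evc_def using evf_cl[OF assms] someI[of "\<lambda>k. k \<in> cl f" f] cl_self[OF assms] by blast

lemma evc_closed: "x \<in> carrier Q \<Longrightarrow> evc R S \<phi> h x \<in> carrier S"
  using evf_closed[OF _ h_closed] by (auto simp: Q_carrier evc_cl)

lemma evc_add:
  "x \<in> carrier Q \<Longrightarrow> y \<in> carrier Q \<Longrightarrow>
    evc R S \<phi> h (x \<oplus>\<^bsub>Q\<^esub> y) = evc R S \<phi> h x \<oplus>\<^bsub>S\<^esub> evc R S \<phi> h y"
  using module.axioms(2)[OF L_module] abelian_group.axioms(1)[THEN abelian_monoid.a_closed, of L]
  by (auto simp: Q_carrier cl_add evc_cl evf_add[OF _ _ h_closed])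

lemma evc_smult:
  assumes "x \<in> carrier Q" "c \<in> carrier R"
  shows "evc R S \<phi> h (c \<odot>\<^bsub>Q\<^esub> x) = \<phi> c \<otimes>\<^bsub>S\<^esub> evc R S \<phi> h x"
  using module.smult_closed[OF L_module] assms
  by (auto simp: Q_carrier cl_smult evc_cl evf_smult[OF _ _ h_closed])

lemma evc_zero: "evc R S \<phi> h \<zero>\<^bsub>Q\<^esub> = \<zero>\<^bsub>S\<^esub>"
  using module.axioms(2)[OF L_module] abelian_monoid.zero_closed[of L]
  by (simp add: cl_zero evc_cl evf_zero abelian_group_def)

lemma evc_single:
  "g \<in> G \<Longrightarrow> c \<in> carrier R \<Longrightarrow> evc R S \<phi> h (cl (single R g c)) = \<phi> c \<otimes>\<^bsub>S\<^esub> h g"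
  by (simp add: evc_cl evf_single[OF _ _ h_closed])

lemma evc_submodule:
  "submodule {x \<in> carrier Q. evc R S \<phi> h x = \<zero>\<^bsub>S\<^esub>} R Q"
proof -
  interpret Q: module R Q by (rule Q_module)
  show ?thesis
  proof (rule Q.submoduleI)
    fix a assume a: "a \<in> {x \<in> carrier Q. evc R S \<phi> h x = \<zero>\<^bsub>S\<^esub>}"
    have "evc R S \<phi> h ((\<ominus> \<one>) \<odot>\<^bsub>Q\<^esub> a) = \<zero>\<^bsub>S\<^esub>"
      using a by (subst evc_smult) auto
    then show "\<ominus>\<^bsub>Q\<^esub> a \<in> {x \<in> carrier Q. evc R S \<phi> h x = \<zero>\<^bsub>S\<^esub>}"
      using a by (simp add: Q.smult_l_minus)
  qed (auto simp: evc_zero evc_add evc_smult)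
qed

end

context coeff_hom
begin

lemma pushforward_eq_evf:
  assumes "f \<in> carrier (free_mod R G)"
  shows "pushforward R S \<phi> h f = (\<lambda>y. evf R S \<phi> (\<lambda>x. if h x = y then \<one>\<^bsub>S\<^esub> else \<zero>\<^bsub>S\<^esub>) f)"
proof
  fix y
  show "pushforward R S \<phi> h f y = evf R S \<phi> (\<lambda>x. if h x = y then \<one>\<^bsub>S\<^esub> else \<zero>\<^bsub>S\<^esub>) f"
    unfolding pushforward_def evf_def
    using assms by (intro H.S.add.finprod_mono_neutral_cong_left) (auto simp: R.free_mod_carrier_iff)
qed

lemma pushforward_closed:
  assumes f: "f \<in> carrier (free_mod R G)" and h: "h \<in> G \<rightarrow> G'"
  shows "pushforward R S \<phi> h f \<in> carrier (free_mod S G')"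
proof -
  have "pushforward R S \<phi> h f y \<in> carrier S" for y
    unfolding pushforward_eq_evf[OF f] by (rule evf_closed[OF f]) auto
  moreover have "supp S (pushforward R S \<phi> h f) \<subseteq> h ` supp R f"
  proof
    fix y assume y: "y \<in> supp S (pushforward R S \<phi> h f)"
    show "y \<in> h ` supp R f"
    proof (rule ccontr)
      assume "y \<notin> h ` supp R f"
      then have "{x \<in> supp R f. h x = y} = {}" by auto
      then have "pushforward R S \<phi> h f y = \<zero>\<^bsub>S\<^esub>" unfolding pushforward_def by (simp only: H.S.finsum_empty)
      then show False using y by (simp add: supp_def)
    qed
  qed
  moreover have "h ` supp R f \<subseteq> G'" "finite (h ` supp R f)"
    using f h by (auto simp: R.free_mod_carrier_iff)
  ultimately show ?thesis by (auto simp: H.S.free_mod_carrier_iff intro: finite_subset)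
qed

lemma pushforward_zero: "pushforward R S \<phi> h (\<lambda>g. \<zero>) = (\<lambda>g. \<zero>\<^bsub>S\<^esub>)"
  by (simp add: pushforward_def supp_def)

lemma pushforward_add:
  assumes "f \<in> carrier (free_mod R G)" "k \<in> carrier (free_mod R G)"
  shows "pushforward R S \<phi> h (\<lambda>g. f g \<oplus> k g) = (\<lambda>y. pushforward R S \<phi> h f y \<oplus>\<^bsub>S\<^esub> pushforward R S \<phi> h k y)"
proof -
  have "(\<lambda>g. f g \<oplus> k g) \<in> carrier (free_mod R G)"
    using abelian_groupE(1)[OF module.axioms(2)[OF R.free_mod_module] assms] by simp
  then show ?thesis using assms by (auto simp: pushforward_eq_evf intro!: ext evf_add)
qed

lemma pushforward_smult:
  assumes "f \<in> carrier (free_mod R G)" "a \<in> carrier R"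
  shows "pushforward R S \<phi> h (\<lambda>g. a \<otimes> f g) = (\<lambda>y. \<phi> a \<otimes>\<^bsub>S\<^esub> pushforward R S \<phi> h f y)"
proof -
  have "(\<lambda>g. a \<otimes> f g) \<in> carrier (free_mod R G)"
    using module.smult_closed[OF R.free_mod_module assms(2,1)] by simp
  then show ?thesis using assms by (auto simp: pushforward_eq_evf intro!: ext evf_smult)
qed

lemma pushforward_diff:
  assumes "f \<in> carrier (free_mod R G)" "k \<in> carrier (free_mod R G)" "h \<in> G \<rightarrow> G'"
  shows "pushforward R S \<phi> h (f \<ominus>\<^bsub>free_mod R G\<^esub> k)
    = pushforward R S \<phi> h f \<ominus>\<^bsub>free_mod S G'\<^esub> pushforward R S \<phi> h k"
proof -
  interpret L: module R "free_mod R G" by (rule R.free_mod_module)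
  interpret L': module S "free_mod S G'" by (rule H.S.free_mod_module)
  have "f \<ominus>\<^bsub>free_mod R G\<^esub> k \<in> carrier (free_mod R G)" using assms by simp
  then have "pushforward R S \<phi> h (f \<ominus>\<^bsub>free_mod R G\<^esub> k)
    = (\<lambda>y. pushforward R S \<phi> h f y \<ominus>\<^bsub>S\<^esub> pushforward R S \<phi> h k y)"
    using assms by (auto simp: pushforward_eq_evf[where G = G] intro!: ext evf_diff)
  then show ?thesis
    using pushforward_closed[OF assms(1,3)] pushforward_closed[OF assms(2,3)]
    by (simp add: L'.minus_eq H.S.free_mod_a_inv H.S.minus_eq)
qed

lemma pushforward_single:
  assumes "g \<in> G" "c \<in> carrier R"
  shows "pushforward R S \<phi> h (single R g c) = single S (h g) (\<phi> c)"
proof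
  fix y
  show "pushforward R S \<phi> h (single R g c) y = single S (h g) (\<phi> c) y"
    using assms by (subst pushforward_eq_evf[where G = G]) (auto simp: evf_single[where G = G] single_def[of S])
qed

end

lemma evf_pushforward:
  fixes R :: "('a, 'x) ring_scheme" and S :: "('b, 'y) ring_scheme" and T :: "('c, 'z) ring_scheme"
  assumes "coeff_hom R S \<phi>" "coeff_hom S T \<psi>" "coeff_hom R T \<theta>"
    and \<theta>: "\<And>c. c \<in> carrier R \<Longrightarrow> \<theta> c = \<psi> (\<phi> c)"
    and f: "f \<in> carrier (free_mod R G)" and h: "h \<in> G \<rightarrow> G'" and k: "k \<in> G' \<rightarrow> carrier T"
    and k': "\<And>g. g \<in> G \<Longrightarrow> k' g = k (h g)"
  shows "evf S T \<psi> k (pushforward R S \<phi> h f) = evf R T \<theta> k' f"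
proof -
  interpret RS: coeff_hom R S \<phi> by fact
  interpret ST: coeff_hom S T \<psi> by fact
  interpret RT: coeff_hom R T \<theta> by fact
  have kh: "k' \<in> G \<rightarrow> carrier T" using h k k' by fastforce
  show ?thesis using f
  proof (induction rule: RS.R.free_mod_induct)
    case zero
    show ?case by (simp add: RS.pushforward_zero ST.evf_zero RT.evf_zero)
  next
    case (single g c)
    then show ?case using \<theta> h k k' kh
      by (simp add: RS.pushforward_single ST.evf_single[where G = G'] RT.evf_single[where G = G] Pi_iff)
  next
    case (add f k)
    then show ?case
      using RS.pushforward_closed[OF _ h]
      by (simp add: RS.pushforward_add ST.evf_add[OF _ _ k] RT.evf_add[OF _ _ kh])
  qed
qed

locale presentation_map = coeff_hom R S \<phi> + P: presentation R G K + P': presentation S G' K'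
  for R :: "('a, 'x) ring_scheme" (structure) and S :: "('b, 'y) ring_scheme" (structure)
    and \<phi> :: "'a \<Rightarrow> 'b" and G :: "'g set" and K :: "('g \<Rightarrow> 'a) set"
    and G' :: "'h set" and K' :: "('h \<Rightarrow> 'b) set" +
  fixes h :: "'g \<Rightarrow> 'h"
  assumes h_gens: "h \<in> G \<rightarrow> G'"
    and h_rels: "\<And>k. k \<in> K \<Longrightarrow> pushforward R S \<phi> h k \<in> lin_span S (free_mod S G') K'"
begin

lemma pushforward_N:
  assumes "k \<in> P.N" shows "pushforward R S \<phi> h k \<in> P'.N"
proof -
  interpret L: module R P.L by (rule P.L_module)
  interpret L': module S P'.L by (rule P'.L_module)
  let ?X = "{k \<in> carrier P.L. pushforward R S \<phi> h k \<in> P'.N}"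
  have zero: "(\<lambda>g. \<zero>\<^bsub>S\<^esub>) \<in> P'.N" using L'.submodule_zero[OF P'.N_submodule] by simp
  have "submodule ?X R P.L"
  proof (rule L.submoduleI)
    fix a assume a: "a \<in> ?X"
    have "\<zero>\<^bsub>P'.L\<^esub> \<ominus>\<^bsub>P'.L\<^esub> pushforward R S \<phi> h a \<in> P'.N"
      using a L'.submoduleE[OF P'.N_submodule] zero by (auto simp: L'.minus_eq)
    moreover have "pushforward R S \<phi> h (\<zero>\<^bsub>P.L\<^esub> \<ominus>\<^bsub>P.L\<^esub> a) = \<zero>\<^bsub>P'.L\<^esub> \<ominus>\<^bsub>P'.L\<^esub> pushforward R S \<phi> h a"
      using a L.zero_closed pushforward_diff[OF _ _ h_gens, of "\<zero>\<^bsub>P.L\<^esub>" a] by (simp add: pushforward_zero)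
    moreover have "a \<in> carrier P.L" using a by blast
    then have "\<zero>\<^bsub>P.L\<^esub> \<ominus>\<^bsub>P.L\<^esub> a = \<ominus>\<^bsub>P.L\<^esub> a" by (simp only: L.minus_eq L.l_zero L.a_inv_closed)
    ultimately show "\<ominus>\<^bsub>P.L\<^esub> a \<in> ?X" using a by auto
  next
    fix a b assume ab: "a \<in> ?X" "b \<in> ?X"
    then have "pushforward R S \<phi> h a \<oplus>\<^bsub>P'.L\<^esub> pushforward R S \<phi> h b \<in> P'.N"
      using L'.submoduleE(5)[OF P'.N_submodule] by blast
    then show "a \<oplus>\<^bsub>P.L\<^esub> b \<in> ?X" using ab L.a_closed[of a b] by (auto simp: pushforward_add)
  next
    fix a b assume ab: "a \<in> carrier R" "b \<in> ?X"
    then have "\<phi> a \<odot>\<^bsub>P'.L\<^esub> pushforward R S \<phi> h b \<in> P'.N"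
      using L'.submoduleE(4)[OF P'.N_submodule] by auto
    then show "a \<odot>\<^bsub>P.L\<^esub> b \<in> ?X" using ab L.smult_closed[of a b] by (auto simp: pushforward_smult)
  qed (use L.zero_closed zero in \<open>auto simp: pushforward_zero\<close>)
  then have "P.N \<subseteq> ?X"
    by (rule lin_span_least) (use h_rels P.K_carrier in auto)
  then show ?thesis using assms by auto
qed

lemma pres_map_cl:
  assumes f: "f \<in> carrier P.L"
  shows "pres_map R S G' K' \<phi> h (P.cl f) = P'.cl (pushforward R S \<phi> h f)"
proof -
  have eq: "P'.cl (pushforward R S \<phi> h k) = P'.cl (pushforward R S \<phi> h f)" if "k \<in> P.cl f" for k
  proof (rule P'.cl_eqI)
    note k = P.cl_mem[OF f that]
    show "pushforward R S \<phi> h k \<ominus>\<^bsub>P'.L\<^esub> pushforward R S \<phi> h f \<in> P'.N"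
      using pushforward_N[OF k(2)] pushforward_diff[OF k(1) f h_gens] by simp
  qed (use f P.cl_mem[OF f that] pushforward_closed[OF _ h_gens] in auto)
  show ?thesis unfolding pres_map_def
    by (rule SUP_eq_const) (use P.cl_self[OF f] eq in blast)+
qed

lemma pres_map_closed: "x \<in> carrier P.Q \<Longrightarrow> pres_map R S G' K' \<phi> h x \<in> carrier P'.Q"
  using pushforward_closed[OF _ h_gens] by (auto simp: P.Q_carrier pres_map_cl)

lemma pres_map_add:
  "x \<in> carrier P.Q \<Longrightarrow> y \<in> carrier P.Q \<Longrightarrow>
    pres_map R S G' K' \<phi> h (x \<oplus>\<^bsub>P.Q\<^esub> y) = pres_map R S G' K' \<phi> h x \<oplus>\<^bsub>P'.Q\<^esub> pres_map R S G' K' \<phi> h y"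
  using pushforward_closed[OF _ h_gens] abelian_groupE(1)[OF module.axioms(2)[OF P.L_module]]
  by (auto simp: P.Q_carrier P.cl_add P'.cl_add pres_map_cl pushforward_add)

lemma pres_map_smult:
  "x \<in> carrier P.Q \<Longrightarrow> c \<in> carrier R \<Longrightarrow>
    pres_map R S G' K' \<phi> h (c \<odot>\<^bsub>P.Q\<^esub> x) = \<phi> c \<odot>\<^bsub>P'.Q\<^esub> pres_map R S G' K' \<phi> h x"
  using pushforward_closed[OF _ h_gens] module.smult_closed[OF P.L_module]
  by (auto simp: P.Q_carrier P.cl_smult P'.cl_smult pres_map_cl pushforward_smult)

end

lemma evc_pres_map:
  assumes "presentation_map R S \<phi> G K G' K' h" "functional S T \<psi> G' K' k" "functional R T \<theta> G K k'"
    and \<theta>: "\<And>c. c \<in> carrier R \<Longrightarrow> \<theta> c = \<psi> (\<phi> c)" and k': "\<And>g. g \<in> G \<Longrightarrow> k' g = k (h g)"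
    and x: "x \<in> carrier (presented R G K)"
  shows "evc S T \<psi> k (pres_map R S G' K' \<phi> h x) = evc R T \<theta> k' x"
proof -
  interpret RS: presentation_map R S \<phi> G K G' K' h by fact
  interpret ST: functional S T \<psi> G' K' k by fact
  interpret RT: functional R T \<theta> G K k' by fact
  obtain f where f: "f \<in> carrier (free_mod R G)" "x = pclass R G K f" using x by (auto simp: RS.P.Q_carrier)
  show ?thesis
    using RS.pushforward_closed[OF f(1) RS.h_gens]
      evf_pushforward[OF RS.coeff_hom_axioms functional.axioms(1)[OF assms(2)]
        functional.axioms(1)[OF assms(3)] \<theta> f(1) RS.h_gens functional.h_closed[OF assms(2)] k']
    by (simp add: f RS.pres_map_cl functional.evc_cl[OF assms(2)] functional.evc_cl[OF assms(3)])
qed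

section \<open>Determinants over a commutative ring\<close>

context abelian_monoid
begin

lemma finsum_cartesian:
  assumes "finite A" "finite B" "\<And>a b. a \<in> A \<Longrightarrow> b \<in> B \<Longrightarrow> f a b \<in> carrier G"
  shows "(\<Oplus>p\<in>A \<times> B. f (fst p) (snd p)) = (\<Oplus>a\<in>A. \<Oplus>b\<in>B. f a b)"
  using assms(1,3)
proof (induction A)
  case (insert a A)
  have split: "insert a A \<times> B = Pair a ` B \<union> A \<times> B" by auto
  have "(\<Oplus>p\<in>insert a A \<times> B. f (fst p) (snd p))
      = (\<Oplus>p\<in>Pair a ` B. f (fst p) (snd p)) \<oplus> (\<Oplus>p\<in>A \<times> B. f (fst p) (snd p))"
    unfolding split using insert assms(2) by (intro finsum_Un_disjoint) auto
  also have "(\<Oplus>p\<in>Pair a ` B. f (fst p) (snd p)) = (\<Oplus>b\<in>B. f a b)"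
    using insert.prems by (subst finsum_reindex) (auto simp: inj_on_def)
  finally show ?case using insert by (subst finsum_insert) (auto intro!: finsum_closed)
qed simp

lemma finsum_swap:
  assumes "finite A" "finite B" "\<And>a b. a \<in> A \<Longrightarrow> b \<in> B \<Longrightarrow> f a b \<in> carrier G"
  shows "(\<Oplus>a\<in>A. \<Oplus>b\<in>B. f a b) = (\<Oplus>b\<in>B. \<Oplus>a\<in>A. f a b)"
  using assms(1,3)
proof (induction A)
  case (insert a A)
  have "(\<Oplus>a\<in>insert a A. \<Oplus>b\<in>B. f a b) = (\<Oplus>b\<in>B. f a b) \<oplus> (\<Oplus>a\<in>A. \<Oplus>b\<in>B. f a b)"
    using insert by (subst finsum_insert) (auto intro!: finsum_closed)
  also have "\<dots> = (\<Oplus>b\<in>B. f a b) \<oplus> (\<Oplus>b\<in>B. \<Oplus>a\<in>A. f a b)"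
    using insert by simp
  also have "\<dots> = (\<Oplus>b\<in>B. f a b \<oplus> (\<Oplus>a\<in>A. f a b))"
    using insert by (subst finsum_addf) (auto intro!: finsum_closed)
  also have "\<dots> = (\<Oplus>b\<in>B. \<Oplus>a\<in>insert a A. f a b)"
    using insert by (intro finsum_cong') (auto intro!: finsum_closed)
  finally show ?case .
qed simp

end

context cring
begin

lemma finprod_finsum_PiE:
  assumes "finite I" "finite B" "\<And>i k. i \<in> I \<Longrightarrow> k \<in> B \<Longrightarrow> g i k \<in> carrier R"
  shows "(\<Otimes>i\<in>I. \<Oplus>k\<in>B. g i k) = (\<Oplus>f\<in>I \<rightarrow>\<^sub>E B. \<Otimes>i\<in>I. g i (f i))"
  using assms(1,3)
proof (induction I)
  case empty
  show ?case by (simp add: finsum_insert)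
next
  case (insert i I)
  let ?F = "I \<rightarrow>\<^sub>E B"
  have fin: "finite ?F" using insert assms(2) by (intro finite_PiE) auto
  have g: "(\<Otimes>j\<in>I. g j (f j)) \<in> carrier R" if "f \<in> ?F" for f
    using insert.prems that by (intro finprod_closed) (auto simp: PiE_iff)
  have "(\<Otimes>i\<in>insert i I. \<Oplus>k\<in>B. g i k) = (\<Oplus>k\<in>B. g i k) \<otimes> (\<Oplus>f\<in>?F. \<Otimes>i\<in>I. g i (f i))"
    using insert by (subst finprod_insert) (auto intro!: finsum_closed)
  also have "\<dots> = (\<Oplus>k\<in>B. g i k \<otimes> (\<Oplus>f\<in>?F. \<Otimes>i\<in>I. g i (f i)))"
    using insert.prems assms(2) g by (intro finsum_ldistr) (auto intro!: finsum_closed)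
  also have "\<dots> = (\<Oplus>k\<in>B. \<Oplus>f\<in>?F. g i k \<otimes> (\<Otimes>i\<in>I. g i (f i)))"
    using insert.prems assms(2) g fin
    by (intro finsum_cong' finsum_rdistr) (auto intro!: finsum_closed)
  also have "\<dots> = (\<Oplus>p\<in>B \<times> ?F. g i (fst p) \<otimes> (\<Otimes>j\<in>I. g j (snd p j)))"
    using insert.prems assms(2) g fin by (intro finsum_cartesian[symmetric]) auto
  also have "\<dots> = (\<Oplus>p\<in>B \<times> ?F. \<Otimes>j\<in>insert i I. g j (((snd p)(i := fst p)) j))"
  proof (intro finsum_cong')
    fix p assume p: "p \<in> B \<times> ?F"
    have "(\<Otimes>j\<in>insert i I. g j (((snd p)(i := fst p)) j))
        = g i (fst p) \<otimes> (\<Otimes>j\<in>I. g j (((snd p)(i := fst p)) j))"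
      using insert p by (subst finprod_insert) (auto simp: PiE_iff)
    also have "(\<Otimes>j\<in>I. g j (((snd p)(i := fst p)) j)) = (\<Otimes>j\<in>I. g j (snd p j))"
      using insert p by (intro finprod_cong') (auto simp: PiE_iff)
    finally show "g i (fst p) \<otimes> (\<Otimes>j\<in>I. g j (snd p j)) = (\<Otimes>j\<in>insert i I. g j (((snd p)(i := fst p)) j))"
      by simp
  qed (use insert.prems insert.hyps in \<open>auto intro!: finprod_closed simp: PiE_iff\<close>)
  also have "\<dots> = (\<Oplus>f\<in>(\<lambda>p. (snd p)(i := fst p)) ` (B \<times> ?F). \<Otimes>j\<in>insert i I. g j (f j))"
  proof (rule finsum_reindex[symmetric])
    show "inj_on (\<lambda>p. (snd p)(i := fst p)) (B \<times> ?F)"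
    proof (rule inj_onI)
      fix p q assume p: "p \<in> B \<times> ?F" and q: "q \<in> B \<times> ?F" and e: "(snd p)(i := fst p) = (snd q)(i := fst q)"
      have "fst p = fst q" using fun_cong[OF e, of i] by simp
      moreover have "snd p j = snd q j" for j
        using fun_cong[OF e, of j] p q insert.hyps by (cases "j = i") (auto simp: PiE_iff extensional_def)
      ultimately show "p = q" by (auto simp: prod_eq_iff)
    qed
  qed (use insert.prems in \<open>auto intro!: finprod_closed simp: PiE_iff\<close>)
  also have "(\<lambda>p. (snd p)(i := fst p)) ` (B \<times> ?F) = insert i I \<rightarrow>\<^sub>E B"
    by (auto simp: PiE_insert_eq case_prod_beta image_def) 
  finally show ?case .
qed

definition sg :: "(nat \<Rightarrow> nat) \<Rightarrow> 'a" where
  "sg \<sigma> = (if evenperm \<sigma> then \<one> else \<ominus> \<one>)"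

lemma sg_closed [simp]: "sg \<sigma> \<in> carrier R" by (simp add: sg_def)

lemma sg_id [simp]: "sg id = \<one>" by (simp add: sg_def evenperm_id)

lemma sg_compose: "\<sigma> permutes {..<n} \<Longrightarrow> \<tau> permutes {..<n} \<Longrightarrow> sg (\<sigma> \<circ> \<tau>) = sg \<sigma> \<otimes> sg \<tau>"
  using evenperm_comp[of \<sigma> \<tau>] permutes_imp_permutation[of "{..<n}"]
  by (auto simp: sg_def l_minus r_minus)

lemma sg_inv: "\<sigma> permutes {..<n} \<Longrightarrow> sg (inv_into UNIV \<sigma>) = sg \<sigma>"
  using evenperm_inv[of \<sigma>] permutes_imp_permutation[of "{..<n}"] by (auto simp: sg_def)

definition det_term :: "nat \<Rightarrow> (nat \<Rightarrow> nat \<Rightarrow> 'a) \<Rightarrow> (nat \<Rightarrow> nat) \<Rightarrow> 'a" where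
  "det_term n A \<sigma> = sg \<sigma> \<otimes> (\<Otimes>i\<in>{..<n}. A i (\<sigma> i))"

definition square :: "nat \<Rightarrow> (nat \<Rightarrow> nat \<Rightarrow> 'a) \<Rightarrow> bool" where
  "square n A \<longleftrightarrow> (\<forall>i<n. \<forall>j<n. A i j \<in> carrier R)"

lemma perm_lt: "\<sigma> permutes {..<n} \<Longrightarrow> i < n \<Longrightarrow> \<sigma> i < n" for i :: nat
  using permutes_in_image[of \<sigma> "{..<n}" i] by simp

lemma entry_closed: "square n A \<Longrightarrow> \<sigma> permutes {..<n} \<Longrightarrow> (\<lambda>i. A i (\<sigma> i)) \<in> {..<n} \<rightarrow> carrier R"
  by (auto simp: square_def perm_lt)

lemma det_term_closed: "square n A \<Longrightarrow> \<sigma> permutes {..<n} \<Longrightarrow> det_term n A \<sigma> \<in> carrier R"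
  unfolding det_term_def by (intro m_closed sg_closed finprod_closed entry_closed)

lemma determinant_eq:
  assumes "square n A"
  shows "determinant R n A = (\<Oplus>\<sigma>\<in>{\<sigma>. \<sigma> permutes {..<n}}. det_term n A \<sigma>)"
  unfolding determinant_def
proof (intro finsum_cong' refl)
  fix \<sigma> assume "\<sigma> \<in> {\<sigma>. \<sigma> permutes {..<n}}"
  then have "(\<Otimes>i\<in>{..<n}. A i (\<sigma> i)) \<in> carrier R"
    using assms by (intro finprod_closed entry_closed) auto
  then show "[sign \<sigma>] \<cdot> (\<Otimes>i\<in>{..<n}. A i (\<sigma> i)) = det_term n A \<sigma>"
    by (auto simp: det_term_def sg_def sign_def l_minus add.int_pow_neg)
qed (use det_term_closed[OF assms] in auto)

lemma determinant_closed [simp, intro]: "square n A \<Longrightarrow> determinant R n A \<in> carrier R"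
  using det_term_closed by (auto simp: determinant_eq intro!: finsum_closed)

lemma determinant_cong:
  assumes "square n B" "\<And>i j. i < n \<Longrightarrow> j < n \<Longrightarrow> A i j = B i j"
  shows "determinant R n A = determinant R n B"
proof -
  have A: "square n A" using assms by (simp add: square_def)
  have "det_term n A \<sigma> = det_term n B \<sigma>" if "\<sigma> permutes {..<n}" for \<sigma>
    unfolding det_term_def using assms entry_closed[OF assms(1) that] perm_lt[OF that]
    by (intro arg_cong2[where f = "(\<otimes>)"] finprod_cong') auto
  then show ?thesis unfolding determinant_eq[OF A] determinant_eq[OF assms(1)]
    using det_term_closed[OF assms(1)] by (intro finsum_cong') auto
qed

lemma det_term_upd:
  assumes A: "square n A" and k: "k < n" and x: "\<And>j. j < n \<Longrightarrow> x j \<in> carrier R" and \<sigma>: "\<sigma> permutes {..<n}"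
  shows "det_term n (A(k := x)) \<sigma> = x (\<sigma> k) \<otimes> (sg \<sigma> \<otimes> (\<Otimes>i\<in>{..<n} - {k}. A i (\<sigma> i)))"
proof -
  have c: "(\<lambda>i. A i (\<sigma> i)) \<in> {..<n} - {k} \<rightarrow> carrier R" using entry_closed[OF A \<sigma>] by auto
  have "{..<n} = insert k ({..<n} - {k})" using k by auto
  then have "(\<Otimes>i\<in>{..<n}. (A(k := x)) i (\<sigma> i)) = (\<Otimes>i\<in>insert k ({..<n} - {k}). (A(k := x)) i (\<sigma> i))"
    by simp
  also have "\<dots> = x (\<sigma> k) \<otimes> (\<Otimes>i\<in>{..<n} - {k}. (A(k := x)) i (\<sigma> i))"
    using c x[OF perm_lt[OF \<sigma> k]] by (subst finprod_insert) (auto simp: Pi_iff)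
  also have "(\<Otimes>i\<in>{..<n} - {k}. (A(k := x)) i (\<sigma> i)) = (\<Otimes>i\<in>{..<n} - {k}. A i (\<sigma> i))"
    using c by (intro finprod_cong') auto
  finally show ?thesis unfolding det_term_def
    using finprod_closed[OF c] x[OF perm_lt[OF \<sigma> k]] by (simp add: m_lcomm)
qed

lemma square_upd: "square n A \<Longrightarrow> (\<And>j. j < n \<Longrightarrow> x j \<in> carrier R) \<Longrightarrow> square n (A(k := x))"
  by (simp add: square_def)

lemma determinant_row_add:
  assumes A: "square n A" and k: "k < n"
    and x: "\<And>j. j < n \<Longrightarrow> x j \<in> carrier R" and y: "\<And>j. j < n \<Longrightarrow> y j \<in> carrier R"
  shows "determinant R n (A(k := \<lambda>j. x j \<oplus> y j)) = determinant R n (A(k := x)) \<oplus> determinant R n (A(k := y))"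
proof -
  have xy: "x j \<oplus> y j \<in> carrier R" if "j < n" for j using x y that by simp
  have sq: "square n (A(k := x))" "square n (A(k := y))" "square n (A(k := \<lambda>j. x j \<oplus> y j))"
    using A x y xy by (auto intro!: square_upd)
  have "det_term n (A(k := \<lambda>j. x j \<oplus> y j)) \<sigma> = det_term n (A(k := x)) \<sigma> \<oplus> det_term n (A(k := y)) \<sigma>"
    if \<sigma>: "\<sigma> permutes {..<n}" for \<sigma>
  proof -
    have "(\<lambda>i. A i (\<sigma> i)) \<in> {..<n} - {k} \<rightarrow> carrier R" using entry_closed[OF A \<sigma>] by auto
    then have "sg \<sigma> \<otimes> (\<Otimes>i\<in>{..<n} - {k}. A i (\<sigma> i)) \<in> carrier R" by (intro m_closed finprod_closed sg_closed)
    then show ?thesis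
      using x y x[OF perm_lt[OF \<sigma> k]] y[OF perm_lt[OF \<sigma> k]]
      by (simp add: det_term_upd[OF A k _ \<sigma>] l_distr)
  qed
  then have "determinant R n (A(k := \<lambda>j. x j \<oplus> y j)) =
      (\<Oplus>\<sigma>\<in>{\<sigma>. \<sigma> permutes {..<n}}. det_term n (A(k := x)) \<sigma> \<oplus> det_term n (A(k := y)) \<sigma>)"
    unfolding determinant_eq[OF sq(3)]
    using det_term_closed[OF sq(1)] det_term_closed[OF sq(2)] by (intro finsum_cong') auto
  also have "\<dots> = determinant R n (A(k := x)) \<oplus> determinant R n (A(k := y))"
    unfolding determinant_eq[OF sq(1)] determinant_eq[OF sq(2)]
    using det_term_closed[OF sq(1)] det_term_closed[OF sq(2)] by (intro finsum_addf) auto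
  finally show ?thesis .
qed

lemma determinant_scale_rows:
  assumes A: "square n A" and a: "a \<in> {..<n} \<rightarrow> carrier R"
  shows "determinant R n (\<lambda>i j. a i \<otimes> A i j) = (\<Otimes>i\<in>{..<n}. a i) \<otimes> determinant R n A"
proof -
  have sq: "square n (\<lambda>i j. a i \<otimes> A i j)" using A a by (auto simp: square_def)
  have "det_term n (\<lambda>i j. a i \<otimes> A i j) \<sigma> = (\<Otimes>i\<in>{..<n}. a i) \<otimes> det_term n A \<sigma>"
    if \<sigma>: "\<sigma> permutes {..<n}" for \<sigma>
    using a entry_closed[OF A \<sigma>] unfolding det_term_def by (simp add: m_lcomm)
  then have "determinant R n (\<lambda>i j. a i \<otimes> A i j) =
      (\<Oplus>\<sigma>\<in>{\<sigma>. \<sigma> permutes {..<n}}. (\<Otimes>i\<in>{..<n}. a i) \<otimes> det_term n A \<sigma>)"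
    unfolding determinant_eq[OF sq]
    using det_term_closed[OF A] a by (intro finsum_cong') (auto intro!: m_closed finprod_closed)
  also have "\<dots> = (\<Otimes>i\<in>{..<n}. a i) \<otimes> determinant R n A"
    unfolding determinant_eq[OF A]
    using det_term_closed[OF A] a by (intro finsum_rdistr[symmetric]) (auto simp: finite_permutations)
  finally show ?thesis .
qed

lemma determinant_row_smult:
  assumes A: "square n A" and k: "k < n" and a: "a \<in> carrier R" and x: "\<And>j. j < n \<Longrightarrow> x j \<in> carrier R"
  shows "determinant R n (A(k := \<lambda>j. a \<otimes> x j)) = a \<otimes> determinant R n (A(k := x))"
proof -
  define b where "b = (\<lambda>i. if i = k then a else \<one>)"
  have "determinant R n (A(k := \<lambda>j. a \<otimes> x j)) = determinant R n (\<lambda>i j. b i \<otimes> (A(k := x)) i j)"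
    using A x a by (intro determinant_cong) (auto simp: square_def b_def)
  also have "\<dots> = (\<Otimes>i\<in>{..<n}. b i) \<otimes> determinant R n (A(k := x))"
    using A x a by (intro determinant_scale_rows) (auto simp: square_def b_def)
  also have "(\<Otimes>i\<in>{..<n}. b i) = a"
    unfolding b_def using finprod_singleton_swap[of k "{..<n}" "\<lambda>_. a"] k a by simp
  finally show ?thesis .
qed

lemma permutes_compose_bij:
  assumes \<tau>: "\<tau> permutes S"
  shows "bij_betw (\<lambda>\<sigma>. \<sigma> \<circ> \<tau>) {\<sigma>. \<sigma> permutes S} {\<sigma>. \<sigma> permutes S}"
proof (rule bij_betw_byWitness[where f' = "\<lambda>\<sigma>. \<sigma> \<circ> inv_into UNIV \<tau>"])
  have e: "\<tau> \<circ> inv_into UNIV \<tau> = id" "inv_into UNIV \<tau> \<circ> \<tau> = id"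
    using permutes_inv_o[OF \<tau>] by auto
  show "\<forall>\<sigma>\<in>{\<sigma>. \<sigma> permutes S}. \<sigma> \<circ> \<tau> \<circ> inv_into UNIV \<tau> = \<sigma>"
    "\<forall>\<sigma>\<in>{\<sigma>. \<sigma> permutes S}. \<sigma> \<circ> inv_into UNIV \<tau> \<circ> \<tau> = \<sigma>"
    using e by (simp_all add: comp_assoc)
qed (use permutes_compose \<tau> permutes_inv[OF \<tau>] in auto)

lemma determinant_permute_rows:
  assumes A: "square n A" and \<tau>: "\<tau> permutes {..<n}"
  shows "determinant R n (\<lambda>i. A (\<tau> i)) = sg \<tau> \<otimes> determinant R n A"
proof -
  let ?P = "{\<sigma>. \<sigma> permutes {..<n}}"
  have sq: "square n (\<lambda>i. A (\<tau> i))" using A perm_lt[OF \<tau>] by (auto simp: square_def)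
  have tm: "det_term n (\<lambda>i. A (\<tau> i)) (\<sigma> \<circ> \<tau>) = sg \<tau> \<otimes> det_term n A \<sigma>" if \<sigma>: "\<sigma> permutes {..<n}" for \<sigma>
  proof -
    have "(\<Otimes>i\<in>{..<n}. A (\<tau> i) (\<sigma> (\<tau> i))) = (\<Otimes>i\<in>\<tau> ` {..<n}. A i (\<sigma> i))"
      using entry_closed[OF A \<sigma>] permutes_image[OF \<tau>] permutes_inj_on[OF \<tau>]
      by (intro finprod_reindex[symmetric]) auto
    then have "(\<Otimes>i\<in>{..<n}. A (\<tau> i) (\<sigma> (\<tau> i))) = (\<Otimes>i\<in>{..<n}. A i (\<sigma> i))"
      by (simp only: permutes_image[OF \<tau>])
    then show ?thesis unfolding det_term_def sg_compose[OF \<sigma> \<tau>]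
      using finprod_closed[OF entry_closed[OF A \<sigma>]] by (simp add: m_ac)
  qed
  have "determinant R n (\<lambda>i. A (\<tau> i)) = (\<Oplus>\<sigma>\<in>(\<lambda>\<sigma>. \<sigma> \<circ> \<tau>) ` ?P. det_term n (\<lambda>i. A (\<tau> i)) \<sigma>)"
    unfolding determinant_eq[OF sq] bij_betw_imp_surj_on[OF permutes_compose_bij[OF \<tau>]] ..
  also have "\<dots> = (\<Oplus>\<sigma>\<in>?P. det_term n (\<lambda>i. A (\<tau> i)) (\<sigma> \<circ> \<tau>))"
    using det_term_closed[OF sq] bij_betw_imp_surj_on[OF permutes_compose_bij[OF \<tau>]]
      bij_betw_imp_inj_on[OF permutes_compose_bij[OF \<tau>]]
    by (intro finsum_reindex) auto
  also have "\<dots> = (\<Oplus>\<sigma>\<in>?P. sg \<tau> \<otimes> det_term n A \<sigma>)"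
    using tm det_term_closed[OF A] by (intro finsum_cong') auto
  also have "\<dots> = sg \<tau> \<otimes> determinant R n A"
    unfolding determinant_eq[OF A] using det_term_closed[OF A]
    by (intro finsum_rdistr[symmetric]) (auto simp: finite_permutations)
  finally show ?thesis .
qed

lemma determinant_equal_rows:
  assumes A: "square n A" and kl: "k < n" "l < n" "k \<noteq> l" and eq: "\<And>j. j < n \<Longrightarrow> A k j = A l j"
  shows "determinant R n A = \<zero>"
proof -
  let ?P = "{\<sigma>. \<sigma> permutes {..<n}}"
  let ?E = "{\<sigma> \<in> ?P. evenperm \<sigma>}" and ?O = "{\<sigma> \<in> ?P. \<not> evenperm \<sigma>}"
  define \<tau> where "\<tau> = transpose k l"
  have \<tau>: "\<tau> permutes {..<n}" using kl by (auto simp: \<tau>_def intro: permutes_swap_id)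
  have odd: "\<not> evenperm \<tau>" using kl by (simp add: \<tau>_def evenperm_swap)
  have parity: "evenperm (\<sigma> \<circ> \<tau>) \<longleftrightarrow> \<not> evenperm \<sigma>" if "\<sigma> permutes {..<n}" for \<sigma>
    using odd evenperm_comp[of \<sigma> \<tau>] permutes_imp_permutation[of "{..<n}"] that \<tau> by auto
  have \<tau>\<tau>: "\<tau> \<circ> \<tau> = id" by (simp add: \<tau>_def)
  have O: "(\<lambda>\<sigma>. \<sigma> \<circ> \<tau>) ` ?E = ?O"
  proof (intro equalityI subsetI)
    fix \<sigma> assume s: "\<sigma> \<in> ?O"
    then have "\<sigma> \<circ> \<tau> \<in> ?E" using parity \<tau> permutes_compose by auto
    moreover have "\<sigma> = (\<sigma> \<circ> \<tau>) \<circ> \<tau>" using \<tau>\<tau> by (simp add: comp_assoc)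
    ultimately show "\<sigma> \<in> (\<lambda>\<sigma>. \<sigma> \<circ> \<tau>) ` ?E" by blast
  qed (use parity \<tau> permutes_compose in auto)
  have fin: "finite ?P" by (simp add: finite_permutations)
  have tm: "det_term n A (\<sigma> \<circ> \<tau>) = \<ominus> det_term n A \<sigma>" if \<sigma>: "\<sigma> permutes {..<n}" for \<sigma>
  proof -
    have "(\<Otimes>i\<in>{..<n}. A i (\<sigma> (\<tau> i))) = (\<Otimes>i\<in>{..<n}. A (\<tau> i) (\<sigma> (\<tau> i)))"
      using eq perm_lt[OF \<sigma>] perm_lt[OF \<tau>] kl A
      by (intro finprod_cong') (auto simp: \<tau>_def transpose_def square_def)
    also have "\<dots> = (\<Otimes>i\<in>\<tau> ` {..<n}. A i (\<sigma> i))"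
      using entry_closed[OF A \<sigma>] permutes_image[OF \<tau>] permutes_inj_on[OF \<tau>]
      by (intro finprod_reindex[symmetric]) auto
    also have "\<dots> = (\<Otimes>i\<in>{..<n}. A i (\<sigma> i))"
      by (simp only: permutes_image[OF \<tau>])
    finally show ?thesis unfolding det_term_def sg_compose[OF \<sigma> \<tau>]
      using finprod_closed[OF entry_closed[OF A \<sigma>]] odd by (simp add: sg_def[of \<tau>] l_minus r_minus)
  qed
  have "?P = ?E \<union> ?O" by auto
  then have "determinant R n A = (\<Oplus>\<sigma>\<in>?E \<union> ?O. det_term n A \<sigma>)" by (simp only: determinant_eq[OF A])
  also have "\<dots> = (\<Oplus>\<sigma>\<in>?E. det_term n A \<sigma>) \<oplus> (\<Oplus>\<sigma>\<in>?O. det_term n A \<sigma>)"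
    using det_term_closed[OF A] fin by (intro finsum_Un_disjoint) auto
  also have "(\<Oplus>\<sigma>\<in>?O. det_term n A \<sigma>) = (\<Oplus>\<sigma>\<in>?E. det_term n A (\<sigma> \<circ> \<tau>))"
    unfolding O[symmetric]
    using det_term_closed[OF A] bij_betw_imp_inj_on[OF permutes_compose_bij[OF \<tau>]] O
    by (intro finsum_reindex) (auto simp: inj_on_def)
  also have "\<dots> = (\<Oplus>\<sigma>\<in>?E. \<ominus> det_term n A \<sigma>)"
    using tm det_term_closed[OF A] by (intro finsum_cong') auto
  also have "(\<Oplus>\<sigma>\<in>?E. det_term n A \<sigma>) \<oplus> (\<Oplus>\<sigma>\<in>?E. \<ominus> det_term n A \<sigma>)
      = (\<Oplus>\<sigma>\<in>?E. det_term n A \<sigma> \<oplus> \<ominus> det_term n A \<sigma>)"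
    using det_term_closed[OF A] by (intro finsum_addf[symmetric]) auto
  also have "\<dots> = (\<Oplus>\<sigma>\<in>?E. \<zero>)"
    using det_term_closed[OF A] by (intro finsum_cong') (auto simp: r_neg)
  finally show ?thesis by simp
qed

lemma determinant_transpose:
  assumes A: "square n A"
  shows "determinant R n (\<lambda>i j. A j i) = determinant R n A"
proof -
  let ?P = "{\<sigma>. \<sigma> permutes {..<n}}"
  have sq: "square n (\<lambda>i j. A j i)" using A by (auto simp: square_def)
  have tm: "det_term n (\<lambda>i j. A j i) (inv_into UNIV \<sigma>) = det_term n A \<sigma>" if \<sigma>: "\<sigma> permutes {..<n}" for \<sigma>
  proof -
    have "(\<Otimes>i\<in>\<sigma> ` {..<n}. A (inv_into UNIV \<sigma> i) i) = (\<Otimes>i\<in>{..<n}. A (inv_into UNIV \<sigma> (\<sigma> i)) (\<sigma> i))"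
      using A perm_lt[OF permutes_inv[OF \<sigma>]] permutes_image[OF \<sigma>] permutes_inj_on[OF \<sigma>]
      by (intro finprod_reindex) (auto simp: square_def)
    then have "(\<Otimes>i\<in>{..<n}. A (inv_into UNIV \<sigma> i) i) = (\<Otimes>i\<in>{..<n}. A i (\<sigma> i))"
      by (simp only: permutes_image[OF \<sigma>] permutes_inverses[OF \<sigma>])
    then show ?thesis by (simp add: det_term_def sg_inv[OF \<sigma>])
  qed
  have img: "inv_into UNIV ` ?P = ?P"
  proof (intro equalityI subsetI)
    fix \<sigma> assume "\<sigma> \<in> ?P"
    then have "inv_into UNIV \<sigma> \<in> ?P" "\<sigma> = inv_into UNIV (inv_into UNIV \<sigma>)"
      using permutes_inv[of \<sigma> "{..<n}"] permutes_inv_inv[of \<sigma> "{..<n}"] by auto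
    then show "\<sigma> \<in> inv_into UNIV ` ?P" by blast
  qed (use permutes_inv in auto)
  have "inj_on (inv_into UNIV) ?P"
    by (rule inj_onI) (metis mem_Collect_eq permutes_inv_inv)
  then have "determinant R n (\<lambda>i j. A j i) = (\<Oplus>\<sigma>\<in>?P. det_term n (\<lambda>i j. A j i) (inv_into UNIV \<sigma>))"
    unfolding determinant_eq[OF sq] using det_term_closed[OF sq] img
    by (subst (1) img[symmetric], intro finsum_reindex) auto
  also have "\<dots> = determinant R n A"
    unfolding determinant_eq[OF A] using tm det_term_closed[OF A] by (intro finsum_cong') auto
  finally show ?thesis .
qed

lemma determinant_product_expand:
  fixes m :: nat
  assumes X: "\<And>i k. i < n \<Longrightarrow> k < m \<Longrightarrow> X i k \<in> carrier R"
    and Y: "\<And>k j. k < m \<Longrightarrow> j < n \<Longrightarrow> Y k j \<in> carrier R"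
  shows "determinant R n (\<lambda>i j. \<Oplus>k\<in>{..<m}. X i k \<otimes> Y k j) =
    (\<Oplus>f\<in>{..<n} \<rightarrow>\<^sub>E {..<m}. (\<Otimes>i\<in>{..<n}. X i (f i)) \<otimes> determinant R n (\<lambda>i. Y (f i)))"
proof -
  let ?P = "{\<sigma>. \<sigma> permutes {..<n}}" and ?F = "{..<n} \<rightarrow>\<^sub>E {..<m}"
  have sq: "square n (\<lambda>i j. \<Oplus>k\<in>{..<m}. X i k \<otimes> Y k j)"
    using X Y by (auto simp: square_def intro!: finsum_closed)
  have Xf: "(\<lambda>i. X i (f i)) \<in> {..<n} \<rightarrow> carrier R" if "f \<in> ?F" for f
    using X that by (auto simp: PiE_iff)
  have Yf: "square n (\<lambda>i. Y (f i))" if "f \<in> ?F" for f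
    using Y that by (auto simp: square_def PiE_iff)
  have fin: "finite ?F" "finite ?P" by (auto intro!: finite_PiE finite_permutations)
  have tm: "det_term n (\<lambda>i j. \<Oplus>k\<in>{..<m}. X i k \<otimes> Y k j) \<sigma> =
      (\<Oplus>f\<in>?F. (\<Otimes>i\<in>{..<n}. X i (f i)) \<otimes> det_term n (\<lambda>i. Y (f i)) \<sigma>)" if \<sigma>: "\<sigma> permutes {..<n}" for \<sigma>
  proof -
    have "(\<Otimes>i\<in>{..<n}. \<Oplus>k\<in>{..<m}. X i k \<otimes> Y k (\<sigma> i)) = (\<Oplus>f\<in>?F. \<Otimes>i\<in>{..<n}. X i (f i) \<otimes> Y (f i) (\<sigma> i))"
      using X Y perm_lt[OF \<sigma>] by (intro finprod_finsum_PiE) auto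
    also have "\<dots> = (\<Oplus>f\<in>?F. (\<Otimes>i\<in>{..<n}. X i (f i)) \<otimes> (\<Otimes>i\<in>{..<n}. Y (f i) (\<sigma> i)))"
      using Xf entry_closed[OF Yf \<sigma>] by (intro finsum_cong' finprod_multf) (auto intro!: finprod_closed m_closed)
    finally have "det_term n (\<lambda>i j. \<Oplus>k\<in>{..<m}. X i k \<otimes> Y k j) \<sigma> =
        sg \<sigma> \<otimes> (\<Oplus>f\<in>?F. (\<Otimes>i\<in>{..<n}. X i (f i)) \<otimes> (\<Otimes>i\<in>{..<n}. Y (f i) (\<sigma> i)))"
      by (simp add: det_term_def)
    also have "\<dots> = (\<Oplus>f\<in>?F. sg \<sigma> \<otimes> ((\<Otimes>i\<in>{..<n}. X i (f i)) \<otimes> (\<Otimes>i\<in>{..<n}. Y (f i) (\<sigma> i))))"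
      using finprod_closed[OF Xf] finprod_closed[OF entry_closed[OF Yf \<sigma>]] fin
      by (intro finsum_rdistr) (auto intro!: m_closed)
    also have "\<dots> = (\<Oplus>f\<in>?F. (\<Otimes>i\<in>{..<n}. X i (f i)) \<otimes> det_term n (\<lambda>i. Y (f i)) \<sigma>)"
      unfolding det_term_def
      using finprod_closed[OF Xf] finprod_closed[OF entry_closed[OF Yf \<sigma>]]
      by (intro finsum_cong' m_lcomm) (auto intro!: m_closed)
    finally show ?thesis .
  qed
  have "determinant R n (\<lambda>i j. \<Oplus>k\<in>{..<m}. X i k \<otimes> Y k j) =
      (\<Oplus>\<sigma>\<in>?P. \<Oplus>f\<in>?F. (\<Otimes>i\<in>{..<n}. X i (f i)) \<otimes> det_term n (\<lambda>i. Y (f i)) \<sigma>)"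
    unfolding determinant_eq[OF sq] using tm finprod_closed[OF Xf] det_term_closed[OF Yf]
    by (intro finsum_cong') (auto intro!: m_closed finsum_closed)
  also have "\<dots> = (\<Oplus>f\<in>?F. \<Oplus>\<sigma>\<in>?P. (\<Otimes>i\<in>{..<n}. X i (f i)) \<otimes> det_term n (\<lambda>i. Y (f i)) \<sigma>)"
    using finprod_closed[OF Xf] det_term_closed[OF Yf] fin
    by (intro finsum_swap) (auto intro!: m_closed)
  also have "\<dots> = (\<Oplus>f\<in>?F. (\<Otimes>i\<in>{..<n}. X i (f i)) \<otimes> determinant R n (\<lambda>i. Y (f i)))"
  proof (intro finsum_cong' refl)
    fix f assume f: "f \<in> ?F"
    show "(\<Oplus>\<sigma>\<in>?P. (\<Otimes>i\<in>{..<n}. X i (f i)) \<otimes> det_term n (\<lambda>i. Y (f i)) \<sigma>) =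
        (\<Otimes>i\<in>{..<n}. X i (f i)) \<otimes> determinant R n (\<lambda>i. Y (f i))"
      unfolding determinant_eq[OF Yf[OF f]]
      using finprod_closed[OF Xf[OF f]] det_term_closed[OF Yf[OF f]] fin
      by (intro finsum_rdistr[symmetric]) auto
  qed (use finprod_closed[OF Xf] Yf in \<open>auto intro!: m_closed\<close>)
  finally show ?thesis .
qed

lemma determinant_mult:
  assumes X: "square n X" and Y: "square n Y"
  shows "determinant R n (\<lambda>i j. \<Oplus>k\<in>{..<n}. X i k \<otimes> Y k j) = determinant R n X \<otimes> determinant R n Y"
proof -
  let ?P = "{\<sigma>. \<sigma> permutes {..<n}}" and ?F = "{..<n} \<rightarrow>\<^sub>E {..<n}" 
  let ?t = "\<lambda>f. (\<Otimes>i\<in>{..<n}. X i (f i)) \<otimes> determinant R n (\<lambda>i. Y (f i))"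
  have fin: "finite ?F" "finite ?P" by (auto intro!: finite_PiE finite_permutations)
  have Xf: "(\<lambda>i. X i (f i)) \<in> {..<n} \<rightarrow> carrier R" if "f \<in> ?F" for f
    using X that by (auto simp: square_def PiE_iff)
  have Yf: "square n (\<lambda>i. Y (f i))" if "f \<in> ?F" for f
    using Y that by (auto simp: square_def PiE_iff)
  have tc: "?t f \<in> carrier R" if "f \<in> ?F" for f
    using finprod_closed[OF Xf[OF that]] Yf[OF that] by auto
  let ?r = "\<lambda>\<sigma>. restrict \<sigma> {..<n}"
  have r: "?r \<sigma> \<in> ?F" if "\<sigma> permutes {..<n}" for \<sigma> using perm_lt[OF that] by auto
  have inj: "inj_on ?r ?P"
  proof (rule inj_onI)
    fix \<sigma> \<tau> assume a: "\<sigma> \<in> ?P" "\<tau> \<in> ?P" and e: "?r \<sigma> = ?r \<tau>"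
    show "\<sigma> = \<tau>"
    proof
      fix x show "\<sigma> x = \<tau> x"
        using fun_cong[OF e, of x] a permutes_not_in[of \<sigma> "{..<n}" x] permutes_not_in[of \<tau> "{..<n}" x]
        by (cases "x < n") auto
    qed
  qed
  have zero: "?t f = \<zero>" if f: "f \<in> ?F - ?r ` ?P" for f
  proof -
    have "\<not> inj_on f {..<n}"
    proof
      assume i: "inj_on f {..<n}"
      have im: "f ` {..<n} \<subseteq> {..<n}" using f by (auto simp: PiE_iff)
      then have im: "f ` {..<n} = {..<n}" using i by (simp add: endo_inj_surj)
      define \<sigma> where "\<sigma> = (\<lambda>x. if x < n then f x else x)"
      have "bij_betw \<sigma> {..<n} {..<n}"
        using i im by (auto simp: bij_betw_def \<sigma>_def inj_on_def image_def)
      then have "\<sigma> permutes {..<n}" by (rule bij_imp_permutes) (simp add: \<sigma>_def)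
      moreover have "f = ?r \<sigma>" using f by (auto simp: \<sigma>_def PiE_iff extensional_def fun_eq_iff)
      ultimately show False using f by blast
    qed
    then obtain k l where kl: "k < n" "l < n" "k \<noteq> l" "f k = f l" by (auto simp: inj_on_def)
    have "determinant R n (\<lambda>i. Y (f i)) = \<zero>"
      using f kl by (intro determinant_equal_rows[OF Yf kl(1-3)]) auto
    then show ?thesis using finprod_closed[OF Xf, of f] f by simp
  qed
  have "determinant R n (\<lambda>i j. \<Oplus>k\<in>{..<n}. X i k \<otimes> Y k j) = (\<Oplus>f\<in>?F. ?t f)"
    using X Y by (intro determinant_product_expand) (auto simp: square_def)
  also have "\<dots> = (\<Oplus>f\<in>?r ` ?P. ?t f)"
    using fin r zero tc by (intro add.finprod_mono_neutral_cong_right) blast+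
  also have "\<dots> = (\<Oplus>\<sigma>\<in>?P. ?t (?r \<sigma>))"
    using inj tc r by (intro finsum_reindex) blast+
  also have "\<dots> = (\<Oplus>\<sigma>\<in>?P. det_term n X \<sigma> \<otimes> determinant R n Y)"
  proof (intro finsum_cong' refl)
    fix \<sigma> assume "\<sigma> \<in> ?P"
    then have \<sigma>: "\<sigma> permutes {..<n}" by simp
    have "(\<Otimes>i\<in>{..<n}. X i (?r \<sigma> i)) = (\<Otimes>i\<in>{..<n}. X i (\<sigma> i))"
      using entry_closed[OF X \<sigma>] by (intro finprod_cong') auto
    moreover have "determinant R n (\<lambda>i. Y (?r \<sigma> i)) = determinant R n (\<lambda>i. Y (\<sigma> i))"
      using Y perm_lt[OF \<sigma>] by (intro determinant_cong) (auto simp: square_def)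
    ultimately show "?t (?r \<sigma>) = det_term n X \<sigma> \<otimes> determinant R n Y"
      using finprod_closed[OF entry_closed[OF X \<sigma>]] Y
      by (simp add: determinant_permute_rows[OF Y \<sigma>] det_term_def m_ac)
  qed (use det_term_closed[OF X] Y in auto)
  also have "\<dots> = determinant R n X \<otimes> determinant R n Y"
    unfolding determinant_eq[OF X] using det_term_closed[OF X] Y fin
    by (intro finsum_ldistr[symmetric]) auto
  finally show ?thesis .
qed

lemma determinant_diag:
  assumes a: "a \<in> {..<n} \<rightarrow> carrier R"
  shows "determinant R n (\<lambda>i j. if i = j then a i else \<zero>) = (\<Otimes>i\<in>{..<n}. a i)"
proof -
  let ?A = "\<lambda>i j. if i = j then a i else \<zero>"
  have A: "square n ?A" using a by (auto simp: square_def)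
  have ac: "a i \<in> carrier R" if "i < n" for i using a that by auto
  have "det_term n ?A \<sigma> = \<zero>" if "\<sigma> \<in> {\<sigma>. \<sigma> permutes {..<n}} - {id}" for \<sigma>
  proof -
    have \<sigma>: "\<sigma> permutes {..<n}" "\<sigma> \<noteq> id" using that by auto
    then obtain k where k: "\<sigma> k \<noteq> k" by (auto simp: fun_eq_iff)
    then have kn: "k < n" using \<sigma>(1) permutes_not_in[of \<sigma> "{..<n}" k] by auto
    have e: "{..<n} = insert k ({..<n} - {k})" using kn by auto
    have "(\<Otimes>i\<in>insert k ({..<n} - {k}). ?A i (\<sigma> i)) = \<zero> \<otimes> (\<Otimes>i\<in>{..<n} - {k}. ?A i (\<sigma> i))"
      using k kn ac by (subst finprod_insert) auto
    also have "\<dots> = \<zero>" using ac by (intro l_null finprod_closed) auto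
    finally show ?thesis using e unfolding det_term_def by simp
  qed
  then have "(\<Oplus>\<sigma>\<in>{\<sigma>. \<sigma> permutes {..<n}}. det_term n ?A \<sigma>) = (\<Oplus>\<sigma>\<in>{id}. det_term n ?A \<sigma>)"
    using det_term_closed[OF A] permutes_id
    by (intro add.finprod_mono_neutral_cong_right) (auto simp: finite_permutations)
  also have "\<dots> = (\<Otimes>i\<in>{..<n}. a i)"
    using finprod_closed[OF a] det_term_closed[OF A permutes_id] by (simp add: det_term_def)
  finally show ?thesis by (simp add: determinant_eq[OF A])
qed

end

context coeff_hom
begin

lemma hom_determinant:
  assumes A: "R.square n A"
  shows "\<phi> (determinant R n A) = determinant S n (\<lambda>i j. \<phi> (A i j))"
proof -
  have sq: "H.S.square n (\<lambda>i j. \<phi> (A i j))" using A by (auto simp: R.square_def H.S.square_def)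
  have "\<phi> (R.sg \<sigma>) = H.S.sg \<sigma>" for \<sigma> by (simp add: R.sg_def H.S.sg_def)
  then have tm: "\<phi> (R.det_term n A \<sigma>) = H.S.det_term n (\<lambda>i j. \<phi> (A i j)) \<sigma>" if "\<sigma> permutes {..<n}" for \<sigma>
    using R.entry_closed[OF A that]
    by (simp add: R.det_term_def H.S.det_term_def H.hom_finprod)
  show ?thesis
    unfolding R.determinant_eq[OF A] H.S.determinant_eq[OF sq]
    using tm R.det_term_closed[OF A] H.S.det_term_closed[OF sq]
    by (subst H.hom_finsum) (auto intro!: H.S.finsum_cong')
qed

end

section \<open>Functionals and maps on tensor products and exterior powers\<close>

locale tensor_data = cring R for R :: "('r, 'y) ring_scheme" (structure) +
  fixes A :: "('a, 'x) ring_scheme" and \<phi> :: "'a \<Rightarrow> 'r" and M :: "('a, 'm, 'z) module_scheme"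
  assumes \<phi>_closed: "a \<in> carrier A \<Longrightarrow> \<phi> a \<in> carrier R"
    and M_add: "x \<in> carrier M \<Longrightarrow> y \<in> carrier M \<Longrightarrow> x \<oplus>\<^bsub>M\<^esub> y \<in> carrier M"
    and M_smult: "a \<in> carrier A \<Longrightarrow> x \<in> carrier M \<Longrightarrow> a \<odot>\<^bsub>M\<^esub> x \<in> carrier M"
begin

lemma tensor_rels_closed: "tensor_rels A \<phi> R M \<subseteq> carrier (free_mod R (carrier M))"
proof -
  interpret L: module R "free_mod R (carrier M)" by (rule free_mod_module)
  show ?thesis unfolding tensor_rels_def Let_def
    using M_add M_smult \<phi>_closed
    by (auto intro!: L.minus_closed L.a_closed[simplified] L.smult_closed[simplified] simp del: L.minus_closed)
qed

sublocale T: presentation R "carrier M" "tensor_rels A \<phi> R M"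
  by unfold_locales (rule tensor_rels_closed)

lemma tensor_eq: "tensor A \<phi> R M = T.Q"
  by (simp add: tensor_def)

lemma pure_tensor_eq: "pure_tensor A \<phi> R M x c = T.cl (single R x c)"
  by (simp add: pure_tensor_def)

lemma pure_tensor_closed:
  "x \<in> carrier M \<Longrightarrow> c \<in> carrier R \<Longrightarrow> pure_tensor A \<phi> R M x c \<in> carrier (tensor A \<phi> R M)"
  by (simp add: pure_tensor_eq tensor_eq)

lemma tensor_module: "module R (tensor A \<phi> R M)"
  unfolding tensor_eq by (rule T.Q_module)

lemma pure_tensor_smult:
  assumes "x \<in> carrier M" "c \<in> carrier R" "d \<in> carrier R"
  shows "d \<odot>\<^bsub>tensor A \<phi> R M\<^esub> pure_tensor A \<phi> R M x c = pure_tensor A \<phi> R M x (d \<otimes> c)"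
proof -
  have "(\<lambda>g. d \<otimes> single R x c g) = single R x (d \<otimes> c)"
    using assms by (auto simp: single_def)
  then show ?thesis
    using assms by (simp add: pure_tensor_eq tensor_eq T.cl_smult)
qed

lemma pure_tensor_add_left:
  assumes "x \<in> carrier M" "y \<in> carrier M"
  shows "pure_tensor A \<phi> R M (x \<oplus>\<^bsub>M\<^esub> y) \<one> = pure_tensor A \<phi> R M x \<one> \<oplus>\<^bsub>tensor A \<phi> R M\<^esub> pure_tensor A \<phi> R M y \<one>"
proof -
  interpret L: module R "free_mod R (carrier M)" by (rule free_mod_module)
  have "T.cl (single R (x \<oplus>\<^bsub>M\<^esub> y) \<one>) = T.cl (single R x \<one> \<oplus>\<^bsub>T.L\<^esub> single R y \<one>)"
  proof (rule T.cl_rel)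
    show "single R (x \<oplus>\<^bsub>M\<^esub> y) \<one> \<ominus>\<^bsub>T.L\<^esub> (single R x \<one> \<oplus>\<^bsub>T.L\<^esub> single R y \<one>) \<in> tensor_rels A \<phi> R M"
      unfolding tensor_rels_def Let_def using assms by blast
  qed (use assms M_add in \<open>auto intro!: L.a_closed[simplified]\<close>)
  then show ?thesis using assms by (simp add: pure_tensor_eq tensor_eq T.cl_add)
qed

lemma pure_tensor_smult_left:
  assumes "x \<in> carrier M" "a \<in> carrier A"
  shows "pure_tensor A \<phi> R M (a \<odot>\<^bsub>M\<^esub> x) \<one> = \<phi> a \<odot>\<^bsub>tensor A \<phi> R M\<^esub> pure_tensor A \<phi> R M x \<one>"
proof -
  interpret L: module R "free_mod R (carrier M)" by (rule free_mod_module)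
  have "T.cl (single R (a \<odot>\<^bsub>M\<^esub> x) \<one>) = T.cl (\<phi> a \<odot>\<^bsub>T.L\<^esub> single R x \<one>)"
  proof (rule T.cl_rel)
    show "single R (a \<odot>\<^bsub>M\<^esub> x) \<one> \<ominus>\<^bsub>T.L\<^esub> (\<phi> a \<odot>\<^bsub>T.L\<^esub> single R x \<one>) \<in> tensor_rels A \<phi> R M"
      unfolding tensor_rels_def Let_def using assms by blast
  qed (use assms M_smult \<phi>_closed in \<open>auto intro!: L.smult_closed[simplified]\<close>)
  then show ?thesis using assms \<phi>_closed by (simp add: pure_tensor_eq tensor_eq T.cl_smult)
qed

lemma tensor_induct [consumes 1, case_names pure zero add]:
  assumes "x \<in> carrier (tensor A \<phi> R M)"
    and "\<And>x c. x \<in> carrier M \<Longrightarrow> c \<in> carrier R \<Longrightarrow> P (pure_tensor A \<phi> R M x c)"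
    and "P \<zero>\<^bsub>tensor A \<phi> R M\<^esub>"
    and "\<And>x y. x \<in> carrier (tensor A \<phi> R M) \<Longrightarrow> y \<in> carrier (tensor A \<phi> R M) \<Longrightarrow> P x \<Longrightarrow> P y
        \<Longrightarrow> P (x \<oplus>\<^bsub>tensor A \<phi> R M\<^esub> y)"
  shows "P x"
  using assms unfolding tensor_eq pure_tensor_eq by (rule T.Q_induct)

end

lemma (in coeff_hom) tensor_functional:
  assumes "tensor_data R A \<alpha> M"
    and l: "l \<in> carrier M \<rightarrow> carrier S"
    and add: "\<And>x y. x \<in> carrier M \<Longrightarrow> y \<in> carrier M \<Longrightarrow> l (x \<oplus>\<^bsub>M\<^esub> y) = l x \<oplus>\<^bsub>S\<^esub> l y"
    and smult: "\<And>a x. a \<in> carrier A \<Longrightarrow> x \<in> carrier M \<Longrightarrow> l (a \<odot>\<^bsub>M\<^esub> x) = \<phi> (\<alpha> a) \<otimes>\<^bsub>S\<^esub> l x"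
  shows "functional R S \<phi> (carrier M) (tensor_rels A \<alpha> R M) l"
proof -
  interpret t: tensor_data R A \<alpha> M by fact
  interpret L: module R "free_mod R (carrier M)" by (rule R.free_mod_module)
  note e = evf_single[OF _ _ l]
  show ?thesis
  proof unfold_locales
    fix k assume k: "k \<in> tensor_rels A \<alpha> R M"
    then consider (1) x y where "x \<in> carrier M" "y \<in> carrier M"
      "k = single R (x \<oplus>\<^bsub>M\<^esub> y) \<one> \<ominus>\<^bsub>free_mod R (carrier M)\<^esub> (single R x \<one> \<oplus>\<^bsub>free_mod R (carrier M)\<^esub> single R y \<one>)"
      | (2) a x where "a \<in> carrier A" "x \<in> carrier M"
      "k = single R (a \<odot>\<^bsub>M\<^esub> x) \<one> \<ominus>\<^bsub>free_mod R (carrier M)\<^esub> (\<alpha> a \<odot>\<^bsub>free_mod R (carrier M)\<^esub> single R x \<one>)"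
      unfolding tensor_rels_def Let_def by blast
    then show "evf R S \<phi> l k = \<zero>\<^bsub>S\<^esub>"
    proof cases
      case 1
      have lc: "l x \<in> carrier S" "l y \<in> carrier S" using 1 l by auto
      have "evf R S \<phi> l k = evf R S \<phi> l (single R (x \<oplus>\<^bsub>M\<^esub> y) \<one>) \<ominus>\<^bsub>S\<^esub>
          evf R S \<phi> l (single R x \<one> \<oplus>\<^bsub>free_mod R (carrier M)\<^esub> single R y \<one>)"
        unfolding 1(3) using 1 t.M_add by (intro evf_diff[OF _ _ l] L.a_closed) auto
      also have "evf R S \<phi> l (single R x \<one> \<oplus>\<^bsub>free_mod R (carrier M)\<^esub> single R y \<one>) = l x \<oplus>\<^bsub>S\<^esub> l y"
        using 1 lc by (simp add: evf_add[OF _ _ l] e)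
      finally show ?thesis using 1 lc t.M_add by (simp add: e add)
    next
      case 2
      have lc: "l x \<in> carrier S" using 2 l by auto
      have "evf R S \<phi> l k = evf R S \<phi> l (single R (a \<odot>\<^bsub>M\<^esub> x) \<one>) \<ominus>\<^bsub>S\<^esub>
          evf R S \<phi> l (\<alpha> a \<odot>\<^bsub>free_mod R (carrier M)\<^esub> single R x \<one>)"
        unfolding 2(3) using 2 t.M_smult t.\<phi>_closed by (intro evf_diff[OF _ _ l] L.smult_closed) auto
      also have "evf R S \<phi> l (\<alpha> a \<odot>\<^bsub>free_mod R (carrier M)\<^esub> single R x \<one>) = \<phi> (\<alpha> a) \<otimes>\<^bsub>S\<^esub> l x"
        using 2 lc t.\<phi>_closed by (simp add: evf_smult[OF _ _ l] e)
      finally show ?thesis using 2 lc t.M_smult t.\<phi>_closed by (simp add: e smult)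
    qed
  qed (rule l)
qed

lemma (in coeff_hom) tensor_presentation_map:
  assumes "tensor_data R A \<alpha> M" "tensor_data S A' \<alpha>' M'"
    and h: "h \<in> carrier M \<rightarrow> carrier M'"
    and add: "\<And>x y. x \<in> carrier M \<Longrightarrow> y \<in> carrier M \<Longrightarrow> h (x \<oplus>\<^bsub>M\<^esub> y) = h x \<oplus>\<^bsub>M'\<^esub> h y"
    and smult: "\<And>a x. a \<in> carrier A \<Longrightarrow> x \<in> carrier M \<Longrightarrow> h (a \<odot>\<^bsub>M\<^esub> x) = a \<odot>\<^bsub>M'\<^esub> h x"
    and A: "\<And>a. a \<in> carrier A \<Longrightarrow> a \<in> carrier A' \<and> \<alpha>' a = \<phi> (\<alpha> a)"
  shows "presentation_map R S \<phi> (carrier M) (tensor_rels A \<alpha> R M) (carrier M') (tensor_rels A' \<alpha>' S M') h"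
proof -
  interpret t: tensor_data R A \<alpha> M by fact
  interpret t': tensor_data S A' \<alpha>' M' by fact
  interpret L: module R "free_mod R (carrier M)" by (rule R.free_mod_module)
  note p = pushforward_single[where G = "carrier M"]
  show ?thesis
  proof unfold_locales
    fix k assume k: "k \<in> tensor_rels A \<alpha> R M"
    then consider (1) x y where "x \<in> carrier M" "y \<in> carrier M"
      "k = single R (x \<oplus>\<^bsub>M\<^esub> y) \<one> \<ominus>\<^bsub>free_mod R (carrier M)\<^esub> (single R x \<one> \<oplus>\<^bsub>free_mod R (carrier M)\<^esub> single R y \<one>)"
      | (2) a x where "a \<in> carrier A" "x \<in> carrier M"
      "k = single R (a \<odot>\<^bsub>M\<^esub> x) \<one> \<ominus>\<^bsub>free_mod R (carrier M)\<^esub> (\<alpha> a \<odot>\<^bsub>free_mod R (carrier M)\<^esub> single R x \<one>)"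
      unfolding tensor_rels_def Let_def by blast
    then have "pushforward R S \<phi> h k \<in> tensor_rels A' \<alpha>' S M'"
    proof cases
      case 1
      have "pushforward R S \<phi> h k = pushforward R S \<phi> h (single R (x \<oplus>\<^bsub>M\<^esub> y) \<one>) \<ominus>\<^bsub>free_mod S (carrier M')\<^esub>
          pushforward R S \<phi> h (single R x \<one> \<oplus>\<^bsub>free_mod R (carrier M)\<^esub> single R y \<one>)"
        unfolding 1(3) using 1 t.M_add by (intro pushforward_diff[OF _ _ h] L.a_closed) auto
      also have "pushforward R S \<phi> h (single R x \<one> \<oplus>\<^bsub>free_mod R (carrier M)\<^esub> single R y \<one>) =
          single S (h x) \<one>\<^bsub>S\<^esub> \<oplus>\<^bsub>free_mod S (carrier M')\<^esub> single S (h y) \<one>\<^bsub>S\<^esub>"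
        using 1 by (simp add: pushforward_add[where G = "carrier M"] p)
      finally have "pushforward R S \<phi> h k = single S (h x \<oplus>\<^bsub>M'\<^esub> h y) \<one>\<^bsub>S\<^esub> \<ominus>\<^bsub>free_mod S (carrier M')\<^esub>
          (single S (h x) \<one>\<^bsub>S\<^esub> \<oplus>\<^bsub>free_mod S (carrier M')\<^esub> single S (h y) \<one>\<^bsub>S\<^esub>)"
        using 1 t.M_add by (simp add: p add)
      then show ?thesis unfolding tensor_rels_def Let_def using 1 h by blast
    next
      case 2
      have "pushforward R S \<phi> h k = pushforward R S \<phi> h (single R (a \<odot>\<^bsub>M\<^esub> x) \<one>) \<ominus>\<^bsub>free_mod S (carrier M')\<^esub>
          pushforward R S \<phi> h (\<alpha> a \<odot>\<^bsub>free_mod R (carrier M)\<^esub> single R x \<one>)"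
        unfolding 2(3) using 2 t.M_smult t.\<phi>_closed by (intro pushforward_diff[OF _ _ h] L.smult_closed) auto
      also have "pushforward R S \<phi> h (\<alpha> a \<odot>\<^bsub>free_mod R (carrier M)\<^esub> single R x \<one>) =
          \<alpha>' a \<odot>\<^bsub>free_mod S (carrier M')\<^esub> single S (h x) \<one>\<^bsub>S\<^esub>"
        using 2 A t.\<phi>_closed by (simp add: pushforward_smult[where G = "carrier M"] p)
      finally have "pushforward R S \<phi> h k = single S (a \<odot>\<^bsub>M'\<^esub> h x) \<one>\<^bsub>S\<^esub> \<ominus>\<^bsub>free_mod S (carrier M')\<^esub>
          (\<alpha>' a \<odot>\<^bsub>free_mod S (carrier M')\<^esub> single S (h x) \<one>\<^bsub>S\<^esub>)"
        using 2 t.M_smult by (simp add: p smult)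
      then show ?thesis unfolding tensor_rels_def Let_def using 2 h A by blast
    qed
    then show "pushforward R S \<phi> h k \<in> lin_span S (free_mod S (carrier M')) (tensor_rels A' \<alpha>' S M')"
      by (rule subsetD[OF lin_span_superset])
  qed (rule h)
qed

lemma tuples_update: "xs \<in> tuples n X \<Longrightarrow> x \<in> X \<Longrightarrow> xs[i := x] \<in> tuples n X"
  using set_update_subset_insert[of xs i x] by (auto simp: tuples_def)

lemma tuples_nth: "xs \<in> tuples n X \<Longrightarrow> i < n \<Longrightarrow> xs ! i \<in> X"
  by (auto simp: tuples_def)

lemma tuples_map: "xs \<in> tuples n X \<Longrightarrow> h \<in> X \<rightarrow> Y \<Longrightarrow> map h xs \<in> tuples n Y"
  by (auto simp: tuples_def)

context module
begin

lemma ext_rels_closed: "ext_rels R n M \<subseteq> carrier (free_mod R (tuples n (carrier M)))"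
proof -
  interpret L: module R "free_mod R (tuples n (carrier M))" by (rule R.free_mod_module)
  show ?thesis unfolding ext_rels_def Let_def
    by (auto intro!: L.minus_closed L.a_closed[simplified] L.smult_closed[simplified] tuples_update
        simp del: L.minus_closed)
qed

lemma ext_presentation: "presentation R (tuples n (carrier M)) (ext_rels R n M)"
  by unfold_locales (rule ext_rels_closed)

lemma wedge_closed: "xs \<in> tuples n (carrier M) \<Longrightarrow> wedge R n M xs \<in> carrier (ext_power R n M)"
  unfolding ext_power_def wedge_def by (rule presentation.cl_closed[OF ext_presentation]) auto

end

definition semilinear ::
  "('a, 'x) ring_scheme \<Rightarrow> ('b, 'y) ring_scheme \<Rightarrow> ('a \<Rightarrow> 'b) \<Rightarrow> ('a, 'm, 'z) module_scheme \<Rightarrow> ('m \<Rightarrow> 'b) \<Rightarrow> bool" where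
  "semilinear R S \<phi> M l \<longleftrightarrow> (\<forall>x\<in>carrier M. l x \<in> carrier S) \<and>
    (\<forall>x\<in>carrier M. \<forall>y\<in>carrier M. l (x \<oplus>\<^bsub>M\<^esub> y) = l x \<oplus>\<^bsub>S\<^esub> l y) \<and>
    (\<forall>c\<in>carrier R. \<forall>x\<in>carrier M. l (c \<odot>\<^bsub>M\<^esub> x) = \<phi> c \<otimes>\<^bsub>S\<^esub> l x)"

definition alternating ::
  "('a, 'x) ring_scheme \<Rightarrow> ('b, 'y) ring_scheme \<Rightarrow> ('a \<Rightarrow> 'b) \<Rightarrow> nat \<Rightarrow> ('a, 'm, 'z) module_scheme
    \<Rightarrow> ('m list \<Rightarrow> 'b) \<Rightarrow> bool" where
  "alternating R S \<phi> n M D \<longleftrightarrow> D \<in> tuples n (carrier M) \<rightarrow> carrier S \<and>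
    (\<forall>xs\<in>tuples n (carrier M). \<forall>i<n. \<forall>x\<in>carrier M. \<forall>y\<in>carrier M.
      D (xs[i := x \<oplus>\<^bsub>M\<^esub> y]) = D (xs[i := x]) \<oplus>\<^bsub>S\<^esub> D (xs[i := y])) \<and>
    (\<forall>xs\<in>tuples n (carrier M). \<forall>i<n. \<forall>c\<in>carrier R. \<forall>x\<in>carrier M.
      D (xs[i := c \<odot>\<^bsub>M\<^esub> x]) = \<phi> c \<otimes>\<^bsub>S\<^esub> D (xs[i := x])) \<and>
    (\<forall>xs\<in>tuples n (carrier M). \<forall>i j. i < j \<longrightarrow> j < n \<longrightarrow> xs ! i = xs ! j \<longrightarrow> D xs = \<zero>\<^bsub>S\<^esub>)"

context coeff_hom
begin

lemma alternating_determinant: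
  assumes M: "module R M" and l: "\<And>j. j < n \<Longrightarrow> semilinear R S \<phi> M (l j)"
  shows "alternating R S \<phi> n M (\<lambda>xs. determinant S n (\<lambda>i j. l j (xs ! i)))"
proof -
  interpret M: module R M by fact
  have sq: "H.S.square n (\<lambda>i j. l j (xs ! i))" if "xs \<in> tuples n (carrier M)" for xs
    using l tuples_nth[OF that] by (auto simp: H.S.square_def semilinear_def)
  have lc: "l j x \<in> carrier S" if "j < n" "x \<in> carrier M" for j x
    using l that by (auto simp: semilinear_def)
  have upd: "determinant S n (\<lambda>i' j. l j (xs[i := x] ! i')) =
      determinant S n ((\<lambda>i' j. l j (xs ! i'))(i := \<lambda>j. l j x))"
    if "xs \<in> tuples n (carrier M)" "i < n" "x \<in> carrier M" for xs i x
    using that sq[OF that(1)] lc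
    by (intro H.S.determinant_cong H.S.square_upd) (auto simp: tuples_def)
  show ?thesis
    unfolding alternating_def
  proof (intro conjI ballI allI impI)
    show "(\<lambda>xs. determinant S n (\<lambda>i j. l j (xs ! i))) \<in> tuples n (carrier M) \<rightarrow> carrier S"
      using sq by auto
  next
    fix xs i x y assume a: "xs \<in> tuples n (carrier M)" "i < n" "x \<in> carrier M" "y \<in> carrier M"
    have "determinant S n ((\<lambda>i' j. l j (xs ! i'))(i := \<lambda>j. l j (x \<oplus>\<^bsub>M\<^esub> y))) =
      determinant S n ((\<lambda>i' j. l j (xs ! i'))(i := \<lambda>j. l j x \<oplus>\<^bsub>S\<^esub> l j y))"
      using a sq[OF a(1)] lc l
      by (intro H.S.determinant_cong H.S.square_upd) (auto simp: semilinear_def)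
    then show "determinant S n (\<lambda>i' j. l j (xs[i := x \<oplus>\<^bsub>M\<^esub> y] ! i')) =
      determinant S n (\<lambda>i' j. l j (xs[i := x] ! i')) \<oplus>\<^bsub>S\<^esub> determinant S n (\<lambda>i' j. l j (xs[i := y] ! i'))"
      using a upd lc H.S.determinant_row_add[OF sq[OF a(1)] a(2), of "\<lambda>j. l j x" "\<lambda>j. l j y"]
      by simp
  next
    fix xs i c x assume a: "xs \<in> tuples n (carrier M)" "i < n" "c \<in> carrier R" "x \<in> carrier M"
    have "determinant S n ((\<lambda>i' j. l j (xs ! i'))(i := \<lambda>j. l j (c \<odot>\<^bsub>M\<^esub> x))) =
      determinant S n ((\<lambda>i' j. l j (xs ! i'))(i := \<lambda>j. \<phi> c \<otimes>\<^bsub>S\<^esub> l j x))"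
      using a sq[OF a(1)] lc l
      by (intro H.S.determinant_cong H.S.square_upd) (auto simp: semilinear_def)
    then show "determinant S n (\<lambda>i' j. l j (xs[i := c \<odot>\<^bsub>M\<^esub> x] ! i')) =
      \<phi> c \<otimes>\<^bsub>S\<^esub> determinant S n (\<lambda>i' j. l j (xs[i := x] ! i'))"
      using a upd lc H.S.determinant_row_smult[OF sq[OF a(1)] a(2), of "\<phi> c" "\<lambda>j. l j x"]
      by simp
  next
    fix xs i j assume "xs \<in> tuples n (carrier M)" "i < j" "j < n" "xs ! i = xs ! j"
    then show "determinant S n (\<lambda>i j. l j (xs ! i)) = \<zero>\<^bsub>S\<^esub>"
      using H.S.determinant_equal_rows[OF sq, of xs i j] by auto
  qed
qed

lemma alternating_combine:
  assumes D: "alternating R S \<phi> n M D" and E: "alternating R S \<phi> n M E" and p: "p \<in> carrier S"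
    and M: "module R M"
  shows "alternating R S \<phi> n M (\<lambda>xs. D xs \<ominus>\<^bsub>S\<^esub> p \<otimes>\<^bsub>S\<^esub> E xs)"
proof -
  interpret M: module R M by fact
  have c: "D xs \<in> carrier S" "E xs \<in> carrier S" if "xs \<in> tuples n (carrier M)" for xs
    using D E that by (auto simp: alternating_def)
  show ?thesis unfolding alternating_def
  proof (intro conjI ballI allI impI)
    show "(\<lambda>xs. D xs \<ominus>\<^bsub>S\<^esub> p \<otimes>\<^bsub>S\<^esub> E xs) \<in> tuples n (carrier M) \<rightarrow> carrier S" using c p by auto
  next
    fix xs i x y assume a: "xs \<in> tuples n (carrier M)" "i < n" "x \<in> carrier M" "y \<in> carrier M"
    have "D (xs[i := x \<oplus>\<^bsub>M\<^esub> y]) = D (xs[i := x]) \<oplus>\<^bsub>S\<^esub> D (xs[i := y])"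
      "E (xs[i := x \<oplus>\<^bsub>M\<^esub> y]) = E (xs[i := x]) \<oplus>\<^bsub>S\<^esub> E (xs[i := y])"
      using D E a by (auto simp: alternating_def)
    then show "D (xs[i := x \<oplus>\<^bsub>M\<^esub> y]) \<ominus>\<^bsub>S\<^esub> p \<otimes>\<^bsub>S\<^esub> E (xs[i := x \<oplus>\<^bsub>M\<^esub> y]) =
        (D (xs[i := x]) \<ominus>\<^bsub>S\<^esub> p \<otimes>\<^bsub>S\<^esub> E (xs[i := x])) \<oplus>\<^bsub>S\<^esub> (D (xs[i := y]) \<ominus>\<^bsub>S\<^esub> p \<otimes>\<^bsub>S\<^esub> E (xs[i := y]))"
      using c[OF tuples_update[OF a(1,3)], of i] c[OF tuples_update[OF a(1,4)], of i] p
      by (simp add: H.S.minus_eq H.S.r_distr H.S.minus_add H.S.a_ac)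
  next
    fix xs i b x assume a: "xs \<in> tuples n (carrier M)" "i < n" "b \<in> carrier R" "x \<in> carrier M"
    have "D (xs[i := b \<odot>\<^bsub>M\<^esub> x]) = \<phi> b \<otimes>\<^bsub>S\<^esub> D (xs[i := x])"
      "E (xs[i := b \<odot>\<^bsub>M\<^esub> x]) = \<phi> b \<otimes>\<^bsub>S\<^esub> E (xs[i := x])"
      using D E a by (auto simp: alternating_def)
    then show "D (xs[i := b \<odot>\<^bsub>M\<^esub> x]) \<ominus>\<^bsub>S\<^esub> p \<otimes>\<^bsub>S\<^esub> E (xs[i := b \<odot>\<^bsub>M\<^esub> x]) =
        \<phi> b \<otimes>\<^bsub>S\<^esub> (D (xs[i := x]) \<ominus>\<^bsub>S\<^esub> p \<otimes>\<^bsub>S\<^esub> E (xs[i := x]))"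
      using c[OF tuples_update[OF a(1,4)], of i] p a(3)
      by (simp add: H.S.minus_eq H.S.r_distr H.S.r_minus H.S.m_lcomm)
  next
    fix xs i j assume a: "xs \<in> tuples n (carrier M)" "i < j" "j < n" "xs ! i = xs ! j"
    then have "D xs = \<zero>\<^bsub>S\<^esub>" "E xs = \<zero>\<^bsub>S\<^esub>" using D E by (auto simp: alternating_def)
    then show "D xs \<ominus>\<^bsub>S\<^esub> p \<otimes>\<^bsub>S\<^esub> E xs = \<zero>\<^bsub>S\<^esub>" using p by (simp add: H.S.minus_eq)
  qed
qed

lemma ext_functional:
  assumes M: "module R M" and D: "alternating R S \<phi> n M D"
  shows "functional R S \<phi> (tuples n (carrier M)) (ext_rels R n M) D"
proof -
  interpret M: module R M by fact
  let ?G = "tuples n (carrier M)"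
  interpret L: module R "free_mod R ?G" by (rule R.free_mod_module)
  have Dc: "D \<in> ?G \<rightarrow> carrier S" using D by (simp add: alternating_def)
  note e = evf_single[OF _ _ Dc]
  interpret P: presentation R ?G "ext_rels R n M" by (rule M.ext_presentation)
  show ?thesis
  proof unfold_locales
    fix k assume "k \<in> ext_rels R n M"
    then consider (1) xs i x y where "xs \<in> ?G" "i < n" "x \<in> carrier M" "y \<in> carrier M"
      "k = single R (xs[i := x \<oplus>\<^bsub>M\<^esub> y]) \<one> \<ominus>\<^bsub>free_mod R ?G\<^esub>
        (single R (xs[i := x]) \<one> \<oplus>\<^bsub>free_mod R ?G\<^esub> single R (xs[i := y]) \<one>)"
      | (2) xs i c x where "xs \<in> ?G" "i < n" "c \<in> carrier R" "x \<in> carrier M"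
      "k = single R (xs[i := c \<odot>\<^bsub>M\<^esub> x]) \<one> \<ominus>\<^bsub>free_mod R ?G\<^esub> (c \<odot>\<^bsub>free_mod R ?G\<^esub> single R (xs[i := x]) \<one>)"
      | (3) xs i j where "xs \<in> ?G" "i < j" "j < n" "xs ! i = xs ! j" "k = single R xs \<one>"
      unfolding ext_rels_def Let_def by blast
    then show "evf R S \<phi> D k = \<zero>\<^bsub>S\<^esub>"
    proof cases
      case 1
      note g = tuples_update[OF 1(1)]
      have c: "D (xs[i := x]) \<in> carrier S" "D (xs[i := y]) \<in> carrier S" using 1 Dc g by auto
      have "evf R S \<phi> D k = evf R S \<phi> D (single R (xs[i := x \<oplus>\<^bsub>M\<^esub> y]) \<one>) \<ominus>\<^bsub>S\<^esub>
          evf R S \<phi> D (single R (xs[i := x]) \<one> \<oplus>\<^bsub>free_mod R ?G\<^esub> single R (xs[i := y]) \<one>)"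
        unfolding 1(5) using 1 g by (intro evf_diff[OF _ _ Dc] L.a_closed) auto
      also have "evf R S \<phi> D (single R (xs[i := x]) \<one> \<oplus>\<^bsub>free_mod R ?G\<^esub> single R (xs[i := y]) \<one>) =
          D (xs[i := x]) \<oplus>\<^bsub>S\<^esub> D (xs[i := y])"
        using 1 c g by (simp add: evf_add[OF _ _ Dc] e)
      finally show ?thesis using 1 c g D by (simp add: e alternating_def)
    next
      case 2
      note g = tuples_update[OF 2(1)]
      have d: "D (xs[i := x]) \<in> carrier S" using 2 Dc g by auto
      have "evf R S \<phi> D k = evf R S \<phi> D (single R (xs[i := c \<odot>\<^bsub>M\<^esub> x]) \<one>) \<ominus>\<^bsub>S\<^esub>
          evf R S \<phi> D (c \<odot>\<^bsub>free_mod R ?G\<^esub> single R (xs[i := x]) \<one>)"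
        unfolding 2(5) using 2 g by (intro evf_diff[OF _ _ Dc] L.smult_closed) auto
      also have "evf R S \<phi> D (c \<odot>\<^bsub>free_mod R ?G\<^esub> single R (xs[i := x]) \<one>) = \<phi> c \<otimes>\<^bsub>S\<^esub> D (xs[i := x])"
        using 2 d g by (simp add: evf_smult[OF _ _ Dc] e)
      finally show ?thesis using 2 d g D by (simp add: e alternating_def)
    next
      case 3
      then have "D xs = \<zero>\<^bsub>S\<^esub>" using D by (auto simp: alternating_def)
      then show ?thesis using 3 by (simp add: e)
    qed
  qed (rule Dc)
qed

lemma ext_presentation_map:
  assumes M: "module R M" and M': "module S M'"
    and h: "h \<in> carrier M \<rightarrow> carrier M'"
    and add: "\<And>x y. x \<in> carrier M \<Longrightarrow> y \<in> carrier M \<Longrightarrow> h (x \<oplus>\<^bsub>M\<^esub> y) = h x \<oplus>\<^bsub>M'\<^esub> h y"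
    and smult: "\<And>a x. a \<in> carrier R \<Longrightarrow> x \<in> carrier M \<Longrightarrow> h (a \<odot>\<^bsub>M\<^esub> x) = \<phi> a \<odot>\<^bsub>M'\<^esub> h x"
  shows "presentation_map R S \<phi> (tuples n (carrier M)) (ext_rels R n M)
    (tuples n (carrier M')) (ext_rels S n M') (map h)"
proof -
  interpret M: module R M by fact
  interpret M': module S M' by fact
  let ?G = "tuples n (carrier M)" and ?G' = "tuples n (carrier M')"
  interpret L: module R "free_mod R ?G" by (rule R.free_mod_module)
  interpret P: presentation R ?G "ext_rels R n M" by (rule M.ext_presentation)
  interpret P': presentation S ?G' "ext_rels S n M'" by (rule M'.ext_presentation)
  note p = pushforward_single[where G = ?G]
  have hG: "map h \<in> ?G \<rightarrow> ?G'" using h by (auto intro: tuples_map)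
  show ?thesis
  proof unfold_locales
    fix k assume "k \<in> ext_rels R n M"
    then consider (1) xs i x y where "xs \<in> ?G" "i < n" "x \<in> carrier M" "y \<in> carrier M"
      "k = single R (xs[i := x \<oplus>\<^bsub>M\<^esub> y]) \<one> \<ominus>\<^bsub>free_mod R ?G\<^esub>
        (single R (xs[i := x]) \<one> \<oplus>\<^bsub>free_mod R ?G\<^esub> single R (xs[i := y]) \<one>)"
      | (2) xs i c x where "xs \<in> ?G" "i < n" "c \<in> carrier R" "x \<in> carrier M"
      "k = single R (xs[i := c \<odot>\<^bsub>M\<^esub> x]) \<one> \<ominus>\<^bsub>free_mod R ?G\<^esub> (c \<odot>\<^bsub>free_mod R ?G\<^esub> single R (xs[i := x]) \<one>)"
      | (3) xs i j where "xs \<in> ?G" "i < j" "j < n" "xs ! i = xs ! j" "k = single R xs \<one>"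
      unfolding ext_rels_def Let_def by blast
    then have "pushforward R S \<phi> (map h) k \<in> ext_rels S n M'"
    proof cases
      case 1
      note g = tuples_update[OF 1(1)]
      have "pushforward R S \<phi> (map h) k = pushforward R S \<phi> (map h) (single R (xs[i := x \<oplus>\<^bsub>M\<^esub> y]) \<one>) \<ominus>\<^bsub>free_mod S ?G'\<^esub>
          pushforward R S \<phi> (map h) (single R (xs[i := x]) \<one> \<oplus>\<^bsub>free_mod R ?G\<^esub> single R (xs[i := y]) \<one>)"
        unfolding 1(5) using 1 g by (intro pushforward_diff[OF _ _ hG] L.a_closed) auto
      also have "pushforward R S \<phi> (map h) (single R (xs[i := x]) \<one> \<oplus>\<^bsub>free_mod R ?G\<^esub> single R (xs[i := y]) \<one>) =
          single S ((map h xs)[i := h x]) \<one>\<^bsub>S\<^esub> \<oplus>\<^bsub>free_mod S ?G'\<^esub> single S ((map h xs)[i := h y]) \<one>\<^bsub>S\<^esub>"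
        using 1 g by (simp add: pushforward_add[where G = ?G] p map_update)
      finally have "pushforward R S \<phi> (map h) k = single S ((map h xs)[i := h x \<oplus>\<^bsub>M'\<^esub> h y]) \<one>\<^bsub>S\<^esub> \<ominus>\<^bsub>free_mod S ?G'\<^esub>
          (single S ((map h xs)[i := h x]) \<one>\<^bsub>S\<^esub> \<oplus>\<^bsub>free_mod S ?G'\<^esub> single S ((map h xs)[i := h y]) \<one>\<^bsub>S\<^esub>)"
        using 1 g by (simp add: p add map_update)
      moreover have "map h xs \<in> ?G'" "h x \<in> carrier M'" "h y \<in> carrier M'" using 1 h hG by auto
      ultimately show ?thesis unfolding ext_rels_def Let_def using 1(2) by blast
    next
      case 2
      note g = tuples_update[OF 2(1)]
      have "pushforward R S \<phi> (map h) k = pushforward R S \<phi> (map h) (single R (xs[i := c \<odot>\<^bsub>M\<^esub> x]) \<one>) \<ominus>\<^bsub>free_mod S ?G'\<^esub>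
          pushforward R S \<phi> (map h) (c \<odot>\<^bsub>free_mod R ?G\<^esub> single R (xs[i := x]) \<one>)"
        unfolding 2(5) using 2 g by (intro pushforward_diff[OF _ _ hG] L.smult_closed) auto
      also have "pushforward R S \<phi> (map h) (c \<odot>\<^bsub>free_mod R ?G\<^esub> single R (xs[i := x]) \<one>) =
          \<phi> c \<odot>\<^bsub>free_mod S ?G'\<^esub> single S ((map h xs)[i := h x]) \<one>\<^bsub>S\<^esub>"
        using 2 g by (simp add: pushforward_smult[where G = ?G] p map_update)
      finally have "pushforward R S \<phi> (map h) k = single S ((map h xs)[i := \<phi> c \<odot>\<^bsub>M'\<^esub> h x]) \<one>\<^bsub>S\<^esub> \<ominus>\<^bsub>free_mod S ?G'\<^esub>
          (\<phi> c \<odot>\<^bsub>free_mod S ?G'\<^esub> single S ((map h xs)[i := h x]) \<one>\<^bsub>S\<^esub>)"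
        using 2 g by (simp add: p smult map_update)
      moreover have "map h xs \<in> ?G'" "h x \<in> carrier M'" "\<phi> c \<in> carrier S" using 2 h hG by auto
      ultimately show ?thesis unfolding ext_rels_def Let_def using 2(2) by blast
    next
      case 3
      have "pushforward R S \<phi> (map h) k = single S (map h xs) \<one>\<^bsub>S\<^esub>" using 3 by (simp add: p)
      moreover have "map h xs \<in> ?G'" using 3 hG by blast
      moreover have "map h xs ! i = map h xs ! j" using 3 by (simp add: tuples_def)
      ultimately show ?thesis unfolding ext_rels_def Let_def using 3(2,3) by blast
    qed
    then show "pushforward R S \<phi> (map h) k \<in> lin_span S (free_mod S ?G') (ext_rels S n M')"
      by (rule subsetD[OF lin_span_superset])
  qed (rule hG)
qed

end

section \<open>Polynomial rings and the ramified extension\<close>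

lemma coeff_homI: "cring R \<Longrightarrow> cring S \<Longrightarrow> h \<in> ring_hom R S \<Longrightarrow> coeff_hom R S h"
  by (intro coeff_hom.intro ring_hom_cringI)

lemma coeff_hom_id: "cring R \<Longrightarrow> coeff_hom R R (\<lambda>x. x)"
  by (intro coeff_homI) (auto simp: ring_hom_def)

lemma evc_hom:
  assumes "functional R S \<phi> G K h" "coeff_hom S T \<psi>" "functional R T \<theta> G K k"
    and \<theta>: "\<And>c. c \<in> carrier R \<Longrightarrow> \<theta> c = \<psi> (\<phi> c)" and k: "\<And>g. g \<in> G \<Longrightarrow> k g = \<psi> (h g)"
    and x: "x \<in> carrier (presented R G K)"
  shows "evc R T \<theta> k x = \<psi> (evc R S \<phi> h x)"
proof -
  interpret RS: functional R S \<phi> G K h by fact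
  interpret ST: coeff_hom S T \<psi> by fact
  interpret RT: coeff_hom R T \<theta> using assms(3) by (rule functional.axioms)
  obtain f where f: "f \<in> carrier (free_mod R G)" "x = pclass R G K f" using x by (auto simp: RS.Q_carrier)
  have c: "f g \<in> carrier R" for g using f by (simp add: RS.R.free_mod_carrier_iff)
  have s: "supp R f \<subseteq> G" using f by (simp add: RS.R.free_mod_carrier_iff)
  have hc: "h g \<in> carrier S" if "g \<in> supp R f" for g using RS.h_closed s that by blast
  have "evf R T \<theta> k f = \<psi> (evf R S \<phi> h f)"
    unfolding evf_def using c s hc \<theta> k
    by (subst ST.H.hom_finsum) (auto intro!: ST.H.S.finsum_cong' simp: subset_iff)
  then show ?thesis using f by (simp add: RS.evc_cl functional.evc_cl[OF assms(3)])
qed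

lemma carrier_UP: "carrier (UP R) = up R"
  by (simp add: UP_def)

lemma coeff_UP: "q \<in> carrier (UP R) \<Longrightarrow> coeff (UP R) q i = q i"
  by (simp add: UP_def)

definition const :: "('a, 'x) ring_scheme \<Rightarrow> 'a \<Rightarrow> nat \<Rightarrow> 'a" where
  "const R a = monom (UP R) a 0"

lemma (in cring) UP_cring_self: "UP_cring R"
  by (intro UP_cring.intro is_cring)

lemma (in cring) cring_UP: "cring (UP R)"
  by (rule UP_cring.UP_cring[OF UP_cring_self])

lemma (in cring) const_hom: "coeff_hom R (UP R) (const R)"
  using UP_ring.const_ring_hom[OF UP_ring.intro, OF ring_axioms]
  by (intro coeff_homI is_cring cring_UP) (simp add: const_def[abs_def])

lemma (in cring) UP_smult_eq:
  assumes "a \<in> carrier R" "q \<in> carrier (UP R)"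
  shows "a \<odot>\<^bsub>UP R\<^esub> q = const R a \<otimes>\<^bsub>UP R\<^esub> q"
proof -
  interpret U: UP_cring R "UP R" by (rule UP_cring_self)
  show ?thesis using assms by (simp add: const_def U.monom_mult_is_smult)
qed

lemma (in coeff_hom) UP_map_hom:
  "coeff_hom (UP R) (UP S) (\<lambda>q i. \<phi> (q i))"
proof -
  interpret U: UP_cring R "UP R" by (rule R.UP_cring_self)
  interpret V: UP_cring S "UP S" by (rule H.S.UP_cring_self)
  have cl: "(\<lambda>i. \<phi> (q i)) \<in> carrier (UP S)" if q: "q \<in> carrier (UP R)" for q
  proof -
    have "q \<in> up R" using q by (simp only: carrier_UP)
    then obtain n where "bound \<zero> n q" "\<And>i. q i \<in> carrier R" by (auto simp: up_def)
    then have "bound \<zero>\<^bsub>S\<^esub> n (\<lambda>i. \<phi> (q i))" "\<And>i. \<phi> (q i) \<in> carrier S" by (auto simp: bound_def)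
    then have "(\<lambda>i. \<phi> (q i)) \<in> up S" by (auto simp: up_def)
    then show ?thesis by (simp only: carrier_UP)
  qed
  note co = coeff_UP[of _ R] and co' = coeff_UP[of _ S]
  show ?thesis
  proof (intro coeff_homI R.cring_UP H.S.cring_UP ring_hom_memI)
    fix q r assume qr: "q \<in> carrier (UP R)" "r \<in> carrier (UP R)"
    have rc: "q i \<in> carrier R" "r i \<in> carrier R" for i
      using qr U.coeff_closed co by metis+
    show "(\<lambda>i. \<phi> (q i)) \<in> carrier (UP S)" by (rule cl[OF qr(1)])
    show "(\<lambda>i. \<phi> ((q \<otimes>\<^bsub>UP R\<^esub> r) i)) = (\<lambda>i. \<phi> (q i)) \<otimes>\<^bsub>UP S\<^esub> (\<lambda>i. \<phi> (r i))"
    proof (rule V.up_eqI)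
      fix i
      have "coeff (UP S) (\<lambda>i. \<phi> ((q \<otimes>\<^bsub>UP R\<^esub> r) i)) i = \<phi> (coeff (UP R) (q \<otimes>\<^bsub>UP R\<^esub> r) i)"
        using qr by (simp add: co co' cl)
      also have "coeff (UP R) (q \<otimes>\<^bsub>UP R\<^esub> r) i = (\<Oplus>j\<in>{..i}. q j \<otimes> r (i - j))"
        using U.coeff_mult[OF qr, of i] qr by (simp add: co)
      also have "\<phi> \<dots> = (\<Oplus>\<^bsub>S\<^esub>j\<in>{..i}. \<phi> (q j) \<otimes>\<^bsub>S\<^esub> \<phi> (r (i - j)))"
        using rc by (subst H.hom_finsum) (auto simp: Pi_def intro!: H.S.finsum_cong')
      also have "\<dots> = coeff (UP S) ((\<lambda>i. \<phi> (q i)) \<otimes>\<^bsub>UP S\<^esub> (\<lambda>i. \<phi> (r i))) i"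
        using V.coeff_mult[OF cl[OF qr(1)] cl[OF qr(2)], of i] qr by (simp add: cl co')
      finally show "coeff (UP S) (\<lambda>i. \<phi> ((q \<otimes>\<^bsub>UP R\<^esub> r) i)) i = \<dots>" .
    qed (use qr cl in auto)
    show "(\<lambda>i. \<phi> ((q \<oplus>\<^bsub>UP R\<^esub> r) i)) = (\<lambda>i. \<phi> (q i)) \<oplus>\<^bsub>UP S\<^esub> (\<lambda>i. \<phi> (r i))"
    proof (rule V.up_eqI)
      fix i
      have "coeff (UP S) (\<lambda>i. \<phi> ((q \<oplus>\<^bsub>UP R\<^esub> r) i)) i = \<phi> (coeff (UP R) (q \<oplus>\<^bsub>UP R\<^esub> r) i)"
        using qr by (simp add: co co' cl)
      also have "coeff (UP R) (q \<oplus>\<^bsub>UP R\<^esub> r) i = q i \<oplus> r i"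
        using U.coeff_add[OF qr, of i] qr by (simp add: co)
      also have "\<phi> \<dots> = \<phi> (q i) \<oplus>\<^bsub>S\<^esub> \<phi> (r i)" using rc by simp
      also have "\<dots> = coeff (UP S) ((\<lambda>i. \<phi> (q i)) \<oplus>\<^bsub>UP S\<^esub> (\<lambda>i. \<phi> (r i))) i"
        using V.coeff_add[OF cl[OF qr(1)] cl[OF qr(2)], of i] qr by (simp add: cl co')
      finally show "coeff (UP S) (\<lambda>i. \<phi> ((q \<oplus>\<^bsub>UP R\<^esub> r) i)) i = \<dots>" .
    qed (use qr cl in auto)
  next
    show "(\<lambda>i. \<phi> (\<one>\<^bsub>UP R\<^esub> i)) = \<one>\<^bsub>UP S\<^esub>"
    proof (rule V.up_eqI)
      fix i
      have "coeff (UP S) (\<lambda>i. \<phi> (\<one>\<^bsub>UP R\<^esub> i)) i = \<phi> (\<one>\<^bsub>UP R\<^esub> i)"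
        by (rule co'[OF cl[OF U.UP_one_closed]])
      also have "\<one>\<^bsub>UP R\<^esub> i = (if i = 0 then \<one> else \<zero>)"
        using U.coeff_one[of i] unfolding co[OF U.UP_one_closed] .
      finally show "coeff (UP S) (\<lambda>i. \<phi> (\<one>\<^bsub>UP R\<^esub> i)) i = coeff (UP S) \<one>\<^bsub>UP S\<^esub> i" by simp
    qed (rule cl[OF U.UP_one_closed], rule V.UP_one_closed)
  qed
qed

lemma (in coeff_hom) UP_map_monom:
  "a \<in> carrier R \<Longrightarrow> (\<lambda>i. \<phi> (monom (UP R) a k i)) = monom (UP S) (\<phi> a) k"
  by (auto simp: UP_def)

lemma (in coeff_hom) UP_map_inj:
  assumes "inj_on \<phi> (carrier R)" "q \<in> carrier (UP R)" "(\<lambda>i. \<phi> (q i)) = \<zero>\<^bsub>UP S\<^esub>"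
  shows "q = \<zero>\<^bsub>UP R\<^esub>"
proof -
  have q: "q i \<in> carrier R" for i using assms(2) by (auto simp: UP_def)
  have "\<phi> (q i) = \<phi> \<zero>" for i using fun_cong[OF assms(3), of i] by (simp add: UP_def)
  then have "q i = \<zero>" for i using assms(1) q[of i] by (meson R.zero_closed inj_onD)
  then show ?thesis by (auto simp: UP_def)
qed

locale ramified =
  fixes K :: "'f ramext"
  assumes ram: "ramified_quadratic K"
begin

abbreviation "F \<equiv> fld K"
abbreviation "\<O> \<equiv> int_ring K"
abbreviation "\<O>\<^sub>0 \<equiv> int_ring0 K"
abbreviation "p \<equiv> unif K"

sublocale F: field F using ram by (simp add: ramified_quadratic_def)

lemma base_subfield: "subfield (base K) F" using ram by (simp add: ramified_quadratic_def)

lemma base_subring: "subring (base K) F" using base_subfield by (rule subfieldE)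

lemma p_closed [simp, intro]: "p \<in> carrier F" and p_nz: "p \<noteq> \<zero>\<^bsub>F\<^esub>" and val_p: "val K p = 1"
  and p0_base: "unif0 K \<in> base K" and p_p: "p \<otimes>\<^bsub>F\<^esub> p = unif0 K"
  using ram by (auto simp: ramified_quadratic_def)

lemma base_closed: "a \<in> base K \<Longrightarrow> a \<in> carrier F"
  using subringE(1)[OF base_subring] by blast

lemma val_mult:
  "x \<in> carrier F \<Longrightarrow> y \<in> carrier F \<Longrightarrow> x \<noteq> \<zero>\<^bsub>F\<^esub> \<Longrightarrow> y \<noteq> \<zero>\<^bsub>F\<^esub> \<Longrightarrow> val K (x \<otimes>\<^bsub>F\<^esub> y) = val K x + val K y"
  using ram by (simp add: ramified_quadratic_def discrete_valuation_def)

lemma val_add: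
  "x \<in> carrier F \<Longrightarrow> y \<in> carrier F \<Longrightarrow> x \<noteq> \<zero>\<^bsub>F\<^esub> \<Longrightarrow> y \<noteq> \<zero>\<^bsub>F\<^esub> \<Longrightarrow> x \<oplus>\<^bsub>F\<^esub> y \<noteq> \<zero>\<^bsub>F\<^esub>
    \<Longrightarrow> min (val K x) (val K y) \<le> val K (x \<oplus>\<^bsub>F\<^esub> y)"
  using ram by (simp add: ramified_quadratic_def discrete_valuation_def)

lemma val_base: "a \<in> base K \<Longrightarrow> a \<noteq> \<zero>\<^bsub>F\<^esub> \<Longrightarrow> even (val K a)"
  using ram by (auto simp: ramified_quadratic_def)

lemma val_one: "val K \<one>\<^bsub>F\<^esub> = 0"
  using val_mult[of "\<one>\<^bsub>F\<^esub>" "\<one>\<^bsub>F\<^esub>"] by simp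

lemma val_minus_one: "val K (\<ominus>\<^bsub>F\<^esub> \<one>\<^bsub>F\<^esub>) = 0"
proof -
  have "\<ominus>\<^bsub>F\<^esub> \<one>\<^bsub>F\<^esub> \<noteq> \<zero>\<^bsub>F\<^esub>" by simp
  then show ?thesis using val_mult[of "\<ominus>\<^bsub>F\<^esub> \<one>\<^bsub>F\<^esub>" "\<ominus>\<^bsub>F\<^esub> \<one>\<^bsub>F\<^esub>"] val_one by (simp add: F.l_minus)
qed

lemma val_minus: "x \<in> carrier F \<Longrightarrow> x \<noteq> \<zero>\<^bsub>F\<^esub> \<Longrightarrow> val K (\<ominus>\<^bsub>F\<^esub> x) = val K x"
  using val_mult[of "\<ominus>\<^bsub>F\<^esub> \<one>\<^bsub>F\<^esub>" x] val_minus_one by (simp add: F.l_minus)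

lemma val_add_less:
  assumes x: "x \<in> carrier F" "x \<noteq> \<zero>\<^bsub>F\<^esub>" and y: "y \<in> carrier F" "y \<noteq> \<zero>\<^bsub>F\<^esub>" and l: "val K x < val K y"
  shows "x \<oplus>\<^bsub>F\<^esub> y \<noteq> \<zero>\<^bsub>F\<^esub> \<and> val K (x \<oplus>\<^bsub>F\<^esub> y) = val K x"
proof
  show nz: "x \<oplus>\<^bsub>F\<^esub> y \<noteq> \<zero>\<^bsub>F\<^esub>"
  proof
    assume "x \<oplus>\<^bsub>F\<^esub> y = \<zero>\<^bsub>F\<^esub>"
    then have "x = \<ominus>\<^bsub>F\<^esub> y" using x y by (simp add: F.sum_zero_eq_neg)
    then show False using val_minus[OF y] l by simp
  qed
  have e: "x = (x \<oplus>\<^bsub>F\<^esub> y) \<oplus>\<^bsub>F\<^esub> (\<ominus>\<^bsub>F\<^esub> y)" using x y by (simp add: F.a_assoc F.r_neg)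
  have "min (val K (x \<oplus>\<^bsub>F\<^esub> y)) (val K (\<ominus>\<^bsub>F\<^esub> y)) \<le> val K x"
    using val_add[of "x \<oplus>\<^bsub>F\<^esub> y" "\<ominus>\<^bsub>F\<^esub> y"] x y nz e by simp
  moreover have "min (val K x) (val K y) \<le> val K (x \<oplus>\<^bsub>F\<^esub> y)" using val_add x y nz by simp
  ultimately show "val K (x \<oplus>\<^bsub>F\<^esub> y) = val K x" using l val_minus[OF y] by linarith
qed

lemma int_iff: "x \<in> carrier \<O> \<longleftrightarrow> x \<in> carrier F \<and> (x = \<zero>\<^bsub>F\<^esub> \<or> 0 \<le> val K x)"
  by (simp add: int_ring_def)

lemma int0_iff: "x \<in> carrier \<O>\<^sub>0 \<longleftrightarrow> x \<in> carrier \<O> \<and> x \<in> base K"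
  by (simp add: int_ring0_def)

lemma int_subring: "subring (carrier \<O>) F"
proof (rule F.subringI)
  fix x y assume xy: "x \<in> carrier \<O>" "y \<in> carrier \<O>"
  then have c: "x \<in> carrier F" "y \<in> carrier F" by (auto simp: int_iff)
  show "x \<otimes>\<^bsub>F\<^esub> y \<in> carrier \<O>"
    using xy c by (cases "x = \<zero>\<^bsub>F\<^esub> \<or> y = \<zero>\<^bsub>F\<^esub>") (auto simp: int_iff val_mult)
  show "x \<oplus>\<^bsub>F\<^esub> y \<in> carrier \<O>"
  proof (cases "x = \<zero>\<^bsub>F\<^esub> \<or> y = \<zero>\<^bsub>F\<^esub>")
    case False
    then show ?thesis using xy c val_add[of x y]
      by (cases "x \<oplus>\<^bsub>F\<^esub> y = \<zero>\<^bsub>F\<^esub>") (auto simp: int_iff)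
  qed (use xy c in auto)
next
  fix x assume x: "x \<in> carrier \<O>"
  then show "\<ominus>\<^bsub>F\<^esub> x \<in> carrier \<O>" by (cases "x = \<zero>\<^bsub>F\<^esub>") (auto simp: int_iff val_minus)
qed (auto simp: int_iff val_one)

lemma int0_subring: "subring (carrier \<O>\<^sub>0) F"
  using F.subring_inter[OF int_subring base_subring] by (simp add: int_ring0_def)

lemma O_eq: "\<O> = F\<lparr>carrier := carrier \<O>\<rparr>" and O0_eq: "\<O>\<^sub>0 = F\<lparr>carrier := carrier \<O>\<^sub>0\<rparr>"
  by (simp_all add: int_ring_def int_ring0_def)

lemma O_simps [simp]:
  "a \<oplus>\<^bsub>\<O>\<^esub> b = a \<oplus>\<^bsub>F\<^esub> b" "a \<otimes>\<^bsub>\<O>\<^esub> b = a \<otimes>\<^bsub>F\<^esub> b" "\<one>\<^bsub>\<O>\<^esub> = \<one>\<^bsub>F\<^esub>" "\<zero>\<^bsub>\<O>\<^esub> = \<zero>\<^bsub>F\<^esub>"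
  "a \<oplus>\<^bsub>\<O>\<^sub>0\<^esub> b = a \<oplus>\<^bsub>F\<^esub> b" "a \<otimes>\<^bsub>\<O>\<^sub>0\<^esub> b = a \<otimes>\<^bsub>F\<^esub> b" "\<one>\<^bsub>\<O>\<^sub>0\<^esub> = \<one>\<^bsub>F\<^esub>" "\<zero>\<^bsub>\<O>\<^sub>0\<^esub> = \<zero>\<^bsub>F\<^esub>"
  by (simp_all add: int_ring_def int_ring0_def)

lemma base_ring_simps [simp]:
  "carrier (base_ring K) = base K"
  "a \<oplus>\<^bsub>base_ring K\<^esub> b = a \<oplus>\<^bsub>F\<^esub> b" "a \<otimes>\<^bsub>base_ring K\<^esub> b = a \<otimes>\<^bsub>F\<^esub> b"
  "\<one>\<^bsub>base_ring K\<^esub> = \<one>\<^bsub>F\<^esub>" "\<zero>\<^bsub>base_ring K\<^esub> = \<zero>\<^bsub>F\<^esub>"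
  by (simp_all add: base_ring_def)

lemma O_cring: "cring \<O>"
  using F.subcring_iff[OF subringE(1)[OF int_subring]] F.subcringI'[OF int_subring] O_eq by simp

lemma O0_cring: "cring \<O>\<^sub>0"
  using F.subcring_iff[OF subringE(1)[OF int0_subring]] F.subcringI'[OF int0_subring] O0_eq by simp

lemma O_F_hom: "coeff_hom \<O> F (\<lambda>x. x)"
  by (intro coeff_homI O_cring F.is_cring) (auto simp: ring_hom_def int_iff)

lemma p_int: "p \<in> carrier \<O>" by (simp add: int_iff val_p)

lemma p_not_base: "p \<notin> base K"
  using val_base[of p] p_nz val_p by auto

lemma base_decomp:
  assumes z: "z \<in> carrier F"
  shows "\<exists>a\<in>base K. \<exists>b\<in>base K. z = a \<oplus>\<^bsub>F\<^esub> p \<otimes>\<^bsub>F\<^esub> b"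
proof -
  have dim: "F.dimension 2 (base K) (carrier F)" using ram by (simp add: ramified_quadratic_def)
  have "\<one>\<^bsub>F\<^esub> \<notin> F.Span (base K) []" by simp
  then have i1: "F.independent (base K) [\<one>\<^bsub>F\<^esub>]" by (intro F.li_Cons) auto
  have "F.Span (base K) [\<one>\<^bsub>F\<^esub>] = {F.combine Ks [\<one>\<^bsub>F\<^esub>] | Ks. length Ks = length [\<one>\<^bsub>F\<^esub>] \<and> set Ks \<subseteq> base K}"
    by (rule F.Span_eq_combine_set_length_version[OF base_subfield]) auto
  then have "p \<notin> F.Span (base K) [\<one>\<^bsub>F\<^esub>]"
    using p_not_base base_closed by (auto simp: length_Suc_conv)
  then have ind: "F.independent (base K) [p, \<one>\<^bsub>F\<^esub>]" using i1 by (intro F.li_Cons) auto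
  have "F.Span (base K) [p, \<one>\<^bsub>F\<^esub>] = carrier F"
    using F.independent_length_eq_dimension[OF base_subfield dim ind] by simp
  moreover have "F.Span (base K) [p, \<one>\<^bsub>F\<^esub>] =
      {F.combine Ks [p, \<one>\<^bsub>F\<^esub>] | Ks. length Ks = length [p, \<one>\<^bsub>F\<^esub>] \<and> set Ks \<subseteq> base K}"
    by (rule F.Span_eq_combine_set_length_version[OF base_subfield]) auto
  ultimately have "z \<in> {F.combine Ks [p, \<one>\<^bsub>F\<^esub>] | Ks. length Ks = length [p, \<one>\<^bsub>F\<^esub>] \<and> set Ks \<subseteq> base K}"
    using z by simp
  then obtain Ks where Ks: "length Ks = Suc (Suc 0)" "set Ks \<subseteq> base K" "z = F.combine Ks [p, \<one>\<^bsub>F\<^esub>]"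
    by auto
  then obtain b a where ab: "Ks = [b, a]" by (auto simp: length_Suc_conv)
  then have "z = a \<oplus>\<^bsub>F\<^esub> p \<otimes>\<^bsub>F\<^esub> b" using Ks base_closed by (auto simp: F.m_comm F.a_comm)
  then show ?thesis using Ks ab by auto
qed

lemma base_int:
  assumes a: "a \<in> base K" and b: "b \<in> base K" and z: "a \<oplus>\<^bsub>F\<^esub> p \<otimes>\<^bsub>F\<^esub> b \<in> carrier \<O>"
  shows "a \<in> carrier \<O>\<^sub>0 \<and> b \<in> carrier \<O>\<^sub>0"
proof -
  have c: "a \<in> carrier F" "b \<in> carrier F" "p \<otimes>\<^bsub>F\<^esub> b \<in> carrier F" using a b base_closed by auto
  have bz: "p \<otimes>\<^bsub>F\<^esub> b \<noteq> \<zero>\<^bsub>F\<^esub>" and vb: "val K (p \<otimes>\<^bsub>F\<^esub> b) = 1 + val K b" if "b \<noteq> \<zero>\<^bsub>F\<^esub>"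
    using that c p_nz val_mult[of p b] by (auto simp: F.integral_iff val_p)
  consider "a = \<zero>\<^bsub>F\<^esub>" | "b = \<zero>\<^bsub>F\<^esub>" | "a \<noteq> \<zero>\<^bsub>F\<^esub>" "b \<noteq> \<zero>\<^bsub>F\<^esub>" by blast
  then show ?thesis
  proof cases
    case 1
    then show ?thesis using z c bz vb a b val_base[OF b] by (cases "b = \<zero>\<^bsub>F\<^esub>") (auto simp: int0_iff int_iff elim: evenE)
  next
    case 2
    then show ?thesis using z c a b by (auto simp: int0_iff int_iff)
  next
    case 3
    have ne: "val K a \<noteq> val K (p \<otimes>\<^bsub>F\<^esub> b)" using vb 3 val_base[OF a] val_base[OF b] by auto
    have "a \<oplus>\<^bsub>F\<^esub> p \<otimes>\<^bsub>F\<^esub> b \<noteq> \<zero>\<^bsub>F\<^esub> \<and> val K (a \<oplus>\<^bsub>F\<^esub> p \<otimes>\<^bsub>F\<^esub> b) = min (val K a) (val K (p \<otimes>\<^bsub>F\<^esub> b))"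
    proof (cases "val K a < val K (p \<otimes>\<^bsub>F\<^esub> b)")
      case True
      then show ?thesis using val_add_less[OF c(1) 3(1) c(3) bz[OF 3(2)]] by simp
    next
      case False
      then show ?thesis using val_add_less[OF c(3) bz[OF 3(2)] c(1) 3(1)] ne c by (simp add: F.a_comm)
    qed
    then have "0 \<le> val K a" "0 \<le> 1 + val K b" using z vb 3 by (auto simp: int_iff)
    moreover have "val K b \<noteq> -1" using val_base[OF b 3(2)] by auto
    ultimately show ?thesis using a b c by (auto simp: int0_iff int_iff)
  qed
qed

lemma base_unique0:
  assumes a: "a \<in> base K" and b: "b \<in> base K" and z: "a \<oplus>\<^bsub>F\<^esub> p \<otimes>\<^bsub>F\<^esub> b = \<zero>\<^bsub>F\<^esub>"
  shows "a = \<zero>\<^bsub>F\<^esub> \<and> b = \<zero>\<^bsub>F\<^esub>"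
proof (cases "b = \<zero>\<^bsub>F\<^esub>")
  case True
  then show ?thesis using z a base_closed by simp
next
  case False
  have c: "a \<in> carrier F" "b \<in> carrier F" using a b base_closed by auto
  then have e: "a = \<ominus>\<^bsub>F\<^esub> (p \<otimes>\<^bsub>F\<^esub> b)" using z F.sum_zero_eq_neg[of a "p \<otimes>\<^bsub>F\<^esub> b"] by simp
  have nz: "p \<otimes>\<^bsub>F\<^esub> b \<noteq> \<zero>\<^bsub>F\<^esub>" using False c p_nz by (simp add: F.integral_iff)
  then have "val K a = 1 + val K b" using e c val_minus[of "p \<otimes>\<^bsub>F\<^esub> b"] val_mult[of p b] False p_nz val_p by simp
  moreover have "a \<noteq> \<zero>\<^bsub>F\<^esub>" using e nz c by (metis F.add.inv_eq_1_iff F.m_closed p_closed)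
  ultimately show ?thesis using val_base[OF a] val_base[OF b False] by auto
qed

lemma base_unique:
  assumes "a \<in> base K" "b \<in> base K" "c \<in> base K" "d \<in> base K"
    and e: "a \<oplus>\<^bsub>F\<^esub> p \<otimes>\<^bsub>F\<^esub> b = c \<oplus>\<^bsub>F\<^esub> p \<otimes>\<^bsub>F\<^esub> d"
  shows "a = c \<and> b = d"
proof -
  have cl: "a \<in> carrier F" "b \<in> carrier F" "c \<in> carrier F" "d \<in> carrier F" using assms base_closed by auto
  have "a \<ominus>\<^bsub>F\<^esub> c \<in> base K" "b \<ominus>\<^bsub>F\<^esub> d \<in> base K"
    using assms subringE[OF base_subring] by (auto simp: F.minus_eq)
  moreover have "(a \<ominus>\<^bsub>F\<^esub> c) \<oplus>\<^bsub>F\<^esub> p \<otimes>\<^bsub>F\<^esub> (b \<ominus>\<^bsub>F\<^esub> d) = (a \<oplus>\<^bsub>F\<^esub> p \<otimes>\<^bsub>F\<^esub> b) \<ominus>\<^bsub>F\<^esub> (c \<oplus>\<^bsub>F\<^esub> p \<otimes>\<^bsub>F\<^esub> d)"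
    using cl by (simp add: F.minus_eq F.r_distr F.r_minus F.minus_add F.a_ac)
  moreover have "\<dots> = \<zero>\<^bsub>F\<^esub>" using e cl by simp
  ultimately have "a \<ominus>\<^bsub>F\<^esub> c = \<zero>\<^bsub>F\<^esub> \<and> b \<ominus>\<^bsub>F\<^esub> d = \<zero>\<^bsub>F\<^esub>" using base_unique0 by simp
  then show ?thesis using cl by simp
qed

definition parts :: "'f \<Rightarrow> 'f \<times> 'f" where
  "parts z = (SOME q. fst q \<in> base K \<and> snd q \<in> base K \<and> z = fst q \<oplus>\<^bsub>F\<^esub> p \<otimes>\<^bsub>F\<^esub> snd q)"

definition "re z = fst (parts z)"
definition "im z = snd (parts z)"

lemma re_im:
  assumes "z \<in> carrier F"
  shows "re z \<in> base K" "im z \<in> base K" "z = re z \<oplus>\<^bsub>F\<^esub> p \<otimes>\<^bsub>F\<^esub> im z"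
proof -
  have "\<exists>q. fst q \<in> base K \<and> snd q \<in> base K \<and> z = fst q \<oplus>\<^bsub>F\<^esub> p \<otimes>\<^bsub>F\<^esub> snd q"
    using base_decomp[OF assms] by (metis fst_conv snd_conv)
  from someI_ex[OF this] show "re z \<in> base K" "im z \<in> base K" "z = re z \<oplus>\<^bsub>F\<^esub> p \<otimes>\<^bsub>F\<^esub> im z"
    by (auto simp: re_def im_def parts_def)
qed

lemma re_im_closed [simp]: "z \<in> carrier F \<Longrightarrow> re z \<in> carrier F" "z \<in> carrier F \<Longrightarrow> im z \<in> carrier F"
  using re_im base_closed by auto

lemma re_im_eqI:
  assumes "a \<in> base K" "b \<in> base K" "z = a \<oplus>\<^bsub>F\<^esub> p \<otimes>\<^bsub>F\<^esub> b"
  shows "re z = a" "im z = b"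
proof -
  have "z \<in> carrier F" using assms base_closed by simp
  from base_unique[OF re_im(1,2)[OF this] assms(1,2)] re_im(3)[OF this] assms(3)
  show "re z = a" "im z = b" by auto
qed

lemma re_im_int: "z \<in> carrier \<O> \<Longrightarrow> re z \<in> carrier \<O>\<^sub>0" "z \<in> carrier \<O> \<Longrightarrow> im z \<in> carrier \<O>\<^sub>0"
  using base_int[of "re z" "im z"] re_im[of z] by (auto simp: int_iff)

lemma re_im_add:
  assumes "z \<in> carrier F" "w \<in> carrier F"
  shows "re (z \<oplus>\<^bsub>F\<^esub> w) = re z \<oplus>\<^bsub>F\<^esub> re w" "im (z \<oplus>\<^bsub>F\<^esub> w) = im z \<oplus>\<^bsub>F\<^esub> im w"
proof -
  have "z \<oplus>\<^bsub>F\<^esub> w = (re z \<oplus>\<^bsub>F\<^esub> p \<otimes>\<^bsub>F\<^esub> im z) \<oplus>\<^bsub>F\<^esub> (re w \<oplus>\<^bsub>F\<^esub> p \<otimes>\<^bsub>F\<^esub> im w)"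
    using re_im(3)[OF assms(1)] re_im(3)[OF assms(2)] by simp
  also have "\<dots> = (re z \<oplus>\<^bsub>F\<^esub> re w) \<oplus>\<^bsub>F\<^esub> p \<otimes>\<^bsub>F\<^esub> (im z \<oplus>\<^bsub>F\<^esub> im w)"
    using assms by (simp add: F.r_distr F.a_ac)
  finally have "z \<oplus>\<^bsub>F\<^esub> w = (re z \<oplus>\<^bsub>F\<^esub> re w) \<oplus>\<^bsub>F\<^esub> p \<otimes>\<^bsub>F\<^esub> (im z \<oplus>\<^bsub>F\<^esub> im w)" .
  note e = this
  have b: "re z \<oplus>\<^bsub>F\<^esub> re w \<in> base K" "im z \<oplus>\<^bsub>F\<^esub> im w \<in> base K"
    using re_im[OF assms(1)] re_im[OF assms(2)] subringE(7)[OF base_subring] by simp_all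
  show "re (z \<oplus>\<^bsub>F\<^esub> w) = re z \<oplus>\<^bsub>F\<^esub> re w" by (rule re_im_eqI(1)[OF b e])
  show "im (z \<oplus>\<^bsub>F\<^esub> w) = im z \<oplus>\<^bsub>F\<^esub> im w" by (rule re_im_eqI(2)[OF b e])
qed

lemma re_im_smult:
  assumes "a \<in> base K" "z \<in> carrier F"
  shows "re (a \<otimes>\<^bsub>F\<^esub> z) = a \<otimes>\<^bsub>F\<^esub> re z" "im (a \<otimes>\<^bsub>F\<^esub> z) = a \<otimes>\<^bsub>F\<^esub> im z"
proof -
  have "a \<otimes>\<^bsub>F\<^esub> z = a \<otimes>\<^bsub>F\<^esub> (re z \<oplus>\<^bsub>F\<^esub> p \<otimes>\<^bsub>F\<^esub> im z)"
    using re_im(3)[OF assms(2)] by simp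
  also have "\<dots> = a \<otimes>\<^bsub>F\<^esub> re z \<oplus>\<^bsub>F\<^esub> p \<otimes>\<^bsub>F\<^esub> (a \<otimes>\<^bsub>F\<^esub> im z)"
    using assms base_closed by (simp add: F.r_distr F.m_lcomm)
  finally have "a \<otimes>\<^bsub>F\<^esub> z = a \<otimes>\<^bsub>F\<^esub> re z \<oplus>\<^bsub>F\<^esub> p \<otimes>\<^bsub>F\<^esub> (a \<otimes>\<^bsub>F\<^esub> im z)" .
  note e = this
  have b: "a \<otimes>\<^bsub>F\<^esub> re z \<in> base K" "a \<otimes>\<^bsub>F\<^esub> im z \<in> base K"
    using re_im[OF assms(2)] assms(1) subringE(6)[OF base_subring] by simp_all
  show "re (a \<otimes>\<^bsub>F\<^esub> z) = a \<otimes>\<^bsub>F\<^esub> re z" by (rule re_im_eqI(1)[OF b e])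
  show "im (a \<otimes>\<^bsub>F\<^esub> z) = a \<otimes>\<^bsub>F\<^esub> im z" by (rule re_im_eqI(2)[OF b e])
qed

end

section \<open>Coordinates on the standard lattices\<close>

locale ramified_lattice = ramified K for K :: "'f ramext" +
  fixes n :: nat
begin

abbreviation "V0 \<equiv> vecs K n"

lemma vecs_iff: "x \<in> carrier V0 \<longleftrightarrow> x \<in> {1..n} \<rightarrow>\<^sub>E carrier F"
  by (simp add: vecs_def)

lemma vecs_simps [simp]:
  "x \<oplus>\<^bsub>V0\<^esub> y = (\<lambda>j\<in>{1..n}. x j \<oplus>\<^bsub>F\<^esub> y j)"
  "a \<odot>\<^bsub>V0\<^esub> x = (\<lambda>j\<in>{1..n}. a \<otimes>\<^bsub>F\<^esub> x j)"
  "\<zero>\<^bsub>V0\<^esub> = (\<lambda>j\<in>{1..n}. \<zero>\<^bsub>F\<^esub>)"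
  by (simp_all add: vecs_def)

lemma Lam_simps [simp]:
  "x \<oplus>\<^bsub>\<Lambda> K n i\<^esub> y = (\<lambda>j\<in>{1..n}. x j \<oplus>\<^bsub>F\<^esub> y j)"
  "a \<odot>\<^bsub>\<Lambda> K n i\<^esub> x = (\<lambda>j\<in>{1..n}. a \<otimes>\<^bsub>F\<^esub> x j)"
  "\<zero>\<^bsub>\<Lambda> K n i\<^esub> = (\<lambda>j\<in>{1..n}. \<zero>\<^bsub>F\<^esub>)"
  by (simp_all add: std_lattice_def Let_def vecs_def)

definition sc :: "int \<Rightarrow> nat \<Rightarrow> 'f" where
  "sc i j = p [^]\<^bsub>F\<^esub> (if int j \<le> i mod int n then - (i div int n) - 1 else - (i div int n))"

lemma p_unit: "p \<in> Units F" using p_nz by (simp add: F.field_Units)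

lemma int_pow_unit: "p [^]\<^bsub>F\<^esub> (k :: int) \<in> Units F"
  unfolding int_pow_def2 using F.Units_pow_closed[OF p_unit] F.Units_inv_Units by presburger

lemma sc_unit: "sc i j \<in> Units F" unfolding sc_def by (rule int_pow_unit)

lemma sc_closed [simp]: "sc i j \<in> carrier F" "inv\<^bsub>F\<^esub> (sc i j) \<in> carrier F"
  using sc_unit by auto

lemma sc_image: "x \<in> carrier F \<Longrightarrow> x \<in> (\<lambda>a. sc i j \<otimes>\<^bsub>F\<^esub> a) ` carrier \<O> \<longleftrightarrow> inv\<^bsub>F\<^esub> (sc i j) \<otimes>\<^bsub>F\<^esub> x \<in> carrier \<O>"
proof
  assume "x \<in> (\<lambda>a. sc i j \<otimes>\<^bsub>F\<^esub> a) ` carrier \<O>"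
  then obtain a where "a \<in> carrier \<O>" "x = sc i j \<otimes>\<^bsub>F\<^esub> a" by auto
  then show "inv\<^bsub>F\<^esub> (sc i j) \<otimes>\<^bsub>F\<^esub> x \<in> carrier \<O>"
    using sc_unit by (simp add: F.m_assoc[symmetric] int_iff)
next
  assume "x \<in> carrier F" "inv\<^bsub>F\<^esub> (sc i j) \<otimes>\<^bsub>F\<^esub> x \<in> carrier \<O>"
  moreover then have "x = sc i j \<otimes>\<^bsub>F\<^esub> (inv\<^bsub>F\<^esub> (sc i j) \<otimes>\<^bsub>F\<^esub> x)"
    using sc_unit by (simp add: F.m_assoc[symmetric])
  ultimately show "x \<in> (\<lambda>a. sc i j \<otimes>\<^bsub>F\<^esub> a) ` carrier \<O>" by blast
qed

lemma Lam_iff: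
  "x \<in> carrier (\<Lambda> K n i) \<longleftrightarrow> x \<in> carrier V0 \<and> (\<forall>j\<in>{1..n}. inv\<^bsub>F\<^esub> (sc i j) \<otimes>\<^bsub>F\<^esub> x j \<in> carrier \<O>)"
proof (cases "x \<in> carrier V0")
  case True
  then have "x j \<in> carrier F" if "j \<in> {1..n}" for j using that by (auto simp: vecs_iff)
  then show ?thesis using True sc_image[of "x _" i]
    by (simp add: std_lattice_def Let_def sc_def del: atLeastAtMost_iff)
qed (simp add: std_lattice_def Let_def)

lemma Lam_vecs: "x \<in> carrier (\<Lambda> K n i) \<Longrightarrow> x \<in> carrier V0" by (simp add: Lam_iff)

lemma vecs_closed:
  "x \<in> carrier V0 \<Longrightarrow> y \<in> carrier V0 \<Longrightarrow> (\<lambda>j\<in>{1..n}. x j \<oplus>\<^bsub>F\<^esub> y j) \<in> carrier V0"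
  "a \<in> carrier F \<Longrightarrow> x \<in> carrier V0 \<Longrightarrow> (\<lambda>j\<in>{1..n}. a \<otimes>\<^bsub>F\<^esub> x j) \<in> carrier V0"
  by (auto simp: vecs_iff)

lemma vecs_nth: "x \<in> carrier V0 \<Longrightarrow> 1 \<le> j \<Longrightarrow> j \<le> n \<Longrightarrow> x j \<in> carrier F"
  by (auto simp: vecs_iff)

lemma int_closed: "a \<in> carrier \<O> \<Longrightarrow> a \<in> carrier F" by (simp add: int_iff)

lemma Lam_closed:
  assumes "x \<in> carrier (\<Lambda> K n i)"
  shows "y \<in> carrier (\<Lambda> K n i) \<Longrightarrow> (\<lambda>j\<in>{1..n}. x j \<oplus>\<^bsub>F\<^esub> y j) \<in> carrier (\<Lambda> K n i)"
    "a \<in> carrier \<O> \<Longrightarrow> (\<lambda>j\<in>{1..n}. a \<otimes>\<^bsub>F\<^esub> x j) \<in> carrier (\<Lambda> K n i)"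
proof -
  show "(\<lambda>j\<in>{1..n}. x j \<oplus>\<^bsub>F\<^esub> y j) \<in> carrier (\<Lambda> K n i)" if y: "y \<in> carrier (\<Lambda> K n i)"
    using assms y vecs_closed(1) vecs_nth subringE(7)[OF int_subring]
    by (auto simp: Lam_iff F.r_distr)
  show "(\<lambda>j\<in>{1..n}. a \<otimes>\<^bsub>F\<^esub> x j) \<in> carrier (\<Lambda> K n i)" if a: "a \<in> carrier \<O>"
    using assms a vecs_closed(2) vecs_nth subringE(6)[OF int_subring] int_closed
    by (auto simp: Lam_iff F.m_lcomm)
qed

lemma Lam_module: "module \<O>\<^sub>0 (\<Lambda> K n i)"
proof (rule moduleI)
  have cF: "a \<in> carrier F" "a \<in> carrier \<O>" if "a \<in> carrier \<O>\<^sub>0" for a using that by (auto simp: int0_iff int_iff)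
  show "cring \<O>\<^sub>0" by (rule O0_cring)
  show "abelian_group (\<Lambda> K n i)"
  proof (rule abelian_groupI)
    fix x assume x: "x \<in> carrier (\<Lambda> K n i)"
    note xj = vecs_nth[OF Lam_vecs[OF x]]
    have x_ext: "x \<in> extensional {1..n}" using x by (auto simp: Lam_iff vecs_iff PiE_def)
    show "\<zero>\<^bsub>\<Lambda> K n i\<^esub> \<oplus>\<^bsub>\<Lambda> K n i\<^esub> x = x" using xj x_ext by (auto simp: fun_eq_iff extensional_def)
    have "(\<lambda>j\<in>{1..n}. (\<ominus>\<^bsub>F\<^esub> \<one>\<^bsub>F\<^esub>) \<otimes>\<^bsub>F\<^esub> x j) \<in> carrier (\<Lambda> K n i)"
      using x subringE[OF int_subring] by (intro Lam_closed(2)) auto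
    then show "\<exists>y\<in>carrier (\<Lambda> K n i). y \<oplus>\<^bsub>\<Lambda> K n i\<^esub> x = \<zero>\<^bsub>\<Lambda> K n i\<^esub>"
      using xj by (intro bexI[of _ "\<lambda>j\<in>{1..n}. (\<ominus>\<^bsub>F\<^esub> \<one>\<^bsub>F\<^esub>) \<otimes>\<^bsub>F\<^esub> x j"]) (auto simp: fun_eq_iff F.l_minus F.l_neg)
    fix y assume y: "y \<in> carrier (\<Lambda> K n i)"
    note yj = vecs_nth[OF Lam_vecs[OF y]]
    show "x \<oplus>\<^bsub>\<Lambda> K n i\<^esub> y \<in> carrier (\<Lambda> K n i)" using x y Lam_closed by simp
    show "x \<oplus>\<^bsub>\<Lambda> K n i\<^esub> y = y \<oplus>\<^bsub>\<Lambda> K n i\<^esub> x" using xj yj by (auto simp: fun_eq_iff F.a_comm)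
    fix z assume z: "z \<in> carrier (\<Lambda> K n i)"
    note zj = vecs_nth[OF Lam_vecs[OF z]]
    show "x \<oplus>\<^bsub>\<Lambda> K n i\<^esub> y \<oplus>\<^bsub>\<Lambda> K n i\<^esub> z = x \<oplus>\<^bsub>\<Lambda> K n i\<^esub> (y \<oplus>\<^bsub>\<Lambda> K n i\<^esub> z)"
      using xj yj zj by (auto simp: fun_eq_iff F.a_assoc)
  qed (auto simp: Lam_iff vecs_iff int_iff)
  show "\<one>\<^bsub>\<O>\<^sub>0\<^esub> \<odot>\<^bsub>\<Lambda> K n i\<^esub> x = x" if x: "x \<in> carrier (\<Lambda> K n i)" for x
  proof -
    have "x \<in> extensional {1..n}" using x by (auto simp: Lam_iff vecs_iff PiE_def)
    then show ?thesis using vecs_nth[OF Lam_vecs[OF x]] by (auto simp: fun_eq_iff extensional_def)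
  qed
  fix a x assume a: "a \<in> carrier \<O>\<^sub>0" and x: "x \<in> carrier (\<Lambda> K n i)"
  note xj = vecs_nth[OF Lam_vecs[OF x]]
  show "a \<odot>\<^bsub>\<Lambda> K n i\<^esub> x \<in> carrier (\<Lambda> K n i)" using a x cF Lam_closed by simp
  { fix b assume b: "b \<in> carrier \<O>\<^sub>0"
    show "(a \<oplus>\<^bsub>\<O>\<^sub>0\<^esub> b) \<odot>\<^bsub>\<Lambda> K n i\<^esub> x = a \<odot>\<^bsub>\<Lambda> K n i\<^esub> x \<oplus>\<^bsub>\<Lambda> K n i\<^esub> b \<odot>\<^bsub>\<Lambda> K n i\<^esub> x"
      using xj cF[OF a] cF[OF b] by (auto simp: fun_eq_iff F.l_distr)
    show "(a \<otimes>\<^bsub>\<O>\<^sub>0\<^esub> b) \<odot>\<^bsub>\<Lambda> K n i\<^esub> x = a \<odot>\<^bsub>\<Lambda> K n i\<^esub> (b \<odot>\<^bsub>\<Lambda> K n i\<^esub> x)"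
      using xj cF[OF a] cF[OF b] by (auto simp: fun_eq_iff F.m_assoc) }
  { fix y assume y: "y \<in> carrier (\<Lambda> K n i)"
    show "a \<odot>\<^bsub>\<Lambda> K n i\<^esub> (x \<oplus>\<^bsub>\<Lambda> K n i\<^esub> y) = a \<odot>\<^bsub>\<Lambda> K n i\<^esub> x \<oplus>\<^bsub>\<Lambda> K n i\<^esub> a \<odot>\<^bsub>\<Lambda> K n i\<^esub> y"
      using xj vecs_nth[OF Lam_vecs[OF y]] cF[OF a] by (auto simp: fun_eq_iff F.r_distr) }
qed

text \<open>
  \<open>crd False i (2 (j - 1))\<close> and \<open>crd False i (2 (j - 1) + 1)\<close> are the coordinates of \<open>x\<^sub>j / sc i j\<close> with respect
  to the basis \<open>1, \<pi>\<close> of \<open>F\<close> over \<open>F\<^sub>0\<close>; the flag \<open>True\<close> multiplies \<open>x\<close> by \<open>\<pi>\<close> first.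
\<close>

definition crd :: "bool \<Rightarrow> int \<Rightarrow> nat \<Rightarrow> (nat \<Rightarrow> 'f) \<Rightarrow> 'f" where
  "crd e i k x = (let j = k div 2 + 1;
      z = inv\<^bsub>F\<^esub> (sc i j) \<otimes>\<^bsub>F\<^esub> (if e then p \<otimes>\<^bsub>F\<^esub> x j else x j)
    in if even k then re z else im z)"

lemma crd_closed:
  assumes "k < 2 * n" "x \<in> carrier V0"
  shows "crd e i k x \<in> carrier F" "crd e i k x \<in> base K"
proof -
  have "x (k div 2 + 1) \<in> carrier F" using assms by (intro vecs_nth) auto
  then show "crd e i k x \<in> carrier F" "crd e i k x \<in> base K"
    using re_im by (auto simp: crd_def Let_def)
qed

lemma crd_int:
  assumes "k < 2 * n" "x \<in> carrier (\<Lambda> K n i)"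
  shows "crd e i k x \<in> carrier \<O>\<^sub>0"
proof -
  have j: "k div 2 + 1 \<in> {1..n}" using assms by auto
  then have xF: "x (k div 2 + 1) \<in> carrier F" using assms by (auto simp: Lam_iff vecs_iff)
  have z: "inv\<^bsub>F\<^esub> (sc i (k div 2 + 1)) \<otimes>\<^bsub>F\<^esub> x (k div 2 + 1) \<in> carrier \<O>"
    using assms(2) j unfolding Lam_iff by blast
  then have "p \<otimes>\<^bsub>F\<^esub> (inv\<^bsub>F\<^esub> (sc i (k div 2 + 1)) \<otimes>\<^bsub>F\<^esub> x (k div 2 + 1)) \<in> carrier \<O>"
    using p_int subringE(6)[OF int_subring] by blast
  then have "inv\<^bsub>F\<^esub> (sc i (k div 2 + 1)) \<otimes>\<^bsub>F\<^esub> (p \<otimes>\<^bsub>F\<^esub> x (k div 2 + 1)) \<in> carrier \<O>"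
    using xF by (simp add: F.m_lcomm)
  then show ?thesis using z re_im_int by (auto simp: crd_def Let_def)
qed

lemma crd_add:
  assumes k: "k < 2 * n" and x: "x \<in> carrier V0" and y: "y \<in> carrier V0"
  shows "crd e i k (\<lambda>j\<in>{1..n}. x j \<oplus>\<^bsub>F\<^esub> y j) = crd e i k x \<oplus>\<^bsub>F\<^esub> crd e i k y"
proof -
  have j: "1 \<le> k div 2 + 1" "k div 2 + 1 \<le> n" using k by auto
  note c = vecs_nth[OF x j] vecs_nth[OF y j]
  show ?thesis using c j by (simp add: crd_def Let_def F.r_distr re_im_add)
qed

lemma crd_smult:
  assumes k: "k < 2 * n" and x: "x \<in> carrier V0" and a: "a \<in> base K"
  shows "crd e i k (\<lambda>j\<in>{1..n}. a \<otimes>\<^bsub>F\<^esub> x j) = a \<otimes>\<^bsub>F\<^esub> crd e i k x"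
proof -
  have j: "1 \<le> k div 2 + 1" "k div 2 + 1 \<le> n" using k by auto
  note c = vecs_nth[OF x j] base_closed[OF a]
  let ?s = "inv\<^bsub>F\<^esub> (sc i (k div 2 + 1))"
  have "?s \<otimes>\<^bsub>F\<^esub> (a \<otimes>\<^bsub>F\<^esub> x (k div 2 + 1)) = a \<otimes>\<^bsub>F\<^esub> (?s \<otimes>\<^bsub>F\<^esub> x (k div 2 + 1))"
    "?s \<otimes>\<^bsub>F\<^esub> (p \<otimes>\<^bsub>F\<^esub> (a \<otimes>\<^bsub>F\<^esub> x (k div 2 + 1))) = a \<otimes>\<^bsub>F\<^esub> (?s \<otimes>\<^bsub>F\<^esub> (p \<otimes>\<^bsub>F\<^esub> x (k div 2 + 1)))"
    using c by (simp_all add: F.m_lcomm)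
  then show ?thesis using c j by (simp add: crd_def Let_def re_im_smult[OF a])
qed

lemma crd_mult_p: "k < 2 * n \<Longrightarrow> crd False i k (\<lambda>j\<in>{1..n}. p \<otimes>\<^bsub>F\<^esub> x j) = crd True i k x"
  by (auto simp: crd_def Let_def)

definition gen :: "int \<Rightarrow> nat \<Rightarrow> nat \<Rightarrow> 'f" where
  "gen i k = (\<lambda>j\<in>{1..n}. if j = k div 2 + 1 then sc i j \<otimes>\<^bsub>F\<^esub> (if even k then \<one>\<^bsub>F\<^esub> else p) else \<zero>\<^bsub>F\<^esub>)"

lemma gen_Lam: "gen i k \<in> carrier (\<Lambda> K n i)"
  using sc_unit p_int by (auto simp: Lam_iff vecs_iff gen_def F.m_assoc[symmetric] int_iff val_one)

lemma Lam_finsum_nth: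
  assumes "finite A" "f \<in> A \<rightarrow> carrier (\<Lambda> K n i)" "j \<in> {1..n}"
  shows "(\<Oplus>\<^bsub>\<Lambda> K n i\<^esub>a\<in>A. f a) j = (\<Oplus>\<^bsub>F\<^esub>a\<in>A. f a j)"
proof -
  interpret Lm: module \<O>\<^sub>0 "\<Lambda> K n i" by (rule Lam_module)
  show ?thesis using assms
  proof (induction A)
    case (insert a A)
    have fa: "f a \<in> carrier (\<Lambda> K n i)" "f \<in> A \<rightarrow> carrier (\<Lambda> K n i)" using insert by auto
    have "(\<lambda>a. f a j) \<in> A \<rightarrow> carrier F" "f a j \<in> carrier F"
      using fa insert.prems(2) vecs_nth[OF Lam_vecs] by (auto simp: Pi_iff)
    then show ?case using insert fa by (simp add: F.finsum_insert Lm.finsum_insert)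
  qed simp
qed

lemma Lam_decomp:
  assumes x: "x \<in> carrier (\<Lambda> K n i)"
  shows "x = (\<Oplus>\<^bsub>\<Lambda> K n i\<^esub>k\<in>{..<2*n}. crd False i k x \<odot>\<^bsub>\<Lambda> K n i\<^esub> gen i k)"
proof -
  interpret Lm: module \<O>\<^sub>0 "\<Lambda> K n i" by (rule Lam_module)
  let ?f = "\<lambda>k. crd False i k x \<odot>\<^bsub>\<Lambda> K n i\<^esub> gen i k"
  have f: "?f \<in> {..<2*n} \<rightarrow> carrier (\<Lambda> K n i)"
    using crd_int[OF _ x] gen_Lam Lm.smult_closed by blast
  show ?thesis
  proof
    fix j
    show "x j = (\<Oplus>\<^bsub>\<Lambda> K n i\<^esub>k\<in>{..<2*n}. ?f k) j"
    proof (cases "j \<in> {1..n}")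
      case False
      have "(\<Oplus>\<^bsub>\<Lambda> K n i\<^esub>k\<in>{..<2*n}. ?f k) \<in> carrier (\<Lambda> K n i)" using f by (rule Lm.finsum_closed)
      then have "(\<Oplus>\<^bsub>\<Lambda> K n i\<^esub>k\<in>{..<2*n}. ?f k) j = undefined"
        using False Lam_vecs unfolding vecs_iff by (blast intro: PiE_arb)
      moreover have "x j = undefined" using False Lam_vecs[OF x] unfolding vecs_iff by (blast intro: PiE_arb)
      ultimately show ?thesis by simp
    next
      case True
      define l where "l = 2 * (j - 1)"
      have l: "l < 2 * n" "Suc l < 2 * n" "l div 2 + 1 = j" "Suc l div 2 + 1 = j" "even l"
        using True by (auto simp: l_def)
      have xj: "x j \<in> carrier F" using x True by (auto simp: Lam_iff vecs_iff)
      define z where "z = inv\<^bsub>F\<^esub> (sc i j) \<otimes>\<^bsub>F\<^esub> x j"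
      have z: "z \<in> carrier F" using xj by (simp add: z_def)
      have t: "?f k j = \<zero>\<^bsub>F\<^esub>" if "k \<in> {..<2*n} - {l, Suc l}" for k
      proof -
        have "j \<noteq> k div 2 + 1" using that True unfolding l_def by (auto; presburger)
        then have "gen i k j = \<zero>\<^bsub>F\<^esub>" using True by (simp add: gen_def)
        moreover have "crd False i k x \<in> carrier F" using that crd_closed[OF _ Lam_vecs[OF x]] by auto
        ultimately show ?thesis using True by simp
      qed
      have fF: "?f k j \<in> carrier F" if "k < 2 * n" for k
      proof -
        have "?f k \<in> carrier (\<Lambda> K n i)" using f that by blast
        from vecs_nth[OF Lam_vecs[OF this]] show ?thesis using True by simp
      qed
      have "(\<Oplus>\<^bsub>\<Lambda> K n i\<^esub>k\<in>{..<2*n}. ?f k) j = (\<Oplus>\<^bsub>F\<^esub>k\<in>{..<2*n}. ?f k j)"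
        by (rule Lam_finsum_nth[OF _ f True]) simp
      also have "\<dots> = (\<Oplus>\<^bsub>F\<^esub>k\<in>{l, Suc l}. ?f k j)"
        using t fF l by (intro F.add.finprod_mono_neutral_cong_right) auto
      also have "\<dots> = ?f l j \<oplus>\<^bsub>F\<^esub> ?f (Suc l) j"
        using fF l by (simp add: F.finsum_insert del: Lam_simps)
      also have "?f l j = re z \<otimes>\<^bsub>F\<^esub> sc i j"
        using True l(3,5) z by (simp add: gen_def crd_def Let_def z_def del: One_nat_def)
      also have "?f (Suc l) j = im z \<otimes>\<^bsub>F\<^esub> (sc i j \<otimes>\<^bsub>F\<^esub> p)"
        using True l(4,5) z by (simp add: gen_def crd_def Let_def z_def del: One_nat_def div_Suc_eq_div_add3)
      also have "re z \<otimes>\<^bsub>F\<^esub> sc i j \<oplus>\<^bsub>F\<^esub> im z \<otimes>\<^bsub>F\<^esub> (sc i j \<otimes>\<^bsub>F\<^esub> p) = sc i j \<otimes>\<^bsub>F\<^esub> (re z \<oplus>\<^bsub>F\<^esub> p \<otimes>\<^bsub>F\<^esub> im z)"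
        using z by (simp add: F.r_distr F.m_ac)
      also have "\<dots> = x j"
        using re_im(3)[OF z] xj sc_unit[of i j] by (simp add: z_def F.m_assoc[symmetric])
      finally show ?thesis by (rule sym)
    qed
  qed
qed

lemma LamR_data:
  assumes "cring R" "\<iota> \<in> ring_hom \<O>\<^sub>0 R"
  shows "tensor_data R \<O>\<^sub>0 \<iota> (\<Lambda> K n i)"
proof -
  interpret Lm: module \<O>\<^sub>0 "\<Lambda> K n i" by (rule Lam_module)
  interpret R: cring R by fact
  show ?thesis
    using ring_hom_closed[OF assms(2)] Lm.smult_closed Lm.a_closed by unfold_locales auto
qed

lemma VF_data: "tensor_data F (base_ring K) (\<lambda>a. a) V0"
  using vecs_closed base_closed by unfold_locales auto

definition Crd :: "bool \<Rightarrow> ('r, 'x) ring_scheme \<Rightarrow> ('f \<Rightarrow> 'r) \<Rightarrow> int \<Rightarrow> nat \<Rightarrow> ('f, 'r) tens \<Rightarrow> 'r" where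
  "Crd e R \<iota> i k = evc R R (\<lambda>c. c) (\<lambda>x. \<iota> (crd e i k x))"

lemma LamR_functional:
  assumes "coeff_hom R S \<phi>" "\<iota> \<in> ring_hom \<O>\<^sub>0 R" "k < 2 * n"
  shows "functional R S \<phi> (carrier (\<Lambda> K n i)) (tensor_rels \<O>\<^sub>0 \<iota> R (\<Lambda> K n i)) (\<lambda>x. \<phi> (\<iota> (crd e i k x)))"
proof -
  interpret RS: coeff_hom R S \<phi> by fact
  have c: "crd e i k x \<in> carrier \<O>\<^sub>0" if "x \<in> carrier (\<Lambda> K n i)" for x using crd_int assms(3) that .
  note h = ring_hom_closed[OF assms(2)] ring_hom_add[OF assms(2)] ring_hom_mult[OF assms(2)]
  show ?thesis
  proof (rule RS.tensor_functional[OF LamR_data[OF RS.R.is_cring assms(2)]])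
    fix x y assume xy: "x \<in> carrier (\<Lambda> K n i)" "y \<in> carrier (\<Lambda> K n i)"
    show "\<phi> (\<iota> (crd e i k (x \<oplus>\<^bsub>\<Lambda> K n i\<^esub> y))) = \<phi> (\<iota> (crd e i k x)) \<oplus>\<^bsub>S\<^esub> \<phi> (\<iota> (crd e i k y))"
      using crd_add[OF assms(3) xy[THEN Lam_vecs], of e i] h c xy by simp
  next
    fix a x assume ax: "a \<in> carrier \<O>\<^sub>0" "x \<in> carrier (\<Lambda> K n i)"
    show "\<phi> (\<iota> (crd e i k (a \<odot>\<^bsub>\<Lambda> K n i\<^esub> x))) = \<phi> (\<iota> a) \<otimes>\<^bsub>S\<^esub> \<phi> (\<iota> (crd e i k x))"
      using crd_smult[OF assms(3) Lam_vecs[OF ax(2)], of a e i] h c ax by (simp add: int0_iff)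
  qed (use c h in auto)
qed

lemma VF_functional:
  assumes "k < 2 * n"
  shows "functional F F (\<lambda>x. x) (carrier V0) (tensor_rels (base_ring K) (\<lambda>a. a) F V0) (\<lambda>x. crd e i k x)"
  by (rule coeff_hom.tensor_functional[OF coeff_hom_id[OF F.is_cring] VF_data])
    (auto simp: crd_closed[OF assms] crd_add[OF assms] crd_smult[OF assms] simp del: One_nat_def)

lemma functional_semilinear:
  assumes "functional R S \<phi> (carrier M) (tensor_rels A \<alpha> R M) h"
  shows "semilinear R S \<phi> (tensor A \<alpha> R M) (evc R S \<phi> h)"
  using functional.evc_closed[OF assms] functional.evc_add[OF assms] functional.evc_smult[OF assms]
  by (simp add: semilinear_def tensor_def)

lemma Crd_semilinear:
  assumes "cring R" "\<iota> \<in> ring_hom \<O>\<^sub>0 R" "k < 2 * n"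
  shows "semilinear R R (\<lambda>c. c) (LamR K n R \<iota> i) (Crd e R \<iota> i k)"
  unfolding Crd_def LamR_def
  by (rule functional_semilinear[OF LamR_functional[OF coeff_hom_id[OF assms(1)] assms(2,3)]])

lemma Crd_semilinear_VF:
  assumes "k < 2 * n"
  shows "semilinear F F (\<lambda>c. c) (VF K n) (Crd e F (\<lambda>a. a) i k)"
  unfolding Crd_def VF_def
  by (rule functional_semilinear[OF VF_functional[OF assms]])

lemma LamR_module:
  assumes "cring R" "\<iota> \<in> ring_hom \<O>\<^sub>0 R"
  shows "module R (LamR K n R \<iota> i)"
  unfolding LamR_def by (rule tensor_data.tensor_module[OF LamR_data[OF assms]])

lemma VF_module: "module F (VF K n)"
  unfolding VF_def by (rule tensor_data.tensor_module[OF VF_data])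

lemma LamR_decomp:
  assumes "cring R" "\<iota> \<in> ring_hom \<O>\<^sub>0 R" "x \<in> carrier (LamR K n R \<iota> i)"
  shows "x = (\<Oplus>\<^bsub>LamR K n R \<iota> i\<^esub>k\<in>{..<2*n}. Crd False R \<iota> i k x \<odot>\<^bsub>LamR K n R \<iota> i\<^esub>
    pure_tensor \<O>\<^sub>0 \<iota> R (\<Lambda> K n i) (gen i k) \<one>\<^bsub>R\<^esub>)"
proof -
  interpret R: cring R by fact
  interpret Lm: module \<O>\<^sub>0 "\<Lambda> K n i" by (rule Lam_module)
  interpret t: tensor_data R \<O>\<^sub>0 \<iota> "\<Lambda> K n i" by (rule LamR_data[OF assms(1,2)])
  interpret M: module R "LamR K n R \<iota> i" by (rule LamR_module[OF assms(1,2)])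
  let ?M = "LamR K n R \<iota> i"
  let ?p = "\<lambda>x. pure_tensor \<O>\<^sub>0 \<iota> R (\<Lambda> K n i) x \<one>\<^bsub>R\<^esub>"
  note LR = LamR_def[of K n R \<iota> i]
  have pc: "?p x \<in> carrier ?M" if "x \<in> carrier (\<Lambda> K n i)" for x
    using t.pure_tensor_closed that by (simp add: LR)
  have C: "Crd False R \<iota> i k x \<in> carrier R" if "k < 2 * n" "x \<in> carrier ?M" for k x
    using Crd_semilinear[OF assms(1,2) that(1)] that(2) by (auto simp: semilinear_def)
  have Cadd: "Crd False R \<iota> i k (x \<oplus>\<^bsub>?M\<^esub> y) = Crd False R \<iota> i k x \<oplus>\<^bsub>R\<^esub> Crd False R \<iota> i k y"
    if "k < 2 * n" "x \<in> carrier ?M" "y \<in> carrier ?M" for k x y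
    using Crd_semilinear[OF assms(1,2) that(1)] that(2,3) by (auto simp: semilinear_def)
  have Csm: "Crd False R \<iota> i k (c \<odot>\<^bsub>?M\<^esub> x) = c \<otimes>\<^bsub>R\<^esub> Crd False R \<iota> i k x"
    if "k < 2 * n" "x \<in> carrier ?M" "c \<in> carrier R" for k x c
    using Crd_semilinear[OF assms(1,2) that(1)] that(2,3) by (auto simp: semilinear_def)
  have p_add: "?p (x \<oplus>\<^bsub>\<Lambda> K n i\<^esub> y) = ?p x \<oplus>\<^bsub>?M\<^esub> ?p y"
    if "x \<in> carrier (\<Lambda> K n i)" "y \<in> carrier (\<Lambda> K n i)" for x y
    unfolding LR by (rule t.pure_tensor_add_left[OF that])
  have p_smult: "?p (a \<odot>\<^bsub>\<Lambda> K n i\<^esub> x) = \<iota> a \<odot>\<^bsub>?M\<^esub> ?p x"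
    if "x \<in> carrier (\<Lambda> K n i)" "a \<in> carrier \<O>\<^sub>0" for x a
    unfolding LR by (rule t.pure_tensor_smult_left[OF that])
  have "?p \<zero>\<^bsub>\<Lambda> K n i\<^esub> = ?p (\<zero>\<^bsub>\<O>\<^sub>0\<^esub> \<odot>\<^bsub>\<Lambda> K n i\<^esub> \<zero>\<^bsub>\<Lambda> K n i\<^esub>)"
    by (simp del: Lam_simps O_simps)
  also have "\<dots> = \<iota> \<zero>\<^bsub>\<O>\<^sub>0\<^esub> \<odot>\<^bsub>?M\<^esub> ?p \<zero>\<^bsub>\<Lambda> K n i\<^esub>"
    by (rule p_smult[OF Lm.zero_closed Lm.R.zero_closed])
  also have "\<iota> \<zero>\<^bsub>\<O>\<^sub>0\<^esub> = \<zero>\<^bsub>R\<^esub>" using ring_hom_zero[OF assms(2)] O0_cring assms(1) by (auto simp: cring_def)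
  also have "\<zero>\<^bsub>R\<^esub> \<odot>\<^bsub>?M\<^esub> ?p \<zero>\<^bsub>\<Lambda> K n i\<^esub> = \<zero>\<^bsub>?M\<^esub>"
    by (rule M.smult_l_null[OF pc[OF Lm.zero_closed]])
  finally have p_zero: "?p \<zero>\<^bsub>\<Lambda> K n i\<^esub> = \<zero>\<^bsub>?M\<^esub>" .
  have p_sum: "?p (\<Oplus>\<^bsub>\<Lambda> K n i\<^esub>a\<in>A. f a) = (\<Oplus>\<^bsub>?M\<^esub>a\<in>A. ?p (f a))"
    if "finite A" "f \<in> A \<rightarrow> carrier (\<Lambda> K n i)" for f and A :: "nat set"
    using that
  proof (induction A)
    case empty show ?case by (simp only: Lm.finsum_empty M.finsum_empty p_zero)
  next
    case (insert a A)
    then have "?p (\<Oplus>\<^bsub>\<Lambda> K n i\<^esub>a\<in>insert a A. f a) = ?p (f a \<oplus>\<^bsub>\<Lambda> K n i\<^esub> (\<Oplus>\<^bsub>\<Lambda> K n i\<^esub>a\<in>A. f a))"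
      by (simp add: Lm.finsum_insert Pi_iff del: Lam_simps)
    also have "\<dots> = ?p (f a) \<oplus>\<^bsub>?M\<^esub> ?p (\<Oplus>\<^bsub>\<Lambda> K n i\<^esub>a\<in>A. f a)"
      using insert by (intro p_add Lm.finsum_closed) auto
    also have "?p (\<Oplus>\<^bsub>\<Lambda> K n i\<^esub>a\<in>A. f a) = (\<Oplus>\<^bsub>?M\<^esub>a\<in>A. ?p (f a))" using insert by blast
    also have "?p (f a) \<oplus>\<^bsub>?M\<^esub> (\<Oplus>\<^bsub>?M\<^esub>a\<in>A. ?p (f a)) = (\<Oplus>\<^bsub>?M\<^esub>a\<in>insert a A. ?p (f a))"
      using insert pc by (intro M.finsum_insert[symmetric]) auto
    finally show ?case .
  qed
  have C_pure: "Crd False R \<iota> i k (?p x) = \<iota> (crd False i k x)" if "k < 2 * n" "x \<in> carrier (\<Lambda> K n i)" for k x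
  proof -
    have "\<iota> (crd False i k x) \<in> carrier R" using crd_int[OF that] ring_hom_closed[OF assms(2)] by blast
    then show ?thesis unfolding Crd_def pure_tensor_def
      using functional.evc_single[OF LamR_functional[OF coeff_hom_id[OF assms(1)] assms(2) that(1)] that(2) R.one_closed]
      by simp
  qed
  let ?S = "\<lambda>x. \<Oplus>\<^bsub>?M\<^esub>k\<in>{..<2*n}. Crd False R \<iota> i k x \<odot>\<^bsub>?M\<^esub> ?p (gen i k)"
  have g: "?p (gen i k) \<in> carrier ?M" for k by (rule pc[OF gen_Lam])
  have one: "?p x = ?S (?p x)" if x: "x \<in> carrier (\<Lambda> K n i)" for x
  proof -
    have "?p x = ?p (\<Oplus>\<^bsub>\<Lambda> K n i\<^esub>k\<in>{..<2*n}. crd False i k x \<odot>\<^bsub>\<Lambda> K n i\<^esub> gen i k)"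
      using Lam_decomp[OF x] by simp
    also have "\<dots> = (\<Oplus>\<^bsub>?M\<^esub>k\<in>{..<2*n}. ?p (crd False i k x \<odot>\<^bsub>\<Lambda> K n i\<^esub> gen i k))"
    proof (rule p_sum)
      show "(\<lambda>k. crd False i k x \<odot>\<^bsub>\<Lambda> K n i\<^esub> gen i k) \<in> {..<2*n} \<rightarrow> carrier (\<Lambda> K n i)"
        using crd_int[OF _ x] gen_Lam Lm.smult_closed by blast
    qed simp
    also have "\<dots> = ?S (?p x)"
    proof (rule M.finsum_cong')
      show "(\<lambda>k. Crd False R \<iota> i k (?p x) \<odot>\<^bsub>?M\<^esub> ?p (gen i k)) \<in> {..<2*n} \<rightarrow> carrier ?M"
        using C pc[OF x] g by auto
      fix k assume "k \<in> {..<2*n}"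
      then show "?p (crd False i k x \<odot>\<^bsub>\<Lambda> K n i\<^esub> gen i k) = Crd False R \<iota> i k (?p x) \<odot>\<^bsub>?M\<^esub> ?p (gen i k)"
        using p_smult[OF gen_Lam crd_int[OF _ x]] C_pure[OF _ x] by simp
    qed simp
    finally show ?thesis .
  qed
  have Sadd: "?S (x \<oplus>\<^bsub>?M\<^esub> y) = ?S x \<oplus>\<^bsub>?M\<^esub> ?S y" if "x \<in> carrier ?M" "y \<in> carrier ?M" for x y
  proof -
    have "?S (x \<oplus>\<^bsub>?M\<^esub> y) = (\<Oplus>\<^bsub>?M\<^esub>k\<in>{..<2*n}. Crd False R \<iota> i k x \<odot>\<^bsub>?M\<^esub> ?p (gen i k) \<oplus>\<^bsub>?M\<^esub>
        Crd False R \<iota> i k y \<odot>\<^bsub>?M\<^esub> ?p (gen i k))"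
      using that C Cadd g by (intro M.finsum_cong') (auto simp: M.smult_l_distr)
    also have "\<dots> = ?S x \<oplus>\<^bsub>?M\<^esub> ?S y" using that C g by (intro M.finsum_addf) auto
    finally show ?thesis .
  qed
  have Ssm: "?S (c \<odot>\<^bsub>?M\<^esub> x) = c \<odot>\<^bsub>?M\<^esub> ?S x" if "x \<in> carrier ?M" "c \<in> carrier R" for c x
  proof -
    have "?S (c \<odot>\<^bsub>?M\<^esub> x) = (\<Oplus>\<^bsub>?M\<^esub>k\<in>{..<2*n}. c \<odot>\<^bsub>?M\<^esub> (Crd False R \<iota> i k x \<odot>\<^bsub>?M\<^esub> ?p (gen i k)))"
      using that C Csm g by (intro M.finsum_cong') (auto simp: M.smult_assoc1)
    also have "\<dots> = c \<odot>\<^bsub>?M\<^esub> ?S x" using that C g by (intro M.finsum_smult_ldistr[symmetric]) auto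
    finally show ?thesis .
  qed
  have "x \<in> carrier (tensor \<O>\<^sub>0 \<iota> R (\<Lambda> K n i))" using assms(3) by (simp add: LR)
  then show "x = ?S x"
  proof (induction rule: t.tensor_induct)
    case (pure x c)
    have e: "pure_tensor \<O>\<^sub>0 \<iota> R (\<Lambda> K n i) x c = c \<odot>\<^bsub>?M\<^esub> ?p x"
      unfolding LR using t.pure_tensor_smult[OF pure(1) R.one_closed pure(2)] pure by simp
    show ?case unfolding e Ssm[OF pc[OF pure(1)] pure(2)] using one[OF pure(1)] by simp
  next
    case zero
    have "?S \<zero>\<^bsub>?M\<^esub> = ?S (\<zero>\<^bsub>R\<^esub> \<odot>\<^bsub>?M\<^esub> \<zero>\<^bsub>?M\<^esub>)" by simp
    also have "\<dots> = \<zero>\<^bsub>R\<^esub> \<odot>\<^bsub>?M\<^esub> ?S \<zero>\<^bsub>?M\<^esub>" by (rule Ssm) simp_all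
    also have "\<dots> = \<zero>\<^bsub>?M\<^esub>" using C g by (intro M.smult_l_null M.finsum_closed) auto
    finally show ?case by (simp add: LR)
  next
    case (add x y)
    then have "x \<in> carrier ?M" "y \<in> carrier ?M" by (simp_all add: LR)
    then show ?case using Sadd[of x y] add by (simp add: LR)
  qed
qed

lemma Crd_map:
  assumes RS: "coeff_hom R S \<rho>"
    and pm: "presentation_map R S \<rho> (carrier M) (tensor_rels A \<iota> R M) (carrier M') (tensor_rels A' \<iota>' S M') (\<lambda>x. x)"
    and f1: "functional R R (\<lambda>x. x) (carrier M) (tensor_rels A \<iota> R M) (\<lambda>x. \<iota> (crd e i k x))"
    and f2: "functional S S (\<lambda>x. x) (carrier M') (tensor_rels A' \<iota>' S M') (\<lambda>x. \<iota>' (crd e i k x))"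
    and f3: "functional R S \<rho> (carrier M) (tensor_rels A \<iota> R M) (\<lambda>x. \<rho> (\<iota> (crd e i k x)))"
    and c: "\<And>x. x \<in> carrier M \<Longrightarrow> \<iota>' (crd e i k x) = \<rho> (\<iota> (crd e i k x))"
    and x: "x \<in> carrier (tensor A \<iota> R M)"
  shows "Crd e S \<iota>' i k (tensor_map R A' \<iota>' S M' \<rho> (\<lambda>x. x) x) = \<rho> (Crd e R \<iota> i k x)"
proof -
  have x': "x \<in> carrier (presented R (carrier M) (tensor_rels A \<iota> R M))" using x by (simp add: tensor_def)
  have "Crd e S \<iota>' i k (tensor_map R A' \<iota>' S M' \<rho> (\<lambda>x. x) x) = evc R S \<rho> (\<lambda>x. \<rho> (\<iota> (crd e i k x))) x"
    unfolding Crd_def tensor_map_def using c by (intro evc_pres_map[OF pm f2 f3 _ _ x']) auto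
  also have "\<dots> = \<rho> (Crd e R \<iota> i k x)"
    unfolding Crd_def by (rule evc_hom[OF f1 RS f3 _ _ x']) auto
  finally show ?thesis .
qed

end

section \<open>The characteristic pencil on exterior powers\<close>

lemma functional_comp:
  assumes "functional R S \<phi> G K h" "coeff_hom S T \<psi>"
    and \<theta>: "coeff_hom R T \<theta>" "\<And>c. c \<in> carrier R \<Longrightarrow> \<theta> c = \<psi> (\<phi> c)"
  shows "functional R T \<theta> G K (\<lambda>g. \<psi> (h g))"
proof -
  interpret RS: functional R S \<phi> G K h by fact
  interpret ST: coeff_hom S T \<psi> by fact
  interpret RT: coeff_hom R T \<theta> by fact
  show ?thesis
  proof unfold_locales
    show "(\<lambda>g. \<psi> (h g)) \<in> G \<rightarrow> carrier T" using RS.h_closed by auto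
    fix k assume k: "k \<in> K"
    then have f: "k \<in> carrier (free_mod R G)" using RS.K_carrier by blast
    have c: "k g \<in> carrier R" for g using f by (simp add: RS.R.free_mod_carrier_iff)
    have s: "supp R k \<subseteq> G" using f by (simp add: RS.R.free_mod_carrier_iff)
    have hc: "h g \<in> carrier S" if "g \<in> supp R k" for g using RS.h_closed s that by blast
    have "evf R T \<theta> (\<lambda>g. \<psi> (h g)) k = \<psi> (evf R S \<phi> h k)"
      unfolding evf_def using c s hc \<theta>(2)
      by (subst ST.H.hom_finsum) (auto intro!: ST.H.S.finsum_cong')
    then show "evf R T \<theta> (\<lambda>g. \<psi> (h g)) k = \<zero>\<^bsub>T\<^esub>" using RS.h_rel[OF k] by simp
  qed
qed

definition pencil_entry :: "('r, 'x) ring_scheme \<Rightarrow> 'r \<Rightarrow> 'r \<Rightarrow> nat \<Rightarrow> 'r" where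
  "pencil_entry R a b = monom (UP R) a 1 \<ominus>\<^bsub>UP R\<^esub> monom (UP R) b 0"

text \<open>
  With \<open>C' = C \<circ> u\<close> and \<open>q = \<chi>\<close> this is the difference of the first functional and \<open>\<chi>\<close> times the second.
\<close>

definition pencil :: "('r, 'x) ring_scheme \<Rightarrow> nat \<Rightarrow> (nat \<Rightarrow> 'm \<Rightarrow> 'r) \<Rightarrow> (nat \<Rightarrow> 'm \<Rightarrow> 'r) \<Rightarrow> (nat \<Rightarrow> 'r)
    \<Rightarrow> 'm list \<Rightarrow> nat \<Rightarrow> 'r" where
  "pencil R n C C' q xs =
    determinant (UP R) n (\<lambda>i j. pencil_entry R (C j (xs ! i)) (C' j (xs ! i))) \<ominus>\<^bsub>UP R\<^esub>
    q \<otimes>\<^bsub>UP R\<^esub> determinant (UP R) n (\<lambda>i j. const R (C j (xs ! i)))"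

context cring
begin

lemma const_closed [simp]: "a \<in> carrier R \<Longrightarrow> const R a \<in> carrier (UP R)"
  using UP_ring.monom_closed[OF UP_ring.intro[OF ring_axioms]] by (simp add: const_def)

lemma pencil_entry_closed [simp]:
  assumes "a \<in> carrier R" "b \<in> carrier R"
  shows "pencil_entry R a b \<in> carrier (UP R)"
proof -
  interpret U: UP_cring R "UP R" by (rule UP_cring_self)
  show ?thesis using assms by (simp add: pencil_entry_def)
qed

lemma pencil_entry_add:
  assumes "a \<in> carrier R" "b \<in> carrier R" "a' \<in> carrier R" "b' \<in> carrier R"
  shows "pencil_entry R (a \<oplus> a') (b \<oplus> b') = pencil_entry R a b \<oplus>\<^bsub>UP R\<^esub> pencil_entry R a' b'"
proof -
  interpret U: UP_cring R "UP R" by (rule UP_cring_self)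
  show ?thesis using assms by (simp add: pencil_entry_def U.P.minus_eq U.P.minus_add U.P.a_ac)
qed

lemma pencil_entry_smult:
  assumes "a \<in> carrier R" "b \<in> carrier R" "c \<in> carrier R"
  shows "pencil_entry R (c \<otimes> a) (c \<otimes> b) = const R c \<otimes>\<^bsub>UP R\<^esub> pencil_entry R a b"
proof -
  interpret U: UP_cring R "UP R" by (rule UP_cring_self)
  have "const R c \<otimes>\<^bsub>UP R\<^esub> monom (UP R) x k = monom (UP R) (c \<otimes> x) k" if "x \<in> carrier R" for x k
    using U.monom_mult[of c x 0 k] assms that by (simp add: const_def)
  then show ?thesis using assms
    by (simp add: pencil_entry_def U.P.minus_eq U.P.r_distr U.P.r_minus)
qed

lemma pencil_entry_scalar:
  assumes "a \<in> carrier R" "c \<in> carrier R"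
  shows "pencil_entry R a (c \<otimes> a) = pencil_entry R \<one> c \<otimes>\<^bsub>UP R\<^esub> const R a"
  using pencil_entry_smult[of \<one> c a] assms cring_UP
  by (simp add: m_comm cring.cring_simprules)

lemma pencil_alternating:
  assumes M: "module R M" and C: "\<And>j. j < n \<Longrightarrow> semilinear R R (\<lambda>x. x) M (C j)"
    and C': "\<And>j. j < n \<Longrightarrow> semilinear R R (\<lambda>x. x) M (C' j)" and q: "q \<in> carrier (UP R)"
  shows "alternating R (UP R) (const R) n M (pencil R n C C' q)"
proof -
  interpret h: coeff_hom R "UP R" "const R" by (rule const_hom)
  have "alternating R (UP R) (const R) n M (\<lambda>xs. determinant (UP R) n (\<lambda>i j. pencil_entry R (C j (xs ! i)) (C' j (xs ! i))))"
    using C C' by (intro h.alternating_determinant[OF M])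
      (auto simp: semilinear_def pencil_entry_add pencil_entry_smult)
  moreover have "alternating R (UP R) (const R) n M (\<lambda>xs. determinant (UP R) n (\<lambda>i j. const R (C j (xs ! i))))"
    using C by (intro h.alternating_determinant[OF M]) (auto simp: semilinear_def)
  ultimately show ?thesis
    unfolding pencil_def[abs_def] using q M by (rule h.alternating_combine)
qed

lemma pencil_functional:
  assumes M: "module R M" and C: "\<And>j. j < n \<Longrightarrow> semilinear R R (\<lambda>x. x) M (C j)"
    and C': "\<And>j. j < n \<Longrightarrow> semilinear R R (\<lambda>x. x) M (C' j)" and q: "q \<in> carrier (UP R)"
  shows "functional R (UP R) (const R) (tuples n (carrier M)) (ext_rels R n M) (pencil R n C C' q)"
  by (rule coeff_hom.ext_functional[OF const_hom M pencil_alternating[OF assms]])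

end

lemma (in coeff_hom) hom_diff:
  "x \<in> carrier R \<Longrightarrow> y \<in> carrier R \<Longrightarrow> \<phi> (x \<ominus> y) = \<phi> x \<ominus>\<^bsub>S\<^esub> \<phi> y"
  by (simp add: R.minus_eq H.S.minus_eq)

lemma (in coeff_hom) UP_map_pencil_entry:
  assumes "a \<in> carrier R" "b \<in> carrier R"
  shows "(\<lambda>i. \<phi> (pencil_entry R a b i)) = pencil_entry S (\<phi> a) (\<phi> b)"
proof -
  interpret U: UP_cring R "UP R" by (rule R.UP_cring_self)
  show ?thesis
    unfolding pencil_entry_def coeff_hom.hom_diff[OF UP_map_hom U.monom_closed[OF assms(1)] U.monom_closed[OF assms(2)]]
      UP_map_monom[OF assms(1)] UP_map_monom[OF assms(2)] ..
qed

lemma (in coeff_hom) UP_map_pencil: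
  assumes C: "\<And>j x. j < n \<Longrightarrow> x \<in> X \<Longrightarrow> C j x \<in> carrier R" and C': "\<And>j x. j < n \<Longrightarrow> x \<in> X \<Longrightarrow> C' j x \<in> carrier R"
    and xs: "xs \<in> tuples n X" and ys: "length ys = n"
    and D: "\<And>i j. j < n \<Longrightarrow> i < n \<Longrightarrow> D j (ys ! i) = \<phi> (C j (xs ! i))"
    and D': "\<And>i j. j < n \<Longrightarrow> i < n \<Longrightarrow> D' j (ys ! i) = \<phi> (C' j (xs ! i))"
    and q: "q \<in> carrier (UP R)"
  shows "pencil S n D D' (\<lambda>i. \<phi> (q i)) ys = (\<lambda>i. \<phi> (pencil R n C C' q xs i))"
proof -
  let ?\<eta> = "\<lambda>q i. \<phi> (q i)"
  interpret U: cring "UP R" by (rule R.cring_UP)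
  interpret V: cring "UP S" by (rule H.S.cring_UP)
  interpret E: coeff_hom "UP R" "UP S" ?\<eta> by (rule UP_map_hom)
  have c: "C j (xs ! i) \<in> carrier R" "C' j (xs ! i) \<in> carrier R" if "i < n" "j < n" for i j
    using C C' that tuples_nth[OF xs] by auto
  have e1: "?\<eta> (const R a) = const S (\<phi> a)" if "a \<in> carrier R" for a
    using UP_map_monom[OF that, of 0] by (simp add: const_def)
  note hdiff = coeff_hom.hom_diff[OF UP_map_hom] and e2 = UP_map_pencil_entry
  have s1: "U.square n (\<lambda>i j. pencil_entry R (C j (xs ! i)) (C' j (xs ! i)))"
    and s2: "U.square n (\<lambda>i j. const R (C j (xs ! i)))"
    using c by (auto simp: U.square_def)
  have d1: "determinant (UP S) n (\<lambda>i j. pencil_entry S (D j (ys ! i)) (D' j (ys ! i))) =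
      ?\<eta> (determinant (UP R) n (\<lambda>i j. pencil_entry R (C j (xs ! i)) (C' j (xs ! i))))"
    unfolding E.hom_determinant[OF s1]
    using c D D' by (intro V.determinant_cong) (auto simp: V.square_def e2)
  have d2: "determinant (UP S) n (\<lambda>i j. const S (D j (ys ! i))) =
      ?\<eta> (determinant (UP R) n (\<lambda>i j. const R (C j (xs ! i))))"
    unfolding E.hom_determinant[OF s2]
    using c D by (intro V.determinant_cong) (auto simp: V.square_def e1)
  have d3: "?\<eta> (q \<otimes>\<^bsub>UP R\<^esub> determinant (UP R) n (\<lambda>i j. const R (C j (xs ! i)))) =
     ?\<eta> q \<otimes>\<^bsub>UP S\<^esub> ?\<eta> (determinant (UP R) n (\<lambda>i j. const R (C j (xs ! i))))"
    by (rule E.H.hom_mult[OF q U.determinant_closed[OF s2]])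
  have cl: "q \<otimes>\<^bsub>UP R\<^esub> determinant (UP R) n (\<lambda>i j. const R (C j (xs ! i))) \<in> carrier (UP R)"
    using q U.determinant_closed[OF s2] by (rule U.m_closed)
  show ?thesis unfolding pencil_def d1 d2 d3[symmetric] by (rule hdiff[OF U.determinant_closed[OF s1] cl, symmetric])
qed

lemma pencil_ext_map:
  assumes RS: "coeff_hom R S \<rho>" and M: "module R M" and M': "module S M'"
    and h: "h \<in> carrier M \<rightarrow> carrier M'"
    and hadd: "\<And>x y. x \<in> carrier M \<Longrightarrow> y \<in> carrier M \<Longrightarrow> h (x \<oplus>\<^bsub>M\<^esub> y) = h x \<oplus>\<^bsub>M'\<^esub> h y"
    and hsmult: "\<And>a x. a \<in> carrier R \<Longrightarrow> x \<in> carrier M \<Longrightarrow> h (a \<odot>\<^bsub>M\<^esub> x) = \<rho> a \<odot>\<^bsub>M'\<^esub> h x"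
    and C: "\<And>j. j < n \<Longrightarrow> semilinear R R (\<lambda>x. x) M (C j)" "\<And>j. j < n \<Longrightarrow> semilinear R R (\<lambda>x. x) M (C' j)"
    and D: "\<And>j. j < n \<Longrightarrow> semilinear S S (\<lambda>x. x) M' (D j)" "\<And>j. j < n \<Longrightarrow> semilinear S S (\<lambda>x. x) M' (D' j)"
    and CD: "\<And>j x. j < n \<Longrightarrow> x \<in> carrier M \<Longrightarrow> D j (h x) = \<rho> (C j x)"
      "\<And>j x. j < n \<Longrightarrow> x \<in> carrier M \<Longrightarrow> D' j (h x) = \<rho> (C' j x)"
    and q: "q \<in> carrier (UP R)" and w: "w \<in> carrier (ext_power R n M)"
  shows "ext_map R S n M' \<rho> h w \<in> carrier (ext_power S n M')"
    and "evc S (UP S) (const S) (pencil S n D D' (\<lambda>i. \<rho> (q i))) (ext_map R S n M' \<rho> h w) =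
      (\<lambda>i. \<rho> (evc R (UP R) (const R) (pencil R n C C' q) w i))"
proof -
  interpret RS: coeff_hom R S \<rho> by fact
  let ?\<eta> = "\<lambda>q i. \<rho> (q i)"
  have E: "coeff_hom (UP R) (UP S) ?\<eta>" by (rule RS.UP_map_hom)
  have pm: "presentation_map R S \<rho> (tuples n (carrier M)) (ext_rels R n M)
    (tuples n (carrier M')) (ext_rels S n M') (map h)"
    by (rule RS.ext_presentation_map[OF M M' h hadd hsmult])
  have w': "w \<in> carrier (presented R (tuples n (carrier M)) (ext_rels R n M))"
    using w by (simp add: ext_power_def)
  show "ext_map R S n M' \<rho> h w \<in> carrier (ext_power S n M')"
    unfolding ext_map_def ext_power_def by (rule presentation_map.pres_map_closed[OF pm w'])
  have qS: "?\<eta> q \<in> carrier (UP S)"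
    by (rule ring_hom_closed[OF ring_hom_cring.homh[OF coeff_hom.axioms(1)[OF E]] q])
  have fR: "functional R (UP R) (const R) (tuples n (carrier M)) (ext_rels R n M) (pencil R n C C' q)"
    by (rule RS.R.pencil_functional[OF M C q])
  have fS: "functional S (UP S) (const S) (tuples n (carrier M')) (ext_rels S n M') (pencil S n D D' (?\<eta> q))"
    by (rule RS.H.S.pencil_functional[OF M' D qS])
  let ?\<theta> = "\<lambda>c. ?\<eta> (const R c)"
  have th: "coeff_hom R (UP S) ?\<theta>"
    using ring_hom_cring.homh[OF coeff_hom.axioms(1)[OF E]] ring_hom_cring.homh[OF coeff_hom.axioms(1)[OF RS.R.const_hom]]
    by (intro coeff_homI RS.R.is_cring RS.H.S.cring_UP) (auto simp: ring_hom_def)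
  have fRS: "functional R (UP S) ?\<theta> (tuples n (carrier M)) (ext_rels R n M) (\<lambda>xs. ?\<eta> (pencil R n C C' q xs))"
    by (rule functional_comp[OF fR E th]) simp
  have "evc S (UP S) (const S) (pencil S n D D' (?\<eta> q)) (ext_map R S n M' \<rho> h w) =
      evc R (UP S) ?\<theta> (\<lambda>xs. ?\<eta> (pencil R n C C' q xs)) w"
    unfolding ext_map_def
  proof (rule evc_pres_map[OF pm fS fRS _ _ w'])
    show "?\<theta> c = const S (\<rho> c)" if "c \<in> carrier R" for c
      using RS.UP_map_monom[OF that, of 0] by (simp add: const_def)
    fix xs assume xs: "xs \<in> tuples n (carrier M)"
    have C_cl: "C j x \<in> carrier R" "C' j x \<in> carrier R" if "j < n" "x \<in> carrier M" for j x
      using C that by (auto simp: semilinear_def)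
    show "?\<eta> (pencil R n C C' q xs) = pencil S n D D' (?\<eta> q) (map h xs)"
      by (rule RS.UP_map_pencil[OF _ _ xs _ _ _ q, symmetric])
        (use C_cl xs tuples_nth[OF xs] CD in \<open>auto simp: tuples_def\<close>)
  qed
  also have "\<dots> = ?\<eta> (evc R (UP R) (const R) (pencil R n C C' q) w)"
    by (rule evc_hom[OF fR E fRS _ _ w']) simp_all
  finally show "evc S (UP S) (const S) (pencil S n D D' (?\<eta> q)) (ext_map R S n M' \<rho> h w) =
      ?\<eta> (evc R (UP R) (const R) (pencil R n C C' q) w)" .
qed

definition kpoly :: "('r, 'x) ring_scheme \<Rightarrow> 'r \<Rightarrow> nat \<Rightarrow> nat \<Rightarrow> nat \<Rightarrow> 'r" where
  "kpoly R a r s = (monom (UP R) \<one>\<^bsub>R\<^esub> 1 \<ominus>\<^bsub>UP R\<^esub> monom (UP R) a 0) [^]\<^bsub>UP R\<^esub> s \<otimes>\<^bsub>UP R\<^esub>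
    (monom (UP R) \<one>\<^bsub>R\<^esub> 1 \<oplus>\<^bsub>UP R\<^esub> monom (UP R) a 0) [^]\<^bsub>UP R\<^esub> r"

lemma (in cring) kpoly_eq:
  assumes "a \<in> carrier R"
  shows "kpoly R a r s = pencil_entry R \<one> a [^]\<^bsub>UP R\<^esub> s \<otimes>\<^bsub>UP R\<^esub> pencil_entry R \<one> (\<ominus> a) [^]\<^bsub>UP R\<^esub> r"
proof -
  interpret U: UP_cring R "UP R" by (rule UP_cring_self)
  show ?thesis using assms by (simp add: kpoly_def pencil_entry_def U.P.minus_eq)
qed

lemma (in cring) kpoly_closed:
  assumes "a \<in> carrier R"
  shows "kpoly R a r s \<in> carrier (UP R)"
proof -
  interpret U: cring "UP R" by (rule cring_UP)
  show ?thesis using assms by (simp add: kpoly_eq)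
qed

lemma (in coeff_hom) UP_map_kpoly:
  assumes a: "a \<in> carrier R"
  shows "(\<lambda>i. \<phi> (kpoly R a r s i)) = kpoly S (\<phi> a) r s"
proof -
  let ?\<eta> = "\<lambda>q i. \<phi> (q i)"
  interpret U: cring "UP R" by (rule R.cring_UP)
  interpret V: cring "UP S" by (rule H.S.cring_UP)
  interpret E: coeff_hom "UP R" "UP S" ?\<eta> by (rule UP_map_hom)
  have e2: "?\<eta> (pencil_entry R \<one> b) = pencil_entry S \<one>\<^bsub>S\<^esub> (\<phi> b)" if "b \<in> carrier R" for b
    using UP_map_pencil_entry[OF R.one_closed that] by simp
  have pe: "pencil_entry R \<one> b \<in> carrier (UP R)" if "b \<in> carrier R" for b using that by simp
  have hp: "?\<eta> (x [^]\<^bsub>UP R\<^esub> (k::nat)) = ?\<eta> x [^]\<^bsub>UP S\<^esub> k" if "x \<in> carrier (UP R)" for x k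
    by (rule E.H.hom_pow[OF that])
  have "?\<eta> (kpoly R a r s) = ?\<eta> (pencil_entry R \<one> a [^]\<^bsub>UP R\<^esub> s) \<otimes>\<^bsub>UP S\<^esub> ?\<eta> (pencil_entry R \<one> (\<ominus> a) [^]\<^bsub>UP R\<^esub> r)"
    unfolding R.kpoly_eq[OF a] by (rule E.H.hom_mult) (use a in auto)
  also have "\<dots> = pencil_entry S \<one>\<^bsub>S\<^esub> (\<phi> a) [^]\<^bsub>UP S\<^esub> s \<otimes>\<^bsub>UP S\<^esub> pencil_entry S \<one>\<^bsub>S\<^esub> (\<phi> (\<ominus> a)) [^]\<^bsub>UP S\<^esub> r"
    unfolding hp[OF pe[OF a]] hp[OF pe[OF R.a_inv_closed[OF a]]] e2[OF a] e2[OF R.a_inv_closed[OF a]] ..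
  also have "\<dots> = kpoly S (\<phi> a) r s" using a by (simp add: H.S.kpoly_eq)
  finally show ?thesis .
qed

lemma (in cring) pencil_eigen:
  assumes len: "length xs = r" "length ys = s" "r + s = n" and a: "a \<in> carrier R"
    and C: "\<And>i j. i < n \<Longrightarrow> j < n \<Longrightarrow> C j ((xs @ ys) ! i) \<in> carrier R"
    and xs: "\<And>x j. x \<in> set xs \<Longrightarrow> j < n \<Longrightarrow> C' j x = \<ominus> a \<otimes> C j x"
    and ys: "\<And>y j. y \<in> set ys \<Longrightarrow> j < n \<Longrightarrow> C' j y = a \<otimes> C j y"
  shows "pencil R n C C' (kpoly R a r s) (xs @ ys) = \<zero>\<^bsub>UP R\<^esub>"
proof -
  interpret U: cring "UP R" by (rule cring_UP)
  let ?zs = "xs @ ys"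
  define c where "c = (\<lambda>i. if i < r then pencil_entry R \<one> (\<ominus> a) else pencil_entry R \<one> a)"
  have cc: "c i \<in> carrier (UP R)" for i using a by (simp add: c_def)
  have sq: "U.square n (\<lambda>i j. const R (C j (?zs ! i)))" using C by (auto simp: U.square_def)
  have ent: "pencil_entry R (C j (?zs ! i)) (C' j (?zs ! i)) = c i \<otimes>\<^bsub>UP R\<^esub> const R (C j (?zs ! i))"
    if "i < n" "j < n" for i j
  proof (cases "i < r")
    case True
    then have "?zs ! i \<in> set xs" using len by (simp add: nth_append)
    then show ?thesis using True C[OF that] a xs that by (simp add: c_def pencil_entry_scalar)
  next
    case False
    then have "?zs ! i \<in> set ys" using len that by (simp add: nth_append)
    then show ?thesis using False C[OF that] a ys that by (simp add: c_def pencil_entry_scalar)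
  qed
  have "determinant (UP R) n (\<lambda>i j. pencil_entry R (C j (?zs ! i)) (C' j (?zs ! i))) =
      determinant (UP R) n (\<lambda>i j. c i \<otimes>\<^bsub>UP R\<^esub> const R (C j (?zs ! i)))"
    using ent cc C by (intro U.determinant_cong) (auto simp: U.square_def)
  also have "\<dots> = (\<Otimes>\<^bsub>UP R\<^esub>i\<in>{..<n}. c i) \<otimes>\<^bsub>UP R\<^esub> determinant (UP R) n (\<lambda>i j. const R (C j (?zs ! i)))"
    using cc by (intro U.determinant_scale_rows[OF sq]) auto
  also have "(\<Otimes>\<^bsub>UP R\<^esub>i\<in>{..<n}. c i) = kpoly R a r s"
  proof -
    have e: "{..<n} = {..<r} \<union> {r..<n}" using len by auto
    have "(\<Otimes>\<^bsub>UP R\<^esub>i\<in>{..<n}. c i) = (\<Otimes>\<^bsub>UP R\<^esub>i\<in>{..<r}. c i) \<otimes>\<^bsub>UP R\<^esub> (\<Otimes>\<^bsub>UP R\<^esub>i\<in>{r..<n}. c i)"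
      unfolding e using cc by (intro U.finprod_Un_disjoint) auto
    also have "(\<Otimes>\<^bsub>UP R\<^esub>i\<in>{..<r}. c i) = (\<Otimes>\<^bsub>UP R\<^esub>i\<in>{..<r}. pencil_entry R \<one> (\<ominus> a))"
      using a by (intro U.finprod_cong') (auto simp: c_def)
    also have "\<dots> = pencil_entry R \<one> (\<ominus> a) [^]\<^bsub>UP R\<^esub> r" using a by (subst U.finprod_const) auto
    also have "(\<Otimes>\<^bsub>UP R\<^esub>i\<in>{r..<n}. c i) = (\<Otimes>\<^bsub>UP R\<^esub>i\<in>{r..<n}. pencil_entry R \<one> a)"
      using a by (intro U.finprod_cong') (auto simp: c_def)
    also have "\<dots> = pencil_entry R \<one> a [^]\<^bsub>UP R\<^esub> s" using a len by (subst U.finprod_const) auto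
    finally show ?thesis using a by (simp add: kpoly_eq U.m_comm)
  qed
  finally show ?thesis unfolding pencil_def
    using U.determinant_closed[OF sq] kpoly_closed[OF a] by simp
qed

context ramified_lattice
begin

lemma F_semilinear_closed: "semilinear R S \<phi> M l \<Longrightarrow> x \<in> carrier M \<Longrightarrow> l x \<in> carrier S"
  by (simp add: semilinear_def)

lemma Crd_mult:
  assumes R: "cring R"
    and pm: "presentation_map R R (\<lambda>x. x) (carrier M) (tensor_rels A \<iota> R M) (carrier M) (tensor_rels A \<iota> R M)
      (\<lambda>x. p \<odot>\<^bsub>V0\<^esub> x)"
    and f: "\<And>e. functional R R (\<lambda>x. x) (carrier M) (tensor_rels A \<iota> R M) (\<lambda>x. \<iota> (crd e i k x))"
    and k: "k < 2 * n" and x: "x \<in> carrier (tensor A \<iota> R M)"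
  shows "Crd False R \<iota> i k (tensor_map R A \<iota> R M (\<lambda>c. c) (\<lambda>x. p \<odot>\<^bsub>V0\<^esub> x) x) = Crd True R \<iota> i k x"
proof -
  have x': "x \<in> carrier (presented R (carrier M) (tensor_rels A \<iota> R M))" using x by (simp add: tensor_def)
  show ?thesis unfolding Crd_def tensor_map_def
    by (rule evc_pres_map[OF pm f f _ _ x']) (use crd_mult_p[OF k] in simp_all)
qed

lemma LamR_mult_map:
  assumes "cring R" "\<iota> \<in> ring_hom \<O>\<^sub>0 R"
  shows "presentation_map R R (\<lambda>x. x) (carrier (\<Lambda> K n i)) (tensor_rels \<O>\<^sub>0 \<iota> R (\<Lambda> K n i))
     (carrier (\<Lambda> K n i)) (tensor_rels \<O>\<^sub>0 \<iota> R (\<Lambda> K n i)) (\<lambda>x. p \<odot>\<^bsub>V0\<^esub> x)"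
proof (rule coeff_hom.tensor_presentation_map[OF coeff_hom_id[OF assms(1)] LamR_data[OF assms] LamR_data[OF assms]])
  show "(\<lambda>x. p \<odot>\<^bsub>V0\<^esub> x) \<in> carrier (\<Lambda> K n i) \<rightarrow> carrier (\<Lambda> K n i)"
    using Lam_closed(2) p_int by simp
  fix x assume x: "x \<in> carrier (\<Lambda> K n i)"
  note xj = vecs_nth[OF Lam_vecs[OF x]]
  show "p \<odot>\<^bsub>V0\<^esub> (x \<oplus>\<^bsub>\<Lambda> K n i\<^esub> y) = p \<odot>\<^bsub>V0\<^esub> x \<oplus>\<^bsub>\<Lambda> K n i\<^esub> p \<odot>\<^bsub>V0\<^esub> y" if y: "y \<in> carrier (\<Lambda> K n i)" for y
    using xj vecs_nth[OF Lam_vecs[OF y]] by (auto simp: fun_eq_iff F.r_distr)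
  show "p \<odot>\<^bsub>V0\<^esub> (a \<odot>\<^bsub>\<Lambda> K n i\<^esub> x) = a \<odot>\<^bsub>\<Lambda> K n i\<^esub> (p \<odot>\<^bsub>V0\<^esub> x)" if a: "a \<in> carrier \<O>\<^sub>0" for a
    using xj that by (auto simp: fun_eq_iff F.m_lcomm int0_iff int_iff)
qed auto

lemma VF_mult_map:
  "presentation_map F F (\<lambda>x. x) (carrier V0) (tensor_rels (base_ring K) (\<lambda>a. a) F V0)
     (carrier V0) (tensor_rels (base_ring K) (\<lambda>a. a) F V0) (\<lambda>x. p \<odot>\<^bsub>V0\<^esub> x)"
proof (rule coeff_hom.tensor_presentation_map[OF coeff_hom_id[OF F.is_cring] VF_data VF_data])
  show "(\<lambda>x. p \<odot>\<^bsub>V0\<^esub> x) \<in> carrier V0 \<rightarrow> carrier V0" using vecs_closed(2) by simp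
  fix x assume x: "x \<in> carrier V0"
  note xj = vecs_nth[OF x]
  show "p \<odot>\<^bsub>V0\<^esub> (x \<oplus>\<^bsub>V0\<^esub> y) = p \<odot>\<^bsub>V0\<^esub> x \<oplus>\<^bsub>V0\<^esub> p \<odot>\<^bsub>V0\<^esub> y" if y: "y \<in> carrier V0" for y
    using xj vecs_nth[OF y] by (auto simp: fun_eq_iff F.r_distr)
  show "p \<odot>\<^bsub>V0\<^esub> (a \<odot>\<^bsub>V0\<^esub> x) = a \<odot>\<^bsub>V0\<^esub> (p \<odot>\<^bsub>V0\<^esub> x)" if a: "a \<in> carrier (base_ring K)" for a
    using xj a base_closed by (auto simp: fun_eq_iff F.m_lcomm)
qed auto

lemma Crd_mulR:
  assumes "cring R" "\<iota> \<in> ring_hom \<O>\<^sub>0 R" "k < 2 * n" "x \<in> carrier (LamR K n R \<iota> i)"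
  shows "Crd False R \<iota> i k (mulR K n R \<iota> i p x) = Crd True R \<iota> i k x"
  unfolding mulR_def
  by (rule Crd_mult[OF assms(1) LamR_mult_map[OF assms(1,2)]
      LamR_functional[OF coeff_hom_id[OF assms(1)] assms(2,3)] assms(3) assms(4)[unfolded LamR_def]])

lemma Crd_eig:
  assumes "v \<in> VF_eig K n c" "c \<in> carrier F" "k < 2 * n"
  shows "Crd True F (\<lambda>a. a) i k v = c \<otimes>\<^bsub>F\<^esub> Crd False F (\<lambda>a. a) i k v"
proof -
  have v: "v \<in> carrier (VF K n)" using assms by (simp add: VF_eig_def)
  have "Crd True F (\<lambda>a. a) i k v =
      Crd False F (\<lambda>a. a) i k (tensor_map F (base_ring K) (\<lambda>a. a) F V0 (\<lambda>a. a) (\<lambda>x. p \<odot>\<^bsub>V0\<^esub> x) v)"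
    by (rule Crd_mult[OF F.is_cring VF_mult_map VF_functional[OF assms(3)] assms(3) v[unfolded VF_def], symmetric])
  also have "\<dots> = Crd False F (\<lambda>a. a) i k (c \<odot>\<^bsub>VF K n\<^esub> v)" using assms(1) by (simp add: VF_eig_def)
  also have "\<dots> = c \<otimes>\<^bsub>F\<^esub> Crd False F (\<lambda>a. a) i k v"
    using Crd_semilinear_VF[OF assms(3)] v assms(2) by (simp add: semilinear_def)
  finally show ?thesis .
qed

lemma O_O0_hom: "\<iota> \<in> ring_hom \<O> R \<Longrightarrow> \<iota> \<in> ring_hom \<O>\<^sub>0 R"
  by (auto simp: ring_hom_def int0_iff)

lemma id_O_hom: "(\<lambda>a. a) \<in> ring_hom \<O> \<O>" "(\<lambda>a. a) \<in> ring_hom \<O>\<^sub>0 \<O>"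
  by (auto simp: ring_hom_def int0_iff)

abbreviation LPen :: "('r, 'x) ring_scheme \<Rightarrow> ('f \<Rightarrow> 'r) \<Rightarrow> int \<Rightarrow> (nat \<Rightarrow> nat) \<Rightarrow> (nat \<Rightarrow> 'r) \<Rightarrow> ('f, 'r) tens list \<Rightarrow> nat \<Rightarrow> 'r" where
  "LPen R \<iota> i f \<equiv> pencil R n (\<lambda>j. Crd False R \<iota> i (f j)) (\<lambda>j. Crd True R \<iota> i (f j))"

lemma W_rs_pencil:
  assumes rs: "r + s = n" and f: "\<And>j. j < n \<Longrightarrow> f j < 2 * n" and w: "w \<in> W_rs K n r s"
  shows "evc F (UP F) (const F) (LPen F (\<lambda>a. a) i f (kpoly F p r s)) w = \<zero>\<^bsub>UP F\<^esub>"
proof -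
  interpret V: module F "VF K n" by (rule VF_module)
  let ?P = "LPen F (\<lambda>a. a) i f (kpoly F p r s)"
  have fn: "functional F (UP F) (const F) (tuples n (carrier (VF K n))) (ext_rels F n (VF K n)) ?P"
    using f by (intro F.pencil_functional[OF VF_module] F.kpoly_closed Crd_semilinear_VF) auto
  let ?G = "{wedge F n (VF K n) (xs @ ys) | xs ys.
        xs \<in> tuples r (VF_eig K n (\<ominus>\<^bsub>F\<^esub> p)) \<and> ys \<in> tuples s (VF_eig K n p)}"
  have "?G \<subseteq> {x \<in> carrier (WF K n). evc F (UP F) (const F) ?P x = \<zero>\<^bsub>UP F\<^esub>}"
  proof
    fix x assume "x \<in> ?G"
    then obtain xs ys where x: "x = wedge F n (VF K n) (xs @ ys)"
      and xs: "xs \<in> tuples r (VF_eig K n (\<ominus>\<^bsub>F\<^esub> p))" and ys: "ys \<in> tuples s (VF_eig K n p)" by blast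
    have eig: "VF_eig K n c \<subseteq> carrier (VF K n)" for c by (auto simp: VF_eig_def)
    have t: "xs @ ys \<in> tuples n (carrier (VF K n))"
      using xs ys eig rs by (fastforce simp: tuples_def)
    have "?P (xs @ ys) = \<zero>\<^bsub>UP F\<^esub>"
    proof (rule F.pencil_eigen[OF _ _ rs p_closed])
      show "length xs = r" "length ys = s" using xs ys by (auto simp: tuples_def)
      show "Crd False F (\<lambda>a. a) i (f j) ((xs @ ys) ! i') \<in> carrier F" if "i' < n" "j < n" for i' j
        by (rule F_semilinear_closed[OF Crd_semilinear_VF[OF f[OF that(2)]] tuples_nth[OF t that(1)]])
      show "Crd True F (\<lambda>a. a) i (f j) x = \<ominus>\<^bsub>F\<^esub> p \<otimes>\<^bsub>F\<^esub> Crd False F (\<lambda>a. a) i (f j) x"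
        if "x \<in> set xs" "j < n" for x j
        using that xs f by (intro Crd_eig) (auto simp: tuples_def)
      show "Crd True F (\<lambda>a. a) i (f j) x = p \<otimes>\<^bsub>F\<^esub> Crd False F (\<lambda>a. a) i (f j) x"
        if "x \<in> set ys" "j < n" for x j
        using that ys f by (intro Crd_eig) (auto simp: tuples_def)
    qed
    moreover have "evc F (UP F) (const F) ?P x = const F \<one>\<^bsub>F\<^esub> \<otimes>\<^bsub>UP F\<^esub> ?P (xs @ ys)"
      unfolding x wedge_def by (rule functional.evc_single[OF fn t F.one_closed])
    ultimately have "evc F (UP F) (const F) ?P x = \<zero>\<^bsub>UP F\<^esub>"
      using cring.cring_simprules(26,27)[OF F.cring_UP] F.const_closed[OF F.one_closed] by simp
    moreover have "x \<in> carrier (WF K n)" unfolding x WF_def by (rule V.wedge_closed[OF t])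
    ultimately show "x \<in> {x \<in> carrier (WF K n). evc F (UP F) (const F) ?P x = \<zero>\<^bsub>UP F\<^esub>}" by simp
  qed
  moreover have "submodule {x \<in> carrier (WF K n). evc F (UP F) (const F) ?P x = \<zero>\<^bsub>UP F\<^esub>} F (WF K n)"
    using functional.evc_submodule[OF fn] by (simp add: WF_def ext_power_def)
  ultimately have "W_rs K n r s \<subseteq> {x \<in> carrier (WF K n). evc F (UP F) (const F) ?P x = \<zero>\<^bsub>UP F\<^esub>}"
    unfolding W_rs_def by (intro lin_span_least)
  then show ?thesis using w by blast
qed

lemma LamR_map:
  assumes RS: "coeff_hom R S \<rho>" and \<iota>: "\<iota> \<in> ring_hom \<O>\<^sub>0 R" and \<iota>': "\<iota>' \<in> ring_hom \<O>\<^sub>0 S"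
    and c: "\<And>a. a \<in> carrier \<O>\<^sub>0 \<Longrightarrow> \<iota>' a = \<rho> (\<iota> a)"
    and h: "h = tensor_map R \<O>\<^sub>0 \<iota>' S (\<Lambda> K n i) \<rho> (\<lambda>x. x)"
  shows "x \<in> carrier (LamR K n R \<iota> i) \<Longrightarrow> h x \<in> carrier (LamR K n S \<iota>' i)"
    and "x \<in> carrier (LamR K n R \<iota> i) \<Longrightarrow> y \<in> carrier (LamR K n R \<iota> i) \<Longrightarrow>
      h (x \<oplus>\<^bsub>LamR K n R \<iota> i\<^esub> y) = h x \<oplus>\<^bsub>LamR K n S \<iota>' i\<^esub> h y"
    and "x \<in> carrier (LamR K n R \<iota> i) \<Longrightarrow> a \<in> carrier R \<Longrightarrow>
      h (a \<odot>\<^bsub>LamR K n R \<iota> i\<^esub> x) = \<rho> a \<odot>\<^bsub>LamR K n S \<iota>' i\<^esub> h x"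
    and "x \<in> carrier (LamR K n R \<iota> i) \<Longrightarrow> k < 2 * n \<Longrightarrow> Crd e S \<iota>' i k (h x) = \<rho> (Crd e R \<iota> i k x)"
proof -
  have cr: "cring R" "cring S" using RS by (auto simp: coeff_hom_def ring_hom_cring_def)
  have pm: "presentation_map R S \<rho> (carrier (\<Lambda> K n i)) (tensor_rels \<O>\<^sub>0 \<iota> R (\<Lambda> K n i))
     (carrier (\<Lambda> K n i)) (tensor_rels \<O>\<^sub>0 \<iota>' S (\<Lambda> K n i)) (\<lambda>x. x)"
    by (rule coeff_hom.tensor_presentation_map[OF RS LamR_data[OF cr(1) \<iota>] LamR_data[OF cr(2) \<iota>']])
      (use c in auto)
  show "x \<in> carrier (LamR K n R \<iota> i) \<Longrightarrow> h x \<in> carrier (LamR K n S \<iota>' i)"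
    unfolding h LamR_def tensor_def tensor_map_def by (rule presentation_map.pres_map_closed[OF pm])
  show "x \<in> carrier (LamR K n R \<iota> i) \<Longrightarrow> y \<in> carrier (LamR K n R \<iota> i) \<Longrightarrow>
      h (x \<oplus>\<^bsub>LamR K n R \<iota> i\<^esub> y) = h x \<oplus>\<^bsub>LamR K n S \<iota>' i\<^esub> h y"
    unfolding h LamR_def tensor_def tensor_map_def by (rule presentation_map.pres_map_add[OF pm])
  show "x \<in> carrier (LamR K n R \<iota> i) \<Longrightarrow> a \<in> carrier R \<Longrightarrow>
      h (a \<odot>\<^bsub>LamR K n R \<iota> i\<^esub> x) = \<rho> a \<odot>\<^bsub>LamR K n S \<iota>' i\<^esub> h x"
    unfolding h LamR_def tensor_def tensor_map_def by (rule presentation_map.pres_map_smult[OF pm])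
  show "Crd e S \<iota>' i k (h x) = \<rho> (Crd e R \<iota> i k x)" if x: "x \<in> carrier (LamR K n R \<iota> i)" and k: "k < 2 * n"
    unfolding h
    by (rule Crd_map[OF RS pm LamR_functional[OF coeff_hom_id[OF cr(1)] \<iota> k] LamR_functional[OF coeff_hom_id[OF cr(2)] \<iota>' k]
        LamR_functional[OF RS \<iota> k] c[OF crd_int[OF k]] x[unfolded LamR_def]])
qed

lemma LamO_incl:
  assumes h: "h = tensor_map \<O> (base_ring K) (\<lambda>a. a) F V0 (\<lambda>a. a) (\<lambda>x. x)"
  shows "x \<in> carrier (LamO K n i) \<Longrightarrow> h x \<in> carrier (VF K n)"
    and "x \<in> carrier (LamO K n i) \<Longrightarrow> y \<in> carrier (LamO K n i) \<Longrightarrow>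
      h (x \<oplus>\<^bsub>LamO K n i\<^esub> y) = h x \<oplus>\<^bsub>VF K n\<^esub> h y"
    and "x \<in> carrier (LamO K n i) \<Longrightarrow> a \<in> carrier \<O> \<Longrightarrow>
      h (a \<odot>\<^bsub>LamO K n i\<^esub> x) = a \<odot>\<^bsub>VF K n\<^esub> h x"
    and "x \<in> carrier (LamO K n i) \<Longrightarrow> k < 2 * n \<Longrightarrow> Crd e F (\<lambda>a. a) i k (h x) = Crd e \<O> (\<lambda>a. a) i k x"
proof -
  have pm: "presentation_map \<O> F (\<lambda>a. a) (carrier (\<Lambda> K n i)) (tensor_rels \<O>\<^sub>0 (\<lambda>a. a) \<O> (\<Lambda> K n i))
     (carrier V0) (tensor_rels (base_ring K) (\<lambda>a. a) F V0) (\<lambda>x. x)"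
    by (rule coeff_hom.tensor_presentation_map[OF O_F_hom LamR_data[OF O_cring id_O_hom(2)] VF_data])
      (auto simp: Lam_vecs int0_iff)
  show "x \<in> carrier (LamO K n i) \<Longrightarrow> h x \<in> carrier (VF K n)"
    unfolding h LamO_def LamR_def VF_def tensor_def tensor_map_def by (rule presentation_map.pres_map_closed[OF pm])
  show "x \<in> carrier (LamO K n i) \<Longrightarrow> y \<in> carrier (LamO K n i) \<Longrightarrow>
      h (x \<oplus>\<^bsub>LamO K n i\<^esub> y) = h x \<oplus>\<^bsub>VF K n\<^esub> h y"
    unfolding h LamO_def LamR_def VF_def tensor_def tensor_map_def by (rule presentation_map.pres_map_add[OF pm])
  show "x \<in> carrier (LamO K n i) \<Longrightarrow> a \<in> carrier \<O> \<Longrightarrow>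
      h (a \<odot>\<^bsub>LamO K n i\<^esub> x) = a \<odot>\<^bsub>VF K n\<^esub> h x"
    unfolding h LamO_def LamR_def VF_def tensor_def tensor_map_def by (rule presentation_map.pres_map_smult[OF pm])
  show "Crd e F (\<lambda>a. a) i k (h x) = Crd e \<O> (\<lambda>a. a) i k x" if x: "x \<in> carrier (LamO K n i)" and k: "k < 2 * n"
    unfolding h
    by (rule Crd_map[OF O_F_hom pm LamR_functional[OF coeff_hom_id[OF O_cring] id_O_hom(2) k] VF_functional[OF k]
        LamR_functional[OF O_F_hom id_O_hom(2) k] refl x[unfolded LamO_def LamR_def]])
qed

lemma WLam_red_pencil:
  assumes R: "cring R" and \<iota>: "\<iota> \<in> ring_hom \<O> R" and rs: "r + s = n" and f: "\<And>j. j < n \<Longrightarrow> f j < 2 * n"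
    and w: "w \<in> carrier (WLam K n i)" "WLam_incl K n w \<in> W_rs K n r s"
  shows "WLam_red K n R \<iota> i w \<in> carrier (ext_power R n (LamR K n R \<iota> i))"
    and "evc R (UP R) (const R) (LPen R \<iota> i f (kpoly R (\<iota> p) r s)) (WLam_red K n R \<iota> i w) = \<zero>\<^bsub>UP R\<^esub>"
proof -
  have LO: "module \<O> (LamO K n i)" unfolding LamO_def by (rule LamR_module[OF O_cring id_O_hom(2)])
  have LR: "module R (LamR K n R \<iota> i)" by (rule LamR_module[OF R O_O0_hom[OF \<iota>]])
  have hom: "coeff_hom \<O> R \<iota>" by (rule coeff_homI[OF O_cring R \<iota>])
  have w': "w \<in> carrier (ext_power \<O> n (LamO K n i))" using w(1) by (simp add: WLam_def)
  have kc: "kpoly \<O> p r s \<in> carrier (UP \<O>)" by (rule cring.kpoly_closed[OF O_cring p_int])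
  have sO: "semilinear \<O> \<O> (\<lambda>x. x) (LamO K n i) (Crd e \<O> (\<lambda>a. a) i (f j))" if "j < n" for e j
    unfolding LamO_def by (rule Crd_semilinear[OF O_cring id_O_hom(2) f[OF that]])
  let ?E = "evc \<O> (UP \<O>) (const \<O>) (LPen \<O> (\<lambda>a. a) i f (kpoly \<O> p r s)) w"
  have e: "?E = evc F (UP F) (const F) (LPen F (\<lambda>a. a) i f (kpoly \<O> p r s)) (WLam_incl K n w)"
    unfolding WLam_incl_def
    by (rule pencil_ext_map(2)[OF O_F_hom LO VF_module _ _ _ sO sO _ _ _ _ kc w', symmetric])
      (use LamO_incl[OF refl] f Crd_semilinear_VF in auto)
  have kk: "kpoly \<O> p r s = kpoly F p r s"
    using coeff_hom.UP_map_kpoly[OF O_F_hom p_int] .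
  have "evc F (UP F) (const F) (LPen F (\<lambda>a. a) i f (kpoly \<O> p r s)) (WLam_incl K n w) = \<zero>\<^bsub>UP F\<^esub>"
    unfolding kk by (rule W_rs_pencil[OF rs f w(2)])
  then have "?E = \<zero>\<^bsub>UP F\<^esub>" by (rule trans[OF e])
  also have "\<zero>\<^bsub>UP F\<^esub> = \<zero>\<^bsub>UP \<O>\<^esub>" by (simp add: UP_def)
  finally have E0: "?E = \<zero>\<^bsub>UP \<O>\<^esub>" .
  have sR: "semilinear R R (\<lambda>x. x) (LamR K n R \<iota> i) (Crd e R \<iota> i (f j))" if "j < n" for e j
    by (rule Crd_semilinear[OF R O_O0_hom[OF \<iota>] f[OF that]])
  have LM: "x \<in> carrier (LamO K n i) \<Longrightarrow> tensor_map \<O> \<O>\<^sub>0 \<iota> R (\<Lambda> K n i) \<iota> (\<lambda>x. x) x \<in> carrier (LamR K n R \<iota> i)"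
    "x \<in> carrier (LamO K n i) \<Longrightarrow> y \<in> carrier (LamO K n i) \<Longrightarrow>
      tensor_map \<O> \<O>\<^sub>0 \<iota> R (\<Lambda> K n i) \<iota> (\<lambda>x. x) (x \<oplus>\<^bsub>LamO K n i\<^esub> y) =
      tensor_map \<O> \<O>\<^sub>0 \<iota> R (\<Lambda> K n i) \<iota> (\<lambda>x. x) x \<oplus>\<^bsub>LamR K n R \<iota> i\<^esub> tensor_map \<O> \<O>\<^sub>0 \<iota> R (\<Lambda> K n i) \<iota> (\<lambda>x. x) y"
    "x \<in> carrier (LamO K n i) \<Longrightarrow> a \<in> carrier \<O> \<Longrightarrow>
      tensor_map \<O> \<O>\<^sub>0 \<iota> R (\<Lambda> K n i) \<iota> (\<lambda>x. x) (a \<odot>\<^bsub>LamO K n i\<^esub> x) =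
      \<iota> a \<odot>\<^bsub>LamR K n R \<iota> i\<^esub> tensor_map \<O> \<O>\<^sub>0 \<iota> R (\<Lambda> K n i) \<iota> (\<lambda>x. x) x"
    "x \<in> carrier (LamO K n i) \<Longrightarrow> k < 2 * n \<Longrightarrow>
      Crd e R \<iota> i k (tensor_map \<O> \<O>\<^sub>0 \<iota> R (\<Lambda> K n i) \<iota> (\<lambda>x. x) x) = \<iota> (Crd e \<O> (\<lambda>a. a) i k x)" for x y a k e
    unfolding LamO_def by (rule LamR_map[OF hom id_O_hom(2) O_O0_hom[OF \<iota>] refl refl]; assumption)+
  note pem = pencil_ext_map[OF hom LO LR _ _ _ sO[of _ False] sO[of _ True]
      sR[of _ False] sR[of _ True] _ _ kc w', where h = "tensor_map \<O> \<O>\<^sub>0 \<iota> R (\<Lambda> K n i) \<iota> (\<lambda>x. x)"]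
  show "WLam_red K n R \<iota> i w \<in> carrier (ext_power R n (LamR K n R \<iota> i))"
    unfolding WLam_red_def by (rule pem(1)) (use LM f in auto)
  have "evc R (UP R) (const R) (LPen R \<iota> i f (\<lambda>j. \<iota> (kpoly \<O> p r s j))) (WLam_red K n R \<iota> i w) = (\<lambda>j. \<iota> (?E j))"
    unfolding WLam_red_def by (rule pem(2)) (use LM f in auto)
  also have "\<dots> = \<zero>\<^bsub>UP R\<^esub>"
    unfolding E0 using ring_hom_cring.hom_zero[OF coeff_hom.axioms(1)[OF coeff_hom.UP_map_hom[OF hom]]] .
  also have "(\<lambda>j. \<iota> (kpoly \<O> p r s j)) = kpoly R (\<iota> p) r s"
    by (rule coeff_hom.UP_map_kpoly[OF hom p_int])
  finally show "evc R (UP R) (const R) (LPen R \<iota> i f (kpoly R (\<iota> p) r s)) (WLam_red K n R \<iota> i w) = \<zero>\<^bsub>UP R\<^esub>" .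
qed

lemma lines_in_pencil:
  assumes R: "cring R" and \<iota>: "\<iota> \<in> ring_hom \<O> R" and rs: "r + s = n" and f: "\<And>j. j < n \<Longrightarrow> f j < 2 * n"
    and U: "U \<subseteq> W_rs K n r s" and lines: "lines_in K n I U R \<iota> Fam" and i: "i \<in> index_set n I"
    and xs: "xs \<in> tuples n (Fam i)" "xs \<in> tuples n (carrier (LamR K n R \<iota> i))"
  shows "LPen R \<iota> i f (kpoly R (\<iota> p) r s) xs = \<zero>\<^bsub>UP R\<^esub>"
proof -
  let ?M = "LamR K n R \<iota> i" and ?P = "LPen R \<iota> i f (kpoly R (\<iota> p) r s)"
  interpret R: cring R by fact
  interpret U: cring "UP R" by (rule R.cring_UP)
  have \<iota>p: "\<iota> p \<in> carrier R" by (rule ring_hom_closed[OF \<iota> p_int])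
  have fn: "functional R (UP R) (const R) (tuples n (carrier ?M)) (ext_rels R n ?M) ?P"
    using f by (intro R.pencil_functional[OF LamR_module[OF R O_O0_hom[OF \<iota>]]] R.kpoly_closed[OF \<iota>p]
        Crd_semilinear[OF R O_O0_hom[OF \<iota>]]) auto
  have "wedge R n ?M xs \<in> ext_sub R n ?M (Fam i)"
    unfolding ext_sub_def by (rule subsetD[OF lin_span_superset imageI[OF xs(1)]])
  then have mem: "wedge R n ?M xs \<in> lin_span R (ext_power R n ?M)
       (WLam_red K n R \<iota> i ` {w \<in> carrier (WLam K n i). WLam_incl K n w \<in> U})"
    by (rule subsetD[OF bspec[OF lines[unfolded lines_in_def] i]])
  have sub: "submodule {x \<in> carrier (ext_power R n ?M). evc R (UP R) (const R) ?P x = \<zero>\<^bsub>UP R\<^esub>} R (ext_power R n ?M)"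
    using functional.evc_submodule[OF fn] by (simp add: ext_power_def)
  have gen: "WLam_red K n R \<iota> i ` {w \<in> carrier (WLam K n i). WLam_incl K n w \<in> U} \<subseteq>
      {x \<in> carrier (ext_power R n ?M). evc R (UP R) (const R) ?P x = \<zero>\<^bsub>UP R\<^esub>}"
    using WLam_red_pencil[OF R \<iota> rs f] U by auto
  have "wedge R n ?M xs \<in> {x \<in> carrier (ext_power R n ?M). evc R (UP R) (const R) ?P x = \<zero>\<^bsub>UP R\<^esub>}"
    by (rule subsetD[OF lin_span_least[OF sub gen] mem])
  then have "evc R (UP R) (const R) ?P (wedge R n ?M xs) = \<zero>\<^bsub>UP R\<^esub>" by simp
  moreover have "evc R (UP R) (const R) ?P (wedge R n ?M xs) = const R \<one>\<^bsub>R\<^esub> \<otimes>\<^bsub>UP R\<^esub> ?P xs"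
    unfolding wedge_def by (rule functional.evc_single[OF fn xs(2) R.one_closed])
  moreover have "const R \<one>\<^bsub>R\<^esub> = \<one>\<^bsub>UP R\<^esub>"
    using ring_hom_one[OF ring_hom_cring.homh[OF coeff_hom.axioms(1)[OF R.const_hom]]] .
  moreover have "?P xs \<in> carrier (UP R)" using functional.h_closed[OF fn] xs(2) by blast
  ultimately show ?thesis by simp
qed

end

section \<open>Characteristic polynomials on direct summands\<close>

lemma (in cring) exists_primeideal:
  assumes J: "ideal J R" and one: "\<one> \<notin> J"
  shows "\<exists>P. primeideal P R \<and> J \<subseteq> P"
proof -
  let ?A = "{I. ideal I R \<and> J \<subseteq> I \<and> \<one> \<notin> I}"
  have "\<exists>M\<in>?A. \<forall>X\<in>?A. M \<subseteq> X \<longrightarrow> X = M"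
  proof (rule subset_Zorn_nonempty)
    show "?A \<noteq> {}" using assms by blast
    fix C assume C: "C \<noteq> {}" "subset.chain ?A C"
    then have ch: "subset.chain {I. ideal I R} C" unfolding subset_chain_def by blast
    have "ideal (\<Union>C) R" using chain_Union_is_ideal[OF ch] C(1) by simp
    moreover have "J \<subseteq> \<Union>C" "\<one> \<notin> \<Union>C" using C unfolding subset_chain_def by blast+
    ultimately show "\<Union>C \<in> ?A" by blast
  qed
  then obtain M where MA: "M \<in> ?A" and MX: "\<forall>X\<in>?A. M \<subseteq> X \<longrightarrow> X = M" by (elim bexE)
  have M: "ideal M R" "J \<subseteq> M" "\<one> \<notin> M" using MA by auto
  have max: "X = M" if "ideal X R" "J \<subseteq> X" "\<one> \<notin> X" "M \<subseteq> X" for X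
    using bspec[OF MX, of X] that by simp
  have "maximalideal M R"
  proof (rule maximalidealI[OF M(1)])
    show "carrier R \<noteq> M" using M(3) by auto
    fix X assume X: "ideal X R" "M \<subseteq> X" "X \<subseteq> carrier R"
    show "X = M \<or> X = carrier R"
    proof (cases "\<one> \<in> X")
      case True
      then show ?thesis using ideal.one_imp_carrier[OF X(1)] by simp
    next
      case False
      then show ?thesis using max[OF X(1) _ False X(2)] M(2) X(2) by blast
    qed
  qed
  then show ?thesis using maximalideal_prime M(2) by blast
qed

lemma (in cring) prime_compl_mult:
  assumes "primeideal \<pp> R" "s \<in> carrier R - \<pp>" "t \<in> carrier R - \<pp>"
  shows "s \<otimes> t \<in> carrier R - \<pp>"
  using primeideal.I_prime[OF assms(1)] assms(2,3) by blast

lemma (in cring) prime_compl_one: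
  assumes "primeideal \<pp> R" shows "\<one> \<in> carrier R - \<pp>"
  using primeideal.I_notcarr[OF assms] ideal.one_imp_carrier[OF primeideal.axioms(1)[OF assms]] by blast

lemma (in cring) prime_compl_pow:
  assumes "primeideal \<pp> R" "s \<in> carrier R - \<pp>"
  shows "s [^] (k::nat) \<in> carrier R - \<pp>"
  by (induction k) (use prime_compl_one[OF assms(1)] prime_compl_mult[OF assms(1) _ assms(2)] in auto)

lemma (in cring) common_denominator:
  assumes \<pp>: "primeideal \<pp> R" and "finite A"
    and ex: "\<And>k. k \<in> A \<Longrightarrow> \<exists>t\<in>carrier R - \<pp>. Q k t"
    and mult: "\<And>k s t. k \<in> A \<Longrightarrow> Q k t \<Longrightarrow> s \<in> carrier R \<Longrightarrow> t \<in> carrier R \<Longrightarrow> Q k (s \<otimes> t)"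
  shows "\<exists>t\<in>carrier R - \<pp>. \<forall>k\<in>A. Q k t"
  using assms(2) ex mult
proof (induction A)
  case empty
  then show ?case using prime_compl_one[OF \<pp>] by blast
next
  case (insert a A)
  then obtain t where t: "t \<in> carrier R - \<pp>" "\<forall>k\<in>A. Q k t" by blast
  obtain s where s: "s \<in> carrier R - \<pp>" "Q a s" using insert.prems(1) by blast
  have "Q a (t \<otimes> s)" using insert.prems(2)[of a s t] s t by blast
  moreover have "Q k (s \<otimes> t)" if "k \<in> A" for k using insert.prems(2)[of k t s] s t that by blast
  moreover have "t \<otimes> s = s \<otimes> t" using s t by (simp add: m_comm)
  ultimately show ?case using prime_compl_mult[OF \<pp> s(1) t(1)] by (intro bexI[of _ "s \<otimes> t"]) auto
qed

locale free_summand = module R M for R :: "('r, 'x) ring_scheme" (structure) and M :: "('r, 'm, 'z) module_scheme" (structure) +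
  fixes P :: "'m set" and n N :: nat and C :: "nat \<Rightarrow> 'm \<Rightarrow> 'r" and b :: "nat \<Rightarrow> 'm"
  assumes C_lin: "k < N \<Longrightarrow> semilinear R R (\<lambda>x. x) M (C k)"
    and b_closed: "k < N \<Longrightarrow> b k \<in> carrier M"
    and decomp: "x \<in> carrier M \<Longrightarrow> x = (\<Oplus>\<^bsub>M\<^esub>k\<in>{..<N}. C k x \<odot>\<^bsub>M\<^esub> b k)"
    and summand: "direct_summand R M P"
begin

lemma C_closed: "k < N \<Longrightarrow> x \<in> carrier M \<Longrightarrow> C k x \<in> carrier R"
  using C_lin by (simp add: semilinear_def)

lemma C_smult: "k < N \<Longrightarrow> x \<in> carrier M \<Longrightarrow> a \<in> carrier R \<Longrightarrow> C k (a \<odot>\<^bsub>M\<^esub> x) = a \<otimes> C k x"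
  using C_lin by (simp add: semilinear_def)

lemma C_add: "k < N \<Longrightarrow> x \<in> carrier M \<Longrightarrow> y \<in> carrier M \<Longrightarrow> C k (x \<oplus>\<^bsub>M\<^esub> y) = C k x \<oplus> C k y"
  using C_lin by (simp add: semilinear_def)

lemma C_finsum:
  assumes "k < N" "finite A" "f \<in> A \<rightarrow> carrier M"
  shows "C k (\<Oplus>\<^bsub>M\<^esub>a\<in>A. f a) = (\<Oplus>a\<in>A. C k (f a))"
  using assms(2,3)
proof (induction A)
  case empty
  have "C k \<zero>\<^bsub>M\<^esub> = C k (\<zero> \<odot>\<^bsub>M\<^esub> \<zero>\<^bsub>M\<^esub>)" by simp
  also have "\<dots> = \<zero> \<otimes> C k \<zero>\<^bsub>M\<^esub>" by (rule C_smult[OF assms(1)]) auto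
  finally show ?case using C_closed[OF assms(1), of "\<zero>\<^bsub>M\<^esub>"] by simp
next
  case (insert a A)
  then show ?case using C_closed[OF assms(1)]
    by (simp add: M.finsum_insert R.finsum_insert C_add[OF assms(1)] Pi_iff)
qed

lemma P_sub: "submodule P R M" and P_carrier: "P \<subseteq> carrier M"
  using summand submoduleE(1) by (auto simp: direct_summand_def)

lemma P_generators: "\<exists>g. (\<forall>k<N. g k \<in> P) \<and> (\<forall>x\<in>P. x = (\<Oplus>\<^bsub>M\<^esub>k\<in>{..<N}. C k x \<odot>\<^bsub>M\<^esub> g k))"
proof -
  obtain Q where Q: "submodule Q R M" "P <+>\<^bsub>M\<^esub> Q = carrier M" "P \<inter> Q = {\<zero>\<^bsub>M\<^esub>}"
    using summand by (auto simp: direct_summand_def)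
  have "\<forall>k. \<exists>y z. k < N \<longrightarrow> y \<in> P \<and> z \<in> Q \<and> b k = y \<oplus>\<^bsub>M\<^esub> z"
  proof
    fix k
    have "k < N \<Longrightarrow> b k \<in> P <+>\<^bsub>M\<^esub> Q" using b_closed Q(2) by simp
    then show "\<exists>y z. k < N \<longrightarrow> y \<in> P \<and> z \<in> Q \<and> b k = y \<oplus>\<^bsub>M\<^esub> z"
      by (auto simp: set_add_def set_mult_def)
  qed
  then obtain g h where gh: "\<And>k. k < N \<Longrightarrow> g k \<in> P \<and> h k \<in> Q \<and> b k = g k \<oplus>\<^bsub>M\<^esub> h k" by metis
  have Qc: "Q \<subseteq> carrier M" using submoduleE(1)[OF Q(1)] .
  have "x = (\<Oplus>\<^bsub>M\<^esub>k\<in>{..<N}. C k x \<odot>\<^bsub>M\<^esub> g k)" if x: "x \<in> P" for x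
  proof -
    have xc: "x \<in> carrier M" using x P_carrier by blast
    have gc: "g k \<in> carrier M" "h k \<in> carrier M" if "k < N" for k using gh[OF that] P_carrier Qc by auto
    let ?y = "\<Oplus>\<^bsub>M\<^esub>k\<in>{..<N}. C k x \<odot>\<^bsub>M\<^esub> g k" and ?z = "\<Oplus>\<^bsub>M\<^esub>k\<in>{..<N}. C k x \<odot>\<^bsub>M\<^esub> h k"
    have y: "?y \<in> P" using gh C_closed[OF _ xc] submoduleE(4)[OF P_sub] by (intro submodule_finsum[OF P_sub]) auto
    have z: "?z \<in> Q" using gh C_closed[OF _ xc] submoduleE(4)[OF Q(1)] by (intro submodule_finsum[OF Q(1)]) auto
    have "x = (\<Oplus>\<^bsub>M\<^esub>k\<in>{..<N}. C k x \<odot>\<^bsub>M\<^esub> b k)" by (rule decomp[OF xc])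
    also have "\<dots> = (\<Oplus>\<^bsub>M\<^esub>k\<in>{..<N}. C k x \<odot>\<^bsub>M\<^esub> g k \<oplus>\<^bsub>M\<^esub> C k x \<odot>\<^bsub>M\<^esub> h k)"
      using gh gc C_closed[OF _ xc] by (intro M.finsum_cong') (auto simp: smult_r_distr)
    also have "\<dots> = ?y \<oplus>\<^bsub>M\<^esub> ?z" using gc C_closed[OF _ xc] by (intro M.finsum_addf) auto
    finally have e: "x = ?y \<oplus>\<^bsub>M\<^esub> ?z" .
    have yc: "?y \<in> carrier M" "?z \<in> carrier M" using y z P_carrier Qc by auto
    have "?z = x \<oplus>\<^bsub>M\<^esub> (\<ominus>\<^bsub>M\<^esub> ?y)"
    proof -
      have "x \<oplus>\<^bsub>M\<^esub> (\<ominus>\<^bsub>M\<^esub> ?y) = (?y \<oplus>\<^bsub>M\<^esub> ?z) \<oplus>\<^bsub>M\<^esub> (\<ominus>\<^bsub>M\<^esub> ?y)" using e by simp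
      also have "\<dots> = ?z" using yc by (simp add: M.a_comm[of ?y ?z] M.a_assoc M.r_neg)
      finally show ?thesis by simp
    qed
    then have "?z \<in> P" using x y submoduleE(3,5)[OF P_sub] by simp
    then have "?z = \<zero>\<^bsub>M\<^esub>" using z Q(3) by blast
    then show ?thesis using e yc by simp
  qed
  then show ?thesis using gh by blast
qed

lemma local_basis_expand:
  fixes m :: nat
  assumes lb: "local_basis R M P n \<pp> as" and \<pp>: "primeideal \<pp> R" and y: "\<And>k. k < m \<Longrightarrow> y k \<in> P"
  shows "\<exists>t\<in>carrier R - \<pp>. \<exists>d. (\<forall>k<m. \<forall>j<n. d k j \<in> carrier R) \<and>
    (\<forall>k<m. t \<odot>\<^bsub>M\<^esub> y k = (\<Oplus>\<^bsub>M\<^esub>j\<in>{..<n}. d k j \<odot>\<^bsub>M\<^esub> as ! j))"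
proof -
  have as: "as ! j \<in> carrier M" if "j < n" for j
    using lb that P_carrier tuples_nth unfolding local_basis_def by blast
  let ?Q = "\<lambda>k t. \<exists>c\<in>{..<n} \<rightarrow> carrier R. t \<odot>\<^bsub>M\<^esub> y k = (\<Oplus>\<^bsub>M\<^esub>j\<in>{..<n}. c j \<odot>\<^bsub>M\<^esub> as ! j)"
  have "\<exists>t\<in>carrier R - \<pp>. \<forall>k\<in>{..<m}. ?Q k t"
  proof (rule R.common_denominator[OF \<pp>])
    show "\<exists>t\<in>carrier R - \<pp>. ?Q k t" if "k \<in> {..<m}" for k
      using lb y that unfolding local_basis_def by blast
    fix k s t assume k: "k \<in> {..<m}" and Q: "?Q k t" and st: "s \<in> carrier R" "t \<in> carrier R"
    then obtain c where c: "c \<in> {..<n} \<rightarrow> carrier R" "t \<odot>\<^bsub>M\<^esub> y k = (\<Oplus>\<^bsub>M\<^esub>j\<in>{..<n}. c j \<odot>\<^bsub>M\<^esub> as ! j)" by blast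
    have "(s \<otimes> t) \<odot>\<^bsub>M\<^esub> y k = s \<odot>\<^bsub>M\<^esub> (\<Oplus>\<^bsub>M\<^esub>j\<in>{..<n}. c j \<odot>\<^bsub>M\<^esub> as ! j)"
      using c(2) st y[of k] k P_carrier by (simp add: smult_assoc1 subset_iff)
    also have "\<dots> = (\<Oplus>\<^bsub>M\<^esub>j\<in>{..<n}. s \<odot>\<^bsub>M\<^esub> (c j \<odot>\<^bsub>M\<^esub> as ! j))"
      using c as st by (intro finsum_smult_ldistr) auto
    also have "\<dots> = (\<Oplus>\<^bsub>M\<^esub>j\<in>{..<n}. (s \<otimes> c j) \<odot>\<^bsub>M\<^esub> as ! j)"
      using c as st by (intro M.finsum_cong') (auto simp: smult_assoc1 Pi_iff)
    finally show "?Q k (s \<otimes> t)" using c st by (intro bexI[of _ "\<lambda>j. s \<otimes> c j"]) auto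
  qed simp
  then obtain t where t: "t \<in> carrier R - \<pp>" "\<forall>k\<in>{..<m}. ?Q k t" by blast
  then have "\<forall>k. \<exists>c. k < m \<longrightarrow> c \<in> {..<n} \<rightarrow> carrier R \<and> t \<odot>\<^bsub>M\<^esub> y k = (\<Oplus>\<^bsub>M\<^esub>j\<in>{..<n}. c j \<odot>\<^bsub>M\<^esub> as ! j)"
    by blast
  then obtain d where "\<forall>k. k < m \<longrightarrow> d k \<in> {..<n} \<rightarrow> carrier R \<and> t \<odot>\<^bsub>M\<^esub> y k = (\<Oplus>\<^bsub>M\<^esub>j\<in>{..<n}. d k j \<odot>\<^bsub>M\<^esub> as ! j)"
    by metis
  then show ?thesis using t(1) by (intro bexI[of _ t] exI[of _ d]) auto
qed

text \<open>
  Projecting the generators \<open>b\<close> of \<open>M\<close> to \<open>P\<close> and expanding the result in \<open>as\<close> factors a multiple \<open>s t\<close> of the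
  identity, with \<open>s, t \<notin> \<pp>\<close>, through the matrix \<open>C\<^sub>k(as\<^sub>i)\<close>; the determinant of this factorization writes
  \<open>(s t)\<^sup>n\<close> as a combination of minors.
\<close>

lemma local_minors:
  assumes lb: "local_basis R M P n \<pp> as" and \<pp>: "primeideal \<pp> R"
  shows "\<exists>u\<in>carrier R - \<pp>. \<forall>z\<in>carrier (UP R).
    (\<forall>f. (\<forall>j<n. f j < N) \<longrightarrow> z \<otimes>\<^bsub>UP R\<^esub> determinant (UP R) n (\<lambda>i j. const R (C (f j) (as ! i))) = \<zero>\<^bsub>UP R\<^esub>) \<longrightarrow>
    const R u \<otimes>\<^bsub>UP R\<^esub> z = \<zero>\<^bsub>UP R\<^esub>"
proof -
  have asP: "as ! j \<in> P" if "j < n" for j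
    using lb that tuples_nth unfolding local_basis_def by blast
  then have as: "as ! j \<in> carrier M" if "j < n" for j using that P_carrier by blast
  obtain g where g: "\<And>k. k < N \<Longrightarrow> g k \<in> P" "\<And>x. x \<in> P \<Longrightarrow> x = (\<Oplus>\<^bsub>M\<^esub>k\<in>{..<N}. C k x \<odot>\<^bsub>M\<^esub> g k)"
    using P_generators by blast
  have gc: "g k \<in> carrier M" if "k < N" for k using g(1)[OF that] P_carrier by blast
  obtain t d where t: "t \<in> carrier R - \<pp>" and d: "\<And>k j. k < N \<Longrightarrow> j < n \<Longrightarrow> d k j \<in> carrier R"
    and td: "\<And>k. k < N \<Longrightarrow> t \<odot>\<^bsub>M\<^esub> g k = (\<Oplus>\<^bsub>M\<^esub>j\<in>{..<n}. d k j \<odot>\<^bsub>M\<^esub> as ! j)"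
    using local_basis_expand[OF lb \<pp>, of N g] g(1) by blast
  have tc: "t \<in> carrier R" using t by blast
  let ?e = "\<lambda>i j. \<Oplus>k\<in>{..<N}. d k j \<otimes> C k (as ! i)"
  have ec: "?e i j \<in> carrier R" if "i < n" "j < n" for i j
    using that d C_closed as by (intro R.finsum_closed) auto
  let ?x = "\<lambda>i j. (if i = j then t else \<zero>) \<ominus> ?e i j"
  have xc: "?x i j \<in> carrier R" if "i < n" "j < n" for i j using ec[OF that] tc by auto
  have rel: "(\<Oplus>\<^bsub>M\<^esub>j\<in>{..<n}. ?x i j \<odot>\<^bsub>M\<^esub> as ! j) = \<zero>\<^bsub>M\<^esub>" if i: "i < n" for i
  proof -
    note Ci = C_closed[OF _ as[OF i]]
    have "t \<odot>\<^bsub>M\<^esub> as ! i = t \<odot>\<^bsub>M\<^esub> (\<Oplus>\<^bsub>M\<^esub>k\<in>{..<N}. C k (as ! i) \<odot>\<^bsub>M\<^esub> g k)"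
      using g(2)[OF asP[OF i]] by simp
    also have "\<dots> = (\<Oplus>\<^bsub>M\<^esub>k\<in>{..<N}. t \<odot>\<^bsub>M\<^esub> (C k (as ! i) \<odot>\<^bsub>M\<^esub> g k))"
      using tc gc Ci by (intro finsum_smult_ldistr) auto
    also have "\<dots> = (\<Oplus>\<^bsub>M\<^esub>k\<in>{..<N}. \<Oplus>\<^bsub>M\<^esub>j\<in>{..<n}. (d k j \<otimes> C k (as ! i)) \<odot>\<^bsub>M\<^esub> as ! j)"
    proof (rule M.finsum_cong')
      fix k assume k: "k \<in> {..<N}"
      have "t \<odot>\<^bsub>M\<^esub> (C k (as ! i) \<odot>\<^bsub>M\<^esub> g k) = C k (as ! i) \<odot>\<^bsub>M\<^esub> (t \<odot>\<^bsub>M\<^esub> g k)"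
        using k tc gc Ci by (simp add: smult_assoc1[symmetric] R.m_comm)
      also have "\<dots> = C k (as ! i) \<odot>\<^bsub>M\<^esub> (\<Oplus>\<^bsub>M\<^esub>j\<in>{..<n}. d k j \<odot>\<^bsub>M\<^esub> as ! j)" using td k by simp
      also have "\<dots> = (\<Oplus>\<^bsub>M\<^esub>j\<in>{..<n}. C k (as ! i) \<odot>\<^bsub>M\<^esub> (d k j \<odot>\<^bsub>M\<^esub> as ! j))"
        using k d as Ci by (intro finsum_smult_ldistr) auto
      also have "\<dots> = (\<Oplus>\<^bsub>M\<^esub>j\<in>{..<n}. (d k j \<otimes> C k (as ! i)) \<odot>\<^bsub>M\<^esub> as ! j)"
        using k d as Ci by (intro M.finsum_cong') (auto simp: smult_assoc1[symmetric] R.m_comm)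
      finally show "t \<odot>\<^bsub>M\<^esub> (C k (as ! i) \<odot>\<^bsub>M\<^esub> g k) = (\<Oplus>\<^bsub>M\<^esub>j\<in>{..<n}. (d k j \<otimes> C k (as ! i)) \<odot>\<^bsub>M\<^esub> as ! j)" .
    qed (use d as Ci in \<open>auto intro!: M.finsum_closed\<close>)
    also have "\<dots> = (\<Oplus>\<^bsub>M\<^esub>j\<in>{..<n}. \<Oplus>\<^bsub>M\<^esub>k\<in>{..<N}. (d k j \<otimes> C k (as ! i)) \<odot>\<^bsub>M\<^esub> as ! j)"
      using d as Ci by (intro M.finsum_swap) auto
    also have "\<dots> = (\<Oplus>\<^bsub>M\<^esub>j\<in>{..<n}. ?e i j \<odot>\<^bsub>M\<^esub> as ! j)"
    proof (rule M.finsum_cong')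
      fix j assume j: "j \<in> {..<n}"
      have "(\<Oplus>k\<in>A. d k j \<otimes> C k (as ! i)) \<odot>\<^bsub>M\<^esub> as ! j = (\<Oplus>\<^bsub>M\<^esub>k\<in>A. (d k j \<otimes> C k (as ! i)) \<odot>\<^bsub>M\<^esub> as ! j)"
        if "finite A" "A \<subseteq> {..<N}" for A
        using that
      proof (induction A)
        case (insert a A)
        then have "(\<lambda>k. d k j \<otimes> C k (as ! i)) \<in> A \<rightarrow> carrier R" "d a j \<otimes> C a (as ! i) \<in> carrier R"
          using d Ci j by auto
        moreover from this have "(\<lambda>k. (d k j \<otimes> C k (as ! i)) \<odot>\<^bsub>M\<^esub> as ! j) \<in> A \<rightarrow> carrier M"
          using as j by auto
        ultimately show ?case using insert as j
          by (simp add: R.finsum_insert M.finsum_insert smult_l_distr)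
      qed (use as j in simp)
      then show "(\<Oplus>\<^bsub>M\<^esub>k\<in>{..<N}. (d k j \<otimes> C k (as ! i)) \<odot>\<^bsub>M\<^esub> as ! j) = ?e i j \<odot>\<^bsub>M\<^esub> as ! j" by simp
    qed (use ec as i in auto)
    finally have e1: "t \<odot>\<^bsub>M\<^esub> as ! i = (\<Oplus>\<^bsub>M\<^esub>j\<in>{..<n}. ?e i j \<odot>\<^bsub>M\<^esub> as ! j)" .
    have "(\<Oplus>\<^bsub>M\<^esub>j\<in>{..<n}. (if i = j then t else \<zero>) \<odot>\<^bsub>M\<^esub> as ! j) =
        (\<Oplus>\<^bsub>M\<^esub>j\<in>{..<n}. if i = j then t \<odot>\<^bsub>M\<^esub> as ! j else \<zero>\<^bsub>M\<^esub>)"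
      using as tc by (intro M.finsum_cong') auto
    also have "\<dots> = t \<odot>\<^bsub>M\<^esub> as ! i"
      using i as tc by (intro M.finsum_singleton) auto
    finally have e2: "(\<Oplus>\<^bsub>M\<^esub>j\<in>{..<n}. (if i = j then t else \<zero>) \<odot>\<^bsub>M\<^esub> as ! j) = t \<odot>\<^bsub>M\<^esub> as ! i" .
    have "(\<Oplus>\<^bsub>M\<^esub>j\<in>{..<n}. (if i = j then t else \<zero>) \<odot>\<^bsub>M\<^esub> as ! j) =
        (\<Oplus>\<^bsub>M\<^esub>j\<in>{..<n}. ?x i j \<odot>\<^bsub>M\<^esub> as ! j \<oplus>\<^bsub>M\<^esub> ?e i j \<odot>\<^bsub>M\<^esub> as ! j)"
    proof (rule M.finsum_cong')
      fix j assume j: "j \<in> {..<n}"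
      have "(if i = j then t else \<zero>) = ?x i j \<oplus> ?e i j"
        using ec[OF i, of j] j tc by (simp add: R.minus_eq R.a_assoc R.l_neg)
      then show "(if i = j then t else \<zero>) \<odot>\<^bsub>M\<^esub> as ! j = ?x i j \<odot>\<^bsub>M\<^esub> as ! j \<oplus>\<^bsub>M\<^esub> ?e i j \<odot>\<^bsub>M\<^esub> as ! j"
        using ec[OF i, of j] xc[OF i, of j] as[of j] j smult_l_distr[of "?x i j" "?e i j" "as ! j"] by simp
    qed (use ec xc as i in auto)
    also have "\<dots> = (\<Oplus>\<^bsub>M\<^esub>j\<in>{..<n}. ?x i j \<odot>\<^bsub>M\<^esub> as ! j) \<oplus>\<^bsub>M\<^esub> (\<Oplus>\<^bsub>M\<^esub>j\<in>{..<n}. ?e i j \<odot>\<^bsub>M\<^esub> as ! j)"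
      using ec xc as i by (intro M.finsum_addf) auto
    finally have "(\<Oplus>\<^bsub>M\<^esub>j\<in>{..<n}. ?x i j \<odot>\<^bsub>M\<^esub> as ! j) \<oplus>\<^bsub>M\<^esub> t \<odot>\<^bsub>M\<^esub> as ! i = t \<odot>\<^bsub>M\<^esub> as ! i"
      using e1 e2 by simp
    moreover have "(\<Oplus>\<^bsub>M\<^esub>j\<in>{..<n}. ?x i j \<odot>\<^bsub>M\<^esub> as ! j) \<in> carrier M"
      using xc as i by (intro M.finsum_closed) auto
    ultimately show ?thesis using tc as[OF i] by (simp add: M.add.r_cancel_one)
  qed
  have "\<exists>s\<in>carrier R - \<pp>. \<forall>i\<in>{..<n}. \<forall>j<n. s \<otimes> ?x i j = \<zero>"
  proof (rule R.common_denominator[OF \<pp>])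
    show "\<exists>s\<in>carrier R - \<pp>. \<forall>j<n. s \<otimes> ?x i j = \<zero>" if i: "i \<in> {..<n}" for i
    proof -
      have "(\<lambda>j. ?x i j) \<in> {..<n} \<rightarrow> carrier R" using xc i by simp
      moreover have "\<forall>c\<in>{..<n} \<rightarrow> carrier R. (\<Oplus>\<^bsub>M\<^esub>j\<in>{..<n}. c j \<odot>\<^bsub>M\<^esub> as ! j) = \<zero>\<^bsub>M\<^esub> \<longrightarrow>
          (\<exists>t\<in>carrier R - \<pp>. \<forall>j<n. t \<otimes> c j = \<zero>)"
        using lb unfolding local_basis_def by (elim conjE)
      ultimately show ?thesis using rel[of i] i by (auto dest!: bspec)
    qed
    show "\<forall>j<n. s \<otimes> s' \<otimes> ?x i j = \<zero>" if "i \<in> {..<n}" "\<forall>j<n. s' \<otimes> ?x i j = \<zero>" "s \<in> carrier R" "s' \<in> carrier R" for i s s'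
    proof (intro allI impI)
      fix j assume j: "j < n"
      have "s \<otimes> s' \<otimes> ?x i j = s \<otimes> (s' \<otimes> ?x i j)" using that xc[of i j] j by (intro R.m_assoc) auto
      also have "s' \<otimes> ?x i j = \<zero>" using that(2) j by blast
      finally show "s \<otimes> s' \<otimes> ?x i j = \<zero>" using that(3) by simp
    qed
  qed simp
  then obtain s where s: "s \<in> carrier R - \<pp>" and sx': "\<forall>i\<in>{..<n}. \<forall>j<n. s \<otimes> ?x i j = \<zero>" by blast
  have sx: "s \<otimes> ?x i j = \<zero>" if "i < n" "j < n" for i j using bspec[OF sx', of i] that by blast
  have sc: "s \<in> carrier R" using s by blast
  have entry: "(if i = j then s \<otimes> t else \<zero>) = (\<Oplus>k\<in>{..<N}. d k i \<otimes> (s \<otimes> C k (as ! j)))" if "i < n" "j < n" for i j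
  proof -
    have "s \<otimes> (if j = i then t else \<zero>) \<ominus> s \<otimes> ?e j i = s \<otimes> ?x j i"
      using sc tc ec[OF that(2,1)] by (simp add: R.minus_eq R.r_distr R.r_minus)
    then have "s \<otimes> (if j = i then t else \<zero>) = s \<otimes> ?e j i"
      using sx[OF that(2,1)] sc tc ec[OF that(2,1)] by (simp split: if_splits)
    also have "\<dots> = (\<Oplus>k\<in>{..<N}. s \<otimes> (d k i \<otimes> C k (as ! j)))"
      using sc d C_closed as that by (intro R.finsum_rdistr) auto
    also have "\<dots> = (\<Oplus>k\<in>{..<N}. d k i \<otimes> (s \<otimes> C k (as ! j)))"
      using sc d C_closed as that by (intro R.finsum_cong') (auto simp: R.m_lcomm)
    finally have e: "s \<otimes> (if j = i then t else \<zero>) = (\<Oplus>k\<in>{..<N}. d k i \<otimes> (s \<otimes> C k (as ! j)))" .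
    show ?thesis unfolding e[symmetric] using sc by (cases "i = j") simp_all
  qed
  let ?F = "{..<n} \<rightarrow>\<^sub>E {..<N}"
  let ?D = "\<lambda>f. determinant R n (\<lambda>i j. C (f i) (as ! j))"
  have Fj: "f j < N" if "f \<in> ?F" "j < n" for f j using that by (auto simp: PiE_iff)
  have Dsq: "R.square n (\<lambda>i j. C (f i) (as ! j))" if "f \<in> ?F" for f
    using C_closed as Fj[OF that] by (auto simp: R.square_def)
  let ?c = "\<lambda>f. (\<Otimes>i\<in>{..<n}. d (f i) i) \<otimes> (\<Otimes>i\<in>{..<n}. s)"
  have cc: "?c f \<in> carrier R" if "f \<in> ?F" for f
    using d Fj[OF that] sc by (auto intro!: R.m_closed R.finprod_closed)
  have sq1: "R.square n (\<lambda>i j. \<Oplus>k\<in>{..<N}. d k i \<otimes> (s \<otimes> C k (as ! j)))"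
    using sc d C_closed as by (auto simp: R.square_def intro!: R.finsum_closed)
  have "(s \<otimes> t) [^] n = (\<Otimes>i\<in>{..<n}. s \<otimes> t)" using sc tc by (subst R.finprod_const) auto
  also have "\<dots> = determinant R n (\<lambda>i j. if i = j then s \<otimes> t else \<zero>)"
    using sc tc by (intro R.determinant_diag[symmetric]) auto
  also have "\<dots> = determinant R n (\<lambda>i j. \<Oplus>k\<in>{..<N}. d k i \<otimes> (s \<otimes> C k (as ! j)))"
    using entry by (intro R.determinant_cong[OF sq1]) auto
  also have "\<dots> = (\<Oplus>f\<in>?F. (\<Otimes>i\<in>{..<n}. d (f i) i) \<otimes> determinant R n (\<lambda>i j. s \<otimes> C (f i) (as ! j)))"
    using sc d C_closed as by (intro R.determinant_product_expand) auto
  also have "\<dots> = (\<Oplus>f\<in>?F. ?c f \<otimes> ?D f)"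
  proof (rule R.finsum_cong')
    fix f assume f: "f \<in> ?F"
    have "determinant R n (\<lambda>i j. s \<otimes> C (f i) (as ! j)) = (\<Otimes>i\<in>{..<n}. s) \<otimes> ?D f"
      using sc by (intro R.determinant_scale_rows[OF Dsq[OF f]]) auto
    then show "(\<Otimes>i\<in>{..<n}. d (f i) i) \<otimes> determinant R n (\<lambda>i j. s \<otimes> C (f i) (as ! j)) = ?c f \<otimes> ?D f"
      using d Fj[OF f] sc R.determinant_closed[OF Dsq[OF f]] by (subst R.m_assoc) (auto intro!: R.finprod_closed)
  qed (use cc Dsq in auto)
  finally have st: "(s \<otimes> t) [^] n = (\<Oplus>f\<in>?F. ?c f \<otimes> ?D f)" .
  interpret U: cring "UP R" by (rule R.cring_UP)
  interpret k: coeff_hom R "UP R" "const R" by (rule R.const_hom)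
  have "const R ((s \<otimes> t) [^] n) \<otimes>\<^bsub>UP R\<^esub> z = \<zero>\<^bsub>UP R\<^esub>"
    if z: "z \<in> carrier (UP R)"
      and ann: "\<And>f. (\<And>j. j < n \<Longrightarrow> f j < N) \<Longrightarrow>
        z \<otimes>\<^bsub>UP R\<^esub> determinant (UP R) n (\<lambda>i j. const R (C (f j) (as ! i))) = \<zero>\<^bsub>UP R\<^esub>" for z
  proof -
    have zD: "z \<otimes>\<^bsub>UP R\<^esub> const R (?D f) = \<zero>\<^bsub>UP R\<^esub>" if f: "f \<in> ?F" for f
    proof -
      have sq: "U.square n (\<lambda>i j. const R (C (f i) (as ! j)))"
        using C_closed as Fj[OF f] by (auto simp: U.square_def)
      have "const R (?D f) = determinant (UP R) n (\<lambda>i j. const R (C (f i) (as ! j)))"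
        by (rule k.hom_determinant[OF Dsq[OF f]])
      also have "\<dots> = determinant (UP R) n (\<lambda>i j. const R (C (f j) (as ! i)))"
        using U.determinant_transpose[OF sq] by simp
      finally show ?thesis using ann[OF Fj[OF f]] by simp
    qed
    have Dc: "?D f \<in> carrier R" if "f \<in> ?F" for f using R.determinant_closed[OF Dsq[OF that]] .
    have "const R ((s \<otimes> t) [^] n) = (\<Oplus>\<^bsub>UP R\<^esub>f\<in>?F. const R (?c f \<otimes> ?D f))"
      unfolding st using cc Dc by (subst k.H.hom_finsum) (auto simp: comp_def)
    then have "const R ((s \<otimes> t) [^] n) \<otimes>\<^bsub>UP R\<^esub> z = (\<Oplus>\<^bsub>UP R\<^esub>f\<in>?F. const R (?c f \<otimes> ?D f)) \<otimes>\<^bsub>UP R\<^esub> z" by simp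
    also have "\<dots> = (\<Oplus>\<^bsub>UP R\<^esub>f\<in>?F. const R (?c f \<otimes> ?D f) \<otimes>\<^bsub>UP R\<^esub> z)"
      using cc Dc z by (intro U.finsum_ldistr) (auto intro!: finite_PiE)
    also have "\<dots> = (\<Oplus>\<^bsub>UP R\<^esub>f\<in>?F. \<zero>\<^bsub>UP R\<^esub>)"
    proof (rule U.finsum_cong')
      fix f assume f: "f \<in> ?F"
      have "const R (?c f \<otimes> ?D f) \<otimes>\<^bsub>UP R\<^esub> z = const R (?c f) \<otimes>\<^bsub>UP R\<^esub> (z \<otimes>\<^bsub>UP R\<^esub> const R (?D f))"
        using k.H.hom_mult[OF cc[OF f] Dc[OF f]] k.H.hom_closed[OF cc[OF f]] k.H.hom_closed[OF Dc[OF f]] z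
        by (simp only: U.m_assoc U.m_comm[of z])
      then show "const R (?c f \<otimes> ?D f) \<otimes>\<^bsub>UP R\<^esub> z = \<zero>\<^bsub>UP R\<^esub>"
        using zD[OF f] k.H.hom_closed[OF cc[OF f]] by (simp only: U.r_null)
    qed auto
    finally show ?thesis by simp
  qed
  moreover have "(s \<otimes> t) [^] n \<in> carrier R - \<pp>"
    using R.prime_compl_pow[OF \<pp> R.prime_compl_mult[OF \<pp> s t]] .
  ultimately show ?thesis by blast
qed

lemma is_charpolyI:
  assumes q: "q \<in> carrier (UP R)" and u: "\<And>x. x \<in> P \<Longrightarrow> u x \<in> P"
    and C': "\<And>k x. k < N \<Longrightarrow> x \<in> P \<Longrightarrow> C' k x = C k (u x)"
    and pencil: "\<And>f xs. (\<And>j. j < n \<Longrightarrow> f j < N) \<Longrightarrow> xs \<in> tuples n P \<Longrightarrow>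
      pencil R n (\<lambda>j. C (f j)) (\<lambda>j. C' (f j)) q xs = \<zero>\<^bsub>UP R\<^esub>"
  shows "is_charpoly R M P n u q"
  unfolding is_charpoly_def
proof (intro conjI allI impI q)
  fix \<pp> as t c
  assume \<pp>: "primeideal \<pp> R" and lb: "local_basis R M P n \<pp> as" and t: "t \<in> carrier R - \<pp>"
    and c: "\<forall>j<n. \<forall>k<n. c j k \<in> carrier R"
    and tu: "\<forall>k<n. t \<odot>\<^bsub>M\<^esub> u (as ! k) = (\<Oplus>\<^bsub>M\<^esub>j\<in>{..<n}. c j k \<odot>\<^bsub>M\<^esub> as ! j)"
  interpret U: UP_cring R "UP R" by (rule R.UP_cring_self)
  let ?S = "UP R"
  have ast: "as \<in> tuples n P" using lb by (simp add: local_basis_def)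
  have asP: "as ! j \<in> P" if "j < n" for j using tuples_nth[OF ast that] .
  then have as: "as ! j \<in> carrier M" if "j < n" for j using that P_carrier by blast
  have tc: "t \<in> carrier R" using t by blast
  let ?A = "\<lambda>j k. pencil_entry R (if j = k then t else \<zero>) (c j k)"
  let ?\<Delta> = "determinant ?S n ?A"
  have sqA: "U.P.square n ?A" using c tc by (auto simp: U.P.square_def)
  have \<Delta>: "?\<Delta> \<in> carrier ?S" by (rule U.P.determinant_closed[OF sqA])
  have tn: "const R (t [^] n) \<in> carrier ?S" using tc by simp
  let ?z = "const R (t [^] n) \<otimes>\<^bsub>?S\<^esub> q \<ominus>\<^bsub>?S\<^esub> ?\<Delta>"
  have zc: "?z \<in> carrier ?S" using tn q \<Delta> by simp
  have ann: "?z \<otimes>\<^bsub>?S\<^esub> determinant ?S n (\<lambda>i j. const R (C (f j) (as ! i))) = \<zero>\<^bsub>?S\<^esub>"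
    if f: "\<And>j. j < n \<Longrightarrow> f j < N" for f
  proof -
    let ?B = "\<lambda>i j. const R (C (f j) (as ! i))"
    let ?T = "\<lambda>i j. pencil_entry R (C (f j) (as ! i)) (C' (f j) (as ! i))"
    have Cc: "C (f j) (as ! i) \<in> carrier R" if "i < n" "j < n" for i j using C_closed[OF f[OF that(2)] as[OF that(1)]] .
    have uM: "u (as ! i) \<in> carrier M" if "i < n" for i using u[OF asP[OF that]] P_carrier by blast
    have C'c: "C' (f j) (as ! i) \<in> carrier R" if "i < n" "j < n" for i j
      using C'[OF f[OF that(2)] asP[OF that(1)]] C_closed[OF f[OF that(2)] uM[OF that(1)]] by simp
    have sqB: "U.P.square n ?B" and sqT: "U.P.square n ?T" using Cc C'c by (auto simp: U.P.square_def)
    have ent: "const R t \<otimes>\<^bsub>?S\<^esub> ?T i j = (\<Oplus>\<^bsub>?S\<^esub>k\<in>{..<n}. ?A k i \<otimes>\<^bsub>?S\<^esub> ?B k j)" if ij: "i < n" "j < n" for i j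
    proof -
      have "t \<otimes> C' (f j) (as ! i) = C (f j) (t \<odot>\<^bsub>M\<^esub> u (as ! i))"
        using C'[OF f[OF ij(2)] asP[OF ij(1)]] C_smult[OF f[OF ij(2)] uM[OF ij(1)] tc] by simp
      also have "\<dots> = C (f j) (\<Oplus>\<^bsub>M\<^esub>k\<in>{..<n}. c k i \<odot>\<^bsub>M\<^esub> as ! k)" using tu ij by simp
      also have "\<dots> = (\<Oplus>k\<in>{..<n}. C (f j) (c k i \<odot>\<^bsub>M\<^esub> as ! k))"
        using c as ij by (intro C_finsum[OF f[OF ij(2)]]) auto
      also have "\<dots> = (\<Oplus>k\<in>{..<n}. c k i \<otimes> C (f j) (as ! k))"
        using c Cc as ij C_smult[OF f[OF ij(2)]] by (intro R.finsum_cong') auto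
      finally have e2: "t \<otimes> C' (f j) (as ! i) = (\<Oplus>k\<in>{..<n}. c k i \<otimes> C (f j) (as ! k))" .
      have "(\<Oplus>k\<in>{..<n}. (if k = i then t else \<zero>) \<otimes> C (f j) (as ! k)) =
        (\<Oplus>k\<in>{..<n}. if i = k then t \<otimes> C (f j) (as ! k) else \<zero>)"
        using tc Cc ij by (intro R.finsum_cong') auto
      also have "\<dots> = t \<otimes> C (f j) (as ! i)" using tc Cc ij by (intro R.finsum_singleton) auto
      finally have e1: "t \<otimes> C (f j) (as ! i) = (\<Oplus>k\<in>{..<n}. (if k = i then t else \<zero>) \<otimes> C (f j) (as ! k))" by simp
      have sum: "pencil_entry R (\<Oplus>k\<in>X. a k) (\<Oplus>k\<in>X. b k) = (\<Oplus>\<^bsub>?S\<^esub>k\<in>X. pencil_entry R (a k) (b k))"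
        if "finite X" "a \<in> X \<rightarrow> carrier R" "b \<in> X \<rightarrow> carrier R" for X :: "nat set" and a b
        using that
      proof (induction X)
        case empty
        show ?case by (simp add: pencil_entry_def)
      next
        case (insert x X)
        then have cl: "a \<in> X \<rightarrow> carrier R" "b \<in> X \<rightarrow> carrier R" "a x \<in> carrier R" "b x \<in> carrier R" by auto
        then have "(\<lambda>k. pencil_entry R (a k) (b k)) \<in> X \<rightarrow> carrier ?S" by (auto simp: Pi_iff)
        then show ?case using insert cl
          by (simp add: R.finsum_insert U.P.finsum_insert R.pencil_entry_add)
      qed
      have "const R t \<otimes>\<^bsub>?S\<^esub> ?T i j = pencil_entry R (t \<otimes> C (f j) (as ! i)) (t \<otimes> C' (f j) (as ! i))"
        using R.pencil_entry_smult[OF Cc[OF ij] C'c[OF ij] tc] by simp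
      also have "\<dots> = (\<Oplus>\<^bsub>?S\<^esub>k\<in>{..<n}. pencil_entry R ((if k = i then t else \<zero>) \<otimes> C (f j) (as ! k)) (c k i \<otimes> C (f j) (as ! k)))"
        unfolding e1 e2 using tc c Cc ij by (intro sum) auto
      also have "\<dots> = (\<Oplus>\<^bsub>?S\<^esub>k\<in>{..<n}. ?A k i \<otimes>\<^bsub>?S\<^esub> ?B k j)"
      proof (rule U.P.finsum_cong')
        fix k assume k: "k \<in> {..<n}"
        let ?a = "if k = i then t else \<zero>"
        have cl: "?a \<in> carrier R" "c k i \<in> carrier R" "C (f j) (as ! k) \<in> carrier R" using tc c Cc k ij by auto
        show "pencil_entry R (?a \<otimes> C (f j) (as ! k)) (c k i \<otimes> C (f j) (as ! k)) = ?A k i \<otimes>\<^bsub>?S\<^esub> ?B k j"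
          using R.pencil_entry_smult[OF cl(1,2,3)] cl
          by (simp only: R.m_comm[OF cl(1) cl(3)] R.m_comm[OF cl(2) cl(3)]
              U.P.m_comm[OF R.pencil_entry_closed[OF cl(1,2)] R.const_closed[OF cl(3)]])
      qed (use sqA sqB ij in \<open>auto simp: U.P.square_def\<close>)
      finally show ?thesis .
    qed
    have tS: "const R t \<in> carrier ?S" using tc by simp
    have "(\<Otimes>\<^bsub>?S\<^esub>i\<in>{..<n}. const R t) \<otimes>\<^bsub>?S\<^esub> determinant ?S n ?T = determinant ?S n (\<lambda>i j. const R t \<otimes>\<^bsub>?S\<^esub> ?T i j)"
      using tS by (intro U.P.determinant_scale_rows[OF sqT, symmetric]) auto
    also have "\<dots> = determinant ?S n (\<lambda>i j. \<Oplus>\<^bsub>?S\<^esub>k\<in>{..<n}. ?A k i \<otimes>\<^bsub>?S\<^esub> ?B k j)"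
      using ent sqA sqB by (intro U.P.determinant_cong) (auto simp: U.P.square_def intro!: U.P.finsum_closed)
    also have "\<dots> = determinant ?S n (\<lambda>i j. ?A j i) \<otimes>\<^bsub>?S\<^esub> determinant ?S n ?B"
      using sqA by (intro U.P.determinant_mult[OF _ sqB]) (auto simp: U.P.square_def)
    also have "determinant ?S n (\<lambda>i j. ?A j i) = ?\<Delta>" by (rule U.P.determinant_transpose[OF sqA])
    finally have e: "(\<Otimes>\<^bsub>?S\<^esub>i\<in>{..<n}. const R t) \<otimes>\<^bsub>?S\<^esub> determinant ?S n ?T = ?\<Delta> \<otimes>\<^bsub>?S\<^esub> determinant ?S n ?B" .
    have dB: "determinant ?S n ?B \<in> carrier ?S" and dT: "determinant ?S n ?T \<in> carrier ?S"
      using U.P.determinant_closed sqB sqT by auto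
    have "(\<Otimes>\<^bsub>?S\<^esub>i\<in>{..<n}. const R t) = const R t [^]\<^bsub>?S\<^esub> n" using tS by (subst U.P.finprod_const) auto
    also have "\<dots> = const R (t [^] n)"
      using ring_hom_cring.hom_pow[OF coeff_hom.axioms(1)[OF R.const_hom] tc, of n] by simp
    finally have pw: "(\<Otimes>\<^bsub>?S\<^esub>i\<in>{..<n}. const R t) = const R (t [^] n)" .
    have "determinant ?S n ?T \<ominus>\<^bsub>?S\<^esub> q \<otimes>\<^bsub>?S\<^esub> determinant ?S n ?B = \<zero>\<^bsub>?S\<^esub>"
      using pencil[OF f ast] by (simp add: pencil_def)
    then have "determinant ?S n ?T = q \<otimes>\<^bsub>?S\<^esub> determinant ?S n ?B" using dB dT q by simp
    then have "const R (t [^] n) \<otimes>\<^bsub>?S\<^esub> (q \<otimes>\<^bsub>?S\<^esub> determinant ?S n ?B) = ?\<Delta> \<otimes>\<^bsub>?S\<^esub> determinant ?S n ?B"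
      using e pw by simp
    then have "(const R (t [^] n) \<otimes>\<^bsub>?S\<^esub> q) \<otimes>\<^bsub>?S\<^esub> determinant ?S n ?B \<ominus>\<^bsub>?S\<^esub> ?\<Delta> \<otimes>\<^bsub>?S\<^esub> determinant ?S n ?B = \<zero>\<^bsub>?S\<^esub>"
      using tn q dB \<Delta> by (simp add: U.P.m_assoc)
    then show ?thesis using tn q dB \<Delta> by (simp add: U.P.minus_eq U.P.l_distr U.P.l_minus)
  qed
  obtain v where v: "v \<in> carrier R - \<pp>" and vz: "const R v \<otimes>\<^bsub>?S\<^esub> ?z = \<zero>\<^bsub>?S\<^esub>"
    using local_minors[OF lb \<pp>] zc ann by blast
  have vS: "const R v \<in> carrier ?S" using v by simp
  have "const R v \<otimes>\<^bsub>?S\<^esub> (const R (t [^] n) \<otimes>\<^bsub>?S\<^esub> q) \<ominus>\<^bsub>?S\<^esub> const R v \<otimes>\<^bsub>?S\<^esub> ?\<Delta> = \<zero>\<^bsub>?S\<^esub>"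
    using vz vS tn q \<Delta> by (simp add: U.P.minus_eq U.P.r_distr U.P.r_minus)
  then have "const R v \<otimes>\<^bsub>?S\<^esub> (const R (t [^] n) \<otimes>\<^bsub>?S\<^esub> q) = const R v \<otimes>\<^bsub>?S\<^esub> ?\<Delta>"
    using vS tn q \<Delta> by simp
  moreover have "t [^] n \<in> carrier R" "v \<in> carrier R" using tc v by auto
  ultimately have "v \<odot>\<^bsub>?S\<^esub> ((t [^] n) \<odot>\<^bsub>?S\<^esub> q) = v \<odot>\<^bsub>?S\<^esub> ?\<Delta>"
    using q \<Delta> tn by (simp add: R.UP_smult_eq)
  then show "\<exists>v\<in>carrier R - \<pp>. v \<odot>\<^bsub>UP R\<^esub> ((t [^] n) \<odot>\<^bsub>UP R\<^esub> q) =
      v \<odot>\<^bsub>UP R\<^esub> determinant (UP R) n (\<lambda>j k. monom (UP R) (if j = k then t else \<zero>) 1 \<ominus>\<^bsub>UP R\<^esub> monom (UP R) (c j k) 0)"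
    using v by (auto simp: pencil_entry_def)
qed

lemma is_charpoly_unique:
  assumes rank: "has_rank R M P n" and u: "\<And>x. x \<in> P \<Longrightarrow> u x \<in> P"
    and q: "is_charpoly R M P n u q" and q': "is_charpoly R M P n u q'"
  shows "q = q'"
proof -
  interpret U: UP_cring R "UP R" by (rule R.UP_cring_self)
  let ?S = "UP R"
  have qc: "q \<in> carrier ?S" "q' \<in> carrier ?S" using q q' by (auto simp: is_charpoly_def)
  let ?J = "{a \<in> carrier R. a \<odot>\<^bsub>?S\<^esub> q = a \<odot>\<^bsub>?S\<^esub> q'}"
  have J: "ideal ?J R"
  proof (rule idealI[OF R.ring_axioms])
    show "subgroup ?J (add_monoid R)"
    proof (rule R.add.subgroupI)
      show "\<ominus> a \<in> ?J" if "a \<in> ?J" for a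
        using that qc U.smult_l_minus[of a q] U.smult_l_minus[of a q'] by (simp add: a_inv_def[symmetric])
      show "a \<oplus> b \<in> ?J" if "a \<in> ?J" "b \<in> ?J" for a b
        using that qc by (simp add: U.UP_smult_l_distr)
    qed (use qc in auto)
    show "x \<otimes> a \<in> ?J" if "a \<in> ?J" "x \<in> carrier R" for a x
      using that qc by (simp add: U.UP_smult_assoc1)
    then show "a \<otimes> x \<in> ?J" if "a \<in> ?J" "x \<in> carrier R" for a x
      using that by (simp add: R.m_comm)
  qed
  have "\<one> \<in> ?J"
  proof (rule ccontr)
    assume "\<one> \<notin> ?J"
    then obtain \<pp> where \<pp>: "primeideal \<pp> R" and J\<pp>: "?J \<subseteq> \<pp>" using R.exists_primeideal[OF J] by blast
    obtain as where lb: "local_basis R M P n \<pp> as" using rank \<pp> by (auto simp: has_rank_def)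
    have "as ! j \<in> P" if "j < n" for j using lb that tuples_nth unfolding local_basis_def by blast
    then obtain t d where t: "t \<in> carrier R - \<pp>" and d: "\<And>k j. k < n \<Longrightarrow> j < n \<Longrightarrow> d k j \<in> carrier R"
      and td: "\<And>k. k < n \<Longrightarrow> t \<odot>\<^bsub>M\<^esub> u (as ! k) = (\<Oplus>\<^bsub>M\<^esub>j\<in>{..<n}. d k j \<odot>\<^bsub>M\<^esub> as ! j)"
      using local_basis_expand[OF lb \<pp>, of n "\<lambda>k. u (as ! k)"] u by blast
    let ?\<Delta> = "determinant ?S n (\<lambda>j k. monom ?S (if j = k then t else \<zero>) 1 \<ominus>\<^bsub>?S\<^esub> monom ?S (d k j) 0)"
    have tc: "t \<in> carrier R" using t by blast
    have \<Delta>: "?\<Delta> \<in> carrier ?S" using tc d by (intro U.P.determinant_closed) (auto simp: U.P.square_def)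
    have ex: "\<exists>v\<in>carrier R - \<pp>. v \<odot>\<^bsub>?S\<^esub> ((t [^] n) \<odot>\<^bsub>?S\<^esub> r) = v \<odot>\<^bsub>?S\<^esub> ?\<Delta>" if "is_charpoly R M P n u r" for r
      using that \<pp> lb t d td unfolding is_charpoly_def
      by (elim conjE allE[of _ \<pp>] allE[of _ as] allE[of _ t] allE[of _ "\<lambda>j k. d k j"]) simp
    obtain v where v: "v \<in> carrier R - \<pp>" "v \<odot>\<^bsub>?S\<^esub> ((t [^] n) \<odot>\<^bsub>?S\<^esub> q) = v \<odot>\<^bsub>?S\<^esub> ?\<Delta>" using ex[OF q] by blast
    obtain w where w: "w \<in> carrier R - \<pp>" "w \<odot>\<^bsub>?S\<^esub> ((t [^] n) \<odot>\<^bsub>?S\<^esub> q') = w \<odot>\<^bsub>?S\<^esub> ?\<Delta>" using ex[OF q'] by blast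
    have vc: "v \<in> carrier R" "w \<in> carrier R" "t [^] n \<in> carrier R" using v w tc by auto
    have "(w \<otimes> v \<otimes> t [^] n) \<odot>\<^bsub>?S\<^esub> q = w \<odot>\<^bsub>?S\<^esub> (v \<odot>\<^bsub>?S\<^esub> ?\<Delta>)"
      using v(2) vc qc by (simp add: U.UP_smult_assoc1)
    also have "\<dots> = v \<odot>\<^bsub>?S\<^esub> (w \<odot>\<^bsub>?S\<^esub> ?\<Delta>)"
      using vc \<Delta> by (simp add: U.UP_smult_assoc1[symmetric] R.m_comm)
    also have "\<dots> = (v \<otimes> w \<otimes> t [^] n) \<odot>\<^bsub>?S\<^esub> q'"
      using w(2) vc qc by (simp add: U.UP_smult_assoc1)
    finally have "w \<otimes> v \<otimes> t [^] n \<in> ?J" using vc by (simp add: R.m_comm)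
    moreover have "w \<otimes> v \<otimes> t [^] n \<in> carrier R - \<pp>"
      using R.prime_compl_mult[OF \<pp> R.prime_compl_mult[OF \<pp> w(1) v(1)] R.prime_compl_pow[OF \<pp> t]] .
    ultimately show False using J\<pp> by blast
  qed
  then show ?thesis using qc by simp
qed

lemma charpoly_eqI:
  assumes "has_rank R M P n" and "\<And>x. x \<in> P \<Longrightarrow> u x \<in> P" and "is_charpoly R M P n u q"
  shows "charpoly R M P n u = q"
  unfolding charpoly_def using is_charpoly_unique[OF assms(1,2)] assms(3) by (intro the_equality) auto

end

section \<open>Descent from \<open>R \<otimes> \<O>\<^sub>F\<close> to \<open>R\<close>\<close>

locale base_change = ramified K + R: cring R
  for K :: "'f ramext" and R :: "('r, 'x) ring_scheme" (structure) +
  fixes \<iota> :: "'f \<Rightarrow> 'r"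
  assumes \<iota>_hom: "\<iota> \<in> ring_hom (int_ring0 K) R"
begin

abbreviation "M0 \<equiv> ring_as_module \<O>"
abbreviation "R' \<equiv> bc_ring K R \<iota>"

lemma M0_simps [simp]:
  "carrier M0 = carrier \<O>" "x \<oplus>\<^bsub>M0\<^esub> y = x \<oplus>\<^bsub>F\<^esub> y" "a \<odot>\<^bsub>M0\<^esub> x = a \<otimes>\<^bsub>F\<^esub> x"
  by (simp_all add: ring_as_module_def)

lemma O_closed: "x \<in> carrier \<O> \<Longrightarrow> x \<in> carrier F" by (simp add: int_iff)

lemma O0_base: "x \<in> carrier \<O>\<^sub>0 \<Longrightarrow> x \<in> base K" by (simp add: int0_iff)

lemma O_mult: "x \<in> carrier \<O> \<Longrightarrow> y \<in> carrier \<O> \<Longrightarrow> x \<otimes>\<^bsub>F\<^esub> y \<in> carrier \<O>"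
  using subringE(6)[OF int_subring] .

lemma O_add: "x \<in> carrier \<O> \<Longrightarrow> y \<in> carrier \<O> \<Longrightarrow> x \<oplus>\<^bsub>F\<^esub> y \<in> carrier \<O>"
  using subringE(7)[OF int_subring] .

lemma O_one: "\<one>\<^bsub>F\<^esub> \<in> carrier \<O>" using subringE(3)[OF int_subring] .

lemma tdata: "tensor_data R \<O>\<^sub>0 \<iota> M0"
  using ring_hom_closed[OF \<iota>_hom] O_mult O_add by unfold_locales (auto simp: int0_iff)

sublocale t: tensor_data R \<O>\<^sub>0 \<iota> M0 by (rule tdata)

abbreviation "T \<equiv> tensor \<O>\<^sub>0 \<iota> R M0"
abbreviation "pt \<equiv> pure_tensor \<O>\<^sub>0 \<iota> R M0"

lemma \<iota>_closed: "a \<in> carrier \<O>\<^sub>0 \<Longrightarrow> \<iota> a \<in> carrier R" using ring_hom_closed[OF \<iota>_hom] .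
lemma \<iota>_add: "a \<in> carrier \<O>\<^sub>0 \<Longrightarrow> b \<in> carrier \<O>\<^sub>0 \<Longrightarrow> \<iota> (a \<oplus>\<^bsub>F\<^esub> b) = \<iota> a \<oplus> \<iota> b"
  using ring_hom_add[OF \<iota>_hom] by simp
lemma \<iota>_mult: "a \<in> carrier \<O>\<^sub>0 \<Longrightarrow> b \<in> carrier \<O>\<^sub>0 \<Longrightarrow> \<iota> (a \<otimes>\<^bsub>F\<^esub> b) = \<iota> a \<otimes> \<iota> b"
  using ring_hom_mult[OF \<iota>_hom] by simp
lemma \<iota>_one: "\<iota> \<one>\<^bsub>F\<^esub> = \<one>" using ring_hom_one[OF \<iota>_hom] by simp
lemma \<iota>_zero: "\<iota> \<zero>\<^bsub>F\<^esub> = \<zero>"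
  using ring_hom_zero[OF \<iota>_hom] O0_cring R.ring_axioms by (simp add: cring_def)

lemma unif0_int: "unif0 K \<in> carrier \<O>\<^sub>0"
  using O_mult[OF p_int p_int] p0_base by (simp add: p_p int0_iff)

text \<open>
  \<open>R \<otimes> \<O>\<^sub>F\<close> is free over \<open>R\<close> with basis \<open>1, \<pi>\<close>. All ring axioms are checked on the two coordinates \<open>A\<close>, \<open>B\<close>
  below, which avoids computing with the convolution product.
\<close>

definition "co f = evc R R (\<lambda>c. c) (\<lambda>x. \<iota> (f x))"

lemma re_functional: "functional R R (\<lambda>c. c) (carrier M0) (tensor_rels \<O>\<^sub>0 \<iota> R M0) (\<lambda>x. \<iota> (re x))"
  and im_functional: "functional R R (\<lambda>c. c) (carrier M0) (tensor_rels \<O>\<^sub>0 \<iota> R M0) (\<lambda>x. \<iota> (im x))"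
proof -
  have id: "coeff_hom R R (\<lambda>c. c)" by (rule coeff_hom_id[OF R.is_cring])
  show "functional R R (\<lambda>c. c) (carrier M0) (tensor_rels \<O>\<^sub>0 \<iota> R M0) (\<lambda>x. \<iota> (re x))"
    by (rule coeff_hom.tensor_functional[OF id tdata])
      (auto simp: re_im_int \<iota>_closed \<iota>_add \<iota>_mult re_im_add re_im_smult O_closed O0_base)
  show "functional R R (\<lambda>c. c) (carrier M0) (tensor_rels \<O>\<^sub>0 \<iota> R M0) (\<lambda>x. \<iota> (im x))"
    by (rule coeff_hom.tensor_functional[OF id tdata])
      (auto simp: re_im_int \<iota>_closed \<iota>_add \<iota>_mult re_im_add re_im_smult O_closed O0_base)
qed

abbreviation "A \<equiv> co re"
abbreviation "B \<equiv> co im"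

lemma T_module: "module R T" by (rule t.tensor_module)

lemma AB_closed [simp]: "x \<in> carrier T \<Longrightarrow> A x \<in> carrier R" "x \<in> carrier T \<Longrightarrow> B x \<in> carrier R"
  using functional.evc_closed[OF re_functional] functional.evc_closed[OF im_functional]
  by (simp_all add: co_def tensor_def)

lemma AB_add:
  "x \<in> carrier T \<Longrightarrow> y \<in> carrier T \<Longrightarrow> A (x \<oplus>\<^bsub>T\<^esub> y) = A x \<oplus> A y"
  "x \<in> carrier T \<Longrightarrow> y \<in> carrier T \<Longrightarrow> B (x \<oplus>\<^bsub>T\<^esub> y) = B x \<oplus> B y"
  using functional.evc_add[OF re_functional] functional.evc_add[OF im_functional]
  by (simp_all add: co_def tensor_def)

lemma AB_smult:
  "x \<in> carrier T \<Longrightarrow> c \<in> carrier R \<Longrightarrow> A (c \<odot>\<^bsub>T\<^esub> x) = c \<otimes> A x"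
  "x \<in> carrier T \<Longrightarrow> c \<in> carrier R \<Longrightarrow> B (c \<odot>\<^bsub>T\<^esub> x) = c \<otimes> B x"
  using functional.evc_smult[OF re_functional] functional.evc_smult[OF im_functional]
  by (simp_all add: co_def tensor_def)

lemma AB_pure:
  assumes "x \<in> carrier \<O>" "c \<in> carrier R"
  shows "A (pt x c) = c \<otimes> \<iota> (re x)" "B (pt x c) = c \<otimes> \<iota> (im x)"
  using functional.evc_single[OF re_functional, of x c] functional.evc_single[OF im_functional, of x c] assms
  by (simp_all add: co_def pure_tensor_def)

lemma pt_closed: "x \<in> carrier \<O> \<Longrightarrow> c \<in> carrier R \<Longrightarrow> pt x c \<in> carrier T"
  using t.pure_tensor_closed by simp

definition "mk a b = a \<odot>\<^bsub>T\<^esub> pt \<one>\<^bsub>F\<^esub> \<one> \<oplus>\<^bsub>T\<^esub> b \<odot>\<^bsub>T\<^esub> pt p \<one>"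

lemma re_im_base: "a \<in> base K \<Longrightarrow> re a = a" "a \<in> base K \<Longrightarrow> im a = \<zero>\<^bsub>F\<^esub>"
  using re_im_eqI[of a "\<zero>\<^bsub>F\<^esub>" a] base_closed subringE(2)[OF base_subring] by auto

lemma re_im_p: "re p = \<zero>\<^bsub>F\<^esub>" "im p = \<one>\<^bsub>F\<^esub>"
  using re_im_eqI[of "\<zero>\<^bsub>F\<^esub>" "\<one>\<^bsub>F\<^esub>" p] subringE(2,3)[OF base_subring] by auto

lemma re_im_one: "re \<one>\<^bsub>F\<^esub> = \<one>\<^bsub>F\<^esub>" "im \<one>\<^bsub>F\<^esub> = \<zero>\<^bsub>F\<^esub>"
  using re_im_base subringE(3)[OF base_subring] by auto

lemma T_decomp:
  assumes "x \<in> carrier T" shows "x = mk (A x) (B x)"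
proof -
  interpret T: module R T by (rule T_module)
  have p1: "pt \<one>\<^bsub>F\<^esub> \<one> \<in> carrier T" "pt p \<one> \<in> carrier T" using pt_closed O_one p_int by auto
  show ?thesis using assms
  proof (induction rule: t.tensor_induct)
    case (pure x c)
    then have x: "x \<in> carrier \<O>" by simp
    have r: "re x \<in> carrier \<O>\<^sub>0" "im x \<in> carrier \<O>\<^sub>0" using re_im_int[OF x] by auto
    have rF: "re x \<in> carrier \<O>" "im x \<in> carrier \<O>" using r by (auto simp: int0_iff)
    have "pt x \<one> = pt (re x \<odot>\<^bsub>M0\<^esub> \<one>\<^bsub>F\<^esub> \<oplus>\<^bsub>M0\<^esub> im x \<odot>\<^bsub>M0\<^esub> p) \<one>"
      using re_im(3)[OF O_closed[OF x]] rF O_closed by (simp add: F.m_comm[of p])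
    also have "\<dots> = pt (re x \<odot>\<^bsub>M0\<^esub> \<one>\<^bsub>F\<^esub>) \<one> \<oplus>\<^bsub>T\<^esub> pt (im x \<odot>\<^bsub>M0\<^esub> p) \<one>"
      using rF O_one p_int O_mult O_closed by (intro t.pure_tensor_add_left) auto
    also have "\<dots> = \<iota> (re x) \<odot>\<^bsub>T\<^esub> pt \<one>\<^bsub>F\<^esub> \<one> \<oplus>\<^bsub>T\<^esub> \<iota> (im x) \<odot>\<^bsub>T\<^esub> pt p \<one>"
      using t.pure_tensor_smult_left[of "\<one>\<^bsub>F\<^esub>" "re x"] t.pure_tensor_smult_left[of p "im x"] r O_one p_int
      by simp
    finally have e: "pt x \<one> = \<iota> (re x) \<odot>\<^bsub>T\<^esub> pt \<one>\<^bsub>F\<^esub> \<one> \<oplus>\<^bsub>T\<^esub> \<iota> (im x) \<odot>\<^bsub>T\<^esub> pt p \<one>" .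
    have "pt x c = c \<odot>\<^bsub>T\<^esub> pt x \<one>" using t.pure_tensor_smult[of x \<one> c] pure x by simp
    also have "\<dots> = mk (A (pt x c)) (B (pt x c))"
      unfolding e using AB_pure[OF x pure(2)] p1 \<iota>_closed[OF r(1)] \<iota>_closed[OF r(2)] pure(2)
      by (simp add: mk_def T.smult_r_distr T.smult_assoc1)
    finally show ?case .
  next
    case zero
    have "A \<zero>\<^bsub>T\<^esub> = \<zero>" "B \<zero>\<^bsub>T\<^esub> = \<zero>"
      using functional.evc_zero[OF re_functional] functional.evc_zero[OF im_functional]
      by (simp_all add: co_def tensor_def)
    then show ?case using p1 by (simp add: mk_def)
  next
    case (add x y)
    have "x \<oplus>\<^bsub>T\<^esub> y = mk (A x) (B x) \<oplus>\<^bsub>T\<^esub> mk (A y) (B y)" using add by simp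
    also have "\<dots> = mk (A (x \<oplus>\<^bsub>T\<^esub> y)) (B (x \<oplus>\<^bsub>T\<^esub> y))"
      using add(1,2) p1 AB_closed by (simp add: AB_add mk_def T.smult_l_distr T.a_ac)
    finally show ?case .
  qed
qed

lemma T_eqI: "x \<in> carrier T \<Longrightarrow> y \<in> carrier T \<Longrightarrow> A x = A y \<Longrightarrow> B x = B y \<Longrightarrow> x = y"
  using T_decomp by metis

lemma mk_closed: "a \<in> carrier R \<Longrightarrow> b \<in> carrier R \<Longrightarrow> mk a b \<in> carrier T"
proof -
  interpret T: module R T by (rule T_module)
  show "a \<in> carrier R \<Longrightarrow> b \<in> carrier R \<Longrightarrow> mk a b \<in> carrier T"
    using pt_closed[OF O_one] pt_closed[OF p_int] by (simp add: mk_def)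
qed

lemma AB_mk:
  assumes "a \<in> carrier R" "b \<in> carrier R" shows "A (mk a b) = a" "B (mk a b) = b"
proof -
  interpret T: module R T by (rule T_module)
  show "A (mk a b) = a" "B (mk a b) = b"
    using assms pt_closed[OF O_one] pt_closed[OF p_int] AB_pure[OF O_one, of \<one>] AB_pure[OF p_int, of \<one>]
    by (simp_all add: mk_def AB_add AB_smult re_im_one re_im_p \<iota>_one \<iota>_zero)
qed

lemma re_im_mult:
  assumes "x \<in> carrier F" "y \<in> carrier F"
  shows "re (x \<otimes>\<^bsub>F\<^esub> y) = re x \<otimes>\<^bsub>F\<^esub> re y \<oplus>\<^bsub>F\<^esub> unif0 K \<otimes>\<^bsub>F\<^esub> (im x \<otimes>\<^bsub>F\<^esub> im y)"
    "im (x \<otimes>\<^bsub>F\<^esub> y) = re x \<otimes>\<^bsub>F\<^esub> im y \<oplus>\<^bsub>F\<^esub> im x \<otimes>\<^bsub>F\<^esub> re y"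
proof -
  note b = re_im[OF assms(1)] re_im[OF assms(2)]
  have c: "re x \<in> carrier F" "im x \<in> carrier F" "re y \<in> carrier F" "im y \<in> carrier F" using b base_closed by auto
  have "x \<otimes>\<^bsub>F\<^esub> y = (re x \<oplus>\<^bsub>F\<^esub> p \<otimes>\<^bsub>F\<^esub> im x) \<otimes>\<^bsub>F\<^esub> (re y \<oplus>\<^bsub>F\<^esub> p \<otimes>\<^bsub>F\<^esub> im y)" using b by simp
  also have "\<dots> = (re x \<otimes>\<^bsub>F\<^esub> re y \<oplus>\<^bsub>F\<^esub> (p \<otimes>\<^bsub>F\<^esub> p) \<otimes>\<^bsub>F\<^esub> (im x \<otimes>\<^bsub>F\<^esub> im y)) \<oplus>\<^bsub>F\<^esub>
      p \<otimes>\<^bsub>F\<^esub> (re x \<otimes>\<^bsub>F\<^esub> im y \<oplus>\<^bsub>F\<^esub> im x \<otimes>\<^bsub>F\<^esub> re y)"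
    using c by (simp add: F.l_distr F.r_distr F.m_ac F.a_ac)
  finally have e: "x \<otimes>\<^bsub>F\<^esub> y = (re x \<otimes>\<^bsub>F\<^esub> re y \<oplus>\<^bsub>F\<^esub> unif0 K \<otimes>\<^bsub>F\<^esub> (im x \<otimes>\<^bsub>F\<^esub> im y)) \<oplus>\<^bsub>F\<^esub>
      p \<otimes>\<^bsub>F\<^esub> (re x \<otimes>\<^bsub>F\<^esub> im y \<oplus>\<^bsub>F\<^esub> im x \<otimes>\<^bsub>F\<^esub> re y)" by (simp add: p_p)
  have "re x \<otimes>\<^bsub>F\<^esub> re y \<oplus>\<^bsub>F\<^esub> unif0 K \<otimes>\<^bsub>F\<^esub> (im x \<otimes>\<^bsub>F\<^esub> im y) \<in> base K"
    "re x \<otimes>\<^bsub>F\<^esub> im y \<oplus>\<^bsub>F\<^esub> im x \<otimes>\<^bsub>F\<^esub> re y \<in> base K"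
    using b p0_base subringE(6,7)[OF base_subring] by simp_all
  from re_im_eqI[OF this e]
  show "re (x \<otimes>\<^bsub>F\<^esub> y) = re x \<otimes>\<^bsub>F\<^esub> re y \<oplus>\<^bsub>F\<^esub> unif0 K \<otimes>\<^bsub>F\<^esub> (im x \<otimes>\<^bsub>F\<^esub> im y)"
    "im (x \<otimes>\<^bsub>F\<^esub> y) = re x \<otimes>\<^bsub>F\<^esub> im y \<oplus>\<^bsub>F\<^esub> im x \<otimes>\<^bsub>F\<^esub> re y" by auto
qed

lemma free_iff: "f \<in> carrier (free_mod R (carrier \<O>)) \<longleftrightarrow> (\<forall>g. f g \<in> carrier R) \<and> supp R f \<subseteq> carrier \<O> \<and> finite (supp R f)"
  by (rule R.free_mod_carrier_iff)

lemma convolve_pushforward: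
  assumes f: "f \<in> carrier (free_mod R (carrier \<O>))" and g: "g \<in> carrier (free_mod R (carrier \<O>))"
  defines "P \<equiv> (\<lambda>q. f (fst q) \<otimes> g (snd q))" and "m \<equiv> (\<lambda>q. fst q \<otimes>\<^bsub>F\<^esub> snd q)"
  shows "P \<in> carrier (free_mod R (carrier \<O> \<times> carrier \<O>))"
    and "convolve \<O> R f g = pushforward R R (\<lambda>c. c) m P"
proof -
  have fg: "f x \<in> carrier R" "g x \<in> carrier R" for x using f g by (auto simp: free_iff)
  have s: "supp R P \<subseteq> supp R f \<times> supp R g" using fg by (auto simp: supp_def P_def)
  have fin: "finite (supp R f)" "finite (supp R g)" "supp R f \<subseteq> carrier \<O>" "supp R g \<subseteq> carrier \<O>"
    using f g by (auto simp: free_iff)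
  then have fin2: "finite (supp R f \<times> supp R g)" "supp R f \<times> supp R g \<subseteq> carrier \<O> \<times> carrier \<O>" by auto
  show "P \<in> carrier (free_mod R (carrier \<O> \<times> carrier \<O>))"
    unfolding R.free_mod_carrier_iff
  proof (intro conjI allI)
    show "P q \<in> carrier R" for q using fg by (simp add: P_def)
    show "supp R P \<subseteq> carrier \<O> \<times> carrier \<O>" using s fin2(2) by (rule subset_trans)
    show "finite (supp R P)" using s fin2(1) by (rule finite_subset)
  qed
  show "convolve \<O> R f g = pushforward R R (\<lambda>c. c) m P"
  proof
    fix z
    have "(\<Oplus>q\<in>{q \<in> supp R P. m q = z}. P q) = (\<Oplus>q\<in>{q \<in> supp R f \<times> supp R g. m q = z}. P q)"
      using s fin2 fg by (intro R.add.finprod_mono_neutral_cong_left) (auto simp: supp_def P_def)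
    then show "convolve \<O> R f g z = pushforward R R (\<lambda>c. c) m P z"
      by (simp add: convolve_def pushforward_def P_def m_def)
  qed
qed

lemma convolve_closed:
  assumes "f \<in> carrier (free_mod R (carrier \<O>))" "g \<in> carrier (free_mod R (carrier \<O>))"
  shows "convolve \<O> R f g \<in> carrier (free_mod R (carrier \<O>))"
  unfolding convolve_pushforward(2)[OF assms]
  by (rule coeff_hom.pushforward_closed[OF coeff_hom_id[OF R.is_cring] convolve_pushforward(1)[OF assms]]) (auto simp: O_mult)

lemma evf_convolve:
  assumes f: "f \<in> carrier (free_mod R (carrier \<O>))" and g: "g \<in> carrier (free_mod R (carrier \<O>))"
    and h: "h \<in> carrier \<O> \<rightarrow> carrier R"
  shows "evf R R (\<lambda>c. c) h (convolve \<O> R f g) =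
    (\<Oplus>x\<in>supp R f. \<Oplus>y\<in>supp R g. (f x \<otimes> g y) \<otimes> h (x \<otimes>\<^bsub>F\<^esub> y))"
proof -
  let ?P = "\<lambda>q. f (fst q) \<otimes> g (snd q)"
  have fg: "f x \<in> carrier R" "g x \<in> carrier R" for x using f g by (auto simp: free_iff)
  have fin: "finite (supp R f)" "finite (supp R g)" "supp R f \<subseteq> carrier \<O>" "supp R g \<subseteq> carrier \<O>"
    using f g by (auto simp: free_iff)
  have hc: "h (x \<otimes>\<^bsub>F\<^esub> y) \<in> carrier R" if "x \<in> carrier \<O>" "y \<in> carrier \<O>" for x y using h O_mult that by auto
  have k: "(\<lambda>q. h (fst q \<otimes>\<^bsub>F\<^esub> snd q)) \<in> carrier \<O> \<times> carrier \<O> \<rightarrow> carrier R" using hc by auto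
  have "evf R R (\<lambda>c. c) h (convolve \<O> R f g) = evf R R (\<lambda>c. c) (\<lambda>q. h (fst q \<otimes>\<^bsub>F\<^esub> snd q)) ?P"
    unfolding convolve_pushforward(2)[OF f g]
    by (rule evf_pushforward[OF coeff_hom_id[OF R.is_cring] coeff_hom_id[OF R.is_cring] coeff_hom_id[OF R.is_cring] _ convolve_pushforward(1)[OF f g] _ h])
      (auto simp: O_mult)
  also have "\<dots> = (\<Oplus>q\<in>supp R f \<times> supp R g. ?P q \<otimes> h (fst q \<otimes>\<^bsub>F\<^esub> snd q))"
    using fin fg by (intro coeff_hom.evf_superset[OF coeff_hom_id[OF R.is_cring] convolve_pushforward(1)[OF f g] k]) (auto simp: supp_def)
  also have "\<dots> = (\<Oplus>x\<in>supp R f. \<Oplus>y\<in>supp R g. (f x \<otimes> g y) \<otimes> h (x \<otimes>\<^bsub>F\<^esub> y))"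
    using fin fg hc by (intro R.finsum_cartesian) (auto simp: subset_iff)
  finally show ?thesis .
qed

lemma finsum_product:
  assumes "finite X" "finite Y" "\<And>x. x \<in> X \<Longrightarrow> a x \<in> carrier R" "\<And>y. y \<in> Y \<Longrightarrow> b y \<in> carrier R"
  shows "(\<Oplus>x\<in>X. \<Oplus>y\<in>Y. a x \<otimes> b y) = (\<Oplus>x\<in>X. a x) \<otimes> (\<Oplus>y\<in>Y. b y)"
proof -
  have "(\<Oplus>x\<in>X. \<Oplus>y\<in>Y. a x \<otimes> b y) = (\<Oplus>x\<in>X. a x \<otimes> (\<Oplus>y\<in>Y. b y))"
    using assms by (intro R.finsum_cong' R.finsum_rdistr[symmetric]) (auto intro!: R.finsum_closed)
  also have "\<dots> = (\<Oplus>x\<in>X. a x) \<otimes> (\<Oplus>y\<in>Y. b y)"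
    using assms by (intro R.finsum_ldistr[symmetric]) (auto intro!: R.finsum_closed)
  finally show ?thesis .
qed

lemma evf_convolve_bilinear:
  assumes f: "f \<in> carrier (free_mod R (carrier \<O>))" and g: "g \<in> carrier (free_mod R (carrier \<O>))"
    and cl: "\<And>x. x \<in> carrier \<O> \<Longrightarrow> a x \<in> carrier R \<and> b x \<in> carrier R \<and> c x \<in> carrier R \<and> d x \<in> carrier R"
    and w: "w \<in> carrier R"
    and h: "\<And>x y. x \<in> carrier \<O> \<Longrightarrow> y \<in> carrier \<O> \<Longrightarrow> h (x \<otimes>\<^bsub>F\<^esub> y) = a x \<otimes> b y \<oplus> w \<otimes> (c x \<otimes> d y)"
    and hc: "h \<in> carrier \<O> \<rightarrow> carrier R"
  defines "u \<equiv> (\<lambda>h f. evf R R (\<lambda>c. c) h f)"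
  shows "u h (convolve \<O> R f g) = u a f \<otimes> u b g \<oplus> w \<otimes> (u c f \<otimes> u d g)"
proof -
  have fg: "f x \<in> carrier R" "g x \<in> carrier R" for x using f g by (auto simp: free_iff)
  have fin: "finite (supp R f)" "finite (supp R g)" and s: "supp R f \<subseteq> carrier \<O>" "supp R g \<subseteq> carrier \<O>"
    using f g by (auto simp: free_iff)
  have fr: "f x \<otimes> a x \<in> carrier R" "f x \<otimes> c x \<in> carrier R" "w \<otimes> (f x \<otimes> c x) \<in> carrier R" if "x \<in> supp R f" for x
    using that s cl fg w by auto
  have gr: "g x \<otimes> b x \<in> carrier R" "g x \<otimes> d x \<in> carrier R" if "x \<in> supp R g" for x
    using that s cl fg by auto
  have eu: "u h f = (\<Oplus>x\<in>supp R f. f x \<otimes> h x)" "u h g = (\<Oplus>x\<in>supp R g. g x \<otimes> h x)" for h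
    by (simp_all add: u_def evf_def)
  have uc: "u c f \<in> carrier R" "u d g \<in> carrier R" unfolding eu using fr gr by (auto intro!: R.finsum_closed)
  have "u h (convolve \<O> R f g) = (\<Oplus>x\<in>supp R f. \<Oplus>y\<in>supp R g. (f x \<otimes> g y) \<otimes> h (x \<otimes>\<^bsub>F\<^esub> y))"
    unfolding u_def by (rule evf_convolve[OF f g hc])
  also have "\<dots> = (\<Oplus>x\<in>supp R f. \<Oplus>y\<in>supp R g. (f x \<otimes> a x) \<otimes> (g y \<otimes> b y) \<oplus>
      (w \<otimes> (f x \<otimes> c x)) \<otimes> (g y \<otimes> d y))"
  proof (intro R.finsum_cong' refl)
    fix x y assume "x \<in> supp R f" "y \<in> supp R g"
    then have xy: "x \<in> carrier \<O>" "y \<in> carrier \<O>" using s by auto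
    show "(f x \<otimes> g y) \<otimes> h (x \<otimes>\<^bsub>F\<^esub> y) = (f x \<otimes> a x) \<otimes> (g y \<otimes> b y) \<oplus> (w \<otimes> (f x \<otimes> c x)) \<otimes> (g y \<otimes> d y)"
      unfolding h[OF xy] using cl[OF xy(1)] cl[OF xy(2)] fg w by (simp add: R.r_distr R.m_ac)
  qed (use fr gr in \<open>auto intro!: R.finsum_closed\<close>)
  also have "\<dots> = (\<Oplus>x\<in>supp R f. (\<Oplus>y\<in>supp R g. (f x \<otimes> a x) \<otimes> (g y \<otimes> b y)) \<oplus>
      (\<Oplus>y\<in>supp R g. (w \<otimes> (f x \<otimes> c x)) \<otimes> (g y \<otimes> d y)))"
    using fr gr by (intro R.finsum_cong' R.finsum_addf refl) (auto intro!: R.finsum_closed)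
  also have "\<dots> = (\<Oplus>x\<in>supp R f. \<Oplus>y\<in>supp R g. (f x \<otimes> a x) \<otimes> (g y \<otimes> b y)) \<oplus>
      (\<Oplus>x\<in>supp R f. \<Oplus>y\<in>supp R g. (w \<otimes> (f x \<otimes> c x)) \<otimes> (g y \<otimes> d y))"
    using fr gr by (intro R.finsum_addf) (auto intro!: R.finsum_closed)
  also have "(\<Oplus>x\<in>supp R f. \<Oplus>y\<in>supp R g. (f x \<otimes> a x) \<otimes> (g y \<otimes> b y)) = u a f \<otimes> u b g"
    unfolding eu using fin fr gr by (intro finsum_product) auto
  also have "(\<Oplus>x\<in>supp R f. \<Oplus>y\<in>supp R g. (w \<otimes> (f x \<otimes> c x)) \<otimes> (g y \<otimes> d y)) =
      (\<Oplus>x\<in>supp R f. w \<otimes> (f x \<otimes> c x)) \<otimes> u d g"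
    unfolding eu using fin fr gr by (intro finsum_product) auto
  also have "(\<Oplus>x\<in>supp R f. w \<otimes> (f x \<otimes> c x)) = w \<otimes> u c f"
    unfolding eu using fin fr w by (intro R.finsum_rdistr[symmetric]) auto
  finally show ?thesis using uc w by (simp add: R.m_assoc)
qed

lemma AB_convolve:
  assumes f: "f \<in> carrier (free_mod R (carrier \<O>))" and g: "g \<in> carrier (free_mod R (carrier \<O>))"
  defines "u \<equiv> (\<lambda>h f. evf R R (\<lambda>c. c) (\<lambda>x. \<iota> (h x)) f)"
  shows "u re (convolve \<O> R f g) = u re f \<otimes> u re g \<oplus> \<iota> (unif0 K) \<otimes> (u im f \<otimes> u im g)"
    and "u im (convolve \<O> R f g) = u re f \<otimes> u im g \<oplus> u im f \<otimes> u re g"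
proof -
  have r0: "re x \<in> carrier \<O>\<^sub>0" "im x \<in> carrier \<O>\<^sub>0" if "x \<in> carrier \<O>" for x using re_im_int that by auto
  have rc: "\<iota> (re x) \<in> carrier R" "\<iota> (im x) \<in> carrier R" if "x \<in> carrier \<O>" for x using r0[OF that] \<iota>_closed by auto
  have mO: "a \<otimes>\<^bsub>F\<^esub> b \<in> carrier \<O>\<^sub>0" if "a \<in> carrier \<O>\<^sub>0" "b \<in> carrier \<O>\<^sub>0" for a b
    using subringE(6)[OF int0_subring] that .
  have wc: "\<iota> (unif0 K) \<in> carrier R" using \<iota>_closed[OF unif0_int] .
  have re_m: "\<iota> (re (x \<otimes>\<^bsub>F\<^esub> y)) = \<iota> (re x) \<otimes> \<iota> (re y) \<oplus> \<iota> (unif0 K) \<otimes> (\<iota> (im x) \<otimes> \<iota> (im y))"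
    and im_m: "\<iota> (im (x \<otimes>\<^bsub>F\<^esub> y)) = \<iota> (re x) \<otimes> \<iota> (im y) \<oplus> \<one> \<otimes> (\<iota> (im x) \<otimes> \<iota> (re y))"
    if "x \<in> carrier \<O>" "y \<in> carrier \<O>" for x y
    using re_im_mult[OF O_closed[OF that(1)] O_closed[OF that(2)]] r0[OF that(1)] r0[OF that(2)] mO unif0_int \<iota>_closed
    by (simp_all add: \<iota>_add \<iota>_mult)
  show "u re (convolve \<O> R f g) = u re f \<otimes> u re g \<oplus> \<iota> (unif0 K) \<otimes> (u im f \<otimes> u im g)"
    unfolding u_def using rc by (intro evf_convolve_bilinear[OF f g _ wc]) (auto simp: re_m)
  have "u im (convolve \<O> R f g) = u re f \<otimes> u im g \<oplus> \<one> \<otimes> (u im f \<otimes> u re g)"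
    unfolding u_def using rc by (intro evf_convolve_bilinear[OF f g _ R.one_closed]) (auto simp: im_m simp del: R.l_one)
  moreover have "u im f \<otimes> u re g \<in> carrier R"
    unfolding u_def using rc
    by (intro R.m_closed coeff_hom.evf_closed[OF coeff_hom_id[OF R.is_cring] f] coeff_hom.evf_closed[OF coeff_hom_id[OF R.is_cring] g]) auto
  ultimately show "u im (convolve \<O> R f g) = u re f \<otimes> u im g \<oplus> u im f \<otimes> u re g" by simp
qed

lemma bc_ring_simps [simp]:
  "carrier R' = carrier T" "\<zero>\<^bsub>R'\<^esub> = \<zero>\<^bsub>T\<^esub>" "x \<oplus>\<^bsub>R'\<^esub> y = x \<oplus>\<^bsub>T\<^esub> y" "\<one>\<^bsub>R'\<^esub> = pt \<one>\<^bsub>F\<^esub> \<one>"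
  by (simp_all add: bc_ring_def tensor_ring_def Let_def)

lemma bc_mult:
  assumes "x \<in> carrier T" "y \<in> carrier T"
  shows "x \<otimes>\<^bsub>R'\<^esub> y = mk (A x \<otimes> A y \<oplus> \<iota> (unif0 K) \<otimes> (B x \<otimes> B y)) (A x \<otimes> B y \<oplus> B x \<otimes> A y)"
proof -
  obtain f g where f: "f \<in> carrier (free_mod R (carrier \<O>))" "x = t.T.cl f"
    and g: "g \<in> carrier (free_mod R (carrier \<O>))" "y = t.T.cl g"
    using assms[unfolded t.tensor_eq t.T.Q_carrier] by auto
  have coA: "A (t.T.cl k) = evf R R (\<lambda>c. c) (\<lambda>x. \<iota> (re x)) k"
    and coB: "B (t.T.cl k) = evf R R (\<lambda>c. c) (\<lambda>x. \<iota> (im x)) k"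
    if "k \<in> carrier (free_mod R (carrier \<O>))" for k
    using that functional.evc_cl[OF re_functional, of k] functional.evc_cl[OF im_functional, of k]
    by (simp_all add: co_def)
  have eq: "t.T.cl (convolve \<O> R k l) = mk (A x \<otimes> A y \<oplus> \<iota> (unif0 K) \<otimes> (B x \<otimes> B y)) (A x \<otimes> B y \<oplus> B x \<otimes> A y)"
    if "k \<in> x" "l \<in> y" for k l
  proof -
    have f': "f \<in> carrier t.T.L" and g': "g \<in> carrier t.T.L" using f g by simp_all
    have k: "k \<in> carrier (free_mod R (carrier \<O>))" "x = t.T.cl k"
      using t.T.cl_mem[OF f'] that f(2) by auto
    have l: "l \<in> carrier (free_mod R (carrier \<O>))" "y = t.T.cl l"
      using t.T.cl_mem[OF g'] that g(2) by auto
    have cc: "convolve \<O> R k l \<in> carrier (free_mod R (carrier \<O>))" by (rule convolve_closed[OF k(1) l(1)])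
    then have ct: "t.T.cl (convolve \<O> R k l) \<in> carrier T"
      using t.T.cl_closed[of "convolve \<O> R k l"] by (simp add: t.tensor_eq)
    have "A (t.T.cl (convolve \<O> R k l)) = A x \<otimes> A y \<oplus> \<iota> (unif0 K) \<otimes> (B x \<otimes> B y)"
      "B (t.T.cl (convolve \<O> R k l)) = A x \<otimes> B y \<oplus> B x \<otimes> A y"
      unfolding k(2) l(2) coA[OF cc] coB[OF cc] coA[OF k(1)] coB[OF k(1)] coA[OF l(1)] coB[OF l(1)]
      by (rule AB_convolve[OF k(1) l(1)])+
    then show ?thesis using T_decomp[OF ct] by simp
  qed
  have ne: "f \<in> x" "g \<in> y" using f g t.T.cl_self by auto
  have "x \<otimes>\<^bsub>R'\<^esub> y = (\<Union>k\<in>x. \<Union>l\<in>y. t.T.cl (convolve \<O> R k l))"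
    by (simp add: bc_ring_def tensor_ring_def Let_def)
  also have "\<dots> = (\<Union>k\<in>x. mk (A x \<otimes> A y \<oplus> \<iota> (unif0 K) \<otimes> (B x \<otimes> B y)) (A x \<otimes> B y \<oplus> B x \<otimes> A y))"
    using eq by (intro SUP_cong refl SUP_eq_const) (use ne in blast)+
  also have "\<dots> = mk (A x \<otimes> A y \<oplus> \<iota> (unif0 K) \<otimes> (B x \<otimes> B y)) (A x \<otimes> B y \<oplus> B x \<otimes> A y)"
    using ne by (intro SUP_eq_const) auto
  finally show ?thesis .
qed

lemma bc_mult_closed: "x \<in> carrier T \<Longrightarrow> y \<in> carrier T \<Longrightarrow> x \<otimes>\<^bsub>R'\<^esub> y \<in> carrier T"
  unfolding bc_mult using \<iota>_closed[OF unif0_int] by (intro mk_closed) auto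

lemma AB_mult:
  assumes "x \<in> carrier T" "y \<in> carrier T"
  shows "A (x \<otimes>\<^bsub>R'\<^esub> y) = A x \<otimes> A y \<oplus> \<iota> (unif0 K) \<otimes> (B x \<otimes> B y)"
    "B (x \<otimes>\<^bsub>R'\<^esub> y) = A x \<otimes> B y \<oplus> B x \<otimes> A y"
  using assms \<iota>_closed[OF unif0_int] by (simp_all add: bc_mult AB_mk)

lemma bc_cring: "cring R'"
proof -
  interpret T: module R T by (rule T_module)
  note w = \<iota>_closed[OF unif0_int]
  have one: "pt \<one>\<^bsub>F\<^esub> \<one> \<in> carrier T" "A (pt \<one>\<^bsub>F\<^esub> \<one>) = \<one>" "B (pt \<one>\<^bsub>F\<^esub> \<one>) = \<zero>"
    using pt_closed[OF O_one] AB_pure[OF O_one, of \<one>] by (auto simp: re_im_one \<iota>_one \<iota>_zero)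
  show ?thesis
  proof (rule cringI)
    show "abelian_group R'"
    proof (rule abelian_groupI)
      fix x assume "x \<in> carrier R'"
      then show "\<exists>y\<in>carrier R'. y \<oplus>\<^bsub>R'\<^esub> x = \<zero>\<^bsub>R'\<^esub>"
        using T.l_neg by (intro bexI[of _ "\<ominus>\<^bsub>T\<^esub> x"]) auto
    qed (auto simp: T.a_ac)
    show "comm_monoid R'"
    proof (rule comm_monoidI)
      fix x y assume xy: "x \<in> carrier R'" "y \<in> carrier R'"
      show "x \<otimes>\<^bsub>R'\<^esub> y \<in> carrier R'" using xy bc_mult_closed by simp
      show "x \<otimes>\<^bsub>R'\<^esub> y = y \<otimes>\<^bsub>R'\<^esub> x"
        using xy w by (intro T_eqI) (auto simp: AB_mult bc_mult_closed R.m_ac R.a_ac)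
      fix z assume z: "z \<in> carrier R'"
      show "x \<otimes>\<^bsub>R'\<^esub> y \<otimes>\<^bsub>R'\<^esub> z = x \<otimes>\<^bsub>R'\<^esub> (y \<otimes>\<^bsub>R'\<^esub> z)"
        using xy z w by (intro T_eqI)
          (auto simp: AB_mult bc_mult_closed R.l_distr R.r_distr R.m_ac R.a_ac)
    next
      fix x assume x: "x \<in> carrier R'"
      show "\<one>\<^bsub>R'\<^esub> \<otimes>\<^bsub>R'\<^esub> x = x"
        using x one w by (intro T_eqI) (auto simp: AB_mult bc_mult_closed)
    qed (use one in auto)
    fix x y z assume "x \<in> carrier R'" "y \<in> carrier R'" "z \<in> carrier R'"
    then show "(x \<oplus>\<^bsub>R'\<^esub> y) \<otimes>\<^bsub>R'\<^esub> z = x \<otimes>\<^bsub>R'\<^esub> z \<oplus>\<^bsub>R'\<^esub> y \<otimes>\<^bsub>R'\<^esub> z"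
      using w by (intro T_eqI) (auto simp: AB_mult AB_add bc_mult_closed R.l_distr R.r_distr R.m_ac R.a_ac)
  qed
qed

lemma left_AB:
  assumes "c \<in> carrier R"
  shows "bc_left K R \<iota> c \<in> carrier T" "A (bc_left K R \<iota> c) = c" "B (bc_left K R \<iota> c) = \<zero>"
  using assms pt_closed[OF O_one] AB_pure[OF O_one] by (auto simp: bc_left_def re_im_one \<iota>_one \<iota>_zero)

lemma right_AB:
  assumes "a \<in> carrier \<O>"
  shows "bc_right K R \<iota> a \<in> carrier T" "A (bc_right K R \<iota> a) = \<iota> (re a)" "B (bc_right K R \<iota> a) = \<iota> (im a)"
  using assms pt_closed[of a \<one>] AB_pure[of a \<one>] re_im_int[OF assms] \<iota>_closed by (auto simp: bc_right_def)

lemma left_hom: "bc_left K R \<iota> \<in> ring_hom R R'"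
proof (rule ring_hom_memI)
  interpret T: module R T by (rule T_module)
  note w = \<iota>_closed[OF unif0_int]
  fix x y assume xy: "x \<in> carrier R" "y \<in> carrier R"
  show "bc_left K R \<iota> x \<in> carrier R'" using left_AB[OF xy(1)] by simp
  show "bc_left K R \<iota> (x \<otimes> y) = bc_left K R \<iota> x \<otimes>\<^bsub>R'\<^esub> bc_left K R \<iota> y"
    using xy w left_AB by (intro T_eqI) (auto simp: AB_mult bc_mult_closed)
  show "bc_left K R \<iota> (x \<oplus> y) = bc_left K R \<iota> x \<oplus>\<^bsub>R'\<^esub> bc_left K R \<iota> y"
    using xy w left_AB by (intro T_eqI) (auto simp: AB_add)
qed (simp add: bc_left_def)

lemma right_hom: "bc_right K R \<iota> \<in> ring_hom \<O> R'"
proof (rule ring_hom_memI)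
  interpret T: module R T by (rule T_module)
  note w = \<iota>_closed[OF unif0_int]
  have mO: "a \<otimes>\<^bsub>F\<^esub> b \<in> carrier \<O>\<^sub>0" if "a \<in> carrier \<O>\<^sub>0" "b \<in> carrier \<O>\<^sub>0" for a b
    using subringE(6)[OF int0_subring] that .
  fix x y assume xy: "x \<in> carrier \<O>" "y \<in> carrier \<O>"
  note r = re_im_int[OF xy(1)] re_im_int[OF xy(2)]
  show "bc_right K R \<iota> x \<in> carrier R'" using right_AB[OF xy(1)] by simp
  show "bc_right K R \<iota> (x \<otimes>\<^bsub>\<O>\<^esub> y) = bc_right K R \<iota> x \<otimes>\<^bsub>R'\<^esub> bc_right K R \<iota> y"
    using xy w right_AB r mO unif0_int O_mult O_closed
    by (intro T_eqI) (auto simp: AB_mult bc_mult_closed re_im_mult \<iota>_add \<iota>_mult)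
  show "bc_right K R \<iota> (x \<oplus>\<^bsub>\<O>\<^esub> y) = bc_right K R \<iota> x \<oplus>\<^bsub>R'\<^esub> bc_right K R \<iota> y"
    using xy w right_AB r O_add O_closed
    by (intro T_eqI) (auto simp: AB_add re_im_add \<iota>_add)
qed (simp add: bc_right_def)

lemma left_right:
  assumes "a \<in> carrier \<O>\<^sub>0" shows "bc_right K R \<iota> a = bc_left K R \<iota> (\<iota> a)"
  using assms right_AB[of a] left_AB[OF \<iota>_closed[OF assms]]
  by (intro T_eqI) (auto simp: int0_iff re_im_base \<iota>_zero)

lemma left_inj: "inj_on (bc_left K R \<iota>) (carrier R)"
  using left_AB(2) by (rule inj_on_inverseI)

end

lemma (in cring) kpoly_square:
  assumes a: "a \<in> carrier R"
  shows "kpoly R a s s = (monom (UP R) \<one> 2 \<ominus>\<^bsub>UP R\<^esub> monom (UP R) (a \<otimes> a) 0) [^]\<^bsub>UP R\<^esub> s"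
proof -
  interpret U: UP_cring R "UP R" by (rule UP_cring_self)
  let ?X = "monom (UP R) \<one> 1" and ?a = "monom (UP R) a 0"
  have c: "?X \<in> carrier (UP R)" "?a \<in> carrier (UP R)" using a by auto
  have "(?X \<ominus>\<^bsub>UP R\<^esub> ?a) \<otimes>\<^bsub>UP R\<^esub> (?X \<oplus>\<^bsub>UP R\<^esub> ?a) = ?X \<otimes>\<^bsub>UP R\<^esub> ?X \<ominus>\<^bsub>UP R\<^esub> ?a \<otimes>\<^bsub>UP R\<^esub> ?a"
  proof -
    have "(?X \<ominus>\<^bsub>UP R\<^esub> ?a) \<otimes>\<^bsub>UP R\<^esub> (?X \<oplus>\<^bsub>UP R\<^esub> ?a) =
      (?X \<otimes>\<^bsub>UP R\<^esub> ?X \<oplus>\<^bsub>UP R\<^esub> \<ominus>\<^bsub>UP R\<^esub> (?a \<otimes>\<^bsub>UP R\<^esub> ?a)) \<oplus>\<^bsub>UP R\<^esub> (?X \<otimes>\<^bsub>UP R\<^esub> ?a \<oplus>\<^bsub>UP R\<^esub> \<ominus>\<^bsub>UP R\<^esub> (?X \<otimes>\<^bsub>UP R\<^esub> ?a))"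
      using c by (simp only: U.P.minus_eq U.P.l_distr U.P.r_distr U.P.l_minus U.P.m_comm[of ?a ?X]
          U.P.a_inv_closed U.P.m_closed U.P.a_closed U.P.a_ac U.P.minus_add)
    then show ?thesis using c by (simp only: U.P.r_neg U.P.m_closed U.P.r_zero U.P.minus_eq U.P.a_closed U.P.a_inv_closed)
  qed
  also have "?X \<otimes>\<^bsub>UP R\<^esub> ?X = monom (UP R) \<one> 2"
    using U.monom_mult[of \<one> \<one> 1 1] by (simp add: numeral_2_eq_2)
  also have "?a \<otimes>\<^bsub>UP R\<^esub> ?a = monom (UP R) (a \<otimes> a) 0"
    using U.monom_mult[OF a a, of 0 0] by simp
  finally have "(?X \<ominus>\<^bsub>UP R\<^esub> ?a) \<otimes>\<^bsub>UP R\<^esub> (?X \<oplus>\<^bsub>UP R\<^esub> ?a) = monom (UP R) \<one> 2 \<ominus>\<^bsub>UP R\<^esub> monom (UP R) (a \<otimes> a) 0" .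
  then show ?thesis unfolding kpoly_def
    using c U.P.nat_pow_distrib[of "?X \<ominus>\<^bsub>UP R\<^esub> ?a" "?X \<oplus>\<^bsub>UP R\<^esub> ?a" s] by simp
qed

context ramified_lattice
begin

lemma charpoly_of_pencil:
  assumes R: "cring R" and \<iota>: "\<iota> \<in> ring_hom \<O>\<^sub>0 R" and LM1: "LM1 K n I R \<iota> Fam" and i: "i \<in> index_set n I"
    and q: "q \<in> carrier (UP R)"
    and pen: "\<And>f xs. (\<And>j. j < n \<Longrightarrow> f j < 2 * n) \<Longrightarrow> xs \<in> tuples n (Fam i) \<Longrightarrow>
      LPen R \<iota> i f q xs = \<zero>\<^bsub>UP R\<^esub>"
  shows "charpoly R (LamR K n R \<iota> i) (Fam i) n (mulR K n R \<iota> i p) = q"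
proof -
  let ?M = "LamR K n R \<iota> i"
  have lm: "direct_summand R ?M (Fam i)" "has_rank R ?M (Fam i) n"
    "\<And>x. x \<in> Fam i \<Longrightarrow> mulR K n R \<iota> i p x \<in> Fam i"
    using LM1 i p_int unfolding LM1_def by blast+
  interpret M: module R ?M by (rule LamR_module[OF R \<iota>])
  interpret t: tensor_data R \<O>\<^sub>0 \<iota> "\<Lambda> K n i" by (rule LamR_data[OF R \<iota>])
  interpret free_summand R ?M "Fam i" n "2 * n" "Crd False R \<iota> i" "\<lambda>k. pure_tensor \<O>\<^sub>0 \<iota> R (\<Lambda> K n i) (gen i k) \<one>\<^bsub>R\<^esub>"
  proof unfold_locales
    show "semilinear R R (\<lambda>x. x) ?M (Crd False R \<iota> i k)" if "k < 2 * n" for k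
      by (rule Crd_semilinear[OF R \<iota> that])
    show "pure_tensor \<O>\<^sub>0 \<iota> R (\<Lambda> K n i) (gen i k) \<one>\<^bsub>R\<^esub> \<in> carrier ?M" for k
      unfolding LamR_def using t.pure_tensor_closed[OF gen_Lam] by simp
    show "x = (\<Oplus>\<^bsub>?M\<^esub>k\<in>{..<2*n}. Crd False R \<iota> i k x \<odot>\<^bsub>?M\<^esub> pure_tensor \<O>\<^sub>0 \<iota> R (\<Lambda> K n i) (gen i k) \<one>\<^bsub>R\<^esub>)"
      if "x \<in> carrier ?M" for x
      by (rule LamR_decomp[OF R \<iota> that])
  qed (rule lm(1))
  have "is_charpoly R ?M (Fam i) n (mulR K n R \<iota> i p) q"
  proof (rule is_charpolyI[OF q lm(3) _ pen])
    show "Crd True R \<iota> i k x = Crd False R \<iota> i k (mulR K n R \<iota> i p x)" if "k < 2 * n" "x \<in> Fam i" for k x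
      using Crd_mulR[OF R \<iota> that(1)] that(2) P_carrier by auto
  qed
  note cp = this
  show ?thesis by (rule charpoly_eqI[OF lm(2) _ cp]) (rule lm(3))
qed

lemma lines_inE_kottwitz:
  assumes rs: "r + s = n" and R: "cring R" and \<iota>: "\<iota> \<in> ring_hom (int_ringE K r s) R"
    and LM1: "LM1 K n I R \<iota> Fam" and U: "U \<subseteq> W_rs K n r s" and lines: "lines_inE K n r s I U R \<iota> Fam"
  shows "kottwitz K n r s I R \<iota> Fam"
  unfolding kottwitz_def
proof
  fix i assume i: "i \<in> index_set n I"
  interpret R: cring R by fact
  have \<iota>0: "\<iota> \<in> ring_hom \<O>\<^sub>0 R"
    using \<iota> O_O0_hom by (auto simp: int_ringE_def split: if_splits)
  have "submodule (Fam i) R (LamR K n R \<iota> i)"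
    using LM1 i unfolding LM1_def direct_summand_def by blast
  then have FamM: "Fam i \<subseteq> carrier (LamR K n R \<iota> i)"
    by (rule module.submoduleE(1)[OF LamR_module[OF R \<iota>0]])
  show "charpoly R (LamR K n R \<iota> i) (Fam i) n (mulR K n R \<iota> i p) = kottwitz_poly K r s R \<iota>"
  proof (cases "r = s")
    case False
    then have \<iota>1: "\<iota> \<in> ring_hom \<O> R" and l: "lines_in K n I U R \<iota> Fam"
      using \<iota> lines by (simp_all add: int_ringE_def lines_inE_def)
    have \<iota>p: "\<iota> p \<in> carrier R" by (rule ring_hom_closed[OF \<iota>1 p_int])
    have "kottwitz_poly K r s R \<iota> = kpoly R (\<iota> p) r s"
      using False by (simp add: kottwitz_poly_def kpoly_def Let_def)
    moreover have "charpoly R (LamR K n R \<iota> i) (Fam i) n (mulR K n R \<iota> i p) = kpoly R (\<iota> p) r s"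
    proof (rule charpoly_of_pencil[OF R \<iota>0 LM1 i R.kpoly_closed[OF \<iota>p]])
      fix f xs assume f: "\<And>j. j < n \<Longrightarrow> f j < 2 * n" and xs: "xs \<in> tuples n (Fam i)"
      have xsM: "xs \<in> tuples n (carrier (LamR K n R \<iota> i))" using xs FamM by (auto simp: tuples_def)
      show "LPen R \<iota> i f (kpoly R (\<iota> p) r s) xs = \<zero>\<^bsub>UP R\<^esub>"
        by (rule lines_in_pencil[OF R \<iota>1 rs _ U l i xs xsM]) (rule f)
    qed
    ultimately show ?thesis by simp
  next
    case True
    interpret base_change K R \<iota> by unfold_locales (rule \<iota>0)
    let ?\<iota>' = "bc_right K R \<iota>" and ?l = "bc_left K R \<iota>"
    have l: "lines_in K n I U R' ?\<iota>' (bc_family K n R \<iota> Fam)" using lines True by (simp add: lines_inE_def)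
    have lh: "coeff_hom R R' ?l" by (rule coeff_homI[OF R bc_cring left_hom])
    let ?q = "kottwitz_poly K r s R \<iota>"
    have w: "\<iota> (unif0 K) \<in> carrier R" by (rule \<iota>_closed[OF unif0_int])
    have q_def: "?q = (monom (UP R) \<one>\<^bsub>R\<^esub> 2 \<ominus>\<^bsub>UP R\<^esub> monom (UP R) (\<iota> (unif0 K)) 0) [^]\<^bsub>UP R\<^esub> s"
      using True by (simp add: kottwitz_poly_def Let_def)
    have qc: "?q \<in> carrier (UP R)"
    proof -
      interpret U: UP_cring R "UP R" by (rule R.UP_cring_self)
      show ?thesis unfolding q_def using w by simp
    qed
    have \<iota>'p: "?\<iota>' p \<in> carrier R'" by (rule ring_hom_closed[OF right_hom p_int])
    have lq: "(\<lambda>j. ?l (?q j)) = kpoly R' (?\<iota>' p) r s"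
    proof -
      interpret L: coeff_hom "UP R" "UP R'" "\<lambda>q j. ?l (q j)" by (rule coeff_hom.UP_map_hom[OF lh])
      interpret U: UP_cring R "UP R" by (rule R.UP_cring_self)
      have sq: "?\<iota>' p \<otimes>\<^bsub>R'\<^esub> ?\<iota>' p = ?l (\<iota> (unif0 K))"
        using ring_hom_mult[OF right_hom p_int p_int] left_right[OF unif0_int] by (simp add: p_p)
      have "(\<lambda>j. ?l (?q j)) = (\<lambda>j. ?l ((monom (UP R) \<one>\<^bsub>R\<^esub> 2 \<ominus>\<^bsub>UP R\<^esub> monom (UP R) (\<iota> (unif0 K)) 0) j)) [^]\<^bsub>UP R'\<^esub> s"
        unfolding q_def by (rule L.H.hom_pow) (use w in simp)
      also have "(\<lambda>j. ?l ((monom (UP R) \<one>\<^bsub>R\<^esub> 2 \<ominus>\<^bsub>UP R\<^esub> monom (UP R) (\<iota> (unif0 K)) 0) j)) =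
          (\<lambda>j. ?l (monom (UP R) \<one>\<^bsub>R\<^esub> 2 j)) \<ominus>\<^bsub>UP R'\<^esub> (\<lambda>j. ?l (monom (UP R) (\<iota> (unif0 K)) 0 j))"
        by (rule L.hom_diff) (use w in simp_all)
      also have "(\<lambda>j. ?l (monom (UP R) \<one>\<^bsub>R\<^esub> 2 j)) = monom (UP R') \<one>\<^bsub>R'\<^esub> 2"
        using coeff_hom.UP_map_monom[OF lh R.one_closed, of 2] ring_hom_one[OF left_hom] by simp
      also have "(\<lambda>j. ?l (monom (UP R) (\<iota> (unif0 K)) 0 j)) = monom (UP R') (?\<iota>' p \<otimes>\<^bsub>R'\<^esub> ?\<iota>' p) 0"
        unfolding sq by (rule coeff_hom.UP_map_monom[OF lh w])
      finally show ?thesis using cring.kpoly_square[OF bc_cring \<iota>'p, of s] True by simp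
    qed
    show ?thesis
    proof (rule charpoly_of_pencil[OF R \<iota>0 LM1 i qc])
      fix f xs assume f: "\<And>j. j < n \<Longrightarrow> f j < 2 * n" and xs: "xs \<in> tuples n (Fam i)"
      let ?h = "tensor_map R \<O>\<^sub>0 ?\<iota>' R' (\<Lambda> K n i) ?l (\<lambda>x. x)"
      have xsM: "xs \<in> tuples n (carrier (LamR K n R \<iota> i))" using xs FamM by (auto simp: tuples_def)
      note hm = LamR_map[OF lh \<iota>0 O_O0_hom[OF right_hom] left_right refl, of _ i]
      have ysM: "map ?h xs \<in> tuples n (carrier (LamR K n R' ?\<iota>' i))"
        by (rule tuples_map[OF xsM]) (use hm(1) in auto)
      have ysF: "map ?h xs \<in> tuples n (bc_family K n R \<iota> Fam i)"
        unfolding bc_family_def Let_def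
        by (rule tuples_map[OF xs]) (intro funcsetI subsetD[OF lin_span_superset] imageI)
      have "(\<lambda>j. ?l (LPen R \<iota> i f ?q xs j)) = LPen R' ?\<iota>' i f (\<lambda>j. ?l (?q j)) (map ?h xs)"
      proof (rule coeff_hom.UP_map_pencil[OF lh _ _ xsM _ _ _ qc, symmetric])
        have cl: "Crd e R \<iota> i (f j) x \<in> carrier R" if "j < n" "x \<in> carrier (LamR K n R \<iota> i)" for e j x
          by (rule F_semilinear_closed[OF Crd_semilinear[OF R \<iota>0 f[OF that(1)]] that(2)])
        show "Crd False R \<iota> i (f j) x \<in> carrier R" "Crd True R \<iota> i (f j) x \<in> carrier R"
          if "j < n" "x \<in> carrier (LamR K n R \<iota> i)" for j x
          using cl that by auto
        show "length (map ?h xs) = n" using xs by (simp add: tuples_def)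
        have crd: "Crd e R' ?\<iota>' i (f j) (map ?h xs ! k) = ?l (Crd e R \<iota> i (f j) (xs ! k))"
          if "j < n" "k < n" for e j k
        proof -
          have "map ?h xs ! k = ?h (xs ! k)" using xs that by (simp add: tuples_def)
          then show ?thesis using LamR_map(4)[OF lh \<iota>0 O_O0_hom[OF right_hom] left_right refl tuples_nth[OF xsM that(2)] f[OF that(1)]]
            by simp
        qed
        then show "Crd False R' ?\<iota>' i (f j) (map ?h xs ! k) = ?l (Crd False R \<iota> i (f j) (xs ! k))"
          if "j < n" "k < n" for j k using that by blast
        show "Crd True R' ?\<iota>' i (f j) (map ?h xs ! k) = ?l (Crd True R \<iota> i (f j) (xs ! k))"
          if "j < n" "k < n" for j k using that crd by blast
      qed
      also have "\<dots> = \<zero>\<^bsub>UP R'\<^esub>"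
        unfolding lq by (rule lines_in_pencil[OF bc_cring right_hom rs _ U l i ysF ysM]) (rule f)
      finally have z: "(\<lambda>j. ?l (LPen R \<iota> i f ?q xs j)) = \<zero>\<^bsub>UP R'\<^esub>" .
      have "LPen R \<iota> i f ?q xs \<in> carrier (UP R)"
      proof -
        have "functional R (UP R) (const R) (tuples n (carrier (LamR K n R \<iota> i))) (ext_rels R n (LamR K n R \<iota> i))
            (LPen R \<iota> i f ?q)"
          using f by (intro R.pencil_functional[OF LamR_module[OF R \<iota>0]] qc Crd_semilinear[OF R \<iota>0]) auto
        then show ?thesis using functional.h_closed xsM by blast
      qed
      then show "LPen R \<iota> i f ?q xs = \<zero>\<^bsub>UP R\<^esub>"
        by (rule coeff_hom.UP_map_inj[OF lh left_inj _ z])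
    qed
  qed
qed

end

theorem lemma5p1p2:
  fixes K :: "'f ramext" and n r s :: nat and I :: "nat set"
    and R :: "('r, 'x) ring_scheme" and \<iota> :: "'f \<Rightarrow> 'r"
    and Fam :: "int \<Rightarrow> ('f, 'r) tens set"
  assumes "ramified_quadratic K"
    and "n \<ge> 2" and "r + s = n"
    and "I \<subseteq> {0..n div 2}" and "I \<noteq> {}" and "admissible_set n I"
    and "cring R" and "\<iota> \<in> ring_hom (int_ringE K r s) R"
    and "LM1 K n I R \<iota> Fam" and "LM2 K n I R \<iota> Fam"
    and "LM3 K n I R \<iota> Fam" and "LM4 K n I R \<iota> Fam"
  shows "(condition_K K n r s I R \<iota> Fam \<longrightarrow> kottwitz K n r s I R \<iota> Fam) \<and>
         (condition_N K n r s I R \<iota> Fam \<longrightarrow> kottwitz K n r s I R \<iota> Fam)"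
proof -
  interpret ramified_lattice K n by unfold_locales (rule assms(1))
  note main = lines_inE_kottwitz[OF assms(3,7,8,9)]
  show ?thesis
    unfolding condition_K_def condition_N_def
    using main[OF order_refl] main[OF Int_lower1] by blast
qed

end
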